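(* The infimum of $$E[S,Z]=\frac12\int_0^\infty\Bigl[S'^2+S^2+\frac{Z'^2}{2\mu}\Bigr]\xi^2\,d\xi$$ subject to the constraint $I[S,Z]=-1$, where $$I[S,Z]=\frac12\int_0^\infty S^2Z\,\xi^2\,d\xi$$ and $(S,Z)$ varies in $H^1_r(\mathbb R^3)\times D^1_r(\mathbb R^3)$, is achieved; after scaling $Z$, this provides a solution of the system $$\Delta S-S=SZ,\qquad \Delta Z=\mu S^2,\qquad S\to0\ \text{ and }\ Z\to0\ \text{ as }\ \xi\to\infty.\qquad(\ast)$$ Furthermore, any solution of $(\ast)$ in this function space satisfies $$M:=\mu\int_0^\infty\xi^2S(\xi)^2\,d\xi\ \ge\ \frac38\,\pi\sqrt3 .$$
   Context: Here $\mu=4\pi G$, where $G$ is the gravitational constant. Functions of $\xi\ge0$ are identified with radial functions on $\mathbb R^3$, $\xi$ being the distance to the origin; the prime denotes $d/d\xi$, and $\Delta=\frac{d^2}{d\xi^2}+\frac2\xi\frac{d}{d\xi}$ is the radial Laplacian in three dimensions. $H^1_r(\mathbb R^3)$ is the space of radial functions on $\mathbb R^3$ that are square-summable together with their first-order derivatives. $D^1_r(\mathbb R^3)$ is the closure of the set of compactly supported, smooth radial functions for the norm $\|\nabla u\|_{L^2}$; it may also be viewed as the space of radial functions in $L^6(\mathbb R^3)$ that have square-summable first-order derivatives.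
   Formalization: The solution of (∗) is obtained by scaling both S and Z by a common constant c>0 (scaling Z alone fails for general μ), and the bound on M is claimed for solutions that are not identically zero (S=Z=0 has M=0). *)

theory Defs
  imports "HOL-Analysis.Analysis"
begin

primrec Ck :: "nat \<Rightarrow> ('a::euclidean_space \<Rightarrow> real) \<Rightarrow> bool" where
  "Ck 0 f \<longleftrightarrow> continuous_on UNIV f"
| "Ck (Suc k) f \<longleftrightarrow> (\<forall>x. f differentiable (at x)) \<and>
     (\<forall>b\<in>Basis. Ck k (\<lambda>x. frechet_derivative f (at x) b))"

definition test_function :: "'a::euclidean_space set \<Rightarrow> ('a \<Rightarrow> real) \<Rightarrow> bool" where
  "test_function \<Omega> \<phi> \<longleftrightarrow> (\<forall>k. Ck k \<phi>) \<and>
     compact (closure {x. \<phi> x \<noteq> 0}) \<and> closure {x. \<phi> x \<noteq> 0} \<subseteq> \<Omega>"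

definition locally_integrable ::
    "'a::euclidean_space set \<Rightarrow> ('a \<Rightarrow> 'b::{banach, second_countable_topology}) \<Rightarrow> bool" where
  "locally_integrable \<Omega> u \<longleftrightarrow> (\<forall>K. compact K \<longrightarrow> K \<subseteq> \<Omega> \<longrightarrow> set_integrable lborel K u)"

definition has_weak_gradient ::
    "('a::euclidean_space \<Rightarrow> real) \<Rightarrow> ('a \<Rightarrow> 'a) \<Rightarrow> 'a set \<Rightarrow> bool" where
  "has_weak_gradient u g \<Omega> \<longleftrightarrow> locally_integrable \<Omega> u \<and> locally_integrable \<Omega> g \<and>
     (\<forall>\<phi>. test_function \<Omega> \<phi> \<longrightarrow> (\<forall>b\<in>Basis.
        (LINT x:\<Omega>|lborel. u x * frechet_derivative \<phi> (at x) b)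
          = - (LINT x:\<Omega>|lborel. (g x \<bullet> b) * \<phi> x)))"

text \<open>Elements of the function spaces are represented by functions of the radius, to be read up to
  equality almost everywhere on \<open>{0<..}\<close>; values at negative arguments play no role.
  Integrability with respect to \<open>lborel\<close> selects Borel representatives, which every
  Lebesgue class has.\<close>

definition radial_ext :: "(real \<Rightarrow> real) \<Rightarrow> real^3 \<Rightarrow> real" where
  "radial_ext S x = S (norm x)"

definition H1r :: "(real \<Rightarrow> real) set" where
  "H1r = {S. integrable lborel (\<lambda>x. (radial_ext S x)\<^sup>2) \<and>
     (\<exists>g. has_weak_gradient (radial_ext S) g UNIV \<and> integrable lborel (\<lambda>x. (norm (g x))\<^sup>2))}"

definition D1r :: "(real \<Rightarrow> real) set" where
  "D1r = {Z. integrable lborel (\<lambda>x. (radial_ext Z x) ^ 6) \<and>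
     (\<exists>g. has_weak_gradient (radial_ext Z) g UNIV \<and> integrable lborel (\<lambda>x. (norm (g x))\<^sup>2))}"

text \<open>The prime is the weak derivative on \<open>{0<..}\<close>. It is unique up to null sets, and it
  exists for all elements of \<open>H1r\<close> and \<open>D1r\<close>, so the choice is immaterial under the integral.\<close>

definition radial_deriv :: "(real \<Rightarrow> real) \<Rightarrow> real \<Rightarrow> real" where
  "radial_deriv S = (SOME S'. has_weak_gradient S S' {0<..})"

definition energy :: "real \<Rightarrow> (real \<Rightarrow> real) \<Rightarrow> (real \<Rightarrow> real) \<Rightarrow> real" where
  "energy \<mu> S Z = 1/2 * (LINT \<xi>:{0<..}|lborel.
     ((radial_deriv S \<xi>)\<^sup>2 + (S \<xi>)\<^sup>2 + (radial_deriv Z \<xi>)\<^sup>2 / (2 * \<mu>)) * \<xi>\<^sup>2)"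

definition interaction :: "(real \<Rightarrow> real) \<Rightarrow> (real \<Rightarrow> real) \<Rightarrow> real" where
  "interaction S Z = 1/2 * (LINT \<xi>:{0<..}|lborel. (S \<xi>)\<^sup>2 * Z \<xi> * \<xi>\<^sup>2)"

definition admissible :: "((real \<Rightarrow> real) \<times> (real \<Rightarrow> real)) set" where
  "admissible = {(S, Z). S \<in> H1r \<and> Z \<in> D1r \<and> interaction S Z = -1}"

definition is_minimizer :: "real \<Rightarrow> (real \<Rightarrow> real) \<Rightarrow> (real \<Rightarrow> real) \<Rightarrow> bool" where
  "is_minimizer \<mu> S Z \<longleftrightarrow> (S, Z) \<in> admissible \<and>
     energy \<mu> S Z = (INF (T, W)\<in>admissible. energy \<mu> T W)"

definition has_radial_laplacian :: "(real \<Rightarrow> real) \<Rightarrow> (real \<Rightarrow> real) \<Rightarrow> bool" where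
  "has_radial_laplacian S L \<longleftrightarrow> (\<exists>S' S''. has_weak_gradient S S' {0<..} \<and>
     has_weak_gradient S' S'' {0<..} \<and>
     (AE \<xi> in lborel. \<xi> > 0 \<longrightarrow> L \<xi> = S'' \<xi> + 2 / \<xi> * S' \<xi>))"

text \<open>The filter \<open>inf at_top (ae_filter lborel)\<close> expresses the limit at infinity outside a null
  set, as is appropriate for functions given up to equality almost everywhere.\<close>

definition solves_system :: "real \<Rightarrow> (real \<Rightarrow> real) \<Rightarrow> (real \<Rightarrow> real) \<Rightarrow> bool" where
  "solves_system \<mu> S Z \<longleftrightarrow>
     (\<exists>LS. has_radial_laplacian S LS \<and>
        (AE \<xi> in lborel. \<xi> > 0 \<longrightarrow> LS \<xi> - S \<xi> = S \<xi> * Z \<xi>)) \<and>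
     (\<exists>LZ. has_radial_laplacian Z LZ \<and>
        (AE \<xi> in lborel. \<xi> > 0 \<longrightarrow> LZ \<xi> = \<mu> * (S \<xi>)\<^sup>2)) \<and>
     (S \<longlongrightarrow> 0) (inf at_top (ae_filter lborel)) \<and>
     (Z \<longlongrightarrow> 0) (inf at_top (ae_filter lborel))"

definition trivial_pair :: "(real \<Rightarrow> real) \<Rightarrow> (real \<Rightarrow> real) \<Rightarrow> bool" where
  "trivial_pair S Z \<longleftrightarrow> (AE \<xi> in lborel. \<xi> > 0 \<longrightarrow> S \<xi> = 0 \<and> Z \<xi> = 0)"

definition mass :: "real \<Rightarrow> (real \<Rightarrow> real) \<Rightarrow> real" where
  "mass \<mu> S = \<mu> * (LINT \<xi>:{0<..}|lborel. \<xi>\<^sup>2 * (S \<xi>)\<^sup>2)"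

end

theory Submission
  imports Defs "HOL-Library.Diagonal_Subsequence"
begin

text \<open>Write \<open>m r = \<integral>\<^sub>0\<^sup>r S\<^sup>2 s\<^sup>2 ds\<close> and \<open>K = \<integral> m\<^sup>2 / r\<^sup>2 dr\<close>. Since \<open>2 I[S,Z] = - \<integral> m Z' dr\<close>, for fixed \<open>S\<close> the
  Cauchy--Schwarz inequality gives \<open>\<integral> Z'\<^sup>2 r\<^sup>2 dr \<ge> 4 / K\<close>, with equality exactly for a multiple of the Newtonian
  potential of \<open>S\<^sup>2\<close>. Minimising \<open>E\<close> thus amounts to maximising \<open>K\<close>, which is homogeneous of degree four,
  on the unit sphere of \<open>H\<^sup>1\<close>; the radial bounds on \<open>m\<close> make \<open>K\<close> continuous under pointwise convergence. The
  first variation at a maximiser is the equation for \<open>S\<close>.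

  For the mass bound put \<open>A = \<integral> S'\<^sup>2 r\<^sup>2 dr\<close>, \<open>B = \<integral> S\<^sup>2 r\<^sup>2 dr\<close> and \<open>C = - \<integral> S\<^sup>2 Z r\<^sup>2 dr\<close>. The energy identity
  \<open>A + B = C\<close> and the Pohozaev identity give \<open>B = 3 A\<close> and \<open>C = 4 A\<close>, while \<open>- Z \<le> M / r\<close> gives
  \<open>C \<le> M \<integral> S\<^sup>2 r dr \<le> M \<surd>(A B)\<close>. Hence \<open>M \<ge> 4 / \<surd>3\<close>, which exceeds \<open>3 \<pi> \<surd>3 / 8\<close> because \<open>\<pi> \<le> 32 / 9\<close>.\<close>

section \<open>Absolutely continuous functions on the half-line\<close>

text \<open>All estimates live on the half-line, where a Sobolev function has a locally absolutely
  continuous representative. The passage from weak gradients in space tests with radial fields. The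
  passage back is available for profiles whose derivative is continuous and bounded near the origin;
  this is why a maximiser must first be shown to be regular. In the integral identities no pointwise
  bound on S' is at hand, so boundary terms vanish only along sequences approaching 0 and infinity;
  that suffices because the integrands are known to be integrable. With N the squared norm of S and
  D the weighted Dirichlet integral of Z, the Dirichlet bound and the maximality of the constant
  \<kappa> reduce the problem to minimising N + D / (2 \<mu>) subject to \<kappa> N^2 D \<ge> 4,
  which a cubic identity solves. Its equality case covers every minimiser, not only the constructed
  one, and explains the common scaling factor N0 / 2. The zero pair solves the system with mass
  zero, so the mass bound concerns nontrivial pairs.\<close>

definition ray :: "real measure" where
  "ray = restrict_space lborel {0<..}"

lemma space_ray [simp]: "space ray = {0<..}"
  by (simp add: ray_def space_restrict_space)

lemma AE_ray: "(AE x in ray. P x) \<longleftrightarrow> (AE x in lborel. x > 0 \<longrightarrow> P x)"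
  unfolding ray_def by (subst AE_restrict_space_iff) auto

lemma integral_ray: "integral\<^sup>L ray f = (LINT x:{0<..}|lborel. f x)" for f :: "real \<Rightarrow> real"
  by (simp add: ray_def integral_restrict_space set_lebesgue_integral_def)

lemma integrable_ray: "integrable ray f \<longleftrightarrow> set_integrable lborel {0<..} f" for f :: "real \<Rightarrow> real"
  by (simp add: ray_def integrable_restrict_space set_integrable_def)

lemma measurable_ray_iff: "f \<in> borel_measurable ray \<longleftrightarrow> f \<in> borel_measurable (restrict_space borel {0<..})"
  for f :: "real \<Rightarrow> real"
  by (rule measurable_cong_sets[THEN arg_cong[where f="\<lambda>A. f \<in> A"]])
     (simp_all add: ray_def sets_restrict_space)

lemma borel_measurable_ray [measurable (raw)]: "f \<in> borel_measurable borel \<Longrightarrow> f \<in> borel_measurable ray"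
  for f :: "real \<Rightarrow> real"
  unfolding measurable_ray_iff by (rule measurable_restrict_space1)

lemma id_measurable_ray [measurable]: "(\<lambda>x. x) \<in> measurable ray borel"
  by (rule borel_measurable_ray) simp

lemma continuous_measurable_ray: "continuous_on {0<..} f \<Longrightarrow> f \<in> borel_measurable ray"
  for f :: "real \<Rightarrow> real"
  unfolding measurable_ray_iff by (rule borel_measurable_continuous_on_restrict)

lemma sigma_finite_ray: "sigma_finite_measure ray"
  unfolding ray_def by (rule sigma_finite_measure_restrict_space[OF sigma_finite_lborel]) simp

lemma indicator_ray [measurable]: "(indicator {a..b} :: real \<Rightarrow> real) \<in> borel_measurable ray"
  by (rule borel_measurable_ray) simp

lemma integral_ray_indicator:
  fixes f :: "real \<Rightarrow> real"
  assumes "0 < a"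
  shows "integrable ray (\<lambda>x. indicator {a..b} x * f x) \<longleftrightarrow> set_integrable lborel {a..b} f"
    and "(\<integral>x. indicator {a..b} x * f x \<partial>ray) = (LINT x:{a..b}|lborel. f x)"
proof -
  have eq: "indicator {0<..} x *\<^sub>R (indicator {a..b} x * f x) = indicator {a..b} x *\<^sub>R f x" for x
    using assms by (auto simp: indicator_def)
  show "integrable ray (\<lambda>x. indicator {a..b} x * f x) \<longleftrightarrow> set_integrable lborel {a..b} f"
    unfolding integrable_ray set_integrable_def eq ..
  show "(\<integral>x. indicator {a..b} x * f x \<partial>ray) = (LINT x:{a..b}|lborel. f x)"
    unfolding integral_ray set_lebesgue_integral_def eq ..
qed

text \<open>The polynomial in t given by the integral of (t f + g)^2 is nonnegative, and its value
  at the minimiser -I / F is the inequality. When F = 0 the polynomial is affine, and an affine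
  function bounded below has slope zero.\<close>

lemma
  fixes f g :: "'a \<Rightarrow> real"
  assumes [measurable]: "f \<in> borel_measurable M" "g \<in> borel_measurable M"
    and f: "integrable M (\<lambda>x. (f x)\<^sup>2)" and g: "integrable M (\<lambda>x. (g x)\<^sup>2)"
  shows integrable_mult_L2: "integrable M (\<lambda>x. f x * g x)"
    and Cauchy_Schwarz_integral:
      "\<bar>\<integral>x. f x * g x \<partial>M\<bar> \<le> sqrt (\<integral>x. (f x)\<^sup>2 \<partial>M) * sqrt (\<integral>x. (g x)\<^sup>2 \<partial>M)"
proof -
  have bd: "\<bar>f x * g x\<bar> \<le> ((f x)\<^sup>2 + (g x)\<^sup>2) / 2" for x
    using sum_squares_bound[of "\<bar>f x\<bar>" "\<bar>g x\<bar>"] by (simp add: abs_mult)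
  show int: "integrable M (\<lambda>x. f x * g x)"
    by (rule Bochner_Integration.integrable_bound[where f="\<lambda>x. ((f x)\<^sup>2 + (g x)\<^sup>2) / 2"])
       (use f g bd in \<open>auto intro!: AE_I2\<close>)
  let ?F = "\<integral>x. (f x)\<^sup>2 \<partial>M" and ?G = "\<integral>x. (g x)\<^sup>2 \<partial>M" and ?I = "\<integral>x. f x * g x \<partial>M"
  have quad: "0 \<le> ?F * t\<^sup>2 + 2 * ?I * t + ?G" for t
  proof -
    have "0 \<le> (\<integral>x. (t * f x + g x)\<^sup>2 \<partial>M)" by simp
    also have "\<dots> = (\<integral>x. t\<^sup>2 * (f x)\<^sup>2 + 2 * t * (f x * g x) + (g x)\<^sup>2 \<partial>M)"
      by (simp add: power2_sum power_mult_distrib algebra_simps)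
    also have "\<dots> = t\<^sup>2 * ?F + 2 * t * ?I + ?G" using f g int by simp
    finally show ?thesis by (simp add: algebra_simps)
  qed
  have F0: "0 \<le> ?F" and G0: "0 \<le> ?G" by simp_all
  have "?I\<^sup>2 \<le> ?F * ?G"
  proof (cases "?F = 0")
    case True
    have "?I = 0"
    proof (rule ccontr)
      assume "?I \<noteq> 0"
      \<comment> \<open>With F = 0 this argument gives the polynomial the value -1.\<close>
      with quad[of "- (?G + 1) / (2 * ?I)"] True show False by (simp add: field_simps)
    qed
    then show ?thesis using True by simp
  next
    case False
    then have "?F > 0" using F0 by linarith
    with quad[of "- ?I / ?F"] show ?thesis by (simp add: field_simps power2_eq_square)
  qed
  then have "sqrt (?I\<^sup>2) \<le> sqrt (?F * ?G)" by (rule real_sqrt_le_mono)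
  then show "\<bar>?I\<bar> \<le> sqrt ?F * sqrt ?G" by (simp add: real_sqrt_mult)
qed

text \<open>Local absolute continuity on the open half-line, expressed through the fundamental
  theorem of calculus. Increments of \<open>F\<close> are thereby fixed exactly, while
  \<open>f\<close> matters only up to null sets; nothing is prescribed at 0 or at infinity.\<close>

definition has_ac_derivative :: "(real \<Rightarrow> real) \<Rightarrow> (real \<Rightarrow> real) \<Rightarrow> bool" where
  "has_ac_derivative F f \<longleftrightarrow> (\<forall>a b. 0 < a \<longrightarrow> a \<le> b \<longrightarrow>
     integrable ray (\<lambda>x. indicator {a..b} x * f x) \<and> (\<integral>x. indicator {a..b} x * f x \<partial>ray) = F b - F a)"

lemma has_ac_derivativeD:
  assumes "has_ac_derivative F f" "0 < a" "a \<le> b"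
  shows "integrable ray (\<lambda>x. indicator {a..b} x * f x)" "(\<integral>x. indicator {a..b} x * f x \<partial>ray) = F b - F a"
  using assms unfolding has_ac_derivative_def by blast+

lemma has_ac_derivative_measurable:
  assumes "has_ac_derivative F f"
  shows "f \<in> borel_measurable ray"
proof (rule borel_measurable_LIMSEQ_real[where u="\<lambda>n x. indicator {1/real (Suc n)..real (Suc n)} x * f x"])
  fix x assume "x \<in> space ray"
  then have x: "x > 0" by simp
  have "\<forall>\<^sub>F n in sequentially. 1/real (Suc n) \<le> x"
    using order_tendstoD(2)[OF LIMSEQ_inverse_real_of_nat x] by eventually_elim (simp add: field_simps)
  moreover have "\<forall>\<^sub>F n in sequentially. x \<le> real (Suc n)"
    using eventually_ge_at_top[of "nat \<lceil>x\<rceil>"] by eventually_elim linarith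
  ultimately have "\<forall>\<^sub>F n in sequentially. indicator {1/real (Suc n)..real (Suc n)} x * f x = f x"
    by eventually_elim simp
  then show "(\<lambda>n. indicator {1/real (Suc n)..real (Suc n)} x * f x) \<longlonglongrightarrow> f x"
    by (rule tendsto_eventually)
next
  fix n
  have "integrable ray (\<lambda>x. indicator {1/real (Suc n)..real (Suc n)} x * f x)"
    by (rule has_ac_derivativeD[OF assms]) (auto simp: field_simps)
  then show "(\<lambda>x. indicator {1/real (Suc n)..real (Suc n)} x * f x) \<in> borel_measurable ray"
    by simp
qed

lemma has_ac_derivative_integral:
  assumes "has_ac_derivative F f" "0 < a" "a \<le> b"
  shows "f integrable_on {a..b}" "integral {a..b} f = F b - F a"
  using has_ac_derivativeD[OF assms] assms(2)
  by (auto simp: integral_ray_indicator set_borel_integral_eq_integral)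

lemma has_ac_derivative_continuous:
  assumes "has_ac_derivative F f"
  shows "continuous_on {0<..} F"
proof -
  have "isCont F x" if "x > 0" for x
  proof -
    have "continuous_on {x/2..2*x} (\<lambda>y. F (x/2) + integral {x/2..y} f)"
      by (intro continuous_intros indefinite_integral_continuous_1 has_ac_derivative_integral(1)[OF assms])
         (use that in auto)
    moreover have "F (x/2) + integral {x/2..y} f = F y" if "y \<in> {x/2..2*x}" for y
      using has_ac_derivative_integral(2)[OF assms, of "x/2" y] that \<open>x > 0\<close> by simp
    ultimately have "continuous_on {x/2..2*x} F" by (rule continuous_on_eq)
    then show ?thesis by (rule continuous_on_interior) (use that in simp)
  qed
  then show ?thesis by (simp add: continuous_at_imp_continuous_on)
qed

lemma has_ac_derivative_measurable':
  "has_ac_derivative F f \<Longrightarrow> F \<in> borel_measurable ray"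
  by (rule continuous_measurable_ray[OF has_ac_derivative_continuous])

lemma has_ac_derivative_C1:
  assumes F: "\<And>x. x > 0 \<Longrightarrow> (F has_real_derivative f x) (at x)" and f: "continuous_on {0<..} f"
  shows "has_ac_derivative F f"
  unfolding has_ac_derivative_def
proof (intro allI impI)
  fix a b :: real assume ab: "0 < a" "a \<le> b"
  have c: "continuous_on {a..b} f" using f by (rule continuous_on_subset) (use ab in auto)
  have i: "set_integrable lborel {a..b} f" by (rule borel_integrable_atLeastAtMost') (rule c)
  have "(f has_integral F b - F a) {a..b}"
  proof (rule fundamental_theorem_of_calculus)
    fix x assume "x \<in> {a..b}"
    then have "(F has_real_derivative f x) (at x within {a..b})"
      using F[of x] ab by (auto intro: DERIV_subset)
    then show "(F has_vector_derivative f x) (at x within {a..b})"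
      by (simp add: has_real_derivative_iff_has_vector_derivative)
  qed (rule ab)
  then have "integral {a..b} f = F b - F a" by (rule integral_unique)
  then show "integrable ray (\<lambda>x. indicator {a..b} x * f x) \<and> (\<integral>x. indicator {a..b} x * f x \<partial>ray) = F b - F a"
    using i ab by (simp add: integral_ray_indicator set_borel_integral_eq_integral)
qed

text \<open>Continuity of \<open>f\<close> upgrades the integral relation to a derivative at every
  point, as the return to classical radial profiles requires.\<close>

lemma has_ac_derivative_deriv:
  assumes F: "has_ac_derivative F f" and f: "continuous_on {0<..} f" and x: "x > 0"
  shows "(F has_real_derivative f x) (at x)"
proof -
  have c: "continuous_on {x/2..2*x} f" using f by (rule continuous_on_subset) (use x in auto)
  have "((\<lambda>y. integral {x/2..y} f) has_real_derivative f x) (at x within {x/2..2*x})"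
    by (rule integral_has_real_derivative[OF c]) (use x in auto)
  then have "((\<lambda>y. integral {x/2..y} f) has_real_derivative f x) (at x)"
    using x by (subst (asm) at_within_Icc_at) auto
  then have "((\<lambda>y. F (x/2) + integral {x/2..y} f) has_real_derivative f x) (at x)"
    by (auto intro!: derivative_eq_intros)
  then show ?thesis
  proof (rule has_field_derivative_transform_within_open[where S="{x/2<..<2*x}"])
    fix y assume "y \<in> {x/2<..<2*x}"
    then show "F (x/2) + integral {x/2..y} f = F y"
      using has_ac_derivative_integral(2)[OF F, of "x/2" y] x by simp
  qed (use x in auto)
qed

lemma has_ac_derivative_cong:
  assumes F: "has_ac_derivative F f" and "\<And>x. x > 0 \<Longrightarrow> F x = G x" and fg: "AE x in ray. f x = g x"
    and [measurable]: "g \<in> borel_measurable ray"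
  shows "has_ac_derivative G g"
  unfolding has_ac_derivative_def
proof (intro allI impI)
  fix a b :: real assume ab: "0 < a" "a \<le> b"
  note [measurable] = has_ac_derivative_measurable[OF F]
  have ae: "AE x in ray. indicator {a..b} x * f x = indicator {a..b} x * g x"
    using fg by eventually_elim simp
  show "integrable ray (\<lambda>x. indicator {a..b} x * g x) \<and> (\<integral>x. indicator {a..b} x * g x \<partial>ray) = G b - G a"
    using has_ac_derivativeD[OF F ab] integrable_cong_AE[OF _ _ ae] integral_cong_AE[OF _ _ ae] assms(2)[of a] assms(2)[of b] ab
    by auto
qed

lemma has_ac_derivative_add:
  assumes "has_ac_derivative F f" "has_ac_derivative G g"
  shows "has_ac_derivative (\<lambda>x. F x + G x) (\<lambda>x. f x + g x)"
  unfolding has_ac_derivative_def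
proof (intro allI impI)
  fix a b :: real assume ab: "0 < a" "a \<le> b"
  show "integrable ray (\<lambda>x. indicator {a..b} x * (f x + g x)) \<and>
      (\<integral>x. indicator {a..b} x * (f x + g x) \<partial>ray) = F b + G b - (F a + G a)"
    using has_ac_derivativeD[OF assms(1) ab] has_ac_derivativeD[OF assms(2) ab] by (simp add: distrib_left)
qed

lemma has_ac_derivative_cmult:
  assumes "has_ac_derivative F f"
  shows "has_ac_derivative (\<lambda>x. c * F x) (\<lambda>x. c * f x)"
proof -
  have eq: "indicator {a..b} x * (c * f x) = c * (indicator {a..b} x * f x)" for a b x :: real by simp
  show ?thesis unfolding has_ac_derivative_def eq using has_ac_derivativeD[OF assms] by (simp add: right_diff_distrib)
qed

lemma has_ac_derivative_const: "has_ac_derivative (\<lambda>x. c) (\<lambda>x. 0)"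
  unfolding has_ac_derivative_def by auto

lemma has_ac_derivative_bounded_mult:
  assumes f: "has_ac_derivative F f" and G: "continuous_on {0<..} G" and ab: "0 < a" "a \<le> b"
  shows "integrable ray (\<lambda>x. indicator {a..b} x * (f x * G x))"
proof -
  note [measurable] = has_ac_derivative_measurable[OF f] continuous_measurable_ray[OF G]
  have "continuous_on {a..b} G" using G by (rule continuous_on_subset) (use ab in auto)
  then have "bounded (G ` {a..b})" by (intro compact_imp_bounded compact_continuous_image) auto
  then obtain C where C: "\<And>x. x \<in> {a..b} \<Longrightarrow> \<bar>G x\<bar> \<le> C" 
    unfolding bounded_iff by (metis image_eqI real_norm_def)
  show ?thesis
  proof (rule Bochner_Integration.integrable_bound[where f="\<lambda>x. C * (indicator {a..b} x * f x)"])
    show "AE x in ray. norm (indicator {a..b} x * (f x * G x)) \<le> norm (C * (indicator {a..b} x * f x))"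
    proof (rule AE_I2)
      fix x show "norm (indicator {a..b} x * (f x * G x)) \<le> norm (C * (indicator {a..b} x * f x))"
      proof (cases "x \<in> {a..b}")
        case True
        have "\<bar>G x\<bar> * \<bar>f x\<bar> \<le> \<bar>C\<bar> * \<bar>f x\<bar>" by (rule mult_right_mono) (use C[OF True] in auto)
        then show ?thesis using True by (simp add: abs_mult mult.commute)
      qed simp
    qed
  qed (use has_ac_derivativeD[OF f ab] in auto)
qed

text \<open>The product rule is Fubini's theorem for \<open>f \<otimes> g\<close> on the square, split along the diagonal.\<close>

lemma has_ac_derivative_mult:
  assumes F: "has_ac_derivative F f" and G: "has_ac_derivative G g"
  shows "has_ac_derivative (\<lambda>x. F x * G x) (\<lambda>x. f x * G x + F x * g x)"
  unfolding has_ac_derivative_def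
proof (intro allI impI)
  fix a b :: real assume ab: "0 < a" "a \<le> b"
  interpret sigma_finite_measure ray by (rule sigma_finite_ray)
  interpret pair_sigma_finite ray ray ..
  note [measurable] = has_ac_derivative_measurable[OF F] has_ac_derivative_measurable[OF G]
    has_ac_derivative_measurable'[OF F] has_ac_derivative_measurable'[OF G]
  define f1 where "f1 x = indicator {a..b} x * f x" for x
  define g1 where "g1 x = indicator {a..b} x * g x" for x
  have f1: "integrable ray f1" "integral\<^sup>L ray f1 = F b - F a"
    and g1: "integrable ray g1" "integral\<^sup>L ray g1 = G b - G a"
    using has_ac_derivativeD[OF F ab] has_ac_derivativeD[OF G ab] unfolding f1_def g1_def by auto
  have [measurable]: "f1 \<in> borel_measurable ray" "g1 \<in> borel_measurable ray" using f1 g1 by auto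
  have i1: "integrable (ray \<Otimes>\<^sub>M ray) (\<lambda>(x, y). f1 x * g1 y)"
  proof (rule Fubini_integrable)
    show "integrable ray (\<lambda>x. \<integral>y. norm (case (x, y) of (x, y) \<Rightarrow> f1 x * g1 y) \<partial>ray)"
      using f1 by (simp add: abs_mult)
  qed (use g1 in auto)
  have i2: "integrable (ray \<Otimes>\<^sub>M ray) (\<lambda>(x, y). indicator {(x, y). y \<le> x} (x, y) * (f1 x * g1 y))"
    by (rule Bochner_Integration.integrable_bound[OF i1]) (auto simp: indicator_def)
  have i3: "integrable (ray \<Otimes>\<^sub>M ray) (\<lambda>(x, y). indicator {(x, y). x < y} (x, y) * (f1 x * g1 y))"
    by (rule Bochner_Integration.integrable_bound[OF i1]) (auto simp: indicator_def)
  have A: "(\<integral>y. indicator {(x, y). y \<le> x} (x, y) * (f1 x * g1 y) \<partial>ray) = f1 x * (G x - G a)" for x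
  proof (cases "x \<in> {a..b}")
    case True
    have "(\<integral>y. indicator {(x, y). y \<le> x} (x, y) * (f1 x * g1 y) \<partial>ray)
        = (\<integral>y. f1 x * (indicator {a..x} y * g y) \<partial>ray)"
      by (rule Bochner_Integration.integral_cong) (use True in \<open>auto simp: g1_def indicator_def\<close>)
    then show ?thesis using has_ac_derivativeD[OF G, of a x] True ab by simp
  qed (simp add: f1_def)
  have B: "(\<integral>x. indicator {(x, y). x < y} (x, y) * (f1 x * g1 y) \<partial>ray) = g1 y * (F y - F a)" for y
  proof (cases "y \<in> {a..b}")
    case True
    have "(\<integral>x. indicator {(x, y). x < y} (x, y) * (f1 x * g1 y) \<partial>ray)
        = (\<integral>x. g1 y * (indicator {a..y} x * f x) \<partial>ray)"
    proof (rule integral_cong_AE)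
      \<comment> \<open>The triangle is open along the diagonal, whereas the increment of
        \<open>F\<close> is an integral over a closed interval; the two differ at the single point
        \<open>y\<close>.\<close>
      have "AE x in lborel. x \<noteq> y" by (rule AE_lborel_singleton)
      then have "AE x in ray. x \<noteq> y" unfolding AE_ray by auto
      then show "AE x in ray. indicator {(x, y). x < y} (x, y) * (f1 x * g1 y) = g1 y * (indicator {a..y} x * f x)"
        by eventually_elim (use True in \<open>auto simp: f1_def indicator_def\<close>)
    qed auto
    then show ?thesis using has_ac_derivativeD[OF F, of a y] True ab by simp
  qed (simp add: g1_def)
  have "(F b - F a) * (G b - G a) = (\<integral>x. (\<integral>y. f1 x * g1 y \<partial>ray) \<partial>ray)"
    using f1 g1 by simp
  also have "\<dots> = integral\<^sup>L (ray \<Otimes>\<^sub>M ray) (\<lambda>(x, y). f1 x * g1 y)"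
    using integral_fst'[OF i1] by simp
  also have "\<dots> = integral\<^sup>L (ray \<Otimes>\<^sub>M ray) (\<lambda>z. (case z of (x, y) \<Rightarrow> indicator {(x, y). y \<le> x} (x, y) * (f1 x * g1 y))
      + (case z of (x, y) \<Rightarrow> indicator {(x, y). x < y} (x, y) * (f1 x * g1 y)))"
    by (rule Bochner_Integration.integral_cong) (auto simp: indicator_def)
  also have "\<dots> = (\<integral>x. f1 x * (G x - G a) \<partial>ray) + (\<integral>y. g1 y * (F y - F a) \<partial>ray)"
    unfolding Bochner_Integration.integral_add[OF i2 i3]
    using integral_fst'[OF i2] integral_snd[OF i3] by (simp add: A B)
  finally have eq: "(F b - F a) * (G b - G a) = (\<integral>x. f1 x * (G x - G a) \<partial>ray) + (\<integral>y. g1 y * (F y - F a) \<partial>ray)" .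
  have j1: "integrable ray (\<lambda>x. f1 x * G x)"
    using has_ac_derivative_bounded_mult[OF F has_ac_derivative_continuous[OF G] ab] by (simp add: f1_def mult.assoc)
  have j2: "integrable ray (\<lambda>x. g1 x * F x)"
    using has_ac_derivative_bounded_mult[OF G has_ac_derivative_continuous[OF F] ab] by (simp add: g1_def mult.assoc)
  have split: "indicator {a..b} x * (f x * G x + F x * g x) = f1 x * G x + g1 x * F x" for x
    by (simp add: f1_def g1_def algebra_simps)
  have "(\<integral>x. f1 x * (G x - G a) \<partial>ray) = (\<integral>x. f1 x * G x \<partial>ray) - (F b - F a) * G a"
    using f1 j1 by (simp add: right_diff_distrib)
  moreover have "(\<integral>x. g1 x * (F x - F a) \<partial>ray) = (\<integral>x. g1 x * F x \<partial>ray) - (G b - G a) * F a"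
    using g1 j2 by (simp add: right_diff_distrib)
  ultimately have "(\<integral>x. f1 x * G x \<partial>ray) + (\<integral>x. g1 x * F x \<partial>ray) = F b * G b - F a * G a"
    using eq by algebra
  then show "integrable ray (\<lambda>x. indicator {a..b} x * (f x * G x + F x * g x)) \<and>
    (\<integral>x. indicator {a..b} x * (f x * G x + F x * g x) \<partial>ray) = F b * G b - F a * G a"
    unfolding split using j1 j2 by simp
qed

text \<open>Smallness is asked for only along some points approaching each end, because
  integrability of a function of the radius yields no more than that.\<close>

definition vanishes_at_ends :: "(real \<Rightarrow> real) \<Rightarrow> bool" where
  "vanishes_at_ends F \<longleftrightarrow> (\<forall>e>0. \<exists>a. 0 < a \<and> a < e \<and> \<bar>F a\<bar> < e) \<and> (\<forall>e>0. \<exists>b>1/e. \<bar>F b\<bar> < e)"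

lemma vanishes_at_endsI:
  assumes "(F \<longlongrightarrow> 0) (at_right 0)" "(F \<longlongrightarrow> 0) at_top"
  shows "vanishes_at_ends F"
  unfolding vanishes_at_ends_def
proof (intro conjI allI impI)
  fix e :: real assume e: "e > 0"
  have "\<forall>\<^sub>F a in at_right 0. \<bar>F a\<bar> < e" using tendstoD[OF assms(1) e] by (simp add: dist_real_def)
  moreover have "\<forall>\<^sub>F a in at_right 0. a < e \<and> 0 < a"
    using e unfolding eventually_at_right_field by auto
  ultimately have "\<forall>\<^sub>F a in at_right 0. 0 < a \<and> a < e \<and> \<bar>F a\<bar> < e" by eventually_elim auto
  then show "\<exists>a. 0 < a \<and> a < e \<and> \<bar>F a\<bar> < e" using eventually_happens by force
  have "\<forall>\<^sub>F b in at_top. \<bar>F b\<bar> < e" using tendstoD[OF assms(2) e] by (simp add: dist_real_def)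
  then have "\<forall>\<^sub>F b in at_top. b > 1/e \<and> \<bar>F b\<bar> < e" using eventually_gt_at_top[of "1/e"] by eventually_elim auto
  then show "\<exists>b>1/e. \<bar>F b\<bar> < e" using eventually_happens by force
qed

lemma integral_exhaust:
  fixes f :: "real \<Rightarrow> real"
  assumes f: "integrable ray f" and a: "a \<longlonglongrightarrow> 0" and b: "filterlim b at_top sequentially"
  shows "(\<lambda>n. \<integral>x. indicator {a n..b n} x * f x \<partial>ray) \<longlonglongrightarrow> integral\<^sup>L ray f"
proof (rule integral_dominated_convergence[where w="\<lambda>x. norm (f x)"])
  show "AE x in ray. (\<lambda>n. indicator {a n..b n} x * f x) \<longlonglongrightarrow> f x"
  proof (rule AE_I2)
    fix x assume "x \<in> space ray" then have x: "x > 0" by simp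
    have "\<forall>\<^sub>F n in sequentially. a n < x" using order_tendstoD(2)[OF a x] .
    moreover have "\<forall>\<^sub>F n in sequentially. x \<le> b n" using b by (simp add: filterlim_at_top)
    ultimately have "\<forall>\<^sub>F n in sequentially. indicator {a n..b n} x * f x = f x"
      by eventually_elim simp
    then show "(\<lambda>n. indicator {a n..b n} x * f x) \<longlonglongrightarrow> f x" by (rule tendsto_eventually)
  qed
qed (use f in \<open>auto simp: indicator_def intro!: AE_I2\<close>)

text \<open>Integrals over exhausting intervals converge by dominated convergence whatever the
  endpoints are, so the limit may be computed along the particular endpoints at which
  \<open>F\<close> is small.\<close>

lemma integral_ac_derivative_eq_0:
  assumes F: "has_ac_derivative F f" and f: "integrable ray f" and v: "vanishes_at_ends F"
  shows "integral\<^sup>L ray f = 0"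
proof -
  have "\<forall>n. \<exists>a. 0 < a \<and> a < 1/real (Suc n) \<and> \<bar>F a\<bar> < 1/real (Suc n)"
    using v unfolding vanishes_at_ends_def by (auto simp del: of_nat_Suc)
  then obtain a where a: "\<And>n. 0 < a n" "\<And>n. a n < 1/real (Suc n)" "\<And>n. \<bar>F (a n)\<bar> < 1/real (Suc n)"
    by metis
  have "\<forall>n. \<exists>b. b > real (Suc n) \<and> \<bar>F b\<bar> < 1/real (Suc n)"
  proof
    fix n
    have "\<exists>b>1/(1/real (Suc n)). \<bar>F b\<bar> < 1/real (Suc n)"
      using v unfolding vanishes_at_ends_def by (metis of_nat_0_less_iff zero_less_Suc zero_less_divide_1_iff)
    then show "\<exists>b. b > real (Suc n) \<and> \<bar>F b\<bar> < 1/real (Suc n)" by simp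
  qed
  then obtain b where b: "\<And>n. b n > real (Suc n)" "\<And>n. \<bar>F (b n)\<bar> < 1/real (Suc n)"
    by metis
  have lim: "(\<lambda>n. 1/real (Suc n)) \<longlonglongrightarrow> 0" using LIMSEQ_inverse_real_of_nat by (simp add: inverse_eq_divide)
  have a0: "a \<longlonglongrightarrow> 0"
    by (rule real_tendsto_sandwich[OF _ _ tendsto_const lim])
       (use a in \<open>auto intro!: always_eventually less_imp_le simp del: of_nat_Suc\<close>)
  have Fa: "(\<lambda>n. F (a n)) \<longlonglongrightarrow> 0"
    by (rule Lim_null_comparison[OF _ lim]) (use a in \<open>auto intro!: always_eventually less_imp_le simp del: of_nat_Suc\<close>)
  have Fb: "(\<lambda>n. F (b n)) \<longlonglongrightarrow> 0"
    by (rule Lim_null_comparison[OF _ lim]) (use b in \<open>auto intro!: always_eventually less_imp_le simp del: of_nat_Suc\<close>)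
  have binf: "filterlim b at_top sequentially"
    by (rule filterlim_at_top_mono[OF filterlim_real_sequentially])
       (use b in \<open>auto intro!: always_eventually simp: less_imp_le; smt (verit) of_nat_Suc\<close>)
  have ab: "a n \<le> b n" for n
  proof -
    have "a n < 1/real (Suc n)" by (rule a)
    also have "\<dots> \<le> real (Suc n)" by (simp add: field_simps)
    also have "\<dots> < b n" by (rule b)
    finally show ?thesis by simp
  qed
  have "(\<lambda>n. F (b n) - F (a n)) \<longlonglongrightarrow> integral\<^sup>L ray f"
    using integral_exhaust[OF f a0 binf] has_ac_derivativeD(2)[OF F a(1) ab] by simp
  moreover have "(\<lambda>n. F (b n) - F (a n)) \<longlonglongrightarrow> 0 - 0" by (intro tendsto_diff Fa Fb)
  ultimately show ?thesis using LIMSEQ_unique by fastforce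
qed

lemma has_ac_derivative_ln: "has_ac_derivative ln (\<lambda>x. 1 / x)"
  by (rule has_ac_derivative_C1) (auto intro!: derivative_eq_intros continuous_intros)

text \<open>Both limits inferior vanish because \<open>1/x\<close> is integrable at neither end of the half-line.\<close>

lemma integrable_ray_small_values:
  fixes h :: "real \<Rightarrow> real"
  assumes h: "integrable ray h" and pos: "\<And>x. x > 0 \<Longrightarrow> h x \<ge> 0" and e: "e > 0"
  shows "\<exists>a. 0 < a \<and> a < e \<and> a * h a < e" and "\<exists>b>1/e. b * h b < e"
proof -
  \<comment> \<open>On an interval inside \<open>I\<close> the function \<open>h\<close> is at least
    e / x, so its integral is at least \<open>e\<close> times the logarithmic length of that
    interval, and these lengths are unbounded.\<close>
  have key: False if I: "\<And>x. 0 < x \<Longrightarrow> x \<in> I \<Longrightarrow> x * h x \<ge> e"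
      and big: "\<And>C. \<exists>a b. 0 < a \<and> a \<le> b \<and> {a..b} \<subseteq> I \<and> ln b - ln a > C" for I
  proof -
    obtain a b where ab: "0 < a" "a \<le> b" "{a..b} \<subseteq> I" "ln b - ln a > integral\<^sup>L ray h / e"
      using big by blast
    have "e * (ln b - ln a) = (\<integral>x. e * (indicator {a..b} x * (1/x)) \<partial>ray)"
      unfolding integral_mult_right_zero has_ac_derivativeD(2)[OF has_ac_derivative_ln ab(1,2)] ..
    also have "\<dots> \<le> integral\<^sup>L ray h"
    proof (rule integral_mono)
      show "integrable ray (\<lambda>x. e * (indicator {a..b} x * (1/x)))"
        using has_ac_derivativeD(1)[OF has_ac_derivative_ln ab(1,2)] by (rule integrable_mult_right)
      fix x assume "x \<in> space ray" then have x: "x > 0" by simp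
      show "e * (indicator {a..b} x * (1/x)) \<le> h x"
      proof (cases "x \<in> {a..b}")
        case True
        then have "x * h x \<ge> e" using I[OF x] ab(3) by auto
        then show ?thesis using x True by (simp add: field_simps)
      qed (use pos[OF x] in simp)
    qed (rule h)
    finally show False using ab(4) e by (simp add: field_simps)
  qed
  show "\<exists>a. 0 < a \<and> a < e \<and> a * h a < e"
  proof (rule ccontr)
    assume n: "\<not> ?thesis"
    show False
    proof (rule key[of "{..<e}"])
      fix C :: real
      \<comment> \<open>The left endpoint is chosen so that its logarithm lies |C| + 1 below that of
        e/2.\<close>
      have "ln (e/2) - ln (e/2 * exp (- (\<bar>C\<bar> + 1))) > C" using e by (subst ln_mult) auto
      moreover have "e/2 * exp (- (\<bar>C\<bar> + 1)) \<le> e/2 * 1" using e by (intro mult_left_mono) auto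
      ultimately show "\<exists>a b. 0 < a \<and> a \<le> b \<and> {a..b} \<subseteq> {..<e} \<and> ln b - ln a > C"
        using e by (intro exI[of _ "e/2 * exp (- (\<bar>C\<bar> + 1))"] exI[of _ "e/2"]) auto
    qed (use n in force)
  qed
  show "\<exists>b>1/e. b * h b < e"
  proof (rule ccontr)
    assume n: "\<not> ?thesis"
    show False
    proof (rule key[of "{1/e<..}"])
      fix C :: real
      have "ln (2/e * exp (\<bar>C\<bar> + 1)) - ln (2/e) > C" using e by (subst ln_mult) auto
      moreover have "2/e * 1 \<le> 2/e * exp (\<bar>C\<bar> + 1)" using e by (intro mult_left_mono) auto
      moreover have "1/e < 2/e" using e by (simp add: field_simps)
      ultimately show "\<exists>a b. 0 < a \<and> a \<le> b \<and> {a..b} \<subseteq> {1/e<..} \<and> ln b - ln a > C"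
        using e by (intro exI[of _ "2/e"] exI[of _ "2/e * exp (\<bar>C\<bar> + 1)"]) auto
    qed (use n in force)
  qed
qed

section \<open>Weak derivatives on the half-line\<close>

text \<open>Smoothness is localised to a set because the norm and real powers are smooth only away
  from zero, and the radial test fields are glued together from two open sets.\<close>

primrec Ck_on :: "'a::euclidean_space set \<Rightarrow> nat \<Rightarrow> ('a \<Rightarrow> real) \<Rightarrow> bool" where
  "Ck_on U 0 f \<longleftrightarrow> continuous_on U f"
| "Ck_on U (Suc k) f \<longleftrightarrow> (\<forall>x\<in>U. f differentiable (at x)) \<and>
     (\<forall>b\<in>Basis. Ck_on U k (\<lambda>x. frechet_derivative f (at x) b))"

lemma Ck_on_UNIV: "Ck_on UNIV k f \<longleftrightarrow> Ck k f"
  by (induction k arbitrary: f) auto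

lemma Ck_on_cong:
  assumes "open U" "\<And>x. x \<in> U \<Longrightarrow> f x = g x" "Ck_on U k f"
  shows "Ck_on U k g"
  using assms
proof (induction k arbitrary: f g)
  case 0
  then show ?case by (simp cong: continuous_on_cong)
next
  case (Suc k)
  have d: "frechet_derivative f (at x) = frechet_derivative g (at x)" if "x \<in> U" for x
    by (rule frechet_derivative_transform_within_open[OF _ Suc.prems(1) that Suc.prems(2)])
       (use Suc.prems(3) that in auto)
  have "g differentiable at x" if "x \<in> U" for x
  proof -
    from Suc.prems(3) that obtain f' where "(f has_derivative f') (at x)" by (auto simp: differentiable_def)
    then have "(g has_derivative f') (at x)"
      by (rule has_derivative_transform_within_open[OF _ Suc.prems(1) that Suc.prems(2)])
    then show ?thesis by (auto simp: differentiable_def)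
  qed
  moreover have "Ck_on U k (\<lambda>x. frechet_derivative g (at x) b)" if "b \<in> Basis" for b
    by (rule Suc.IH[where f="\<lambda>x. frechet_derivative f (at x) b"]) (use d Suc.prems that in auto)
  ultimately show ?case by simp
qed

lemma Ck_on_subset: "Ck_on U k f \<Longrightarrow> V \<subseteq> U \<Longrightarrow> Ck_on V k f"
  by (induction k arbitrary: f) (auto intro: continuous_on_subset)

lemma Ck_on_Un:
  "open U \<Longrightarrow> open V \<Longrightarrow> Ck_on U k f \<Longrightarrow> Ck_on V k f \<Longrightarrow> Ck_on (U \<union> V) k f"
  by (induction k arbitrary: f) (auto intro: continuous_on_open_Un)

text \<open>Allows a derivative to be exhibited by the differentiation rules instead of computing
  with \<open>frechet_derivative\<close>.\<close>

lemma Ck_on_SucI: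
  assumes "open U" "\<And>x. x \<in> U \<Longrightarrow> (f has_derivative D x) (at x)" "\<And>b. b \<in> Basis \<Longrightarrow> Ck_on U k (\<lambda>x. D x b)"
  shows "Ck_on U (Suc k) f"
proof -
  have "frechet_derivative f (at x) = D x" if "x \<in> U" for x
    using frechet_derivative_at[OF assms(2)[OF that]] by simp
  then have "Ck_on U k (\<lambda>x. frechet_derivative f (at x) b)" if "b \<in> Basis" for b
    by (intro Ck_on_cong[OF assms(1) _ assms(3)[OF that]]) simp
  then show ?thesis using assms(2) by (auto simp: differentiable_def)
qed

lemma Ck_on_SucD: "Ck_on U (Suc k) f \<Longrightarrow> Ck_on U k f"
proof (induction k arbitrary: f)
  case 0
  then show ?case by (auto intro!: continuous_at_imp_continuous_on differentiable_imp_continuous_within)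
next
  case (Suc k)
  then show ?case by (metis Ck_on.simps(2))
qed

lemma Ck_on_Suc_has_derivative:
  "Ck_on U (Suc k) f \<Longrightarrow> x \<in> U \<Longrightarrow> (f has_derivative frechet_derivative f (at x)) (at x)"
  by (simp add: frechet_derivative_works)

lemma Ck_on_const: "Ck_on U k (\<lambda>x. c)"
  by (induction k arbitrary: c) auto

lemma Ck_on_inner: "open U \<Longrightarrow> Ck_on U k (\<lambda>x. x \<bullet> b)"
proof (cases k)
  case (Suc j)
  assume "open U"
  then show ?thesis unfolding Suc
    by (intro Ck_on_SucI[where D="\<lambda>x h. h \<bullet> b"]) (auto intro!: derivative_eq_intros Ck_on_const)
qed (auto intro!: continuous_intros)

lemma Ck_on_id_real: "open U \<Longrightarrow> Ck_on U k (\<lambda>x::real. x)"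
  using Ck_on_inner[of U k 1] by simp

lemma Ck_on_add:
  assumes "open U" "Ck_on U k f" "Ck_on U k g"
  shows "Ck_on U k (\<lambda>x. f x + g x)"
  using assms
proof (induction k arbitrary: f g)
  case 0
  then show ?case by (auto intro: continuous_intros)
next
  case (Suc k)
  show ?case
  proof (rule Ck_on_SucI)
    show "((\<lambda>x. f x + g x) has_derivative (\<lambda>h. frechet_derivative f (at x) h + frechet_derivative g (at x) h)) (at x)"
      if "x \<in> U" for x
      by (intro derivative_intros Ck_on_Suc_has_derivative[OF Suc.prems(2) that] Ck_on_Suc_has_derivative[OF Suc.prems(3) that])
  qed (use Suc in auto)
qed

lemma Ck_on_mult:
  assumes "open U" "Ck_on U k f" "Ck_on U k g"
  shows "Ck_on U k (\<lambda>x. f x * g x)"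
  using assms
proof (induction k arbitrary: f g)
  case 0
  then show ?case by (auto intro: continuous_intros)
next
  case (Suc k)
  show ?case
  proof (rule Ck_on_SucI)
    show "((\<lambda>x. f x * g x) has_derivative (\<lambda>h. f x * frechet_derivative g (at x) h + frechet_derivative f (at x) h * g x)) (at x)"
      if "x \<in> U" for x
      by (intro derivative_intros Ck_on_Suc_has_derivative[OF Suc.prems(2) that] Ck_on_Suc_has_derivative[OF Suc.prems(3) that])
    show "Ck_on U k (\<lambda>x. f x * frechet_derivative g (at x) b + frechet_derivative f (at x) b * g x)" if "b \<in> Basis" for b
      using Suc.prems that by (intro Ck_on_add Suc.IH Ck_on_SucD[OF Suc.prems(2)] Ck_on_SucD[OF Suc.prems(3)]) simp_all
  qed (use Suc in auto)
qed

lemma Ck_on_cmult: "open U \<Longrightarrow> Ck_on U k f \<Longrightarrow> Ck_on U k (\<lambda>x. c * f x)"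
  by (intro Ck_on_mult Ck_on_const)

text \<open>Since \<open>f\<close> depends on one real variable, each partial derivative of the
  composite is a product of a derivative of \<open>h\<close> with f' composed with \<open>h\<close>.
  The induction hypothesis applies to the second factor, so \<open>f\<close> is kept
  arbitrary.\<close>

lemma Ck_on_compose:
  fixes h :: "'a::euclidean_space \<Rightarrow> real"
  assumes "open U" "open V" "h ` U \<subseteq> V" "Ck_on V k f" "Ck_on U k h"
  shows "Ck_on U k (\<lambda>x. f (h x))"
  using assms
proof (induction k arbitrary: f)
  case 0
  then show ?case using continuous_on_compose2 by auto
next
  case (Suc k)
  show ?case
  proof (rule Ck_on_SucI)
    fix x assume x: "x \<in> U"
    have hx: "h x \<in> V" using x Suc.prems by auto
    have "frechet_derivative f (at (h x)) t = t * frechet_derivative f (at (h x)) 1" for t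
      using linear_frechet_derivative[of f "at (h x)"] Suc.prems(4) hx linear_cmul[of "frechet_derivative f (at (h x))" t 1]
      by (auto simp: )
    then have "frechet_derivative f (at (h x)) = (\<lambda>t. t * frechet_derivative f (at (h x)) 1)" by blast
    then have f: "(f has_derivative (\<lambda>t. t * frechet_derivative f (at (h x)) 1)) (at (h x))"
      using Ck_on_Suc_has_derivative[OF Suc.prems(4) hx] by metis
    show "((\<lambda>x. f (h x)) has_derivative (\<lambda>t. frechet_derivative h (at x) t * frechet_derivative f (at (h x)) 1)) (at x)"
      by (rule has_derivative_compose[OF Ck_on_Suc_has_derivative[OF Suc.prems(5) x] f])
  next
    fix b :: 'a assume b: "b \<in> Basis"
    show "Ck_on U k (\<lambda>x. frechet_derivative h (at x) b * frechet_derivative f (at (h x)) 1)"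
    proof (rule Ck_on_mult[OF Suc.prems(1)])
      show "Ck_on U k (\<lambda>x. frechet_derivative h (at x) b)" using Suc.prems(5) b by simp
      have "Ck_on V k (\<lambda>x. frechet_derivative f (at x) 1)" using Suc.prems(4) by simp
      then show "Ck_on U k (\<lambda>x. frechet_derivative f (at (h x)) 1)"
        by (rule Suc.IH[OF Suc.prems(1-3) _ Ck_on_SucD[OF Suc.prems(5)]])
    qed
  qed (use Suc in auto)
qed

text \<open>Differentiation stays among multiples of powers, so the induction runs with an arbitrary
  exponent.\<close>

lemma Ck_on_powr: "Ck_on {0<..} k (\<lambda>t::real. t powr a)"
proof (induction k arbitrary: a)
  case 0
  then show ?case by (auto intro!: continuous_intros)
next
  case (Suc k)
  show ?case
  proof (rule Ck_on_SucI)
    show "((\<lambda>t. t powr a) has_derivative (\<lambda>h. h * (a * t powr (a - 1)))) (at t)" if "t \<in> {0<..}" for t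
      using has_real_derivative_powr[of t a] that by (simp add: has_field_derivative_def mult_commute_abs)
    show "Ck_on {0<..} k (\<lambda>t. b * (a * t powr (a - 1)))" for b
      by (intro Ck_on_cmult Suc.IH) auto
  qed auto
qed

section \<open>Flat exponentials and smooth bump functions\<close>

lemma power_mult_exp_neg_tendsto_0: "((\<lambda>s::real. s ^ k * poly p s * exp (- s)) \<longlongrightarrow> 0) at_top"
proof (induction p arbitrary: k)
  case 0
  then show ?case by simp
next
  \<comment> \<open>Splitting off the constant coefficient leaves the same expression with exponent
    \<open>Suc k\<close>; hence \<open>k\<close> is arbitrary in the induction.\<close>
  case (pCons a p)
  have "((\<lambda>s::real. a * (s ^ k / exp s) + s ^ Suc k * poly p s * exp (- s)) \<longlongrightarrow> a * 0 + 0) at_top"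
    by (intro tendsto_intros pCons tendsto_power_div_exp_0)
  then show ?case by (simp add: field_simps exp_minus)
qed

text \<open>The classical function exp(-1/t), flat at the origin, times a polynomial in 1/t. With
  the polynomial as a parameter the family is closed under differentiation, and smoothness becomes a
  single induction.\<close>

definition flat_exp :: "real poly \<Rightarrow> real \<Rightarrow> real" where
  "flat_exp p t = (if t > 0 then poly p (1/t) * exp (- (1/t)) else 0)"

text \<open>Differentiating 1/t twice over, in the polynomial and in the exponential, produces the
  factor 1/t^2, which is the \<open>monom 1 2\<close>. Only t = 0 needs a limit: the right
  difference quotient is s p(s) exp(-s) with s = 1/t.\<close>

lemma flat_exp_deriv:
  "(flat_exp p has_real_derivative flat_exp (monom 1 2 * (p - pderiv p)) t) (at t)"
proof -
  consider "t > 0" | "t < 0" | "t = 0" by linarith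
  then show ?thesis
  proof cases
    case 1
    have "((\<lambda>t. poly p (1/t) * exp (- (1/t))) has_real_derivative flat_exp (monom 1 2 * (p - pderiv p)) t) (at t)"
      using 1 by (auto intro!: derivative_eq_intros simp: flat_exp_def poly_monom field_simps power2_eq_square)
    then show ?thesis
      by (rule has_field_derivative_transform_within_open[where S="{0<..}"]) (use 1 in \<open>auto simp: flat_exp_def\<close>)
  next
    case 2
    have "((\<lambda>t. 0) has_real_derivative flat_exp (monom 1 2 * (p - pderiv p)) t) (at t)"
      using 2 by (auto intro!: derivative_eq_intros simp: flat_exp_def)
    then show ?thesis
      by (rule has_field_derivative_transform_within_open[where S="{..<0}"]) (use 2 in \<open>auto simp: flat_exp_def\<close>)
  next
    case 3
    have "((\<lambda>y. flat_exp p y / y) \<longlongrightarrow> 0) (at_right 0)"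
    proof (rule Lim_transform_eventually)
      show "((\<lambda>y. inverse y ^ 1 * poly p (inverse y) * exp (- inverse y)) \<longlongrightarrow> 0) (at_right 0)"
        by (rule filterlim_compose[OF power_mult_exp_neg_tendsto_0 filterlim_inverse_at_top_right])
      show "\<forall>\<^sub>F y in at_right 0. inverse y ^ 1 * poly p (inverse y) * exp (- inverse y) = flat_exp p y / y"
        using eventually_at_right_less[of 0] by eventually_elim (simp add: flat_exp_def field_simps)
    qed
    moreover have "((\<lambda>y. flat_exp p y / y) \<longlongrightarrow> 0) (at_left 0)"
    proof (rule Lim_transform_eventually[OF tendsto_const])
      show "\<forall>\<^sub>F y in at_left 0. 0 = flat_exp p y / y"
        unfolding eventually_at_left_field by (auto simp: flat_exp_def intro!: exI[of _ "-1"])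
    qed
    ultimately have "((\<lambda>y. flat_exp p y / y) \<longlongrightarrow> 0) (at 0)" unfolding filterlim_at_split by blast
    then show ?thesis using 3 by (simp add: has_field_derivative_iff flat_exp_def)
  qed
qed

lemma Ck_on_flat_exp: "Ck_on UNIV k (flat_exp p)"
proof (induction k arbitrary: p)
  case 0
  then show ?case using DERIV_continuous_on[of UNIV "flat_exp p", OF DERIV_subset[OF flat_exp_deriv]] by auto
next
  case (Suc k)
  show ?case
  proof (rule Ck_on_SucI)
    show "(flat_exp p has_derivative (\<lambda>h. h * flat_exp (monom 1 2 * (p - pderiv p)) t)) (at t)" for t
      using flat_exp_deriv[of p t] by (simp add: has_field_derivative_def mult_commute_abs)
    show "Ck_on UNIV k (\<lambda>t. b * flat_exp (monom 1 2 * (p - pderiv p)) t)" for b :: real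
      by (intro Ck_on_cmult Suc.IH) auto
  qed auto
qed

lemma test_functionI:
  assumes "\<And>k. Ck_on UNIV k \<phi>" "\<And>x. \<phi> x \<noteq> 0 \<Longrightarrow> x \<in> K" "compact K" "K \<subseteq> \<Omega>"
  shows "test_function \<Omega> \<phi>"
proof -
  have "closure {x. \<phi> x \<noteq> 0} \<subseteq> K" using assms by (intro closure_minimal compact_imp_closed) auto
  moreover from this have "compact (closure {x. \<phi> x \<noteq> 0})"
    using assms(3) by (metis closed_closure compact_Int_closed inf.absorb_iff2)
  ultimately show ?thesis unfolding test_function_def using assms by (auto simp: Ck_on_UNIV)
qed

text \<open>The product in the argument is positive exactly between \<open>a\<close> and
  \<open>b\<close>. Increasing \<open>n\<close> steepens the bump towards the indicator of the open
  interval, which serves in place of mollification.\<close>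

definition bump :: "real \<Rightarrow> real \<Rightarrow> real \<Rightarrow> real \<Rightarrow> real" where
  "bump n a b x = flat_exp 1 (n * ((x - a) * (b - x)))"

lemma bump_nonzero: "n > 0 \<Longrightarrow> a \<le> b \<Longrightarrow> bump n a b x \<noteq> 0 \<longleftrightarrow> x \<in> {a<..<b}"
  by (auto simp: bump_def flat_exp_def zero_less_mult_iff)

lemma bump_bounds: "0 \<le> bump n a b x" "bump n a b x \<le> 1"
  by (auto simp: bump_def flat_exp_def)

lemma Ck_on_bump: "Ck_on UNIV k (bump n a b)"
proof -
  have "Ck_on UNIV k (\<lambda>x. n * ((x + (- a)) * (b + (- 1) * x)))"
    by (intro Ck_on_mult Ck_on_add Ck_on_const Ck_on_id_real) auto
  then have "Ck_on UNIV k (\<lambda>x. flat_exp 1 (n * ((x + (- a)) * (b + (- 1) * x))))"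
    by (intro Ck_on_compose[OF _ _ _ Ck_on_flat_exp]) auto
  then show ?thesis by (simp add: bump_def[abs_def])
qed

lemma test_function_bump: "n > 0 \<Longrightarrow> a \<le> b \<Longrightarrow> {a..b} \<subseteq> \<Omega> \<Longrightarrow> test_function \<Omega> (bump n a b)"
  by (rule test_functionI[where K="{a..b}"]) (auto simp: Ck_on_bump bump_nonzero)

lemma bump_tendsto:
  assumes "a \<le> b"
  shows "(\<lambda>n. bump (real (Suc n)) a b x) \<longlonglongrightarrow> indicator {a<..<b} x"
proof (cases "x \<in> {a<..<b}")
  case True
  define P where "P = (x - a) * (b - x)"
  have pos: "P > 0" using True by (simp add: P_def)
  have "(\<lambda>n. exp (- (inverse (real (Suc n)) / P))) \<longlonglongrightarrow> exp (- (0 / P))"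
    using pos by (intro tendsto_intros LIMSEQ_inverse_real_of_nat) auto
  moreover have "bump (real (Suc n)) a b x = exp (- (inverse (real (Suc n)) / P))" for n
    using pos unfolding bump_def P_def[symmetric] flat_exp_def by (simp add: divide_inverse del: of_nat_Suc)
  ultimately show ?thesis using True by simp
next
  case False
  then have "bump (real (Suc n)) a b x = 0" for n using bump_nonzero[of "real (Suc n)" a b x] assms by auto
  then show ?thesis using False by simp
qed

lemma test_function_ray:
  assumes "test_function {0<..} \<phi>"
  obtains \<phi>' a b where "0 < a" "a \<le> b" "\<And>x. x \<notin> {a..b} \<Longrightarrow> \<phi> x = 0" "\<And>x. x \<notin> {a..b} \<Longrightarrow> \<phi>' x = 0"
    "\<And>x::real. (\<phi> has_real_derivative \<phi>' x) (at x)" "continuous_on UNIV \<phi>'"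
    "\<And>x. frechet_derivative \<phi> (at x) 1 = \<phi>' x" "\<And>k. Ck_on UNIV k \<phi>"
proof -
  let ?K = "closure {x. \<phi> x \<noteq> 0}"
  have K: "compact ?K" "?K \<subseteq> {0<..}" and Ck: "\<And>k. Ck_on UNIV k \<phi>"
    using assms by (auto simp: test_function_def Ck_on_UNIV)
  have "\<exists>a b. 0 < a \<and> a \<le> b \<and> ?K \<subseteq> {a..b}"
  proof (cases "?K = {}")
    case False
    obtain a where "a \<in> ?K" "\<And>x. x \<in> ?K \<Longrightarrow> a \<le> x" using compact_attains_inf[OF K(1) False] by blast
    moreover obtain b where "b \<in> ?K" "\<And>x. x \<in> ?K \<Longrightarrow> x \<le> b" using compact_attains_sup[OF K(1) False] by blast
    ultimately show ?thesis using K(2) by (intro exI[of _ a] exI[of _ b]) auto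
  qed (auto intro: exI[of _ 1])
  then obtain a b where ab: "0 < a" "a \<le> b" "?K \<subseteq> {a..b}" by blast
  have z: "\<phi> x = 0" if "x \<notin> {a..b}" for x using that ab(3) closure_subset[of "{x. \<phi> x \<noteq> 0}"] by blast
  define \<phi>' where "\<phi>' x = frechet_derivative \<phi> (at x) 1" for x
  have diff: "\<phi> differentiable at x" for x using Ck[of "Suc 0"] by simp
  have d: "(\<phi> has_real_derivative \<phi>' x) (at x)" for x
  proof -
    have "frechet_derivative \<phi> (at x) t = \<phi>' x * t" for t
      using linear_cmul[OF linear_frechet_derivative[OF diff[of x]], of t 1] by (simp add: \<phi>'_def mult.commute)
    then have "frechet_derivative \<phi> (at x) = (*) (\<phi>' x)" by auto
    then show ?thesis using frechet_derivative_works[THEN iffD1, OF diff[of x]] by (simp add: has_field_derivative_def)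
  qed
  have "\<phi>' x = 0" if "x \<notin> {a..b}" for x
  proof -
    have "((\<lambda>x. 0) has_real_derivative 0) (at x)" by simp
    then have "(\<phi> has_real_derivative 0) (at x)"
      by (rule has_field_derivative_transform_within_open[where S="- {a..b}"])
         (use that z in \<open>auto intro: open_Compl\<close>)
    then show ?thesis using DERIV_unique[OF d] by blast
  qed
  moreover have "continuous_on UNIV \<phi>'" using Ck[of "Suc 0"] by (simp add: \<phi>'_def[abs_def])
  moreover have "frechet_derivative \<phi> (at x) 1 = \<phi>' x" for x by (simp add: \<phi>'_def)
  ultimately show ?thesis using ab(1,2) z d Ck by (intro that[of a b \<phi>']) blast+
qed

section \<open>Local integrability and weak derivatives on the half-line\<close>

lemma integral_ray_compact_support:
  fixes f :: "real \<Rightarrow> real"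
  assumes "\<And>x. x \<notin> {a..b} \<Longrightarrow> f x = 0"
  shows "(\<lambda>x. indicator {a..b} x * f x) = f"
  by (rule ext) (use assms in \<open>auto simp: indicator_def\<close>)

text \<open>A nonempty compact subset of the open half-line lies between its least and greatest
  elements, and the least one is positive.\<close>

lemma locally_integrable_ray_iff:
  fixes f :: "real \<Rightarrow> real"
  shows "locally_integrable {0<..} f \<longleftrightarrow> (\<forall>a b. 0 < a \<longrightarrow> a \<le> b \<longrightarrow> integrable ray (\<lambda>x. indicator {a..b} x * f x))"
    (is "?L = ?R")
proof
  assume ?L
  show ?R
  proof (intro allI impI)
    fix a b :: real assume ab: "0 < a" "a \<le> b"
    have "compact {a..b}" "{a..b} \<subseteq> {0<..}" using ab by auto
    then show "integrable ray (\<lambda>x. indicator {a..b} x * f x)"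
      using \<open>?L\<close> unfolding locally_integrable_def integral_ray_indicator(1)[OF ab(1)] by blast
  qed
next
  assume R: ?R
  show ?L unfolding locally_integrable_def
  proof (intro allI impI)
    fix K :: "real set" assume K: "compact K" "K \<subseteq> {0<..}"
    show "set_integrable lborel K f"
    proof (cases "K = {}")
      case False
      obtain a where a: "a \<in> K" "\<And>x. x \<in> K \<Longrightarrow> a \<le> x" using compact_attains_inf[OF K(1) False] by blast
      obtain b where b: "b \<in> K" "\<And>x. x \<in> K \<Longrightarrow> x \<le> b" using compact_attains_sup[OF K(1) False] by blast
      have a0: "0 < a" using a K by auto
      have "set_integrable lborel {a..b} f"
        using R a0 b(2)[OF a(1)] by (simp add: integral_ray_indicator(1)[OF a0, symmetric])
      moreover have "K \<in> sets lborel" using K(1) by (simp add: borel_compact)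
      moreover have "K \<subseteq> {a..b}" using a b by auto
      ultimately show ?thesis by (rule set_integrable_subset)
    qed (simp add: set_integrable_def)
  qed
qed

lemma locally_integrable_ray_measurable:
  fixes f :: "real \<Rightarrow> real"
  assumes "locally_integrable {0<..} f"
  shows "f \<in> borel_measurable ray"
proof (rule borel_measurable_LIMSEQ_real[where u="\<lambda>n x. indicator {1/real (Suc n)..real (Suc n)} x * f x"])
  fix x assume "x \<in> space ray"
  then have x: "x > 0" by simp
  have "\<forall>\<^sub>F n in sequentially. 1/real (Suc n) \<le> x"
    using order_tendstoD(2)[OF LIMSEQ_inverse_real_of_nat x] by eventually_elim (simp add: field_simps)
  moreover have "\<forall>\<^sub>F n in sequentially. x \<le> real (Suc n)"
    using eventually_ge_at_top[of "nat \<lceil>x\<rceil>"] by eventually_elim linarith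
  ultimately have "\<forall>\<^sub>F n in sequentially. indicator {1/real (Suc n)..real (Suc n)} x * f x = f x"
    by eventually_elim simp
  then show "(\<lambda>n. indicator {1/real (Suc n)..real (Suc n)} x * f x) \<longlonglongrightarrow> f x"
    by (rule tendsto_eventually)
next
  fix n
  have "integrable ray (\<lambda>x. indicator {1/real (Suc n)..real (Suc n)} x * f x)"
    using assms unfolding locally_integrable_ray_iff by (auto simp: field_simps)
  then show "(\<lambda>x. indicator {1/real (Suc n)..real (Suc n)} x * f x) \<in> borel_measurable ray"
    by simp
qed

lemma locally_integrable_ray_bounded_mult:
  fixes u \<phi> :: "real \<Rightarrow> real"
  assumes u: "locally_integrable {0<..} u" and \<phi>: "continuous_on UNIV \<phi>" "\<And>x. x \<notin> {a..b} \<Longrightarrow> \<phi> x = 0" and a: "0 < a" "a \<le> b"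
  shows "integrable ray (\<lambda>x. u x * \<phi> x)"
proof -
  note [measurable] = locally_integrable_ray_measurable[OF u] borel_measurable_continuous_onI[OF \<phi>(1)]
  have "continuous_on {a..b} \<phi>" using \<phi>(1) by (rule continuous_on_subset) auto
  then have "bounded (\<phi> ` {a..b})" by (intro compact_imp_bounded compact_continuous_image) auto
  then obtain C where C: "\<And>x. x \<in> {a..b} \<Longrightarrow> \<bar>\<phi> x\<bar> \<le> C" unfolding bounded_iff by (metis image_eqI real_norm_def)
  show ?thesis
  proof (rule Bochner_Integration.integrable_bound[where f="\<lambda>x. C * (indicator {a..b} x * u x)"])
    show "AE x in ray. norm (u x * \<phi> x) \<le> norm (C * (indicator {a..b} x * u x))"
    proof (rule AE_I2)
      fix x show "norm (u x * \<phi> x) \<le> norm (C * (indicator {a..b} x * u x))"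
      proof (cases "x \<in> {a..b}")
        case True
        have "\<bar>\<phi> x\<bar> * \<bar>u x\<bar> \<le> \<bar>C\<bar> * \<bar>u x\<bar>" by (rule mult_right_mono) (use C[OF True] in auto)
        then show ?thesis using True by (simp add: abs_mult mult.commute)
      qed (use \<phi>(2) in simp)
    qed
  qed (use u a in \<open>auto simp: locally_integrable_ray_iff\<close>)
qed

lemma has_weak_gradient_ray_iff:
  fixes u g :: "real \<Rightarrow> real"
  shows "has_weak_gradient u g {0<..} \<longleftrightarrow> locally_integrable {0<..} u \<and> locally_integrable {0<..} g \<and>
     (\<forall>\<phi>. test_function {0<..} \<phi> \<longrightarrow>
        (\<integral>x. u x * frechet_derivative \<phi> (at x) 1 \<partial>ray) = - (\<integral>x. g x * \<phi> x \<partial>ray))"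
  by (simp add: has_weak_gradient_def integral_ray)

lemma has_ac_derivative_locally_integrable:
  assumes "has_ac_derivative F f"
  shows "locally_integrable {0<..} f" "locally_integrable {0<..} F"
proof -
  show "locally_integrable {0<..} f" using assms by (simp add: locally_integrable_ray_iff has_ac_derivative_def)
  show "locally_integrable {0<..} F" unfolding locally_integrable_def
  proof (intro allI impI)
    fix K :: "real set" assume K: "compact K" "K \<subseteq> {0<..}"
    have "continuous_on K F" using has_ac_derivative_continuous[OF assms] K(2) by (rule continuous_on_subset)
    then show "set_integrable lborel K F" unfolding set_integrable_def by (rule borel_integrable_compact[OF K(1)])
  qed
qed

text \<open>Integration by parts, in the form of the product rule for \<open>F\<close> and the test
  function. The function \<open>u\<close> may differ from \<open>F\<close> on a null set, since
  elements of the function spaces are arbitrary representatives.\<close>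

lemma has_weak_gradient_of_ac:
  assumes F: "has_ac_derivative F f" and u: "u \<in> borel_measurable ray" "AE x in ray. u x = F x"
  shows "has_weak_gradient u f {0<..}"
  unfolding has_weak_gradient_ray_iff
proof (intro conjI allI impI)
  note li = has_ac_derivative_locally_integrable[OF F]
  note [measurable] = u(1) locally_integrable_ray_measurable[OF li(1)] locally_integrable_ray_measurable[OF li(2)]
  show "locally_integrable {0<..} f" by (rule li)
  show "locally_integrable {0<..} u"
    unfolding locally_integrable_ray_iff
  proof (intro allI impI)
    fix a b :: real assume ab: "0 < a" "a \<le> b"
    have "integrable ray (\<lambda>x. indicator {a..b} x * F x)" using li(2) ab by (simp add: locally_integrable_ray_iff)
    then show "integrable ray (\<lambda>x. indicator {a..b} x * u x)"
      by (rule integrable_cong_AE_imp) (use u(2) in \<open>auto elim: eventually_mono\<close>)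
  qed
  fix \<phi> :: "real \<Rightarrow> real" assume "test_function {0<..} \<phi>"
  then obtain \<phi>' a b where ab: "0 < a" "a \<le> b" and z: "\<And>x. x \<notin> {a..b} \<Longrightarrow> \<phi> x = 0" "\<And>x. x \<notin> {a..b} \<Longrightarrow> \<phi>' x = 0"
    and d: "\<And>x::real. (\<phi> has_real_derivative \<phi>' x) (at x)" and c': "continuous_on UNIV \<phi>'"
    and fr: "\<And>x. frechet_derivative \<phi> (at x) 1 = \<phi>' x"
    by (rule test_function_ray) auto
  have c: "continuous_on UNIV \<phi>" using d by (auto intro!: continuous_at_imp_continuous_on DERIV_isCont)
  note [measurable] = borel_measurable_continuous_onI[OF c] borel_measurable_continuous_onI[OF c']
  have ac: "has_ac_derivative \<phi> \<phi>'" using d c' by (intro has_ac_derivative_C1) (auto intro: continuous_on_subset)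
  have i1: "integrable ray (\<lambda>x. f x * \<phi> x)" and i2: "integrable ray (\<lambda>x. F x * \<phi>' x)"
    using locally_integrable_ray_bounded_mult[OF li(1) c z(1) ab] locally_integrable_ray_bounded_mult[OF li(2) c' z(2) ab] by auto
  have "integral\<^sup>L ray (\<lambda>x. f x * \<phi> x + F x * \<phi>' x) = 0"
  proof -
    \<comment> \<open>The test function is known to vanish only outside \<open>{a..b}\<close>, so
      the interval is enlarged to make both boundary values zero.\<close>
    have zz: "(\<lambda>x. indicator {a/2..b+1} x * (f x * \<phi> x + F x * \<phi>' x)) = (\<lambda>x. f x * \<phi> x + F x * \<phi>' x)"
      by (rule integral_ray_compact_support) (use z ab in auto)
    have "\<phi> (a/2) = 0" "\<phi> (b+1) = 0" using z ab by auto
    then show ?thesis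
      using has_ac_derivativeD(2)[OF has_ac_derivative_mult[OF F ac], of "a/2" "b+1"] ab unfolding zz by simp
  qed
  then have "(\<integral>x. F x * \<phi>' x \<partial>ray) = - (\<integral>x. f x * \<phi> x \<partial>ray)" using i1 i2 by simp
  moreover have "(\<integral>x. u x * \<phi>' x \<partial>ray) = (\<integral>x. F x * \<phi>' x \<partial>ray)"
    by (rule integral_cong_AE) (use u(2) in \<open>auto elim: eventually_mono\<close>)
  ultimately show "(\<integral>x. u x * frechet_derivative \<phi> (at x) 1 \<partial>ray) = - (\<integral>x. f x * \<phi> x \<partial>ray)"
    by (simp add: fr)
qed

section \<open>Functions determined by their integrals and the du Bois-Reymond lemma\<close>

lemma AE_eq_0_of_integral_greaterThan:
  fixes W :: "real \<Rightarrow> real"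
  assumes W: "integrable lborel W" and z: "\<And>x. (\<integral>y. indicator {x<..} y * W y \<partial>lborel) = 0"
  shows "AE x in lborel. W x = 0"
proof -
  have [measurable]: "W \<in> borel_measurable borel" using W by auto
  let ?p = "\<lambda>x. ennreal (max 0 (W x))" and ?n = "\<lambda>x. ennreal (max 0 (- W x))"
  have ip: "integrable lborel (\<lambda>y. indicator A y * max 0 (W y))" if [measurable]: "A \<in> sets borel" for A
    by (rule Bochner_Integration.integrable_bound[OF W]) (auto simp: indicator_def)
  have im: "integrable lborel (\<lambda>y. indicator A y * max 0 (- W y))" if [measurable]: "A \<in> sets borel" for A
    by (rule Bochner_Integration.integrable_bound[OF W]) (auto simp: indicator_def)
  have ep: "emeasure (density lborel ?p) A = ennreal (\<integral>y. indicator A y * max 0 (W y) \<partial>lborel)"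
    if A: "A \<in> sets borel" for A
  proof -
    have "emeasure (density lborel ?p) A = (\<integral>\<^sup>+y. ennreal (indicator A y * max 0 (W y)) \<partial>lborel)"
      using A by (simp add: emeasure_density ennreal_mult' ennreal_indicator mult.commute)
    also have "\<dots> = ennreal (\<integral>y. indicator A y * max 0 (W y) \<partial>lborel)"
      by (rule nn_integral_eq_integral[OF ip[OF A]]) simp
    finally show ?thesis .
  qed
  have em: "emeasure (density lborel ?n) A = ennreal (\<integral>y. indicator A y * max 0 (- W y) \<partial>lborel)"
    if A: "A \<in> sets borel" for A
  proof -
    have "emeasure (density lborel ?n) A = (\<integral>\<^sup>+y. ennreal (indicator A y * max 0 (- W y)) \<partial>lborel)"
      using A by (simp add: emeasure_density ennreal_mult' ennreal_indicator mult.commute)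
    also have "\<dots> = ennreal (\<integral>y. indicator A y * max 0 (- W y) \<partial>lborel)"
      by (rule nn_integral_eq_integral[OF im[OF A]]) simp
    finally show ?thesis .
  qed
  \<comment> \<open>The hypothesis says that the finite measures with densities the positive and
    negative part of \<open>W\<close> agree on all sets \<open>{x<..}\<close>. They are therefore
    equal, and so are their densities almost everywhere.\<close>
  have "density lborel ?p = density lborel ?n"
  proof (rule measure_eqI_lessThan)
    fix x :: real
    have A: "{x<..} \<in> sets borel" by simp
    show "emeasure (density lborel ?p) {x<..} < \<infinity>" unfolding ep[OF A] by simp
    have "(\<integral>y. indicator {x<..} y * max 0 (W y) \<partial>lborel) - (\<integral>y. indicator {x<..} y * max 0 (- W y) \<partial>lborel)
      = (\<integral>y. indicator {x<..} y * W y \<partial>lborel)"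
      unfolding Bochner_Integration.integral_diff[OF ip[OF A] im[OF A], symmetric]
      by (rule Bochner_Integration.integral_cong) (auto simp: max_def algebra_simps)
    then show "emeasure (density lborel ?p) {x<..} = emeasure (density lborel ?n) {x<..}"
      unfolding ep[OF A] em[OF A] z by simp
  qed auto
  moreover have "(\<integral>\<^sup>+x. ?p x \<partial>lborel) \<noteq> \<infinity>" using ep[of UNIV] by (simp add: emeasure_density)
  ultimately have "AE x in lborel. ?p x = ?n x" by (subst (asm) finite_density_unique) auto
  then show ?thesis by eventually_elim (auto simp: max_def split: if_splits)
qed

lemma AE_eq_0_of_ac_derivative_const:
  assumes w: "has_ac_derivative (\<lambda>x. c) w"
  shows "AE x in ray. w x = 0"
proof -
  note [measurable] = has_ac_derivative_measurable[OF w]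
  have "AE x in lborel. indicator {a..b} x * w x = 0" if ab: "0 < a" "a \<le> b" for a b
  proof (rule AE_eq_0_of_integral_greaterThan)
    show i: "integrable lborel (\<lambda>x. indicator {a..b} x * w x)"
      using has_ac_derivativeD(1)[OF w ab] integral_ray_indicator(1)[OF ab(1), of b w] by (simp add: set_integrable_def)
    have [measurable]: "(\<lambda>y. indicator {a..b} y * w y) \<in> borel_measurable borel" using i by auto
    fix x
    show "(\<integral>y. indicator {x<..} y * (indicator {a..b} y * w y) \<partial>lborel) = 0"
    proof (cases "x < b")
      case True
      \<comment> \<open>The sets \<open>{x<..}\<close> and \<open>{a..b}\<close> intersect in
        \<open>{m..b}\<close>, up to the single point \<open>x\<close>.\<close>
      define m where "m = max a x"
      have m: "0 < m" "m \<le> b" "a \<le> m" "x \<le> m" "m = a \<or> m = x" using True ab unfolding m_def by linarith+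
      have j: "set_integrable lborel {m..b} w"
        using has_ac_derivativeD(1)[OF w m(1,2)] integral_ray_indicator(1)[OF m(1), of b w] by simp
      have "(\<integral>y. indicator {x<..} y * (indicator {a..b} y * w y) \<partial>lborel) = (\<integral>y. indicator {m..b} y * w y \<partial>lborel)"
      proof (rule integral_cong_AE)
        show "AE y in lborel. indicator {x<..} y * (indicator {a..b} y * w y) = indicator {m..b} y * w y"
          using AE_lborel_singleton[of x]
        proof eventually_elim
          case (elim y)
          then have "y \<in> {x<..} \<and> y \<in> {a..b} \<longleftrightarrow> y \<in> {m..b}" using m by auto
          then show ?case by (cases "y \<in> {m..b}") (auto simp: indicator_def)
        qed
      qed (use j in \<open>auto simp: set_integrable_def\<close>)
      also have "\<dots> = 0" using has_ac_derivativeD(2)[OF w m(1,2)] integral_ray_indicator(2)[OF m(1), of b w]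
        by (simp add: set_lebesgue_integral_def)
      finally show ?thesis .
    next
      case False
      have "(\<integral>y. indicator {x<..} y * (indicator {a..b} y * w y) \<partial>lborel) = (\<integral>y. 0 \<partial>(lborel::real measure))"
        by (rule Bochner_Integration.integral_cong) (use False in \<open>auto simp: indicator_def\<close>)
      then show ?thesis by simp
    qed
  qed
  then have "AE x in lborel. indicator {1/real (Suc n)..real (Suc n)} x * w x = 0" for n
    by (rule meta_mp) (auto simp: field_simps)
  then have "AE x in lborel. \<forall>n. indicator {1/real (Suc n)..real (Suc n)} x * w x = 0"
    unfolding AE_all_countable by blast
  then show ?thesis unfolding AE_ray
  proof eventually_elim
    case (elim x)
    show ?case
    proof
      assume x: "x > 0"
      obtain n1 where n1: "inverse (real (Suc n1)) < x" using reals_Archimedean[OF x] by blast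
      obtain n2 where n2: "x < real n2" using reals_Archimedean2 by blast
      have "1 / real (Suc (max n1 n2)) \<le> 1 / real (Suc n1)" by (intro divide_left_mono) auto
      then have "x \<in> {1/real (Suc (max n1 n2))..real (Suc (max n1 n2))}"
        using n1 n2 by (auto simp: inverse_eq_divide)
      then show "w x = 0" using elim[rule_format, of "max n1 n2"] by simp
    qed
  qed
qed

text \<open>The set where two continuous functions differ is open, and a nonempty open set is not a
  null set.\<close>

lemma AE_ray_eq_continuous:
  assumes F: "continuous_on {0<..} F" and G: "continuous_on {0<..} G" and ae: "AE x in ray. F x = G x" and x: "x > 0"
  shows "F x = (G x :: real)"
proof (rule ccontr)
  assume ne: "F x \<noteq> G x"
  let ?U = "{0<..} \<inter> (\<lambda>x. F x - G x) -` (- {0})"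
  have o: "open ?U" by (rule continuous_open_preimage[OF continuous_on_diff[OF F G]]) auto
  have "AE y in lborel. y \<notin> ?U" using ae unfolding AE_ray by eventually_elim auto
  then have "?U \<in> null_sets lborel" using o by (subst (asm) AE_iff_null_sets[symmetric]) auto
  then have "negligible ?U" unfolding negligible_iff_null_sets by (rule null_sets_completionI)
  moreover have "?U \<noteq> {}" using ne x by auto
  ultimately show False using open_not_negligible[OF o] by blast
qed

text \<open>The primitive started at 0 vanishes to the left of the support of \<eta>; zero mean
  makes it vanish to the right as well, so it has compact support again.\<close>

lemma test_function_primitive:
  assumes \<eta>: "test_function {0<..} \<eta>" and z: "(\<integral>x. \<eta> x \<partial>ray) = 0"
  obtains \<phi> :: "real \<Rightarrow> real" where "test_function {0<..} \<phi>" "\<And>x. frechet_derivative \<phi> (at x) 1 = \<eta> x"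
proof -
  obtain a b where ab: "0 < a" "a \<le> b" and z0: "\<And>x. x \<notin> {a..b} \<Longrightarrow> \<eta> x = 0" and Ck: "\<And>k. Ck_on UNIV k \<eta>"
    by (rule test_function_ray[OF \<eta>]) blast
  have c: "continuous_on UNIV \<eta>" using Ck[of 0] by simp
  define \<phi> where "\<phi> x = integral {0..x} \<eta>" for x
  have small: "\<phi> x = 0" if "x < a" for x
  proof -
    have "\<phi> x = integral {0..x} (\<lambda>x. 0)" unfolding \<phi>_def by (rule Henstock_Kurzweil_Integration.integral_cong) (use that z0 in auto)
    then show ?thesis by simp
  qed
  have d: "(\<phi> has_real_derivative \<eta> x) (at x)" for x
  proof (cases "x < a")
    case True
    have "((\<lambda>x. 0) has_real_derivative \<eta> x) (at x)" using True z0 by simp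
    then show ?thesis
      by (rule has_field_derivative_transform_within_open[where S="{..<a}"]) (use True small in auto)
  next
    case False
    have "((\<lambda>y. integral {0..y} \<eta>) has_real_derivative \<eta> x) (at x within {0..x+1})"
      by (rule integral_has_real_derivative) (use c False ab in \<open>auto intro: continuous_on_subset\<close>)
    then show ?thesis unfolding \<phi>_def[abs_def] using False ab by (subst (asm) at_within_Icc_at) auto
  qed
  have hd: "(\<phi> has_derivative (\<lambda>h. h * \<eta> x)) (at x)" for x
    using d[of x] by (simp add: has_field_derivative_def mult_commute_abs)
  have fr: "frechet_derivative \<phi> (at x) = (\<lambda>h. h * \<eta> x)" for x using frechet_derivative_at[OF hd] by simp
  have CkS: "Ck_on UNIV (Suc k) \<phi>" for k
    by (rule Ck_on_SucI[OF _ hd]) (auto intro: Ck_on_cmult Ck)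
  have ac: "has_ac_derivative \<phi> \<eta>" by (rule has_ac_derivative_C1[OF d]) (use c in \<open>auto intro: continuous_on_subset\<close>)
  have big: "\<phi> x = 0" if "x > b" for x
  proof -
    have "(\<lambda>y. indicator {a/2..x} y * \<eta> y) = \<eta>" by (rule integral_ray_compact_support) (use that z0 ab in auto)
    moreover have "(\<integral>y. indicator {a/2..x} y * \<eta> y \<partial>ray) = \<phi> x - \<phi> (a/2)"
      by (rule has_ac_derivativeD(2)[OF ac]) (use ab that in auto)
    ultimately have "\<phi> x - \<phi> (a/2) = 0" using z by simp
    then show ?thesis using small[of "a/2"] ab by simp
  qed
  have "test_function {0<..} \<phi>"
  proof (rule test_functionI[where K="{a..b}"])
    show "\<phi> x \<noteq> 0 \<Longrightarrow> x \<in> {a..b}" for x using small[of x] big[of x] by force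
    show "Ck_on UNIV k \<phi>" for k by (rule Ck_on_SucD[OF CkS])
  qed (use ab in auto)
  then show ?thesis using that fr by simp
qed

text \<open>Subtracting from a bump the multiple of a fixed bump \<theta> with the same integral
  leaves mean zero, hence the derivative of a test function. So v - c, where c is the
  \<theta>-weighted mean of v, integrates to zero against every bump and, as bumps sharpen to
  indicators, over every interval.\<close>

lemma du_Bois_Reymond:
  assumes v: "locally_integrable {0<..} v"
    and z: "\<And>\<phi>. test_function {0<..} \<phi> \<Longrightarrow> (\<integral>x. v x * frechet_derivative \<phi> (at x) 1 \<partial>ray) = 0"
  obtains c where "AE x in ray. v x = c"
proof -
  note [measurable] = locally_integrable_ray_measurable[OF v]
  define \<theta> where "\<theta> = bump 1 1 2"
  have \<theta>: "test_function {0<..} \<theta>" unfolding \<theta>_def by (rule test_function_bump) auto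
  have cont: "continuous_on UNIV (bump n a b)" for n a b using Ck_on_bump[of 0 n a b] by simp
  have [measurable]: "bump n a b \<in> borel_measurable borel" for n a b
    by (rule borel_measurable_continuous_onI[OF cont])
  have one: "locally_integrable {0<..} (\<lambda>x::real. 1::real)"
    by (rule has_ac_derivative_locally_integrable(2)[OF has_ac_derivative_const])
  have supp: "bump n a b x = 0" if "n > 0" "a \<le> b" "x \<notin> {a..b}" for n a b x
    using bump_nonzero[OF that(1,2), of x] that(3) by auto
  have i1: "integrable ray (bump n a b)" and iv: "integrable ray (\<lambda>x. v x * bump n a b x)" if "n > 0" "0 < a" "a \<le> b" for n a b
    using locally_integrable_ray_bounded_mult[OF one cont supp that(2,3)] that(1)
      locally_integrable_ray_bounded_mult[OF v cont supp that(2,3)] that by auto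
  define T where "T = (\<integral>x. \<theta> x \<partial>ray)"
  have "T \<noteq> 0"
  proof
    assume "T = 0"
    then have "AE x in ray. \<theta> x = 0" unfolding T_def using i1[of 1 1 2]
      by (subst (asm) integral_nonneg_eq_0_iff_AE) (auto simp: \<theta>_def bump_bounds)
    then have "\<theta> (3/2) = 0" using AE_ray_eq_continuous[of \<theta> "\<lambda>x. 0" "3/2"] cont[of 1 1 2]
      by (auto simp: \<theta>_def intro: continuous_on_subset)
    then show False using bump_nonzero[of 1 1 2 "3/2"] by (simp add: \<theta>_def)
  qed
  define c where "c = (\<integral>x. v x * \<theta> x \<partial>ray) / T"
  have key: "(\<integral>x. v x * bump n a b x \<partial>ray) = c * (\<integral>x. bump n a b x \<partial>ray)" if n: "n > 0" and ab: "0 < a" "a \<le> b" for n a b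
  proof -
    define s where "s = (\<integral>x. bump n a b x \<partial>ray) / T"
    let ?\<eta> = "\<lambda>x. bump n a b x + (- s) * \<theta> x"
    have "test_function {0<..} ?\<eta>"
    proof (rule test_functionI[where K="{min a 1..max b 2}"])
      show "Ck_on UNIV k ?\<eta>" for k unfolding \<theta>_def by (intro Ck_on_add Ck_on_cmult Ck_on_bump) auto
      show "x \<in> {min a 1..max b 2}" if "?\<eta> x \<noteq> 0" for x
      proof -
        have "x \<in> {a..b} \<or> x \<in> {1..2}" using that supp[OF n ab(2), of x] supp[of 1 1 2 x] by (force simp: \<theta>_def)
        then show ?thesis by auto
      qed
    qed (use ab in auto)
    moreover have "(\<integral>x. ?\<eta> x \<partial>ray) = 0"
      using i1[OF n ab] i1[of 1 1 2] \<open>T \<noteq> 0\<close> by (simp add: \<theta>_def[symmetric] T_def[symmetric] s_def)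
    ultimately obtain \<phi> where "test_function {0<..} \<phi>" "\<And>x. frechet_derivative \<phi> (at x) 1 = ?\<eta> x"
      using test_function_primitive[of ?\<eta>] by blast
    then have "(\<integral>x. v x * ?\<eta> x \<partial>ray) = 0" using z[of \<phi>] by simp
    moreover have "(\<integral>x. v x * ?\<eta> x \<partial>ray) = (\<integral>x. v x * bump n a b x + (- s) * (v x * \<theta> x) \<partial>ray)"
      by (rule Bochner_Integration.integral_cong) (auto simp: algebra_simps)
    ultimately show ?thesis using iv[OF n ab] iv[of 1 1 2] \<open>T \<noteq> 0\<close> by (simp add: \<theta>_def[symmetric] s_def c_def)
  qed
  have "has_ac_derivative (\<lambda>x. 0) (\<lambda>x. v x - c)"
    unfolding has_ac_derivative_def
  proof (intro allI impI)
    fix a b :: real assume ab: "0 < a" "a \<le> b"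
    have ia: "integrable ray (\<lambda>x. indicator {a..b} x * v x)" "integrable ray (\<lambda>x. indicator {a..b} x :: real)"
      using v[unfolded locally_integrable_ray_iff, rule_format, OF ab] one[unfolded locally_integrable_ray_iff, rule_format, OF ab]
      by simp_all
    have ends: "AE x in ray. x \<noteq> a \<and> x \<noteq> b"
      unfolding AE_ray using AE_lborel_singleton[of a] AE_lborel_singleton[of b] by eventually_elim auto
    have L1: "(\<lambda>n. \<integral>x. v x * bump (real (Suc n)) a b x \<partial>ray) \<longlonglongrightarrow> (\<integral>x. indicator {a..b} x * v x \<partial>ray)"
    proof (rule integral_dominated_convergence[where w="\<lambda>x. \<bar>indicator {a..b} x * v x\<bar>"])
      show "AE x in ray. (\<lambda>n. v x * bump (real (Suc n)) a b x) \<longlonglongrightarrow> indicator {a..b} x * v x"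
        using ends
      proof eventually_elim
        case (elim x)
        have "(\<lambda>n. v x * bump (real (Suc n)) a b x) \<longlonglongrightarrow> v x * indicator {a<..<b} x"
          by (intro tendsto_intros bump_tendsto ab)
        moreover have "v x * indicator {a<..<b} x = indicator {a..b} x * v x" using elim by (auto simp: indicator_def)
        ultimately show ?case by simp
      qed
      show "AE x in ray. norm (v x * bump (real (Suc n)) a b x) \<le> \<bar>indicator {a..b} x * v x\<bar>" for n
      proof (rule AE_I2)
        fix x
        show "norm (v x * bump (real (Suc n)) a b x) \<le> \<bar>indicator {a..b} x * v x\<bar>"
          using bump_bounds[of "real (Suc n)" a b x] supp[of "real (Suc n)" a b x] ab
          by (cases "x \<in> {a..b}") (auto simp: abs_mult mult_left_le)
      qed
    qed (use ia in auto)
    have L2: "(\<lambda>n. \<integral>x. bump (real (Suc n)) a b x \<partial>ray) \<longlonglongrightarrow> (\<integral>x. indicator {a..b} x \<partial>ray)"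
    proof (rule integral_dominated_convergence[where w="\<lambda>x. indicator {a..b} x"])
      show "AE x in ray. (\<lambda>n. bump (real (Suc n)) a b x) \<longlonglongrightarrow> indicator {a..b} x"
        using ends
      proof eventually_elim
        case (elim x)
        moreover have "(indicator {a<..<b} x :: real) = indicator {a..b} x" using elim by (auto simp: indicator_def)
        ultimately show ?case using bump_tendsto[OF ab(2), of x] by simp
      qed
      show "AE x in ray. norm (bump (real (Suc n)) a b x) \<le> indicator {a..b} x" for n
      proof (rule AE_I2)
        fix x
        show "norm (bump (real (Suc n)) a b x) \<le> indicator {a..b} x"
          using bump_bounds[of "real (Suc n)" a b x] supp[of "real (Suc n)" a b x] ab
          by (cases "x \<in> {a..b}") auto
      qed
    qed (use ia in auto)
    have "(\<lambda>n. \<integral>x. v x * bump (real (Suc n)) a b x \<partial>ray) \<longlonglongrightarrow> c * (\<integral>x. indicator {a..b} x \<partial>ray)"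
      using tendsto_mult[OF tendsto_const[of c] L2] by (subst key) (use ab in auto)
    then have "(\<integral>x. indicator {a..b} x * v x \<partial>ray) = c * (\<integral>x. indicator {a..b} x \<partial>ray)"
      using LIMSEQ_unique[OF L1] by blast
    moreover have "indicator {a..b} x * (v x - c) = indicator {a..b} x * v x - c * indicator {a..b} x" for x by (simp add: algebra_simps)
    ultimately show "integrable ray (\<lambda>x. indicator {a..b} x * (v x - c)) \<and> (\<integral>x. indicator {a..b} x * (v x - c) \<partial>ray) = 0 - 0"
      using ia by simp
  qed
  from AE_eq_0_of_ac_derivative_const[OF this] have "AE x in ray. v x = c" by eventually_elim simp
  then show ?thesis by (rule that)
qed

text \<open>The base point is 1 and not 0, because \<open>g\<close> may fail to be integrable up to
  the origin.\<close>

lemma has_ac_derivative_primitive: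
  assumes g: "locally_integrable {0<..} g"
  obtains F where "has_ac_derivative F g"
proof -
  define F where "F x = (if x \<ge> 1 then (\<integral>y. indicator {1..x} y * g y \<partial>ray) else - (\<integral>y. indicator {x..1} y * g y \<partial>ray))" for x
  have i: "integrable ray (\<lambda>x. indicator {a..b} x * g x)" if "0 < a" for a b
    using g that by (cases "a \<le> b") (auto simp: locally_integrable_ray_iff)
  have add: "(\<integral>y. indicator {a..b} y * g y \<partial>ray) + (\<integral>y. indicator {b..c} y * g y \<partial>ray) = (\<integral>y. indicator {a..c} y * g y \<partial>ray)"
    if "0 < a" "a \<le> b" "b \<le> c" for a b c
  proof -
    have "(\<integral>y. indicator {a..c} y * g y \<partial>ray) = (\<integral>y. indicator {a..b} y * g y + indicator {b..c} y * g y \<partial>ray)"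
    proof (rule integral_cong_AE)
      have "AE y in ray. y \<noteq> b" unfolding AE_ray using AE_lborel_singleton[of b] by eventually_elim auto
      then show "AE y in ray. indicator {a..c} y * g y = indicator {a..b} y * g y + indicator {b..c} y * g y"
        by eventually_elim (use that in \<open>auto simp: indicator_def\<close>)
    qed (use i that in \<open>auto intro!: borel_measurable_add borel_measurable_integrable\<close>)
    then show ?thesis using i that by simp
  qed
  have "has_ac_derivative F g"
    unfolding has_ac_derivative_def
  proof (intro allI impI conjI)
    fix a b :: real assume ab: "0 < a" "a \<le> b"
    then show "integrable ray (\<lambda>x. indicator {a..b} x * g x)" by (intro i)
    have "(\<integral>y. indicator {1..1} y * g y \<partial>ray) = 0" using add[of 1 1 1] by simp
    then show "(\<integral>x. indicator {a..b} x * g x \<partial>ray) = F b - F a"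
      unfolding F_def using add[of a b 1] add[of a 1 b] add[of 1 a b] ab by auto
  qed
  then show ?thesis by (rule that)
qed

text \<open>The difference between \<open>u\<close> and a primitive of \<open>g\<close> has weak
  derivative zero and is constant almost everywhere. The resulting \<open>F\<close> is the
  continuous representative in which the later computations take place.\<close>

lemma has_weak_gradient_ray_ac:
  assumes "has_weak_gradient u g {0<..}"
  obtains F where "has_ac_derivative F g" "AE x in ray. u x = F x"
proof -
  have u: "locally_integrable {0<..} u" and g: "locally_integrable {0<..} g"
    and w: "\<And>\<phi>. test_function {0<..} \<phi> \<Longrightarrow>
        (\<integral>x. u x * frechet_derivative \<phi> (at x) 1 \<partial>ray) = - (\<integral>x. g x * \<phi> x \<partial>ray)"
    using assms unfolding has_weak_gradient_ray_iff by blast+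
  obtain F0 where F0: "has_ac_derivative F0 g" using has_ac_derivative_primitive[OF g] .
  have w0: "has_weak_gradient F0 g {0<..}"
    by (rule has_weak_gradient_of_ac[OF F0 has_ac_derivative_measurable'[OF F0]]) simp
  note li0 = has_ac_derivative_locally_integrable(2)[OF F0]
  have "locally_integrable {0<..} (\<lambda>x. u x - F0 x)"
    using u li0 unfolding locally_integrable_ray_iff by (simp add: right_diff_distrib)
  moreover have "(\<integral>x. (u x - F0 x) * frechet_derivative \<phi> (at x) 1 \<partial>ray) = 0" if \<phi>: "test_function {0<..} \<phi>" for \<phi>
  proof -
    obtain \<phi>' a b where ab: "0 < a" "a \<le> b" and zz: "\<And>x. x \<notin> {a..b} \<Longrightarrow> \<phi>' x = 0" and c': "continuous_on UNIV \<phi>'"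
      and fr: "\<And>x. frechet_derivative \<phi> (at x) 1 = \<phi>' x"
      by (rule test_function_ray[OF \<phi>]) blast
    have "(\<integral>x. u x * \<phi>' x \<partial>ray) = (\<integral>x. F0 x * \<phi>' x \<partial>ray)"
      using w[OF \<phi>] w0[unfolded has_weak_gradient_ray_iff, THEN conjunct2, THEN conjunct2, rule_format, OF \<phi>]
      unfolding fr by (rule trans[OF _ sym])
    then show ?thesis
      using locally_integrable_ray_bounded_mult[OF u c' zz ab] locally_integrable_ray_bounded_mult[OF li0 c' zz ab]
      by (simp add: fr left_diff_distrib)
  qed
  ultimately obtain c where c: "AE x in ray. u x - F0 x = c" by (rule du_Bois_Reymond)
  have "has_ac_derivative (\<lambda>x. F0 x + c) g"
    using has_ac_derivative_add[OF F0 has_ac_derivative_const[of c]] by simp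
  moreover have "AE x in ray. u x = F0 x + c" using c by eventually_elim simp
  ultimately show ?thesis by (rule that)
qed

lemma has_ac_derivative_unique:
  assumes F: "has_ac_derivative F f" and G: "has_ac_derivative G g" and ae: "AE x in ray. F x = G x"
  shows "AE x in ray. f x = g x" "\<And>x. x > 0 \<Longrightarrow> F x = G x"
proof -
  show eq: "F x = G x" if "x > 0" for x
    using has_ac_derivative_continuous[OF F] has_ac_derivative_continuous[OF G] ae that
    by (rule AE_ray_eq_continuous)
  note [measurable] = has_ac_derivative_measurable[OF F] has_ac_derivative_measurable[OF G]
  have "has_ac_derivative (\<lambda>x. F x + (-1) * G x) (\<lambda>x. f x + (-1) * g x)"
    by (intro has_ac_derivative_add has_ac_derivative_cmult F G)
  then have "has_ac_derivative (\<lambda>x. 0) (\<lambda>x. f x + (-1) * g x)"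
    by (rule has_ac_derivative_cong) (use eq in auto)
  from AE_eq_0_of_ac_derivative_const[OF this] show "AE x in ray. f x = g x" by eventually_elim simp
qed

lemma has_weak_gradient_ray_unique:
  assumes u: "has_weak_gradient u g {0<..}" and F: "has_ac_derivative F f" "AE x in ray. u x = F x"
  shows "AE x in ray. g x = f x"
proof -
  obtain F' where F': "has_ac_derivative F' g" "AE x in ray. u x = F' x" using has_weak_gradient_ray_ac[OF u] .
  have "AE x in ray. F' x = F x" using F(2) F'(2) by eventually_elim simp
  then show ?thesis by (rule has_ac_derivative_unique(1)[OF F'(1) F(1)])
qed

section \<open>Polar coordinates\<close>

text \<open>The area of the sphere of radius \<open>r\<close>, as a density on the whole
  line.\<close>

definition radial_weight :: "real \<Rightarrow> real" where
  "radial_weight r = indicator {0<..} r * (4 * pi * r\<^sup>2)"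

lemma radial_weight_measurable [measurable]: "radial_weight \<in> borel_measurable borel"
  unfolding radial_weight_def[abs_def] by measurable

lemma radial_weight_nonneg [simp]: "0 \<le> radial_weight r"
  by (simp add: radial_weight_def)

text \<open>Both measures are determined by the sets \<open>{..x}\<close>. There the push-forward
  gives the volume 4/3 \<pi> x^3 of a ball, and the weight is the derivative of that volume.\<close>

lemma distr_norm:
  "distr lborel borel (norm :: real^3 \<Rightarrow> real) = density lborel (\<lambda>r. ennreal (radial_weight r))"
proof (rule measure_eqI_generator_eq[where E="range atMost" and \<Omega>=UNIV and A="\<lambda>n. {..real n}"])
  show "Int_stable (range (atMost :: real \<Rightarrow> _))"
    by (auto simp: Int_stable_def)
  have pre: "norm -` {..x} = (cball 0 x :: (real^3) set)" for x by auto
  have ball: "emeasure (distr lborel borel (norm :: real^3 \<Rightarrow> real)) {..x} = (if x < 0 then 0 else ennreal (4/3 * pi * x ^ 3))" for x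
    by (auto simp: emeasure_distr pre emeasure_cball unit_ball_vol_3)
  show "emeasure (distr lborel borel (norm :: real^3 \<Rightarrow> real)) X = emeasure (density lborel (\<lambda>r. ennreal (radial_weight r))) X"
    if X: "X \<in> range atMost" for X
  proof -
    from X obtain x where X: "X = {..x}" by auto
    have "emeasure (density lborel (\<lambda>r. ennreal (radial_weight r))) X = (\<integral>\<^sup>+r. ennreal (radial_weight r) * indicator {..x} r \<partial>lborel)"
      unfolding X by (rule emeasure_density) auto
    also have "\<dots> = (\<integral>\<^sup>+r. ennreal (4 * pi * r\<^sup>2) * indicator {0..x} r \<partial>lborel)"
      by (rule nn_integral_cong) (auto simp: radial_weight_def indicator_def)
    also have "\<dots> = (if x < 0 then 0 else ennreal (4/3 * pi * x ^ 3))"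
    proof (cases "x < 0")
      case False
      have "(\<integral>\<^sup>+r. ennreal (4 * pi * r\<^sup>2) * indicator {0..x} r \<partial>lborel) = 4/3 * pi * x ^ 3 - 4/3 * pi * 0 ^ 3"
        by (rule nn_integral_FTC_Icc) (use False in \<open>auto intro!: derivative_eq_intros simp: power2_eq_square\<close>)
      then show ?thesis using False by simp
    qed simp
    finally show ?thesis using ball X by simp
  qed
  show "sets (distr lborel borel norm) = sigma_sets UNIV (range (atMost :: real \<Rightarrow> _))"
    by (simp add: borel_eq_atMost)
  show "sets (density lborel (\<lambda>r. ennreal (radial_weight r))) = sigma_sets UNIV (range atMost)"
    by (simp add: borel_eq_atMost)
  show "(\<Union>i. {..real i}) = UNIV" using real_arch_simple by auto
  show "emeasure (distr lborel borel (norm :: real^3 \<Rightarrow> real)) {..real i} \<noteq> \<infinity>" for i by (simp add: ball)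
qed auto

lemma nn_integral_radial:
  fixes F :: "real \<Rightarrow> ennreal"
  assumes [measurable]: "F \<in> borel_measurable borel"
  shows "(\<integral>\<^sup>+x. F (norm x) \<partial>(lborel :: (real^3) measure)) = (\<integral>\<^sup>+r. ennreal (radial_weight r) * F r \<partial>lborel)"
proof -
  have "(\<integral>\<^sup>+x. F (norm x) \<partial>(lborel :: (real^3) measure)) = integral\<^sup>N (distr lborel borel (norm :: real^3 \<Rightarrow> real)) F"
    by (subst nn_integral_distr) auto
  then show ?thesis by (simp add: distr_norm nn_integral_density)
qed

lemma AE_norm_pos: "AE x in (lborel :: (real^3) measure). norm x > 0"
  using AE_lborel_singleton[of "0 :: real^3"] by eventually_elim simp

lemma borel_measurable_zero_extension:
  fixes f :: "real \<Rightarrow> real"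
  assumes "f \<in> borel_measurable ray"
  shows "(\<lambda>r. if r > 0 then f r else 0) \<in> borel_measurable borel"
proof -
  have "(\<lambda>r. indicator {0<..} r *\<^sub>R f r) \<in> borel_measurable borel"
    using assms unfolding measurable_ray_iff by (subst (asm) borel_measurable_restrict_space_iff) auto
  moreover have "(\<lambda>r. indicator {0<..} r *\<^sub>R f r) = (\<lambda>r. if r > 0 then f r else 0)" by (auto simp: indicator_def)
  ultimately show ?thesis by simp
qed

lemma
  fixes f :: "real \<Rightarrow> real"
  assumes f: "f \<in> borel_measurable ray"
  shows radial_measurable: "(\<lambda>x::real^3. f (norm x)) \<in> borel_measurable borel"
    and integrable_radial_iff: "integrable (lborel :: (real^3) measure) (\<lambda>x. f (norm x)) \<longleftrightarrow> integrable ray (\<lambda>r. f r * r\<^sup>2)"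
    and integral_radial: "(\<integral>x. f (norm x) \<partial>(lborel :: (real^3) measure)) = 4 * pi * (\<integral>r. f r * r\<^sup>2 \<partial>ray)"
proof -
  \<comment> \<open>Measurability on the half-line leaves the values at 0 and below uncontrolled,
    while \<open>norm\<close> attains 0. The extension by zero is Borel and gives the same radial
    function almost everywhere.\<close>
  define f0 where "f0 r = (if r > 0 then f r else 0)" for r
  have [measurable]: "f0 \<in> borel_measurable borel"
    unfolding f0_def[abs_def] by (rule borel_measurable_zero_extension[OF f])
  have "(\<lambda>x::real^3. f (norm x)) = (\<lambda>x. if x = 0 then f 0 else f0 (norm x))" by (auto simp: f0_def)
  moreover have "(\<lambda>x::real^3. if x = 0 then f 0 else f0 (norm x)) \<in> borel_measurable borel" by measurable
  ultimately show [measurable]: "(\<lambda>x::real^3. f (norm x)) \<in> borel_measurable borel" by simp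
  have ae: "AE x in (lborel :: (real^3) measure). f (norm x) = f0 (norm x)"
    using AE_norm_pos by eventually_elim (simp add: f0_def)
  have eq: "radial_weight r *\<^sub>R f0 r = 4 * pi * (indicator {0<..} r * (f r * r\<^sup>2))" for r
    by (auto simp: radial_weight_def f0_def indicator_def)
  have "integrable (lborel :: (real^3) measure) (\<lambda>x. f (norm x)) \<longleftrightarrow> integrable (lborel :: (real^3) measure) (\<lambda>x. f0 (norm x))"
    by (rule integrable_cong_AE[OF _ _ ae]) auto
  also have "\<dots> \<longleftrightarrow> integrable (distr lborel borel (norm :: real^3 \<Rightarrow> real)) f0"
    by (subst integrable_distr_eq) auto
  also have "\<dots> \<longleftrightarrow> integrable lborel (\<lambda>r. radial_weight r *\<^sub>R f0 r)"
    unfolding distr_norm by (subst integrable_density) auto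
  also have "\<dots> \<longleftrightarrow> integrable ray (\<lambda>r. f r * r\<^sup>2)"
    unfolding eq integrable_ray set_integrable_def by simp
  finally show "integrable (lborel :: (real^3) measure) (\<lambda>x. f (norm x)) \<longleftrightarrow> integrable ray (\<lambda>r. f r * r\<^sup>2)" .
  have "(\<integral>x. f (norm x) \<partial>(lborel :: (real^3) measure)) = (\<integral>x. f0 (norm x) \<partial>(lborel :: (real^3) measure))"
    by (rule integral_cong_AE[OF _ _ ae]) auto
  also have "\<dots> = integral\<^sup>L (distr lborel borel (norm :: real^3 \<Rightarrow> real)) f0"
    by (subst integral_distr) auto
  also have "\<dots> = (\<integral>r. radial_weight r *\<^sub>R f0 r \<partial>lborel)"
    unfolding distr_norm by (subst integral_density) auto
  also have "\<dots> = 4 * pi * (\<integral>r. f r * r\<^sup>2 \<partial>ray)"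
    unfolding eq integral_ray set_lebesgue_integral_def by simp
  finally show "(\<integral>x. f (norm x) \<partial>(lborel :: (real^3) measure)) = 4 * pi * (\<integral>r. f r * r\<^sup>2 \<partial>ray)" .
qed

text \<open>The profile is recovered by restricting the radial function to a coordinate
  axis.\<close>

lemma measurable_ray_of_radial:
  fixes f :: "real \<Rightarrow> real"
  assumes "(\<lambda>x::real^3. f (norm x)) \<in> borel_measurable borel"
  shows "f \<in> borel_measurable ray"
proof -
  have "(\<lambda>r::real. f (norm (r *\<^sub>R (axis 1 1 :: real^3)))) \<in> borel_measurable borel"
    by (rule measurable_compose[OF _ assms]) (intro borel_measurable_scaleR measurable_ident borel_measurable_const | simp)+
  then have "(\<lambda>r::real. f \<bar>r\<bar>) \<in> borel_measurable ray"
    by (intro borel_measurable_ray) (simp add: norm_axis_1)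
  then show ?thesis
    by (subst measurable_cong[where g="\<lambda>r. f \<bar>r\<bar>"]) auto
qed

text \<open>The density of the push-forward under the norm is the spherical mean; its \<open>L\<^sup>2\<close> bound is
  obtained by testing against truncations of the mean itself.\<close>

lemma spherical_mean:
  fixes h :: "real^3 \<Rightarrow> real"
  assumes [measurable]: "h \<in> borel_measurable borel" and h0: "\<And>x. h x \<ge> 0"
    and h2: "integrable lborel (\<lambda>x. (h x)\<^sup>2)"
  obtains a where "a \<in> borel_measurable borel" "\<And>r. a r \<ge> 0" "integrable ray (\<lambda>r. (a r)\<^sup>2 * r\<^sup>2)"
    "distr (density lborel (\<lambda>x. ennreal (h x))) borel norm = density lborel (\<lambda>r. ennreal (a r * radial_weight r))"
proof -
  let ?D = "density lborel (\<lambda>x. ennreal (h x))"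
  let ?\<nu> = "distr ?D borel (norm :: real^3 \<Rightarrow> real)"
  \<comment> \<open>A null set of radii pulls back to a null set in space by the formula for the
    push-forward of volume, so a Radon-Nikodym density exists.\<close>
  have ac: "absolutely_continuous lborel ?\<nu>"
    unfolding absolutely_continuous_def
  proof
    fix A assume A: "A \<in> null_sets (lborel :: real measure)"
    then have [measurable]: "A \<in> sets borel" by auto
    have "A \<in> null_sets (density lborel (\<lambda>r. ennreal (radial_weight r)))"
      using absolutely_continuousI_density[of "\<lambda>r. ennreal (radial_weight r)" lborel] A
      unfolding absolutely_continuous_def by auto
    then have "emeasure (distr lborel borel (norm :: real^3 \<Rightarrow> real)) A = 0"
      unfolding distr_norm by auto
    then have "norm -` A \<in> null_sets (lborel :: (real^3) measure)"
      using measurable_sets[of norm "lborel :: (real^3) measure" borel A] by (intro null_setsI) (auto simp: emeasure_distr)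
    then have "norm -` A \<in> null_sets ?D"
      using absolutely_continuousI_density[of "\<lambda>x. ennreal (h x)" lborel] unfolding absolutely_continuous_def by auto
    then show "A \<in> null_sets ?\<nu>" by (auto simp: null_sets_def emeasure_distr)
  qed
  define \<kappa> where "\<kappa> = RN_deriv lborel ?\<nu>"
  have [measurable]: "\<kappa> \<in> borel_measurable borel" unfolding \<kappa>_def using borel_measurable_RN_deriv[of lborel] by simp
  have \<kappa>: "density lborel \<kappa> = ?\<nu>" unfolding \<kappa>_def by (rule sigma_finite_measure.density_RN_deriv[OF sigma_finite_lborel ac]) simp
  have int: "(\<integral>\<^sup>+r. \<kappa> r * F r \<partial>lborel) = (\<integral>\<^sup>+x. ennreal (h x) * F (norm x) \<partial>lborel)"
    if [measurable]: "F \<in> borel_measurable borel" for F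
  proof -
    have "(\<integral>\<^sup>+r. \<kappa> r * F r \<partial>lborel) = integral\<^sup>N (density lborel \<kappa>) F" by (simp add: nn_integral_density)
    also have "\<dots> = (\<integral>\<^sup>+x. F (norm x) \<partial>?D)" unfolding \<kappa> by (subst nn_integral_distr) auto
    also have "\<dots> = (\<integral>\<^sup>+x. ennreal (h x) * F (norm x) \<partial>lborel)" by (subst nn_integral_density) auto
    finally show ?thesis .
  qed
  define W where "W = (\<integral>\<^sup>+x. (ennreal (h x))\<^sup>2 \<partial>lborel)"
  have W: "W < \<infinity>"
  proof -
    have "W = (\<integral>\<^sup>+x. ennreal ((h x)\<^sup>2) \<partial>lborel)" unfolding W_def by (simp add: h0 ennreal_power)
    then show ?thesis using nn_integral_eq_integral[OF h2] by simp
  qed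
  have cs: "(\<integral>\<^sup>+r. \<kappa> r * F r \<partial>lborel)\<^sup>2 \<le> W * (\<integral>\<^sup>+r. ennreal (radial_weight r) * (F r)\<^sup>2 \<partial>lborel)"
    if [measurable]: "F \<in> borel_measurable borel" for F
    unfolding int[OF that] W_def using nn_integral_radial[of "\<lambda>r. (F r)\<^sup>2"]
      Cauchy_Schwarz_nn_integral[of "\<lambda>x. ennreal (h x)" lborel "\<lambda>x. F (norm x)"] by simp
  have fin_ball: "(\<integral>\<^sup>+r. ennreal (radial_weight r) * (c * indicator {..real n} r) \<partial>lborel) < \<infinity>" if c: "c < \<infinity>" for c n
  proof -
    have "(\<integral>\<^sup>+r. ennreal (radial_weight r) * (c * indicator {..real n} r) \<partial>lborel)
        = (\<integral>\<^sup>+x. c * indicator {..real n} (norm x) \<partial>(lborel :: (real^3) measure))"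
      by (rule nn_integral_radial[symmetric]) auto
    also have "\<dots> = (\<integral>\<^sup>+x. c * indicator (cball 0 (real n)) x \<partial>(lborel :: (real^3) measure))"
      by (rule nn_integral_cong) (auto simp: indicator_def)
    also have "\<dots> = c * emeasure lborel (cball (0 :: real^3) (real n))" by (rule nn_integral_cmult_indicator) auto
    also have "\<dots> < \<infinity>" using c by (simp add: emeasure_cball ennreal_mult_less_top)
    finally show ?thesis .
  qed
  \<comment> \<open>Testing Cauchy-Schwarz with the indicator of a ball bounds the integral of
    \<kappa> over bounded sets of radii, so \<kappa> is finite almost everywhere.\<close>
  have "AE r in lborel. \<kappa> r * indicator {..real n} r \<noteq> \<infinity>" for n
  proof (rule nn_integral_PInf_AE)
    have "(\<integral>\<^sup>+r. \<kappa> r * indicator {..real n} r \<partial>lborel)\<^sup>2 \<le> W * (\<integral>\<^sup>+r. ennreal (radial_weight r) * (1 * indicator {..real n} r) \<partial>lborel)"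
    proof -
      have sq: "(indicator {..real n} r :: ennreal)\<^sup>2 = 1 * indicator {..real n} r" for r by (simp add: indicator_def)
      show ?thesis using cs[of "indicator {..real n}"] unfolding sq by simp
    qed
    also have "\<dots> < \<infinity>" using W fin_ball[of 1 n] by (simp add: ennreal_mult_less_top)
    finally show "(\<integral>\<^sup>+r. \<kappa> r * indicator {..real n} r \<partial>lborel) \<noteq> \<infinity>"
      by (auto simp: power2_eq_square)
  qed auto
  then have "AE r in lborel. \<forall>n. \<kappa> r * indicator {..real n} r \<noteq> \<infinity>" unfolding AE_all_countable by blast
  then have fin: "AE r in lborel. \<kappa> r \<noteq> \<infinity>"
  proof eventually_elim
    case (elim r)
    obtain n where "r \<le> real n" using real_arch_simple by blast
    then show ?case using elim[rule_format, of n] by simp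
  qed
  have "(\<integral>\<^sup>+r. \<kappa> r * indicator {..0} r \<partial>lborel) = (\<integral>\<^sup>+x. ennreal (h x) * indicator {..0} (norm x) \<partial>lborel)"
    by (rule int) simp
  also have "\<dots> = (\<integral>\<^sup>+x. 0 \<partial>(lborel :: (real^3) measure))"
    by (rule nn_integral_cong_AE) (use AE_norm_pos in \<open>auto elim!: eventually_mono\<close>)
  finally have "AE r in lborel. \<kappa> r * indicator {..0} r = 0"
    using nn_integral_0_iff_AE[of "\<lambda>r. \<kappa> r * indicator {..0} r" lborel] by simp
  then have neg: "AE r in lborel. r \<le> 0 \<longrightarrow> \<kappa> r = 0" by eventually_elim auto
  define a where "a r = (if r > 0 then enn2real (\<kappa> r) / (4 * pi * r\<^sup>2) else 0)" for r
  have [measurable]: "a \<in> borel_measurable borel" unfolding a_def[abs_def] by measurable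
  have a0: "a r \<ge> 0" for r by (simp add: a_def)
  have a\<kappa>: "AE r in lborel. \<kappa> r = ennreal (a r * radial_weight r)"
    using fin neg
  proof eventually_elim
    case (elim r)
    show ?case
    proof (cases "r > 0")
      case True
      then have "a r * radial_weight r = enn2real (\<kappa> r)" by (simp add: a_def radial_weight_def)
      then show ?thesis using elim(1) by (simp add: less_top)
    qed (use elim in \<open>auto simp: a_def\<close>)
  qed
  \<comment> \<open>Truncation in height and in range makes \<open>X n\<close> finite a priori; only
    then may it be cancelled from (X n)^2 \<le> W X n.\<close>
  define F where "F n r = ennreal (min (a r) (real n)) * indicator {..real n} r" for n r
  have [measurable]: "F n \<in> borel_measurable borel" for n unfolding F_def[abs_def] by measurable
  define X where "X n = (\<integral>\<^sup>+r. ennreal (radial_weight r) * (F n r)\<^sup>2 \<partial>lborel)" for n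
  have Xle: "X n \<le> W" for n
  proof -
    have "X n \<le> (\<integral>\<^sup>+r. ennreal (radial_weight r) * (ennreal ((real n)\<^sup>2) * indicator {..real n} r) \<partial>lborel)"
      unfolding X_def
    proof (rule nn_integral_mono)
      fix r
      have "(F n r)\<^sup>2 \<le> ennreal ((real n)\<^sup>2) * indicator {..real n} r"
        using a0[of r] by (auto simp: F_def indicator_def ennreal_power intro!: ennreal_leI power_mono)
      then show "ennreal (radial_weight r) * (F n r)\<^sup>2 \<le> ennreal (radial_weight r) * (ennreal ((real n)\<^sup>2) * indicator {..real n} r)"
        by (rule mult_left_mono) simp
    qed
    also have "\<dots> < \<infinity>" by (rule fin_ball) simp
    finally have Xfin: "X n < \<infinity>" .
    have "X n \<le> (\<integral>\<^sup>+r. \<kappa> r * F n r \<partial>lborel)"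
      unfolding X_def
    proof (rule nn_integral_mono_AE)
      show "AE r in lborel. ennreal (radial_weight r) * (F n r)\<^sup>2 \<le> \<kappa> r * F n r"
        using a\<kappa>
      proof eventually_elim
        case (elim r)
        have "F n r \<le> ennreal (a r)" using a0[of r] by (auto simp: F_def indicator_def intro!: ennreal_leI)
        then have "ennreal (radial_weight r) * F n r * F n r \<le> ennreal (radial_weight r) * ennreal (a r) * F n r"
          by (intro mult_right_mono mult_left_mono) auto
        also have "ennreal (radial_weight r) * ennreal (a r) = \<kappa> r"
          unfolding elim by (simp add: ennreal_mult[symmetric] a0 mult.commute)
        finally show ?case by (simp add: power2_eq_square mult.assoc)
      qed
    qed
    then have "(X n)\<^sup>2 \<le> (\<integral>\<^sup>+r. \<kappa> r * F n r \<partial>lborel)\<^sup>2" by (rule power_mono) simp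
    also have "\<dots> \<le> W * X n" unfolding X_def by (rule cs) simp
    finally have sq: "(X n)\<^sup>2 \<le> W * X n" .
    obtain x where x: "X n = ennreal x" "x \<ge> 0" using Xfin by (cases "X n") auto
    obtain w where w: "W = ennreal w" "w \<ge> 0" using W by (cases W) auto
    have "x\<^sup>2 \<le> w * x" using sq x w by (simp add: ennreal_power ennreal_mult[symmetric])
    then have "x \<le> w" using x(2) w(2) by (cases "x = 0") (auto simp: power2_eq_square)
    then show ?thesis using x w by (simp add: ennreal_leI)
  qed
  have lim: "(\<integral>\<^sup>+r. ennreal (radial_weight r * (a r)\<^sup>2) \<partial>lborel) \<le> W"
  proof -
    have "(\<integral>\<^sup>+r. ennreal (radial_weight r * (a r)\<^sup>2) \<partial>lborel) = (\<integral>\<^sup>+r. liminf (\<lambda>n. ennreal (radial_weight r) * (F n r)\<^sup>2) \<partial>lborel)"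
    proof (rule nn_integral_cong)
      fix r
      have "\<forall>\<^sub>F n in sequentially. ennreal (radial_weight r) * (F n r)\<^sup>2 = ennreal (radial_weight r * (a r)\<^sup>2)"
        using eventually_ge_at_top[of "nat \<lceil>max r (a r)\<rceil>"]
      proof eventually_elim
        case (elim n)
        then have "r \<le> real n" "a r \<le> real n" by linarith+
        then show ?case using a0[of r] by (simp add: F_def ennreal_power ennreal_mult)
      qed
      then have "(\<lambda>n. ennreal (radial_weight r) * (F n r)\<^sup>2) \<longlonglongrightarrow> ennreal (radial_weight r * (a r)\<^sup>2)"
        by (rule tendsto_eventually)
      then show "ennreal (radial_weight r * (a r)\<^sup>2) = liminf (\<lambda>n. ennreal (radial_weight r) * (F n r)\<^sup>2)"
        by (intro lim_imp_Liminf[symmetric]) auto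
    qed
    also have "\<dots> \<le> liminf X" unfolding X_def by (rule nn_integral_liminf) simp
    also have "\<dots> \<le> W" by (rule Liminf_le) (use Xle in auto)
    finally show ?thesis .
  qed
  have "integrable lborel (\<lambda>r. radial_weight r * (a r)\<^sup>2)"
    by (rule integrableI_nonneg) (use lim W in auto)
  then have "integrable lborel (\<lambda>r. 1 / (4 * pi) * (radial_weight r * (a r)\<^sup>2))" by (rule integrable_mult_right)
  moreover have "1 / (4 * pi) * (radial_weight r * (a r)\<^sup>2) = indicator {0<..} r *\<^sub>R ((a r)\<^sup>2 * r\<^sup>2)" for r
    by (simp add: radial_weight_def)
  ultimately have "integrable ray (\<lambda>r. (a r)\<^sup>2 * r\<^sup>2)" by (simp add: integrable_ray set_integrable_def)
  moreover have "?\<nu> = density lborel (\<lambda>r. ennreal (a r * radial_weight r))"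
    unfolding \<kappa>[symmetric] by (rule density_cong[OF _ _ a\<kappa>]) auto
  ultimately show ?thesis using that[of a] a0 by simp
qed

text \<open>The function \<open>k\<close> is the spherical mean of \<open>w\<close>, formed as the
  difference of the means of the positive and negative parts. Square-integrability of the radial
  factor makes both contributions finite.\<close>

lemma spherical_mean_integral:
  fixes w :: "real^3 \<Rightarrow> real"
  assumes [measurable]: "w \<in> borel_measurable borel" and w2: "integrable lborel (\<lambda>x. (w x)\<^sup>2)"
  obtains k where "k \<in> borel_measurable borel" "integrable ray (\<lambda>r. (k r)\<^sup>2 * r\<^sup>2)"
    "\<And>F. F \<in> borel_measurable borel \<Longrightarrow> integrable lborel (\<lambda>x::real^3. (F (norm x))\<^sup>2) \<Longrightarrow>
       (\<integral>x. w x * F (norm x) \<partial>lborel) = 4 * pi * (\<integral>r. k r * F r * r\<^sup>2 \<partial>ray)"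
proof -
  let ?p = "\<lambda>x. max 0 (w x)" and ?n = "\<lambda>x. max 0 (- w x)"
  have ip: "integrable lborel (\<lambda>x. (?p x)\<^sup>2)" by (rule Bochner_Integration.integrable_bound[OF w2]) (auto simp: max_def)
  have im: "integrable lborel (\<lambda>x. (?n x)\<^sup>2)" by (rule Bochner_Integration.integrable_bound[OF w2]) (auto simp: max_def)
  obtain a where [measurable]: "a \<in> borel_measurable borel" and a: "\<And>r. a r \<ge> 0" "integrable ray (\<lambda>r. (a r)\<^sup>2 * r\<^sup>2)"
    "distr (density lborel (\<lambda>x. ennreal (?p x))) borel norm = density lborel (\<lambda>r. ennreal (a r * radial_weight r))"
    by (rule spherical_mean[OF _ _ ip]) auto
  obtain b where [measurable]: "b \<in> borel_measurable borel" and b: "\<And>r. b r \<ge> 0" "integrable ray (\<lambda>r. (b r)\<^sup>2 * r\<^sup>2)"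
    "distr (density lborel (\<lambda>x. ennreal (?n x))) borel norm = density lborel (\<lambda>r. ennreal (b r * radial_weight r))"
    by (rule spherical_mean[OF _ _ im]) auto
  have one: "(\<integral>x. h x * F (norm x) \<partial>lborel) = 4 * pi * (\<integral>r. c r * F r * r\<^sup>2 \<partial>ray) \<and> integrable ray (\<lambda>r. c r * F r * r\<^sup>2)"
    if [measurable]: "h \<in> borel_measurable borel" "c \<in> borel_measurable borel" "F \<in> borel_measurable borel"
      and h: "\<And>x. h x \<ge> 0" and c: "\<And>r. c r \<ge> 0"
      and eq: "distr (density lborel (\<lambda>x. ennreal (h x))) borel norm = density lborel (\<lambda>r. ennreal (c r * radial_weight r))"
      and i: "integrable lborel (\<lambda>x. h x * F (norm x))" for h :: "real^3 \<Rightarrow> real" and c F :: "real \<Rightarrow> real"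
  proof -
    have e: "(c r * radial_weight r) *\<^sub>R F r = 4 * pi * (indicator {0<..} r *\<^sub>R (c r * F r * r\<^sup>2))" for r
      by (simp add: radial_weight_def)
    have "(\<integral>x. h x * F (norm x) \<partial>lborel) = (\<integral>x. F (norm x) \<partial>density lborel (\<lambda>x. ennreal (h x)))"
      by (subst integral_density) (use h in auto)
    also have "\<dots> = integral\<^sup>L (distr (density lborel (\<lambda>x. ennreal (h x))) borel norm) F"
      by (subst integral_distr) auto
    also have "\<dots> = (\<integral>r. (c r * radial_weight r) *\<^sub>R F r \<partial>lborel)"
      unfolding eq by (subst integral_density) (use c in auto)
    also have "\<dots> = 4 * pi * (\<integral>r. c r * F r * r\<^sup>2 \<partial>ray)"
      unfolding e integral_ray set_lebesgue_integral_def by simp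
    finally have 1: "(\<integral>x. h x * F (norm x) \<partial>lborel) = 4 * pi * (\<integral>r. c r * F r * r\<^sup>2 \<partial>ray)" .
    have "integrable (density lborel (\<lambda>x. ennreal (h x))) (\<lambda>x. F (norm x))"
      by (subst integrable_density) (use h i in auto)
    then have "integrable (distr (density lborel (\<lambda>x. ennreal (h x))) borel norm) F"
      by (subst integrable_distr_eq) auto
    then have "integrable lborel (\<lambda>r. (c r * radial_weight r) *\<^sub>R F r)"
      unfolding eq by (subst (asm) integrable_density) (use c in auto)
    then have "integrable lborel (\<lambda>r. 1 / (4 * pi) * ((c r * radial_weight r) *\<^sub>R F r))" by (rule integrable_mult_right)
    then have "integrable ray (\<lambda>r. c r * F r * r\<^sup>2)" unfolding e by (simp add: integrable_ray set_integrable_def)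
    then show ?thesis using 1 by simp
  qed
  define k where "k r = a r - b r" for r
  have "integrable ray (\<lambda>r. (k r)\<^sup>2 * r\<^sup>2)"
  proof (rule Bochner_Integration.integrable_bound[where f="\<lambda>r. 2 * ((a r)\<^sup>2 * r\<^sup>2) + 2 * ((b r)\<^sup>2 * r\<^sup>2)"])
    show "AE r in ray. norm ((k r)\<^sup>2 * r\<^sup>2) \<le> norm (2 * ((a r)\<^sup>2 * r\<^sup>2) + 2 * ((b r)\<^sup>2 * r\<^sup>2))"
    proof (rule AE_I2)
      fix r
      have "(k r)\<^sup>2 \<le> 2 * (a r)\<^sup>2 + 2 * (b r)\<^sup>2" using zero_le_power2[of "a r + b r"] by (simp add: k_def power2_sum power2_diff)
      then have "(k r)\<^sup>2 * r\<^sup>2 \<le> (2 * (a r)\<^sup>2 + 2 * (b r)\<^sup>2) * r\<^sup>2" by (rule mult_right_mono) simp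
      then show "norm ((k r)\<^sup>2 * r\<^sup>2) \<le> norm (2 * ((a r)\<^sup>2 * r\<^sup>2) + 2 * ((b r)\<^sup>2 * r\<^sup>2))" by (simp add: algebra_simps)
    qed
    show "(\<lambda>r. (k r)\<^sup>2 * r\<^sup>2) \<in> borel_measurable ray" unfolding k_def by (rule borel_measurable_ray) measurable
  qed (use a b in simp)
  moreover have "(\<integral>x. w x * F (norm x) \<partial>lborel) = 4 * pi * (\<integral>r. k r * F r * r\<^sup>2 \<partial>ray)"
    if [measurable]: "F \<in> borel_measurable borel" and F2: "integrable lborel (\<lambda>x::real^3. (F (norm x))\<^sup>2)" for F
  proof -
    have i1: "integrable lborel (\<lambda>x. ?p x * F (norm x))" by (rule integrable_mult_L2[OF _ _ ip F2]) auto
    have i2: "integrable lborel (\<lambda>x. ?n x * F (norm x))" by (rule integrable_mult_L2[OF _ _ im F2]) auto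
    note o1 = one[OF _ _ _ _ a(1) a(3) i1, simplified] and o2 = one[OF _ _ _ _ b(1) b(3) i2, simplified]
    have "(\<integral>x. w x * F (norm x) \<partial>lborel) = (\<integral>x. ?p x * F (norm x) - ?n x * F (norm x) \<partial>lborel)"
      by (rule Bochner_Integration.integral_cong) (auto simp: max_def)
    also have "\<dots> = 4 * pi * (\<integral>r. a r * F r * r\<^sup>2 \<partial>ray) - 4 * pi * (\<integral>r. b r * F r * r\<^sup>2 \<partial>ray)"
      using i1 i2 o1 o2 by simp
    also have "\<dots> = 4 * pi * (\<integral>r. a r * F r * r\<^sup>2 - b r * F r * r\<^sup>2 \<partial>ray)"
      using o1 o2 by (simp add: right_diff_distrib)
    also have "(\<lambda>r. a r * F r * r\<^sup>2 - b r * F r * r\<^sup>2) = (\<lambda>r. k r * F r * r\<^sup>2)" by (auto simp: k_def algebra_simps)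
    finally show ?thesis .
  qed
  moreover have "k \<in> borel_measurable borel" unfolding k_def by measurable
  ultimately show ?thesis using that by blast
qed

section \<open>Weak gradients of radial functions\<close>

lemma integrable_ray_continuous:
  fixes f :: "real \<Rightarrow> real"
  assumes f: "continuous_on {0<..} f" and z: "\<And>x. x \<notin> {a..b} \<Longrightarrow> f x = 0" and a: "0 < a"
  shows "integrable ray f"
proof -
  have "continuous_on {a..b} f" using f by (rule continuous_on_subset) (use a in auto)
  then have "set_integrable lborel {a..b} f" by (rule borel_integrable_atLeastAtMost')
  then have "integrable ray (\<lambda>x. indicator {a..b} x * f x)" by (simp add: integral_ray_indicator(1)[OF a])
  then show ?thesis using integral_ray_compact_support[OF z] by simp
qed

lemma locally_integrable_UNIV_measurable:
  fixes u :: "'a::euclidean_space \<Rightarrow> 'b::euclidean_space"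
  assumes u: "locally_integrable UNIV u"
  shows "u \<in> borel_measurable borel"
proof (rule borel_measurable_LIMSEQ_metric[where f="\<lambda>n x. indicator (cball 0 (real n)) x *\<^sub>R u x"])
  fix n
  have "set_integrable lborel (cball 0 (real n)) u" using u by (simp add: locally_integrable_def)
  then show "(\<lambda>x. indicator (cball 0 (real n)) x *\<^sub>R u x) \<in> borel_measurable borel"
    by (auto simp: set_integrable_def)
next
  fix x :: 'a
  have "\<forall>\<^sub>F n in sequentially. indicator (cball 0 (real n)) x *\<^sub>R u x = u x"
    using eventually_ge_at_top[of "nat \<lceil>norm x\<rceil>"]
  proof eventually_elim
    case (elim n)
    then have "norm x \<le> real n" by linarith
    then show ?case by simp
  qed
  then show "(\<lambda>n. indicator (cball 0 (real n)) x *\<^sub>R u x) \<longlonglongrightarrow> u x" by (rule tendsto_eventually)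
qed

lemma locally_integrable_UNIV_mult:
  fixes u f :: "'a::euclidean_space \<Rightarrow> real"
  assumes u: "locally_integrable UNIV u" and f: "continuous_on UNIV f" "compact K" "\<And>x. x \<notin> K \<Longrightarrow> f x = 0"
  shows "integrable lborel (\<lambda>x. u x * f x)"
proof -
  note [measurable] = locally_integrable_UNIV_measurable[OF u] borel_measurable_continuous_onI[OF f(1)]
  have "continuous_on K f" using f(1) by (rule continuous_on_subset) auto
  then have "bounded (f ` K)" by (intro compact_imp_bounded compact_continuous_image f)
  then obtain C where C: "\<And>x. x \<in> K \<Longrightarrow> \<bar>f x\<bar> \<le> C" unfolding bounded_iff by (metis image_eqI real_norm_def)
  have "set_integrable lborel K u" using u f(2) by (simp add: locally_integrable_def)
  then have i: "integrable lborel (\<lambda>x. indicator K x * u x)" by (simp add: set_integrable_def)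
  show ?thesis
  proof (rule Bochner_Integration.integrable_bound[where f="\<lambda>x. C * (indicator K x * u x)"])
    show "AE x in lborel. norm (u x * f x) \<le> norm (C * (indicator K x * u x))"
    proof (rule AE_I2)
      fix x show "norm (u x * f x) \<le> norm (C * (indicator K x * u x))"
      proof (cases "x \<in> K")
        case True
        have "\<bar>f x\<bar> * \<bar>u x\<bar> \<le> \<bar>C\<bar> * \<bar>u x\<bar>" by (rule mult_right_mono) (use C[OF True] in auto)
        then show ?thesis using True by (simp add: abs_mult mult.commute)
      qed (use f(3) in simp)
    qed
  qed (use i in auto)
qed

lemma locally_integrable_UNIV_bounded:
  fixes f :: "'a::euclidean_space \<Rightarrow> 'b::euclidean_space"
  assumes [measurable]: "f \<in> borel_measurable borel" and bd: "\<And>R. \<exists>C. \<forall>x\<in>cball 0 R. norm (f x) \<le> C"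
  shows "locally_integrable UNIV f"
  unfolding locally_integrable_def
proof (intro allI impI)
  fix K :: "'a set" assume K: "compact K"
  then obtain R where R: "K \<subseteq> cball 0 R" using compact_imp_bounded[of K] by (force simp: bounded_iff)
  obtain C where C: "\<And>x. x \<in> cball 0 R \<Longrightarrow> norm (f x) \<le> C" using bd by blast
  have [measurable]: "K \<in> sets borel" using K by (simp add: borel_compact)
  have "integrable lborel (\<lambda>x. C * indicator K x)"
    by (intro integrable_mult_right integrable_real_indicator) (use K emeasure_compact_finite in auto)
  then show "set_integrable lborel K f" unfolding set_integrable_def
    by (rule Bochner_Integration.integrable_bound) (use C R in \<open>fastforce simp: indicator_def intro!: AE_I2\<close>)+
qed

lemma test_function_UNIV:
  fixes \<phi> :: "'a::euclidean_space \<Rightarrow> real"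
  assumes "test_function UNIV \<phi>"
  obtains R where "R > 0" "\<And>x. norm x \<ge> R \<Longrightarrow> \<phi> x = 0" "\<And>x b. norm x \<ge> R \<Longrightarrow> frechet_derivative \<phi> (at x) b = 0"
    "\<And>x. (\<phi> has_derivative frechet_derivative \<phi> (at x)) (at x)"
    "\<And>b. b \<in> Basis \<Longrightarrow> continuous_on UNIV (\<lambda>x. frechet_derivative \<phi> (at x) b)" "continuous_on UNIV \<phi>"
proof -
  let ?K = "closure {x. \<phi> x \<noteq> 0}"
  have K: "compact ?K" and Ck: "\<And>k. Ck_on UNIV k \<phi>" using assms by (auto simp: test_function_def Ck_on_UNIV)
  obtain R0 where R0: "\<And>x. x \<in> ?K \<Longrightarrow> norm x \<le> R0" using compact_imp_bounded[OF K] unfolding bounded_iff by blast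
  define R where "R = \<bar>R0\<bar> + 1"
  have z: "\<phi> x = 0" if "norm x > \<bar>R0\<bar>" for x
    using that R0[of x] closure_subset[of "{x. \<phi> x \<noteq> 0}"] by force
  have d: "(\<phi> has_derivative frechet_derivative \<phi> (at x)) (at x)" for x
    using Ck_on_Suc_has_derivative[OF Ck[of "Suc 0"]] by simp
  have dz: "frechet_derivative \<phi> (at x) b = 0" if "norm x \<ge> R" for x b
  proof -
    have "((\<lambda>x. 0) has_derivative (\<lambda>h. 0)) (at x)" by simp
    then have "(\<phi> has_derivative (\<lambda>h. 0)) (at x)"
      by (rule has_derivative_transform_within_open[where s="- cball 0 \<bar>R0\<bar>"])
         (use that z in \<open>auto simp: R_def\<close>)
    then show ?thesis using frechet_derivative_at by metis
  qed
  show ?thesis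
  proof (rule that[of R])
    show "continuous_on UNIV (\<lambda>x. frechet_derivative \<phi> (at x) b)" if "b \<in> Basis" for b
      using Ck[of "Suc 0"] that by simp
    show "continuous_on UNIV \<phi>" using Ck[of 0] by simp
  qed (use z d dz in \<open>auto simp: R_def\<close>)
qed

lemma has_weak_gradient_UNIV_iff:
  "has_weak_gradient u g UNIV \<longleftrightarrow> locally_integrable UNIV u \<and> locally_integrable UNIV g \<and>
     (\<forall>\<phi>. test_function UNIV \<phi> \<longrightarrow> (\<forall>b\<in>Basis.
        (\<integral>x. u x * frechet_derivative \<phi> (at x) b \<partial>lborel) = - (\<integral>x. (g x \<bullet> b) * \<phi> x \<partial>lborel)))"
  by (simp add: has_weak_gradient_def set_lebesgue_integral_def)

text \<open>The norm is the square root of the polynomial x \<bullet> x, which maps the punctured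
  space into the domain where powers are smooth.\<close>

lemma Ck_on_norm: "Ck_on (- {0}) k (norm :: 'a::euclidean_space \<Rightarrow> real)"
proof -
  have sq: "Ck_on (- {0}) j (\<lambda>x::'a. x \<bullet> x)" for j
  proof (cases j)
    case (Suc i)
    show ?thesis unfolding Suc
    proof (rule Ck_on_SucI)
      show "((\<lambda>x. x \<bullet> x) has_derivative (\<lambda>h. 2 * (x \<bullet> h))) (at x)" for x :: 'a
        by (auto intro!: derivative_eq_intros simp: inner_commute)
      show "Ck_on (- {0}) i (\<lambda>x::'a. 2 * (x \<bullet> b))" for b by (intro Ck_on_cmult Ck_on_inner) auto
    qed auto
  qed (auto intro!: continuous_intros)
  have "Ck_on (- {0}) k (\<lambda>x::'a. (x \<bullet> x) powr (1/2))"
    by (rule Ck_on_compose[OF _ _ _ Ck_on_powr sq]) auto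
  then show ?thesis
    by (rule Ck_on_cong[rotated 2]) (auto simp: powr_half_sqrt norm_eq_sqrt_inner)
qed

text \<open>Testing against the components of \<open>\<psi>(\<bar>x\<bar>) x / \<bar>x\<bar>\<^sup>3\<close>, whose divergence is
  \<open>\<psi>'(\<bar>x\<bar>) / \<bar>x\<bar>\<^sup>2\<close>, reduces the weak gradient on space to the weak derivative on the half-line.\<close>

definition radial_field :: "(real \<Rightarrow> real) \<Rightarrow> real^3 \<Rightarrow> real^3 \<Rightarrow> real" where
  "radial_field \<psi> b x = (x \<bullet> b) * (\<psi> (norm x) * norm x powr (-3))"

text \<open>Near the origin \<psi> vanishes, so the field is zero on a ball and crosses the
  singularity smoothly. Elsewhere x / |x|^3 is divergence-free, and only the radial derivative of
  \<psi> survives.\<close>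

lemma radial_field:
  assumes \<psi>: "test_function {0<..} \<psi>"
  shows "b \<in> Basis \<Longrightarrow> test_function UNIV (radial_field \<psi> b)"
    and "x \<noteq> 0 \<Longrightarrow> (\<Sum>b\<in>Basis. frechet_derivative (radial_field \<psi> b) (at x) b) = frechet_derivative \<psi> (at (norm x)) 1 / (norm x)\<^sup>2"
proof -
  define \<Phi> where "\<Phi> = radial_field \<psi>"
  have \<Phi>: "\<Phi> b = (\<lambda>x. (x \<bullet> b) * (\<psi> (norm x) * norm x powr (-3)))" for b
    by (auto simp: \<Phi>_def radial_field_def)
  obtain \<psi>' \<alpha> \<beta> where ab: "0 < \<alpha>" "\<alpha> \<le> \<beta>" and z: "\<And>x. x \<notin> {\<alpha>..\<beta>} \<Longrightarrow> \<psi> x = 0"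
    and d: "\<And>x::real. (\<psi> has_real_derivative \<psi>' x) (at x)"
    and fr: "\<And>x. frechet_derivative \<psi> (at x) 1 = \<psi>' x" and Ck: "\<And>k. Ck_on UNIV k \<psi>"
    by (rule test_function_ray[OF \<psi>]) blast
  show "test_function UNIV (radial_field \<psi> b)" if b: "b \<in> Basis"
    unfolding \<Phi>_def[symmetric]
  proof (rule test_functionI[where K="cball 0 \<beta>"])
    fix k
    have "Ck_on {0<..} k (\<lambda>r. \<psi> r * r powr (-3))"
      by (intro Ck_on_mult Ck_on_powr Ck_on_subset[OF Ck]) auto
    then have "Ck_on (- {0}) k (\<lambda>x::real^3. \<psi> (norm x) * norm x powr (-3))"
      by (rule Ck_on_compose[OF _ _ _ _ Ck_on_norm, rotated 3]) auto
    then have 1: "Ck_on (- {0}) k (\<Phi> b)" unfolding \<Phi> by (intro Ck_on_mult[OF _ Ck_on_inner]) auto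
    have 2: "Ck_on (ball 0 \<alpha>) k (\<Phi> b)"
      by (rule Ck_on_cong[OF _ _ Ck_on_const[of _ _ 0]]) (use z in \<open>auto simp: \<Phi>\<close>)
    have "(- {0}) \<union> ball 0 \<alpha> = (UNIV :: (real^3) set)" using ab by auto
    then show "Ck_on UNIV k (\<Phi> b)" using Ck_on_Un[OF _ _ 1 2] by auto
  next
    show "x \<in> cball 0 \<beta>" if "\<Phi> b x \<noteq> 0" for x
      using that z[of "norm x"] by (force simp: \<Phi>)
  qed auto
  assume x: "x \<noteq> 0"
  let ?r = "norm x"
  have r: "?r > 0" using x by simp
  define \<eta> where "\<eta> r = \<psi> r * r powr (-3)" for r
  define \<eta>' where "\<eta>' = \<psi>' ?r * ?r powr (-3) + \<psi> ?r * (-3 * ?r powr (-4))"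
  have d\<eta>: "(\<eta> has_derivative (\<lambda>h. h * \<eta>')) (at ?r)"
  proof -
    have p: "((\<lambda>r. r powr (-3)) has_real_derivative (-3) * ?r powr (-4)) (at ?r)"
      using has_real_derivative_powr[OF r, of "-3"] by simp
    have "(\<eta> has_real_derivative \<eta>') (at ?r)" unfolding \<eta>_def[abs_def] \<eta>'_def
      using DERIV_mult[OF d p] by (simp add: algebra_simps)
    then show ?thesis by (simp add: has_field_derivative_def mult_commute_abs)
  qed
  have "(\<Phi> b has_derivative (\<lambda>h. (x \<bullet> b) * ((h \<bullet> sgn x) * \<eta>') + (h \<bullet> b) * \<eta> ?r)) (at x)" for b
  proof -
    have "((\<lambda>x. \<eta> (norm x)) has_derivative (\<lambda>h. (h \<bullet> sgn x) * \<eta>')) (at x)"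
      by (rule has_derivative_compose[OF has_derivative_norm[OF x] d\<eta>])
    moreover have "((\<lambda>x. x \<bullet> b) has_derivative (\<lambda>h. h \<bullet> b)) (at x)" by (auto intro!: derivative_eq_intros)
    ultimately show ?thesis unfolding \<Phi> \<eta>_def[symmetric] by (rule has_derivative_mult[rotated])
  qed
  from frechet_derivative_at[OF this]
  have "(\<Sum>b\<in>Basis. frechet_derivative (\<Phi> b) (at x) b) = (\<Sum>b\<in>Basis. (x \<bullet> b) * (b \<bullet> sgn x) * \<eta>' + (b \<bullet> b) * \<eta> ?r)"
    by (metis (no_types, lifting) mult.assoc)
  also have "\<dots> = (\<Sum>b\<in>Basis. (x \<bullet> b) * (sgn x \<bullet> b)) * \<eta>' + 3 * \<eta> ?r"
    by (simp add: sum.distrib sum_distrib_right inner_Basis inner_commute)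
  also have "(\<Sum>b\<in>Basis. (x \<bullet> b) * (sgn x \<bullet> b)) = x \<bullet> sgn x" by (rule euclidean_inner[symmetric])
  also have "x \<bullet> sgn x = ?r"
    using r unfolding sgn_div_norm inner_scaleR_right dot_square_norm by (simp add: power2_eq_square)
  also have "?r * \<eta>' + 3 * \<eta> ?r = \<psi>' ?r / ?r\<^sup>2"
  proof -
    have p: "?r powr (-3) = 1 / ?r ^ 3" "?r powr (-4) = 1 / ?r ^ 4"
      using powr_realpow[OF r, of 3] powr_realpow[OF r, of 4] by (simp_all add: powr_minus divide_inverse)
    show ?thesis unfolding \<eta>'_def \<eta>_def p using r by (simp add: field_simps power2_eq_square power3_eq_cube power4_eq_xxxx)
  qed
  finally show "(\<Sum>b\<in>Basis. frechet_derivative (radial_field \<psi> b) (at x) b) = frechet_derivative \<psi> (at ?r) 1 / ?r\<^sup>2"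
    by (simp add: fr \<Phi>_def)
qed

lemma locally_integrable_radial:
  assumes u: "locally_integrable UNIV (radial_ext S)"
  shows "locally_integrable {0<..} S"
  unfolding locally_integrable_ray_iff
proof (intro allI impI)
  fix a b :: real assume ab: "0 < a" "a \<le> b"
  have S: "S \<in> borel_measurable ray"
    using locally_integrable_UNIV_measurable[OF u] by (intro measurable_ray_of_radial) (simp add: radial_ext_def[abs_def])
  define f where "f r = indicator {a..b} r * S r" for r
  have f: "f \<in> borel_measurable ray" using S unfolding f_def[abs_def] by (intro borel_measurable_times indicator_ray)
  have "set_integrable lborel (cball 0 b) (radial_ext S)" using u by (simp add: locally_integrable_def)
  then have "integrable lborel (\<lambda>x::real^3. f (norm x))"
    unfolding set_integrable_def
    by (rule Bochner_Integration.integrable_bound)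
       (use radial_measurable[OF f] in \<open>auto simp: f_def radial_ext_def indicator_def\<close>)
  then have i: "integrable ray (\<lambda>r. f r * r\<^sup>2)" by (simp add: integrable_radial_iff[OF f])
  have "integrable ray f"
  proof (rule Bochner_Integration.integrable_bound[where f="\<lambda>r. 1/a\<^sup>2 * (f r * r\<^sup>2)"])
    show "AE r in ray. norm (f r) \<le> norm (1/a\<^sup>2 * (f r * r\<^sup>2))"
    proof (rule AE_I2)
      fix r show "norm (f r) \<le> norm (1/a\<^sup>2 * (f r * r\<^sup>2))"
      proof (cases "r \<in> {a..b}")
        case True
        then have "a\<^sup>2 \<le> r\<^sup>2" using ab by (intro power_mono) auto
        then have "1 \<le> r\<^sup>2 / a\<^sup>2" using ab by (simp add: field_simps)
        then have "\<bar>f r\<bar> * 1 \<le> \<bar>f r\<bar> * (r\<^sup>2 / a\<^sup>2)" by (rule mult_left_mono) simp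
        then show ?thesis by (simp add: abs_mult)
      qed (simp add: f_def)
    qed
  qed (use i f in auto)
  then show "integrable ray (\<lambda>x. indicator {a..b} x * S x)" by (simp add: f_def[abs_def])
qed

text \<open>From 2 |k| \<le> k^2 r^2 + 1/r^2, whose last term is integrable on compact intervals
  away from the origin.\<close>

lemma locally_integrable_of_weighted_L2:
  fixes k :: "real \<Rightarrow> real"
  assumes [measurable]: "k \<in> borel_measurable ray" and k2: "integrable ray (\<lambda>r. (k r)\<^sup>2 * r\<^sup>2)"
  shows "locally_integrable {0<..} k"
  unfolding locally_integrable_ray_iff
proof (intro allI impI)
  fix a b :: real assume ab: "0 < a" "a \<le> b"
  have i: "integrable ray (\<lambda>r. indicator {a..b} r * (1 / r\<^sup>2))"
    unfolding integral_ray_indicator(1)[OF ab(1)]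
    by (rule borel_integrable_atLeastAtMost') (use ab in \<open>auto intro!: continuous_intros\<close>)
  show "integrable ray (\<lambda>x. indicator {a..b} x * k x)"
  proof (rule Bochner_Integration.integrable_bound[where f="\<lambda>r. (k r)\<^sup>2 * r\<^sup>2 + indicator {a..b} r * (1 / r\<^sup>2)"])
    show "AE r in ray. norm (indicator {a..b} r * k r) \<le> norm ((k r)\<^sup>2 * r\<^sup>2 + indicator {a..b} r * (1 / r\<^sup>2))"
    proof (rule AE_I2)
      fix r assume "r \<in> space ray" then have r: "r > 0" by simp
      show "norm (indicator {a..b} r * k r) \<le> norm ((k r)\<^sup>2 * r\<^sup>2 + indicator {a..b} r * (1 / r\<^sup>2))"
      proof (cases "r \<in> {a..b}")
        case True
        have "2 * (\<bar>k r * r\<bar> * (1/r)) \<le> \<bar>k r * r\<bar>\<^sup>2 + (1/r)\<^sup>2" using sum_squares_bound[of "\<bar>k r * r\<bar>" "1/r"] by simp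
        then have "2 * \<bar>k r\<bar> \<le> (k r)\<^sup>2 * r\<^sup>2 + 1 / r\<^sup>2" using r by (simp add: abs_mult power_mult_distrib power_divide)
        then show ?thesis using True by simp
      qed simp
    qed
  qed (use k2 i in auto)
qed

text \<open>The given \<open>g\<close> is an arbitrary weak gradient; averaging its radial component
  over spheres produces \<open>k\<close> and preserves square-integrability. Summing the weak
  identity over the components of the radial field, whose divergence carries the factor 1/r^2,
  cancels the volume weight and leaves the one-dimensional identity.\<close>

lemma radial_weak_gradient:
  assumes wg: "has_weak_gradient (radial_ext S) g UNIV" and g2: "integrable lborel (\<lambda>x. (norm (g x))\<^sup>2)"
  obtains k where "has_weak_gradient S k {0<..}" "integrable ray (\<lambda>r. (k r)\<^sup>2 * r\<^sup>2)"
proof -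
  have u: "locally_integrable UNIV (radial_ext S)" and g: "locally_integrable UNIV g"
    and weak: "\<And>\<phi> b. test_function UNIV \<phi> \<Longrightarrow> b \<in> Basis \<Longrightarrow>
        (\<integral>x. radial_ext S x * frechet_derivative \<phi> (at x) b \<partial>lborel) = - (\<integral>x. (g x \<bullet> b) * \<phi> x \<partial>lborel)"
    using wg unfolding has_weak_gradient_UNIV_iff by blast+
  have S: "S \<in> borel_measurable ray"
    using locally_integrable_UNIV_measurable[OF u] by (intro measurable_ray_of_radial) (simp add: radial_ext_def[abs_def])
  note [measurable] = locally_integrable_UNIV_measurable[OF g]
  define w where "w x = (g x \<bullet> x) / norm x" for x
  have [measurable]: "w \<in> borel_measurable borel" unfolding w_def[abs_def] by measurable
  have "integrable lborel (\<lambda>x. (w x)\<^sup>2)"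
  proof (rule Bochner_Integration.integrable_bound[OF g2])
    show "AE x in lborel. norm ((w x)\<^sup>2) \<le> norm ((norm (g x))\<^sup>2)"
    proof (rule AE_I2)
      fix x
      have "\<bar>w x\<bar> \<le> norm (g x)"
        using Cauchy_Schwarz_ineq2[of "g x" x] by (cases "x = 0") (auto simp: w_def field_simps)
      then have "\<bar>w x\<bar>\<^sup>2 \<le> (norm (g x))\<^sup>2" by (rule power_mono) simp
      then show "norm ((w x)\<^sup>2) \<le> norm ((norm (g x))\<^sup>2)" by simp
    qed
  qed auto
  then obtain k where k[measurable]: "k \<in> borel_measurable borel" and k2: "integrable ray (\<lambda>r. (k r)\<^sup>2 * r\<^sup>2)"
    and kF: "\<And>F. F \<in> borel_measurable borel \<Longrightarrow> integrable lborel (\<lambda>x::real^3. (F (norm x))\<^sup>2) \<Longrightarrow>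
       (\<integral>x. w x * F (norm x) \<partial>lborel) = 4 * pi * (\<integral>r. k r * F r * r\<^sup>2 \<partial>ray)"
    by (rule spherical_mean_integral[rotated]) auto
  have "has_weak_gradient S k {0<..}"
    unfolding has_weak_gradient_ray_iff
  proof (intro conjI allI impI)
    show "locally_integrable {0<..} S" by (rule locally_integrable_radial[OF u])
    show "locally_integrable {0<..} k" by (rule locally_integrable_of_weighted_L2[OF borel_measurable_ray[OF k] k2])
    fix \<psi> :: "real \<Rightarrow> real" assume \<psi>: "test_function {0<..} \<psi>"
    then obtain \<psi>' \<alpha> \<beta> where ab: "0 < \<alpha>" "\<alpha> \<le> \<beta>" and z: "\<And>x. x \<notin> {\<alpha>..\<beta>} \<Longrightarrow> \<psi> x = 0"
      and c': "continuous_on UNIV \<psi>'" and d: "\<And>x::real. (\<psi> has_real_derivative \<psi>' x) (at x)"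
      and fr: "\<And>x. frechet_derivative \<psi> (at x) 1 = \<psi>' x"
      by (rule test_function_ray) blast
    have c: "continuous_on UNIV \<psi>" using d by (auto intro!: continuous_at_imp_continuous_on DERIV_isCont)
    note [measurable] = borel_measurable_continuous_onI[OF c] borel_measurable_continuous_onI[OF c'] 
    define \<Phi> where "\<Phi> = radial_field \<psi>"
    note tf = radial_field[OF \<psi>, folded \<Phi>_def]
    define F where "F r = \<psi> r / r\<^sup>2" for r
    have [measurable]: "F \<in> borel_measurable borel" unfolding F_def[abs_def] by measurable
    have F2: "integrable lborel (\<lambda>x::real^3. (F (norm x))\<^sup>2)"
    proof -
      have Fm: "(\<lambda>r. (F r)\<^sup>2) \<in> borel_measurable ray" by (rule borel_measurable_ray) measurable
      have "integrable ray (\<lambda>r. (F r)\<^sup>2 * r\<^sup>2)"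
        by (rule integrable_ray_continuous[where a=\<alpha> and b=\<beta>])
           (use z ab c in \<open>auto simp: F_def intro!: continuous_intros intro: continuous_on_subset\<close>)
      then show ?thesis by (simp add: integrable_radial_iff[OF Fm])
    qed
    have i1: "integrable lborel (\<lambda>x. radial_ext S x * frechet_derivative (\<Phi> b) (at x) b)"
      and i2: "integrable lborel (\<lambda>x. (g x \<bullet> b) * \<Phi> b x)" if b: "b \<in> Basis" for b
    proof -
      obtain R where "R > 0" and R: "\<And>x. norm x \<ge> R \<Longrightarrow> \<Phi> b x = 0" "\<And>x c. norm x \<ge> R \<Longrightarrow> frechet_derivative (\<Phi> b) (at x) c = 0"
        and "\<And>x. (\<Phi> b has_derivative frechet_derivative (\<Phi> b) (at x)) (at x)"
        and c1: "\<And>c. c \<in> Basis \<Longrightarrow> continuous_on UNIV (\<lambda>x. frechet_derivative (\<Phi> b) (at x) c)" and c2: "continuous_on UNIV (\<Phi> b)"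
        by (rule test_function_UNIV[OF tf(1)[OF b]]) blast
      show "integrable lborel (\<lambda>x. radial_ext S x * frechet_derivative (\<Phi> b) (at x) b)"
        by (rule locally_integrable_UNIV_mult[OF u c1[OF b] compact_cball[of 0 R]]) (use R in auto)
      have "locally_integrable UNIV (\<lambda>x. g x \<bullet> b)" unfolding locally_integrable_def
      proof (intro allI impI)
        fix K :: "(real^3) set" assume "compact K"
        then have "set_integrable lborel K g" using g by (simp add: locally_integrable_def)
        then show "set_integrable lborel K (\<lambda>x. g x \<bullet> b)"
          unfolding set_integrable_def using integrable_inner_left[of b lborel "\<lambda>x. indicator K x *\<^sub>R g x"] by simp
      qed
      then show "integrable lborel (\<lambda>x. (g x \<bullet> b) * \<Phi> b x)"
        by (rule locally_integrable_UNIV_mult[OF _ c2 compact_cball[of 0 R]]) (use R in auto)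
    qed
    have "4 * pi * (\<integral>r. S r * \<psi>' r \<partial>ray) = 4 * pi * (\<integral>r. (S r * \<psi>' r / r\<^sup>2) * r\<^sup>2 \<partial>ray)"
      by (intro arg_cong[where f="\<lambda>x. 4 * pi * x"] Bochner_Integration.integral_cong) auto
    also have "\<dots> = (\<integral>x. S (norm x) * \<psi>' (norm x) / (norm x)\<^sup>2 \<partial>(lborel :: (real^3) measure))"
    proof (rule integral_radial[symmetric])
      have "(\<lambda>r. \<psi>' r / r\<^sup>2) \<in> borel_measurable ray" by (rule borel_measurable_ray) measurable
      then have "(\<lambda>r. S r * (\<psi>' r / r\<^sup>2)) \<in> borel_measurable ray" by (rule borel_measurable_times[OF S])
      then show "(\<lambda>r. S r * \<psi>' r / r\<^sup>2) \<in> borel_measurable ray" by simp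
    qed
    also have "\<dots> = (\<integral>x. (\<Sum>b\<in>Basis. radial_ext S x * frechet_derivative (\<Phi> b) (at x) b) \<partial>(lborel :: (real^3) measure))"
    proof (rule integral_cong_AE)
      have "(\<lambda>r. \<psi>' r / r\<^sup>2) \<in> borel_measurable ray" by (rule borel_measurable_ray) measurable
      then have "(\<lambda>r. S r * (\<psi>' r / r\<^sup>2)) \<in> borel_measurable ray" by (rule borel_measurable_times[OF S])
      from radial_measurable[OF this]
      show "(\<lambda>x::real^3. S (norm x) * \<psi>' (norm x) / (norm x)\<^sup>2) \<in> borel_measurable lborel" by simp
      show "(\<lambda>x. \<Sum>b\<in>Basis. radial_ext S x * frechet_derivative (\<Phi> b) (at x) b) \<in> borel_measurable lborel"
        using i1 by (intro borel_measurable_sum) auto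
      show "AE x in (lborel :: (real^3) measure). S (norm x) * \<psi>' (norm x) / (norm x)\<^sup>2 = (\<Sum>b\<in>Basis. radial_ext S x * frechet_derivative (\<Phi> b) (at x) b)"
        using AE_norm_pos
      proof eventually_elim
        case (elim x)
        then have x: "x \<noteq> 0" by auto
        show ?case unfolding sum_distrib_left[symmetric] tf(2)[OF x] fr by (simp add: radial_ext_def)
      qed
    qed
    also have "\<dots> = (\<Sum>b\<in>Basis. \<integral>x. radial_ext S x * frechet_derivative (\<Phi> b) (at x) b \<partial>lborel)"
      by (rule Bochner_Integration.integral_sum) (rule i1)
    also have "\<dots> = (\<Sum>b\<in>Basis. - (\<integral>x. (g x \<bullet> b) * \<Phi> b x \<partial>lborel))"
      by (rule sum.cong[OF refl]) (rule weak[OF tf(1)])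
    also have "\<dots> = - (\<integral>x. (\<Sum>b\<in>Basis. (g x \<bullet> b) * \<Phi> b x) \<partial>lborel)"
      unfolding sum_negf by (subst Bochner_Integration.integral_sum) (use i2 in auto)
    also have "(\<lambda>x. \<Sum>b\<in>Basis. (g x \<bullet> b) * \<Phi> b x) = (\<lambda>x. w x * F (norm x))"
    proof
      fix x :: "real^3"
      have "(\<Sum>b\<in>Basis. (g x \<bullet> b) * \<Phi> b x) = (\<Sum>b\<in>Basis. (g x \<bullet> b) * (x \<bullet> b)) * (\<psi> (norm x) * norm x powr (-3))"
        by (simp add: \<Phi>_def radial_field_def sum_distrib_right mult.assoc)
      also have "\<dots> = (g x \<bullet> x) * (\<psi> (norm x) * norm x powr (-3))" by (simp add: euclidean_inner[symmetric])
      also have "\<dots> = w x * F (norm x)"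
      proof (cases "x = 0")
        case False
        then have r: "norm x > 0" by simp
        have "norm x powr (-3) = 1 / norm x ^ 3" using powr_realpow[OF r, of 3] by (simp add: powr_minus divide_inverse)
        then show ?thesis by (simp add: w_def F_def power2_eq_square power3_eq_cube)
      qed (simp add: w_def)
      finally show "(\<Sum>b\<in>Basis. (g x \<bullet> b) * \<Phi> b x) = w x * F (norm x)" .
    qed
    also have "(\<integral>x. w x * F (norm x) \<partial>lborel) = 4 * pi * (\<integral>r. k r * F r * r\<^sup>2 \<partial>ray)"
      by (rule kF[OF _ F2]) simp
    also have "(\<integral>r. k r * F r * r\<^sup>2 \<partial>ray) = (\<integral>r. k r * \<psi> r \<partial>ray)"
      by (rule Bochner_Integration.integral_cong) (auto simp: F_def)
    finally show "(\<integral>r. S r * frechet_derivative \<psi> (at r) 1 \<partial>ray) = - (\<integral>r. k r * \<psi> r \<partial>ray)"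
      using mult_left_cancel[of "4 * pi" "\<integral>r. S r * \<psi>' r \<partial>ray" "- (\<integral>r. k r * \<psi> r \<partial>ray)"] by (simp add: fr)
  qed
  then show ?thesis using k2 that by blast
qed

section \<open>From a radial profile back to a weak gradient in space\<close>

lemma integral_translation:
  fixes G :: "'a::euclidean_space \<Rightarrow> real"
  assumes [measurable]: "G \<in> borel_measurable borel"
  shows "(\<integral>x. G (c + x) \<partial>lborel) = (\<integral>x. G x \<partial>lborel)" "integrable lborel (\<lambda>x. G (c + x)) \<longleftrightarrow> integrable lborel G"
proof -
  show "(\<integral>x. G (c + x) \<partial>lborel) = (\<integral>x. G x \<partial>lborel)"
    by (subst lborel_distr_plus[of c, symmetric], subst integral_distr) auto
  show "integrable lborel (\<lambda>x. G (c + x)) \<longleftrightarrow> integrable lborel G"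
    by (subst (2) lborel_distr_plus[of c, symmetric], subst integrable_distr_eq) auto
qed

lemma difference_quotient_tendsto:
  fixes f :: "'a::real_normed_vector \<Rightarrow> real"
  assumes f: "(f has_derivative D) (at x)" and h: "h \<longlonglongrightarrow> 0" "\<And>n::nat. h n \<noteq> 0"
  shows "(\<lambda>n. (f (x + h n *\<^sub>R b) - f x) / h n) \<longlonglongrightarrow> D b"
proof -
  have lin: "linear D" using f by (rule has_derivative_linear)
  have l: "((\<lambda>s. x + s *\<^sub>R b) has_derivative (\<lambda>s. s *\<^sub>R b)) (at 0)" by (auto intro!: derivative_eq_intros)
  have "((\<lambda>s. f (x + s *\<^sub>R b)) has_derivative (\<lambda>s. D (s *\<^sub>R b))) (at 0)"
    by (rule has_derivative_compose[OF l]) (use f in simp)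
  then have "((\<lambda>s. f (x + s *\<^sub>R b)) has_real_derivative D b) (at 0)"
    by (simp add: has_field_derivative_def linear_cmul[OF lin] mult_commute_abs)
  then have "((\<lambda>s. (f (x + s *\<^sub>R b) - f x) / s) \<longlongrightarrow> D b) (at 0)" by (simp add: has_field_derivative_iff)
  moreover have "filterlim h (at 0) sequentially" using h by (intro filterlim_atI) auto
  ultimately show ?thesis by (rule filterlim_compose)
qed

text \<open>The identity is obtained by discrete integration by parts: difference quotients are moved
  from the test function to the radial function by translation invariance.\<close>

lemma radial_has_weak_gradient:
  assumes d: "\<And>r. r > 0 \<Longrightarrow> (S has_real_derivative k r) (at r)" and kc: "continuous_on {0<..} k"
    and bd: "\<And>R. \<exists>C. \<forall>r\<in>{0<..R}. \<bar>k r\<bar> \<le> C"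
  shows "has_weak_gradient (radial_ext S) (\<lambda>x. (k (norm x) / norm x) *\<^sub>R x) UNIV"
proof -
  have Sc: "continuous_on {0<..} S" using d by (auto intro!: continuous_at_imp_continuous_on DERIV_isCont)
  \<comment> \<open>The bound on \<open>k\<close> makes \<open>S\<close> Lipschitz on bounded
    intervals. Since the norm is 1-Lipschitz, this dominates all difference quotients of the radial
    extension, including those whose segment passes close to the origin.\<close>
  have lip: "\<bar>S r - S r'\<bar> \<le> C * \<bar>r - r'\<bar>"
    if C: "\<forall>r\<in>{0<..R}. \<bar>k r\<bar> \<le> C" and r: "0 < r" "r \<le> R" "0 < r'" "r' \<le> R" for C R r r'
  proof -
    have aux: "\<bar>S r - S r'\<bar> \<le> C * \<bar>r - r'\<bar>" if r: "0 < r" "r < r'" "r' \<le> R" for r r'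
    proof -
      obtain t where t: "r < t" "t < r'" "S r' - S r = (r' - r) * k t"
        using MVT2[of r r' S k] d r by auto
      have "\<bar>S r' - S r\<bar> = (r' - r) * \<bar>k t\<bar>" using t r by (simp add: abs_mult)
      also have "\<dots> \<le> (r' - r) * C" using C t r by (intro mult_left_mono) auto
      finally show ?thesis using r by (simp add: abs_minus_commute mult.commute)
    qed
    show ?thesis
      using aux[of r r'] aux[of r' r] r by (cases r r' rule: linorder_cases) (auto simp: abs_minus_commute)
  qed
  have Sm: "S \<in> borel_measurable ray" and km: "(\<lambda>r. k r / r) \<in> borel_measurable ray"
    by (intro continuous_measurable_ray Sc continuous_intros kc; simp)+
  let ?u = "radial_ext S" and ?g = "\<lambda>x::real^3. (k (norm x) / norm x) *\<^sub>R x"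
  have um[measurable]: "?u \<in> borel_measurable borel" using radial_measurable[OF Sm] by (simp add: radial_ext_def[abs_def])
  have gm[measurable]: "?g \<in> borel_measurable borel" using radial_measurable[OF km] by measurable
  have ul: "locally_integrable UNIV ?u"
  proof (rule locally_integrable_UNIV_bounded[OF um])
    fix R :: real
    define R' where "R' = \<bar>R\<bar> + 1"
    obtain C where C: "\<forall>r\<in>{0<..R'}. \<bar>k r\<bar> \<le> C" using bd by blast
    have "R' \<in> {0<..R'}" by (simp add: R'_def)
    then have "\<bar>k R'\<bar> \<le> C" using C by blast
    then have "C \<ge> 0" by linarith
    have "norm (?u x) \<le> \<bar>S 0\<bar> + \<bar>S R'\<bar> + C * R'" if x: "x \<in> cball 0 R" for x
    proof (cases "x = 0")
      case True
      then show ?thesis using \<open>C \<ge> 0\<close> by (simp add: radial_ext_def R'_def)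
    next
      case False
      have "\<bar>S (norm x) - S R'\<bar> \<le> C * \<bar>norm x - R'\<bar>"
        by (rule lip[OF C]) (use x False in \<open>auto simp: R'_def\<close>)
      also have "\<dots> \<le> C * R'" using x \<open>C \<ge> 0\<close> by (intro mult_left_mono) (auto simp: R'_def)
      finally show ?thesis by (simp add: radial_ext_def)
    qed
    then show "\<exists>C. \<forall>x\<in>cball 0 R. norm (?u x) \<le> C" by blast
  qed
  have gl: "locally_integrable UNIV ?g"
  proof (rule locally_integrable_UNIV_bounded[OF gm])
    fix R :: real
    obtain C where C: "\<forall>r\<in>{0<..R}. \<bar>k r\<bar> \<le> C" using bd by blast
    have "norm (?g x) \<le> \<bar>C\<bar>" if "x \<in> cball 0 R" for x
      using C[rule_format, of "norm x"] that by (cases "x = 0") auto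
    then show "\<exists>C. \<forall>x\<in>cball 0 R. norm (?g x) \<le> C" by blast
  qed
  have "(\<integral>x. ?u x * frechet_derivative \<phi> (at x) b \<partial>lborel) = - (\<integral>x. (?g x \<bullet> b) * \<phi> x \<partial>lborel)"
    if \<phi>: "test_function UNIV \<phi>" and b: "b \<in> Basis" for \<phi> b
  proof -
    obtain R where R: "R > 0" "\<And>x. norm x \<ge> R \<Longrightarrow> \<phi> x = 0" "\<And>x b. norm x \<ge> R \<Longrightarrow> frechet_derivative \<phi> (at x) b = 0"
      and \<phi>d: "\<And>x. (\<phi> has_derivative frechet_derivative \<phi> (at x)) (at x)"
      and c1: "\<And>b. b \<in> Basis \<Longrightarrow> continuous_on UNIV (\<lambda>x. frechet_derivative \<phi> (at x) b)" and c: "continuous_on UNIV \<phi>"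
      by (rule test_function_UNIV[OF \<phi>]) blast
    let ?D = "\<lambda>x. frechet_derivative \<phi> (at x) b"
    have [measurable]: "\<phi> \<in> borel_measurable borel" "?D \<in> borel_measurable borel"
      using borel_measurable_continuous_onI[OF c] borel_measurable_continuous_onI[OF c1[OF b]] by auto
    have nb: "norm b = 1" using b by simp
    define h where "h n = inverse (real (Suc n))" for n
    have h: "h \<longlonglongrightarrow> 0" "\<And>n. h n \<noteq> 0" "\<And>n. h n > 0" "\<And>n. h n \<le> 1"
      using LIMSEQ_inverse_real_of_nat by (auto simp: h_def[abs_def] inverse_le_1_iff simp del: of_nat_Suc)
    have "continuous_on (cball 0 R) ?D" using c1[OF b] by (rule continuous_on_subset) auto
    then have "bounded (?D ` cball 0 R)" by (intro compact_imp_bounded compact_continuous_image) auto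
    then obtain C1 where C1: "\<And>x. x \<in> cball 0 R \<Longrightarrow> \<bar>?D x\<bar> \<le> C1" unfolding bounded_iff by (metis image_eqI real_norm_def)
    have C1': "\<bar>?D x\<bar> \<le> \<bar>C1\<bar>" for x using C1[of x] R(3)[of x b] by (cases "norm x \<le> R") auto
    have quot: "\<bar>(\<phi> (x + s *\<^sub>R b) - \<phi> x) / s\<bar> \<le> \<bar>C1\<bar>" if s: "s > 0" for x s
    proof -
      have dl: "((\<lambda>t. \<phi> (x + t *\<^sub>R b)) has_real_derivative ?D (x + t *\<^sub>R b)) (at t)" for t
      proof -
        have l: "((\<lambda>t. x + t *\<^sub>R b) has_derivative (\<lambda>t. t *\<^sub>R b)) (at t)" by (auto intro!: derivative_eq_intros)
        have "((\<lambda>t. \<phi> (x + t *\<^sub>R b)) has_derivative (\<lambda>s. frechet_derivative \<phi> (at (x + t *\<^sub>R b)) (s *\<^sub>R b))) (at t)"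
          by (rule has_derivative_compose[OF l \<phi>d])
        then show ?thesis
          by (simp add: has_field_derivative_def linear_cmul[OF has_derivative_linear[OF \<phi>d]] mult_commute_abs)
      qed
      obtain t where "\<phi> (x + s *\<^sub>R b) - \<phi> (x + 0 *\<^sub>R b) = (s - 0) * ?D (x + t *\<^sub>R b)"
        using MVT2[OF s dl] by blast
      then show ?thesis using C1'[of "x + t *\<^sub>R b"] s by simp
    qed
    \<comment> \<open>Shifts have length at most 1, so the shifted supports stay within the ball of
      radius R + 1.\<close>
    have iK: "integrable lborel (\<lambda>x. indicator (cball 0 (R + 1)) x * ?u x)"
      using ul compact_cball[of 0 "R + 1"] unfolding locally_integrable_def set_integrable_def by simp
    have L: "(\<lambda>n. \<integral>x. ?u x * ((\<phi> (x + h n *\<^sub>R b) - \<phi> x) / h n) \<partial>lborel) \<longlonglongrightarrow> (\<integral>x. ?u x * ?D x \<partial>lborel)"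
    proof (rule integral_dominated_convergence[where w="\<lambda>x. \<bar>C1\<bar> * \<bar>indicator (cball 0 (R + 1)) x * ?u x\<bar>"])
      show "AE x in lborel. (\<lambda>n. ?u x * ((\<phi> (x + h n *\<^sub>R b) - \<phi> x) / h n)) \<longlonglongrightarrow> ?u x * ?D x"
        by (intro AE_I2 tendsto_mult tendsto_const difference_quotient_tendsto[OF \<phi>d h(1,2)])
      show "AE x in lborel. norm (?u x * ((\<phi> (x + h n *\<^sub>R b) - \<phi> x) / h n)) \<le> \<bar>C1\<bar> * \<bar>indicator (cball 0 (R + 1)) x * ?u x\<bar>" for n
      proof (rule AE_I2)
        fix x
        show "norm (?u x * ((\<phi> (x + h n *\<^sub>R b) - \<phi> x) / h n)) \<le> \<bar>C1\<bar> * \<bar>indicator (cball 0 (R + 1)) x * ?u x\<bar>"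
        proof (cases "norm x \<le> R + 1")
          case True
          have "\<bar>?u x\<bar> * \<bar>(\<phi> (x + h n *\<^sub>R b) - \<phi> x) / h n\<bar> \<le> \<bar>?u x\<bar> * \<bar>C1\<bar>"
            by (rule mult_left_mono[OF quot[OF h(3)]]) simp
          then show ?thesis using True by (simp add: abs_mult mult.commute)
        next
          case False
          have "norm x \<le> norm (x + h n *\<^sub>R b) + norm (h n *\<^sub>R b)" by (metis add_diff_cancel_right' norm_triangle_ineq4)
          then have "norm (x + h n *\<^sub>R b) \<ge> R" using False h(3)[of n] h(4)[of n] nb by simp
          then show ?thesis using R(2)[of x] R(2)[of "x + h n *\<^sub>R b"] False by simp
        qed
      qed
    qed (use iK in auto)
    obtain C where C: "\<forall>r\<in>{0<..R + 1}. \<bar>k r\<bar> \<le> C" using bd by blast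
    have i\<phi>: "integrable lborel \<phi>"
    proof -
      have "locally_integrable UNIV (\<lambda>x::real^3. 1::real)" by (rule locally_integrable_UNIV_bounded) auto
      from locally_integrable_UNIV_mult[OF this c compact_cball[of 0 R]] show ?thesis using R(2) by simp
    qed
    have M: "(\<lambda>n. \<integral>x. ((?u (x + (- h n) *\<^sub>R b) - ?u x) / (- h n)) * \<phi> x \<partial>lborel) \<longlonglongrightarrow> (\<integral>x. (?g x \<bullet> b) * \<phi> x \<partial>lborel)"
    proof (rule integral_dominated_convergence[where w="\<lambda>x. C * \<bar>\<phi> x\<bar>"])
      show "AE x in lborel. (\<lambda>n. ((?u (x + (- h n) *\<^sub>R b) - ?u x) / (- h n)) * \<phi> x) \<longlonglongrightarrow> (?g x \<bullet> b) * \<phi> x"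
        using AE_norm_pos
      proof eventually_elim
        case (elim x)
        then have x: "x \<noteq> 0" by auto
        have "(S has_derivative (\<lambda>t. t * k (norm x))) (at (norm x))"
          using d[OF elim] by (simp add: has_field_derivative_def mult_commute_abs)
        from has_derivative_compose[OF has_derivative_norm[OF x] this]
        have "(?u has_derivative (\<lambda>y. (y \<bullet> sgn x) * k (norm x))) (at x)" by (simp add: radial_ext_def[abs_def])
        from difference_quotient_tendsto[OF this, of "\<lambda>n. - h n" b]
        have "(\<lambda>n. (?u (x + (- h n) *\<^sub>R b) - ?u x) / (- h n)) \<longlonglongrightarrow> (b \<bullet> sgn x) * k (norm x)"
          using h(1,2) tendsto_minus[OF h(1)] by simp
        moreover have "(b \<bullet> sgn x) * k (norm x) = ?g x \<bullet> b" by (simp add: sgn_div_norm inner_commute divide_inverse)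
        ultimately show ?case by (intro tendsto_mult tendsto_const) simp
      qed
      show "AE x in lborel. norm (((?u (x + (- h n) *\<^sub>R b) - ?u x) / (- h n)) * \<phi> x) \<le> C * \<bar>\<phi> x\<bar>" for n
        \<comment> \<open>Both \<open>x\<close> and its translate must avoid the origin, where the
          value of \<open>S\<close> is arbitrary.\<close>
        using AE_norm_pos AE_lborel_singleton[of "h n *\<^sub>R b"]
      proof eventually_elim
        case (elim x)
        show ?case
        proof (cases "norm x \<le> R")
          case True
          let ?y = "x + (- h n) *\<^sub>R b"
          have y: "norm ?y > 0" using elim(2) by simp
          have "norm ?y \<le> norm x + norm (h n *\<^sub>R b)" using norm_triangle_ineq4[of x "h n *\<^sub>R b"] by simp
          then have yR: "norm ?y \<le> R + 1" using True h(3)[of n] h(4)[of n] nb by simp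
          have "\<bar>norm ?y - norm x\<bar> \<le> norm (?y - x)" by (rule norm_triangle_ineq3)
          also have "\<dots> = h n" using nb h(3)[of n] by simp
          finally have diff: "\<bar>norm ?y - norm x\<bar> \<le> h n" .
          have C0: "C \<ge> 0" using C[rule_format, of "norm x"] elim(1) True by auto
          have "\<bar>?u ?y - ?u x\<bar> \<le> C * \<bar>norm ?y - norm x\<bar>"
            unfolding radial_ext_def by (rule lip[OF C]) (use elim(1) True y yR in auto)
          also have "\<dots> \<le> C * h n" by (rule mult_left_mono[OF diff C0])
          finally have "\<bar>?u ?y - ?u x\<bar> / h n \<le> C" using h(3)[of n] by (simp add: field_simps)
          then have "\<bar>(?u ?y - ?u x) / (- h n)\<bar> \<le> C" using h(3)[of n] by simp
          then have "\<bar>(?u ?y - ?u x) / (- h n)\<bar> * \<bar>\<phi> x\<bar> \<le> C * \<bar>\<phi> x\<bar>" by (rule mult_right_mono) simp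
          then show ?thesis by (simp only: real_norm_def abs_mult)
        next
          case False
          then show ?thesis using R(2)[of x] by simp
        qed
      qed
      show "(\<lambda>x. (?g x \<bullet> b) * \<phi> x) \<in> borel_measurable lborel" using gm by measurable
    qed (use i\<phi> in auto)
    have eq: "(\<integral>x. ?u x * ((\<phi> (x + h n *\<^sub>R b) - \<phi> x) / h n) \<partial>lborel)
        = - (\<integral>x. ((?u (x + (- h n) *\<^sub>R b) - ?u x) / (- h n)) * \<phi> x \<partial>lborel)" for n
    proof -
      have cs: "continuous_on UNIV (\<lambda>x. \<phi> (x + h n *\<^sub>R b))"
        by (rule continuous_on_compose2[OF c]) (auto intro!: continuous_intros)
      have j1: "integrable lborel (\<lambda>x. ?u x * \<phi> x)"
        by (rule locally_integrable_UNIV_mult[OF ul c compact_cball[of 0 R]]) (use R in auto)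
      have j2: "integrable lborel (\<lambda>x. ?u x * \<phi> (x + h n *\<^sub>R b))"
      proof (rule locally_integrable_UNIV_mult[OF ul cs compact_cball[of 0 "R + 1"]])
        fix x :: "real^3" assume "x \<notin> cball 0 (R + 1)"
        then have x: "norm x > R + 1" by simp
        have "norm x \<le> norm (x + h n *\<^sub>R b) + norm (h n *\<^sub>R b)" by (metis add_diff_cancel_right' norm_triangle_ineq4)
        then have "norm (x + h n *\<^sub>R b) \<ge> R" using x h(3)[of n] h(4)[of n] nb by simp
        then show "\<phi> (x + h n *\<^sub>R b) = 0" by (rule R(2))
      qed
      have Gm: "(\<lambda>x. ?u x * \<phi> (x + h n *\<^sub>R b)) \<in> borel_measurable borel" by measurable
      have tr: "(\<integral>x. ?u (x + (- h n) *\<^sub>R b) * \<phi> x \<partial>lborel) = (\<integral>x. ?u x * \<phi> (x + h n *\<^sub>R b) \<partial>lborel)"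
        and j3: "integrable lborel (\<lambda>x. ?u (x + (- h n) *\<^sub>R b) * \<phi> x)"
        using integral_translation[OF Gm, of "(- h n) *\<^sub>R b"] j2 by (simp_all add: add.commute)
      have "(\<integral>x. ?u x * ((\<phi> (x + h n *\<^sub>R b) - \<phi> x) / h n) \<partial>lborel)
         = (\<integral>x. 1 / h n * (?u x * \<phi> (x + h n *\<^sub>R b) - ?u x * \<phi> x) \<partial>lborel)"
        by (rule Bochner_Integration.integral_cong) (auto simp: right_diff_distrib diff_divide_distrib)
      also have "\<dots> = 1 / h n * ((\<integral>x. ?u x * \<phi> (x + h n *\<^sub>R b) \<partial>lborel) - (\<integral>x. ?u x * \<phi> x \<partial>lborel))"
        using j1 j2 by (subst integral_mult_right_zero) (simp add: Bochner_Integration.integral_diff)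
      also have "\<dots> = 1 / h n * (\<integral>x. ?u (x + (- h n) *\<^sub>R b) * \<phi> x - ?u x * \<phi> x \<partial>lborel)"
        unfolding tr[symmetric] using j1 j3 by (subst Bochner_Integration.integral_diff) auto
      also have "\<dots> = (\<integral>x. 1 / h n * (?u (x + (- h n) *\<^sub>R b) * \<phi> x - ?u x * \<phi> x) \<partial>lborel)"
        by (rule integral_mult_right_zero[symmetric])
      also have "\<dots> = (\<integral>x. - (((?u (x + (- h n) *\<^sub>R b) - ?u x) / (- h n)) * \<phi> x) \<partial>lborel)"
        using h(2)[of n] by (intro Bochner_Integration.integral_cong) (auto simp: field_simps)
      also have "\<dots> = - (\<integral>x. ((?u (x + (- h n) *\<^sub>R b) - ?u x) / (- h n)) * \<phi> x \<partial>lborel)"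
        by (rule Bochner_Integration.integral_minus)
      finally show ?thesis .
    qed
    show ?thesis using LIMSEQ_unique[OF L[unfolded eq] tendsto_minus[OF M]] .
  qed
  then show ?thesis unfolding has_weak_gradient_UNIV_iff using ul gl by blast
qed

section \<open>Radial Sobolev functions\<close>

lemma has_ac_derivative_eqI:
  assumes F: "has_ac_derivative F f" and FG: "\<And>x. x > 0 \<Longrightarrow> F x = G x" and fg: "\<And>x. x > 0 \<Longrightarrow> f x = g x"
  shows "has_ac_derivative G g"
proof (rule has_ac_derivative_cong[OF F FG])
  show "AE x in ray. f x = g x" by (rule AE_I2) (simp add: fg)
  show "g \<in> borel_measurable ray"
    using has_ac_derivative_measurable[OF F] fg by (subst measurable_cong[where g=f]) auto
qed

lemma has_ac_derivative_power: "has_ac_derivative (\<lambda>r. r ^ n) (\<lambda>r. real n * r ^ (n - 1))"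
  by (rule has_ac_derivative_C1) (auto intro!: derivative_eq_intros continuous_intros)

lemma has_ac_derivative_inverse: "has_ac_derivative (\<lambda>r. 1 / r) (\<lambda>r. - (1 / r\<^sup>2))"
  by (rule has_ac_derivative_C1)
     (auto intro!: derivative_eq_intros continuous_intros simp: power2_eq_square)

lemma has_ac_derivative_const_unique:
  assumes "has_ac_derivative F (\<lambda>x. 0)" "x > 0"
  shows "F x = F 1"
proof (cases "x \<le> 1")
  case True
  show ?thesis using has_ac_derivativeD(2)[OF assms(1) assms(2) True] by simp
next
  case False
  then have "1 \<le> x" by simp
  then show ?thesis using has_ac_derivativeD(2)[OF assms(1) zero_less_one, of x] by simp
qed

lemma has_ac_derivative_mono:
  assumes F: "has_ac_derivative F f" and f: "\<And>x. x > 0 \<Longrightarrow> f x \<ge> 0" and ab: "0 < a" "a \<le> b"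
  shows "F a \<le> F b"
proof -
  have "0 \<le> (\<integral>x. indicator {a..b} x * f x \<partial>ray)"
    by (rule integral_nonneg_AE) (use f in \<open>auto intro!: AE_I2\<close>)
  then show ?thesis using has_ac_derivativeD(2)[OF F ab] by simp
qed

text \<open>The auxiliary function \<open>h\<close> supplies sequences tending to the two ends along which \<open>r h(r)\<close>
  is small.\<close>

lemma vanishes_at_ends_of_bound:
  assumes h: "integrable ray h" "\<And>r. r > 0 \<Longrightarrow> h r \<ge> 0" and C: "C \<ge> 0"
    and F0: "\<And>r. 0 < r \<Longrightarrow> r < 1 \<Longrightarrow> \<bar>F r\<bar> \<le> C * (r + r * h r + sqrt (r + r * h r))"
    and F1: "\<And>r. r > 1 \<Longrightarrow> \<bar>F r\<bar> \<le> C * (1/r + r * h r + sqrt (1/r + r * h r))"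
  shows "vanishes_at_ends F"
  unfolding vanishes_at_ends_def
proof (intro conjI allI impI)
  have small: "\<exists>d>0. d \<le> e \<and> d < 1 \<and> (\<forall>t. 0 \<le> t \<longrightarrow> t < 2 * d \<longrightarrow> C * (t + sqrt t) < e)" if e: "e > 0" for e :: real
  proof -
    have "((\<lambda>d. C * (2 * d + sqrt (2 * d))) \<longlongrightarrow> C * (2 * 0 + sqrt (2 * 0))) (at_right 0)"
      by (intro tendsto_intros)
    then have "\<forall>\<^sub>F d in at_right 0. C * (2 * d + sqrt (2 * d)) < e" using e by (auto dest: order_tendstoD(2))
    moreover have "\<forall>\<^sub>F d in at_right 0. 0 < d \<and> d < min 1 e" using e by (auto simp: eventually_at_right_field intro!: exI[of _ "min 1 e"])
    ultimately have "\<forall>\<^sub>F d in at_right 0. 0 < d \<and> d < min 1 e \<and> C * (2 * d + sqrt (2 * d)) < e" by eventually_elim auto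
    then obtain d where d: "0 < d" "d < min 1 e" "C * (2 * d + sqrt (2 * d)) < e" using eventually_happens by force
    have "C * (t + sqrt t) < e" if "0 \<le> t" "t < 2 * d" for t
    proof -
      have "C * (t + sqrt t) \<le> C * (2 * d + sqrt (2 * d))" using that C by (intro mult_left_mono add_mono) auto
      then show ?thesis using d(3) by linarith
    qed
    then show ?thesis using d by (intro exI[of _ d]) auto
  qed
  fix e :: real assume e: "e > 0"
  then obtain d where d: "d > 0" "d \<le> e" "d < 1" "\<And>t. 0 \<le> t \<Longrightarrow> t < 2 * d \<Longrightarrow> C * (t + sqrt t) < e" using small by blast
  obtain a where a: "0 < a" "a < d" "a * h a < d" using integrable_ray_small_values(1)[OF h d(1)] by blast
  have "C * (a + a * h a + sqrt (a + a * h a)) < e" using a h(2)[of a] by (intro d(4)) auto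
  then show "\<exists>a. 0 < a \<and> a < e \<and> \<bar>F a\<bar> < e" using F0[of a] a d by (intro exI[of _ a]) auto
  obtain b where b: "b > 1/d" "b * h b < d" using integrable_ray_small_values(2)[OF h d(1)] by blast
  have "1/e \<le> 1/d" "1 < 1/d" using d e by (auto simp: field_simps)
  then have b1: "b > 1" "b > 1/e" using b by linarith+
  have "1/b < d" using b(1) d(1) b1(1) by (simp add: field_simps)
  then have "C * (1/b + b * h b + sqrt (1/b + b * h b)) < e" using b h(2)[of b] b1 by (intro d(4)) auto
  then show "\<exists>b>1/e. \<bar>F b\<bar> < e" using F1[of b] b1 by (intro exI[of _ b]) auto
qed

section \<open>Tails and cumulative integrals\<close>

lemma integrable_inverse_square_tail: "integrable ray (\<lambda>s. indicator {1..} s * (1 / s\<^sup>2))"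
proof -
  have "(\<integral>\<^sup>+s. ennreal (1 / s\<^sup>2) * indicator {1..} s \<partial>lborel) = ennreal (0 - (- (1 / (1::real))))"
  proof (rule nn_integral_FTC_atLeast[where F="\<lambda>s. - (1 / s)"])
    have "((\<lambda>s::real. - inverse s) \<longlongrightarrow> - 0) at_top" by (intro tendsto_minus tendsto_inverse_0_at_top filterlim_ident)
    then show "((\<lambda>s::real. - (1 / s)) \<longlongrightarrow> 0) at_top" by (simp add: inverse_eq_divide)
  qed (auto intro!: derivative_eq_intros simp: power2_eq_square)
  moreover have "(\<integral>\<^sup>+s. ennreal (indicator {1..} s * (1 / (s::real)\<^sup>2)) \<partial>lborel) = (\<integral>\<^sup>+s. ennreal (1 / s\<^sup>2) * indicator {1..} s \<partial>lborel)"
    by (rule nn_integral_cong) (simp add: indicator_def)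
  ultimately have "integrable lborel (\<lambda>s::real. indicator {1..} s * (1 / s\<^sup>2))"
    by (intro integrableI_nonneg) auto
  then have "integrable lborel (\<lambda>s::real. indicator {0<..} s *\<^sub>R (indicator {1..} s * (1 / s\<^sup>2)))"
    by (rule Bochner_Integration.integrable_bound) (auto simp: indicator_def)
  then show ?thesis unfolding integrable_ray set_integrable_def .
qed

lemma
  shows integrable_ray_initial: "integrable ray (indicator {..r} :: real \<Rightarrow> real)"
    and integral_ray_initial: "r \<ge> 0 \<Longrightarrow> integral\<^sup>L ray (indicator {..r} :: real \<Rightarrow> real) = r"
proof -
  have e: "indicator {0<..} x *\<^sub>R indicator {..r} x = (indicator {0<..r} x :: real)" for x by (auto simp: indicator_def)
  show "integrable ray (indicator {..r} :: real \<Rightarrow> real)"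
    unfolding integrable_ray set_integrable_def e by (cases "r \<ge> 0") auto
  show "integral\<^sup>L ray (indicator {..r} :: real \<Rightarrow> real) = r" if "r \<ge> 0"
    unfolding integral_ray set_lebesgue_integral_def e using that by simp
qed

text \<open>On \<open>ray\<close> the indicator of \<open>{..r}\<close> selects the radii between 0
  and \<open>r\<close>, so this is the primitive started at the origin.\<close>

definition cumulative :: "(real \<Rightarrow> real) \<Rightarrow> real \<Rightarrow> real" where
  "cumulative h r = (\<integral>s. indicator {..r} s * h s \<partial>ray)"

lemma integrable_cumulative:
  fixes h :: "real \<Rightarrow> real"
  assumes "integrable ray h"
  shows "integrable ray (\<lambda>s. indicator {..r} s * h s)"
  using assms by (rule Bochner_Integration.integrable_bound)
    (use assms in \<open>auto simp: indicator_def intro!: borel_measurable_times borel_measurable_ray AE_I2\<close>)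

lemma has_ac_derivative_cumulative:
  assumes h: "integrable ray h"
  shows "has_ac_derivative (cumulative h) h"
  unfolding has_ac_derivative_def
proof (intro allI impI)
  fix a b :: real assume ab: "0 < a" "a \<le> b"
  have i: "integrable ray (\<lambda>s. indicator {a..b} s * h s)"
    using h by (rule Bochner_Integration.integrable_bound)
      (use h in \<open>auto simp: indicator_def intro!: borel_measurable_times borel_measurable_ray AE_I2\<close>)
  have "cumulative h b = (\<integral>s. indicator {..a} s * h s + indicator {a..b} s * h s \<partial>ray)"
    unfolding cumulative_def
  proof (rule integral_cong_AE)
    have "AE s in ray. s \<noteq> a" unfolding AE_ray using AE_lborel_singleton[of a] by eventually_elim auto
    then show "AE s in ray. indicator {..b} s * h s = indicator {..a} s * h s + indicator {a..b} s * h s"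
      by eventually_elim (use ab in \<open>auto simp: indicator_def\<close>)
  qed (use i integrable_cumulative[OF h] in \<open>auto intro!: borel_measurable_add\<close>)
  also have "\<dots> = cumulative h a + (\<integral>s. indicator {a..b} s * h s \<partial>ray)"
    unfolding cumulative_def using i integrable_cumulative[OF h] by simp
  finally show "integrable ray (\<lambda>x. indicator {a..b} x * h x) \<and> (\<integral>x. indicator {a..b} x * h x \<partial>ray) = cumulative h b - cumulative h a"
    using i by simp
qed

lemma cumulative_nonneg: "(\<And>s. s > 0 \<Longrightarrow> h s \<ge> 0) \<Longrightarrow> cumulative h r \<ge> 0"
  unfolding cumulative_def by (rule integral_nonneg_AE) (auto intro!: AE_I2)

lemma cumulative_le:
  assumes "integrable ray h" "\<And>s. s > 0 \<Longrightarrow> h s \<ge> 0"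
  shows "cumulative h r \<le> integral\<^sup>L ray h"
  unfolding cumulative_def
  by (rule integral_mono[OF integrable_cumulative assms(1)]) (use assms in \<open>auto simp: indicator_def\<close>)

text \<open>On the initial interval h s \<le> C s \<le> C r; the factor 1/2 that exact integration
  would give is discarded.\<close>

lemma cumulative_le_square:
  assumes h: "integrable ray h" and C: "C \<ge> 0" "\<And>s. s > 0 \<Longrightarrow> h s \<le> C * s" and r: "r > 0"
  shows "cumulative h r \<le> C * r\<^sup>2"
proof -
  have "cumulative h r \<le> (\<integral>s. (C * r) * indicator {..r} s \<partial>ray)"
    unfolding cumulative_def
  proof (rule integral_mono[OF integrable_cumulative[OF h]])
    show "integrable ray (\<lambda>s. (C * r) * indicator {..r} s)" by (intro integrable_mult_right integrable_ray_initial)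
    fix s assume "s \<in> space ray"
    then have s: "s > 0" by simp
    show "indicator {..r} s * h s \<le> (C * r) * indicator {..r} s"
    proof (cases "s \<le> r")
      case True
      have "h s \<le> C * s" by (rule C(2)[OF s])
      also have "\<dots> \<le> C * r" using True C by (intro mult_left_mono) auto
      finally show ?thesis using True by simp
    qed simp
  qed
  also have "\<dots> = C * r * r" using integral_ray_initial[of r] r by simp
  finally show ?thesis by (simp add: power2_eq_square)
qed

lemma cumulative_at_top:
  assumes h: "integrable ray h"
  shows "(cumulative h \<longlongrightarrow> integral\<^sup>L ray h) at_top"
  unfolding cumulative_def
proof (rule integral_dominated_convergence_at_top[where w="\<lambda>s. \<bar>h s\<bar>"])
  show "AE s in ray. ((\<lambda>r. indicator {..r} s * h s) \<longlongrightarrow> h s) at_top"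
  proof (rule AE_I2)
    fix s
    have "\<forall>\<^sub>F r in at_top. indicator {..r} s * h s = h s"
      using eventually_ge_at_top[of s] by eventually_elim simp
    then show "((\<lambda>r. indicator {..r} s * h s) \<longlongrightarrow> h s) at_top" by (rule tendsto_eventually)
  qed
  show "\<forall>\<^sub>F r in at_top. AE s in ray. norm (indicator {..r} s * h s) \<le> \<bar>h s\<bar>"
    by (rule always_eventually) (auto simp: indicator_def intro!: AE_I2)
  show "\<And>r. (\<lambda>s. indicator {..r} s * h s) \<in> borel_measurable ray" using integrable_cumulative[OF h] by auto
qed (use h in auto)

section \<open>Pointwise decay of radial functions\<close>

lemma ac_increment:
  assumes S: "has_ac_derivative S k" and k2: "integrable ray (\<lambda>r. (k r)\<^sup>2 * r\<^sup>2)" and ab: "0 < a" "a \<le> b"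
  shows "\<bar>S b - S a\<bar> \<le> sqrt (\<integral>r. (k r)\<^sup>2 * r\<^sup>2 \<partial>ray) * sqrt (1/a - 1/b)"
proof -
  note [measurable] = has_ac_derivative_measurable[OF S]
  let ?f = "\<lambda>r. k r * r" and ?g = "\<lambda>r. indicator {a..b} r * (1 / r)"
  have sq: "(?g r)\<^sup>2 = - (indicator {a..b} r * (- (1 / r\<^sup>2)))" for r by (simp add: indicator_def power_divide)
  have g2: "integrable ray (\<lambda>r. (?g r)\<^sup>2)" "(\<integral>r. (?g r)\<^sup>2 \<partial>ray) = 1/a - 1/b"
    unfolding sq using has_ac_derivativeD[OF has_ac_derivative_inverse ab] by simp_all
  have f2: "(?f r)\<^sup>2 = (k r)\<^sup>2 * r\<^sup>2" for r by (simp add: power_mult_distrib)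
  have "(\<integral>r. ?f r * ?g r \<partial>ray) = (\<integral>r. indicator {a..b} r * k r \<partial>ray)"
    by (rule Bochner_Integration.integral_cong) auto
  then have "S b - S a = (\<integral>r. ?f r * ?g r \<partial>ray)" using has_ac_derivativeD(2)[OF S ab] by simp
  then have "\<bar>S b - S a\<bar> = \<bar>\<integral>r. ?f r * ?g r \<partial>ray\<bar>" by simp
  also have "\<dots> \<le> sqrt (\<integral>r. (?f r)\<^sup>2 \<partial>ray) * sqrt (\<integral>r. (?g r)\<^sup>2 \<partial>ray)"
    by (rule Cauchy_Schwarz_integral) (use k2 g2(1) in \<open>simp_all add: f2\<close>)
  finally show ?thesis unfolding f2 g2(2) .
qed

text \<open>The increment from \<open>x\<close> to a distant point is at most the square root of A /
  x, by Cauchy-Schwarz for S' r and 1/r; at suitable distant points \<open>S\<close> itself is as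
  small as desired.\<close>

lemma radial_decay:
  assumes S: "has_ac_derivative S k" and k2: "integrable ray (\<lambda>r. (k r)\<^sup>2 * r\<^sup>2)"
    and fr: "\<And>e. e > 0 \<Longrightarrow> \<exists>b>1/e. \<bar>S b\<bar> < e" and x: "x > 0"
  shows "\<bar>S x\<bar> \<le> sqrt (\<integral>r. (k r)\<^sup>2 * r\<^sup>2 \<partial>ray) / sqrt x" "(S x)\<^sup>2 * x \<le> (\<integral>r. (k r)\<^sup>2 * r\<^sup>2 \<partial>ray)"
proof -
  let ?A = "\<integral>r. (k r)\<^sup>2 * r\<^sup>2 \<partial>ray"
  have A: "?A \<ge> 0" by simp
  have "\<bar>S x\<bar> \<le> sqrt ?A * sqrt (1/x) + e" if e: "e > 0" for e
  proof -
    \<comment> \<open>The second entry ensures that a point beyond 1/d lies to the right of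
      \<open>x\<close>.\<close>
    define d where "d = min e (1 / x)"
    have d: "d > 0" "d \<le> e" "d \<le> 1/x" using e x by (auto simp: d_def)
    obtain b where b: "b > 1/d" "\<bar>S b\<bar> < d" using fr[OF d(1)] by blast
    have "x \<le> 1/d" using d x by (simp add: field_simps)
    then have xb: "x \<le> b" using b by linarith
    have "\<bar>S b - S x\<bar> \<le> sqrt ?A * sqrt (1/x - 1/b)" by (rule ac_increment[OF S k2 x xb])
    also have "\<dots> \<le> sqrt ?A * sqrt (1/x)" using A x xb by (intro mult_left_mono real_sqrt_le_mono) auto
    finally show ?thesis using b(2) d(2) by linarith
  qed
  then have le: "\<bar>S x\<bar> \<le> sqrt ?A * sqrt (1/x)" by (rule field_le_epsilon)
  then show "\<bar>S x\<bar> \<le> sqrt ?A / sqrt x" by (simp add: real_sqrt_divide)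
  have "\<bar>S x\<bar>\<^sup>2 \<le> (sqrt ?A * sqrt (1/x))\<^sup>2" using le by (rule power_mono) simp
  also have "\<dots> = ?A / x" using A x by (simp add: power_mult_distrib real_sqrt_divide power_divide)
  finally show "(S x)\<^sup>2 * x \<le> ?A" using x by (simp add: field_simps)
qed

text \<open>Integrability makes r (S r)^p r^2 small at some distant radii, and for r > 1 this bounds
  (S r)^p itself. The exponent is 2 for the space \<open>H1r\<close> and 6 for
  \<open>D1r\<close>.\<close>

lemma frequently_small:
  assumes i: "integrable ray (\<lambda>r. (S r) ^ p * r\<^sup>2)" and p: "even p" "p > 0" and e: "e > 0"
  shows "\<exists>b>1/e. \<bar>S b\<bar> < e"
proof -
  define d where "d = min (min 1 e) (e ^ p)"
  have d: "d > 0" "d \<le> 1" "d \<le> e" "d \<le> e ^ p" using e by (auto simp: d_def)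
  obtain b where b: "b > 1/d" "b * ((S b) ^ p * b\<^sup>2) < d"
    using integrable_ray_small_values(2)[OF i _ d(1)] p(1) by (auto simp: zero_le_even_power)
  have "1/d \<ge> 1" "1/e \<le> 1/d" using d e by (auto simp: field_simps)
  then have b1: "b > 1" "b > 1/e" using b(1) by linarith+
  have "\<bar>S b\<bar> ^ p * 1 \<le> \<bar>S b\<bar> ^ p * b ^ 3" using b1 by (intro mult_left_mono one_le_power) auto
  also have "\<dots> = b * ((S b) ^ p * b\<^sup>2)" using p(1) by (simp add: power_even_abs power3_eq_cube power2_eq_square)
  finally have "\<bar>S b\<bar> ^ p < e ^ p" using b(2) d(4) by linarith
  then have "\<bar>S b\<bar> < e" using e by (rule power_less_imp_less_base[OF _ less_imp_le])
  then show ?thesis using b1 by blast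
qed

lemma radial_decay_tendsto:
  assumes S: "has_ac_derivative S k" and k2: "integrable ray (\<lambda>r. (k r)\<^sup>2 * r\<^sup>2)"
    and fr: "\<And>e. e > 0 \<Longrightarrow> \<exists>b>1/e. \<bar>S b\<bar> < e"
  shows "(S \<longlongrightarrow> 0) at_top"
proof (rule Lim_null_comparison)
  let ?A = "\<integral>r. (k r)\<^sup>2 * r\<^sup>2 \<partial>ray"
  show "\<forall>\<^sub>F x in at_top. norm (S x) \<le> sqrt ?A * inverse (sqrt x)"
    using eventually_gt_at_top[of 0] by eventually_elim (use radial_decay(1)[OF S k2 fr] in \<open>simp add: divide_inverse\<close>)
  have "((\<lambda>x. inverse (sqrt x)) \<longlongrightarrow> 0) at_top" by (rule tendsto_inverse_0_at_top[OF sqrt_at_top])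
  then have "((\<lambda>x. sqrt ?A * inverse (sqrt x)) \<longlongrightarrow> sqrt ?A * 0) at_top" by (intro tendsto_intros)
  then show "((\<lambda>x. sqrt ?A * inverse (sqrt x)) \<longlongrightarrow> 0) at_top" by simp
qed

text \<open>The derivative is carried along as a second component, and the function is a continuous
  representative, so that pointwise bounds make sense.\<close>

definition radial_H1 :: "(real \<Rightarrow> real) \<Rightarrow> (real \<Rightarrow> real) \<Rightarrow> bool" where
  "radial_H1 S k \<longleftrightarrow> has_ac_derivative S k \<and> integrable ray (\<lambda>r. (k r)\<^sup>2 * r\<^sup>2) \<and> integrable ray (\<lambda>r. (S r)\<^sup>2 * r\<^sup>2)"

text \<open>Decay at infinity takes the place of sixth-power integrability: it follows from
  membership in \<open>D1r\<close> and is the property that fixes the additive constant of a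
  potential.\<close>

definition radial_D1 :: "(real \<Rightarrow> real) \<Rightarrow> (real \<Rightarrow> real) \<Rightarrow> bool" where
  "radial_D1 Z l \<longleftrightarrow> has_ac_derivative Z l \<and> integrable ray (\<lambda>r. (l r)\<^sup>2 * r\<^sup>2) \<and> (Z \<longlongrightarrow> 0) at_top"

text \<open>The squared norm in three-dimensional \<open>L\<^sup>2\<close>, up to the factor 4
  \<pi>; it is applied to functions and to their derivatives.\<close>

definition sq_norm :: "(real \<Rightarrow> real) \<Rightarrow> real" where
  "sq_norm S = (\<integral>r. (S r)\<^sup>2 * r\<^sup>2 \<partial>ray)"

definition cumulated_mass :: "(real \<Rightarrow> real) \<Rightarrow> real \<Rightarrow> real" where
  "cumulated_mass S = cumulative (\<lambda>r. (S r)\<^sup>2 * r\<^sup>2)"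

lemma sq_norm_nonneg [simp]: "0 \<le> sq_norm S"
  unfolding sq_norm_def by simp

lemma radial_D1_decay:
  assumes "radial_D1 Z l" "r > 0"
  shows "\<bar>Z r\<bar> \<le> sqrt (sq_norm l) / sqrt r"
proof -
  have "\<exists>b>1/e. \<bar>Z b\<bar> < e" if e: "e > 0" for e
  proof -
    have "\<forall>\<^sub>F b in at_top. \<bar>Z b\<bar> < e" using assms(1) tendstoD[of Z 0 at_top e] e by (auto simp: radial_D1_def dist_real_def)
    then have "\<forall>\<^sub>F b in at_top. b > 1/e \<and> \<bar>Z b\<bar> < e" using eventually_gt_at_top[of "1/e"] by eventually_elim auto
    then show ?thesis using eventually_happens by force
  qed
  then show ?thesis using radial_decay(1)[of Z l r] assms by (auto simp: radial_D1_def sq_norm_def)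
qed

locale radial_H1_function =
  fixes S k
  assumes H1: "radial_H1 S k"
begin

lemma ac: "has_ac_derivative S k" and k2: "integrable ray (\<lambda>r. (k r)\<^sup>2 * r\<^sup>2)" and S2: "integrable ray (\<lambda>r. (S r)\<^sup>2 * r\<^sup>2)"
  using H1 by (auto simp: radial_H1_def)

lemma S_measurable [measurable]: "S \<in> borel_measurable ray" and k_measurable [measurable]: "k \<in> borel_measurable ray"
  using has_ac_derivative_measurable[OF ac] has_ac_derivative_measurable'[OF ac] by auto

lemma decay: "r > 0 \<Longrightarrow> \<bar>S r\<bar> \<le> sqrt (sq_norm k) / sqrt r"
  and decay_square: "r > 0 \<Longrightarrow> (S r)\<^sup>2 * r \<le> sq_norm k"
  and tendsto_0: "(S \<longlongrightarrow> 0) at_top"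
  using radial_decay[OF ac k2 frequently_small[OF S2]] radial_decay_tendsto[OF ac k2 frequently_small[OF S2]]
  by (auto simp: sq_norm_def)

lemma square_weight_le: "r > 0 \<Longrightarrow> (S r)\<^sup>2 * r\<^sup>2 \<le> sq_norm k * r"
  using mult_right_mono[OF decay_square, of r r] by (simp add: power2_eq_square mult.assoc)

abbreviation "m \<equiv> cumulated_mass S"

lemma m_ac: "has_ac_derivative m (\<lambda>r. (S r)\<^sup>2 * r\<^sup>2)"
  unfolding cumulated_mass_def by (rule has_ac_derivative_cumulative[OF S2])

lemma m_measurable [measurable]: "m \<in> borel_measurable ray"
  by (rule has_ac_derivative_measurable'[OF m_ac])

lemma m_nonneg [simp]: "m r \<ge> 0" and m_le: "m r \<le> sq_norm S"
  and m_le_square: "r > 0 \<Longrightarrow> m r \<le> sq_norm k * r\<^sup>2"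
  and m_at_top: "(m \<longlongrightarrow> sq_norm S) at_top"
  unfolding cumulated_mass_def sq_norm_def
  using cumulative_nonneg cumulative_le[OF S2] cumulative_at_top[OF S2]
    cumulative_le_square[OF S2 sq_norm_nonneg square_weight_le] by (auto simp: sq_norm_def)

text \<open>Up to radius 1 the decay estimate bounds S^2 r; beyond 1 the weight r is at most
  r^2.\<close>

lemma integrable_first_moment: "integrable ray (\<lambda>r. (S r)\<^sup>2 * r)"
proof (rule Bochner_Integration.integrable_bound[where f="\<lambda>r. sq_norm k * indicator {..1} r + (S r)\<^sup>2 * r\<^sup>2"])
  show "AE r in ray. norm ((S r)\<^sup>2 * r) \<le> norm (sq_norm k * indicator {..1} r + (S r)\<^sup>2 * r\<^sup>2)"
  proof (rule AE_I2)
    fix r assume "r \<in> space ray"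
    then have r: "r > 0" by simp
    show "norm ((S r)\<^sup>2 * r) \<le> norm (sq_norm k * indicator {..1} r + (S r)\<^sup>2 * r\<^sup>2)"
    proof (cases "r \<le> 1")
      case True
      have "0 \<le> (S r)\<^sup>2 * r\<^sup>2" by simp
      then have "(S r)\<^sup>2 * r \<le> sq_norm k + (S r)\<^sup>2 * r\<^sup>2" using decay_square[OF r] by linarith
      then show ?thesis using True r by simp
    next
      case False
      then have "(S r)\<^sup>2 * r \<le> (S r)\<^sup>2 * r\<^sup>2" by (intro mult_left_mono) (auto simp: power2_eq_square)
      then show ?thesis using False r by simp
    qed
  qed
qed (use S2 integrable_ray_initial in auto)

text \<open>The Newtonian field of the density S^2: bounded near the origin because \<open>m\<close>
  is at most a multiple of r^2, and of order 1/r^2 at a distance because \<open>m\<close> is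
  bounded.\<close>

lemma field_integrable: "integrable ray (\<lambda>r. m r / r\<^sup>2)"
proof (rule Bochner_Integration.integrable_bound[where f="\<lambda>r. sq_norm k * indicator {..1} r + sq_norm S * (indicator {1..} r * (1 / r\<^sup>2))"])
  show "AE r in ray. norm (m r / r\<^sup>2) \<le> norm (sq_norm k * indicator {..1} r + sq_norm S * (indicator {1..} r * (1 / r\<^sup>2)))"
  proof (rule AE_I2)
    fix r assume "r \<in> space ray"
    then have r: "r > 0" by simp
    show "norm (m r / r\<^sup>2) \<le> norm (sq_norm k * indicator {..1} r + sq_norm S * (indicator {1..} r * (1 / r\<^sup>2)))"
    proof (cases "r \<le> 1")
      case True
      have 1: "m r / r\<^sup>2 \<le> sq_norm k" using m_le_square[OF r] r by (simp add: field_simps)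
      have 2: "0 \<le> sq_norm S * (indicator {1..} r * (1 / r\<^sup>2))" by simp
      have "indicator {..1} r = (1 :: real)" using True by simp
      then have "m r / r\<^sup>2 \<le> sq_norm k * indicator {..1} r + sq_norm S * (indicator {1..} r * (1 / r\<^sup>2))"
        using add_increasing2[OF 2 1] by (simp only: mult_1_right)
      moreover have "0 \<le> m r / r\<^sup>2" by simp
      ultimately show ?thesis unfolding real_norm_def by linarith
    next
      case False
      have "m r / r\<^sup>2 \<le> sq_norm S / r\<^sup>2" using m_le by (intro divide_right_mono) auto
      then show ?thesis using False by simp
    qed
  qed
qed (auto intro!: Bochner_Integration.integrable_add integrable_mult_right integrable_ray_initial integrable_inverse_square_tail
  simp del: times_divide_eq_right)

lemma self_energy_integrable: "integrable ray (\<lambda>r. (m r)\<^sup>2 / r\<^sup>2)"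
proof (rule Bochner_Integration.integrable_bound[where f="\<lambda>r. sq_norm S * (m r / r\<^sup>2)"])
  show "AE r in ray. norm ((m r)\<^sup>2 / r\<^sup>2) \<le> norm (sq_norm S * (m r / r\<^sup>2))"
  proof (rule AE_I2)
    fix r
    have "m r * (m r / r\<^sup>2) \<le> sq_norm S * (m r / r\<^sup>2)" by (rule mult_right_mono[OF m_le]) simp
    then show "norm ((m r)\<^sup>2 / r\<^sup>2) \<le> norm (sq_norm S * (m r / r\<^sup>2))" by (simp add: power2_eq_square)
  qed
qed (auto intro!: integrable_mult_right field_integrable simp del: times_divide_eq_right)

lemma interaction_integrable:
  assumes "radial_D1 Z l"
  shows "integrable ray (\<lambda>r. (S r)\<^sup>2 * Z r * r\<^sup>2)"
proof -
  have Zac: "has_ac_derivative Z l" using assms by (simp add: radial_D1_def)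
  note [measurable] = has_ac_derivative_measurable'[OF Zac]
  let ?d = "sqrt (sq_norm l)"
  show ?thesis
  proof (rule Bochner_Integration.integrable_bound[where f="\<lambda>r. ?d * ((S r)\<^sup>2 * r) + ?d * ((S r)\<^sup>2 * r\<^sup>2)"])
    show "AE r in ray. norm ((S r)\<^sup>2 * Z r * r\<^sup>2) \<le> norm (?d * ((S r)\<^sup>2 * r) + ?d * ((S r)\<^sup>2 * r\<^sup>2))"
    proof (rule AE_I2)
      fix r assume "r \<in> space ray"
      then have r: "r > 0" by simp
      have "\<bar>Z r\<bar> * r \<le> ?d * (1 + r)"
      proof -
        have "\<bar>Z r\<bar> * r \<le> ?d / sqrt r * r" using radial_D1_decay[OF assms r] r by (intro mult_right_mono) auto
        also have "\<dots> = ?d * (r / sqrt r)" by simp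
        also have "r / sqrt r = sqrt r" using r by (simp add: real_div_sqrt)
        also have "sqrt r \<le> 1 + r"
        proof -
          have "sqrt r \<le> sqrt ((1 + r)\<^sup>2)" using r by (intro real_sqrt_le_mono) (simp add: power2_sum)
          then show ?thesis using r by simp
        qed
        finally show ?thesis by (simp add: mult_left_mono)
      qed
      then have "(S r)\<^sup>2 * r * (\<bar>Z r\<bar> * r) \<le> (S r)\<^sup>2 * r * (?d * (1 + r))" using r by (intro mult_left_mono) auto
      then show "norm ((S r)\<^sup>2 * Z r * r\<^sup>2) \<le> norm (?d * ((S r)\<^sup>2 * r) + ?d * ((S r)\<^sup>2 * r\<^sup>2))"
        using r by (simp add: abs_mult power2_eq_square algebra_simps)
    qed
  qed (use S2 integrable_first_moment in auto)
qed

text \<open>Partial integration, with S^2 r^2 as the derivative of \<open>m\<close>. The boundary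
  term is of order r^(3/2) at the origin and r^(-1/2) at infinity.\<close>

lemma interaction_eq:
  assumes Z: "radial_D1 Z l"
  shows "integrable ray (\<lambda>r. m r * l r)" "(\<integral>r. (S r)\<^sup>2 * Z r * r\<^sup>2 \<partial>ray) = - (\<integral>r. m r * l r \<partial>ray)"
proof -
  have Zac: "has_ac_derivative Z l" and l2: "integrable ray (\<lambda>r. (l r)\<^sup>2 * r\<^sup>2)" using Z by (simp_all add: radial_D1_def)
  note [measurable] = has_ac_derivative_measurable'[OF Zac] has_ac_derivative_measurable[OF Zac]
  have "integrable ray (\<lambda>r. (m r / r) * (l r * r))"
    by (rule integrable_mult_L2) (use self_energy_integrable l2 in \<open>auto simp: power_divide power_mult_distrib\<close>)
  then show i: "integrable ray (\<lambda>r. m r * l r)"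
    by (subst Bochner_Integration.integrable_cong[where g="\<lambda>r. (m r / r) * (l r * r)"]) auto
  have "integral\<^sup>L ray (\<lambda>r. (S r)\<^sup>2 * r\<^sup>2 * Z r + m r * l r) = 0"
  proof (rule integral_ac_derivative_eq_0[OF has_ac_derivative_mult[OF m_ac Zac]])
    show "integrable ray (\<lambda>r. (S r)\<^sup>2 * r\<^sup>2 * Z r + m r * l r)"
      using interaction_integrable[OF Z] i by (intro Bochner_Integration.integrable_add) (simp_all add: mult_ac)
    let ?d = "sqrt (sq_norm l)"
    show "vanishes_at_ends (\<lambda>r. m r * Z r)"
    \<comment> \<open>The pointwise bounds on \<open>m\<close> and \<open>Z\<close> control both
      ends, so the auxiliary integrable function is zero.\<close>
    proof (rule vanishes_at_ends_of_bound[where h="\<lambda>r. 0" and C="(sq_norm k + sq_norm S) * ?d"])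
      fix r :: real
      { assume r: "0 < r" "r < 1"
        have "\<bar>m r * Z r\<bar> \<le> (sq_norm k * r\<^sup>2) * (?d / sqrt r)"
          unfolding abs_mult using m_le_square[OF r(1)] radial_D1_decay[OF Z r(1)] by (intro mult_mono) auto
        also have "\<dots> = sq_norm k * ?d * (r * (r / sqrt r))" by (simp add: power2_eq_square)
        also have "\<dots> = sq_norm k * ?d * (r * sqrt r)" using real_div_sqrt[of r] r by (simp only: less_imp_le)
        also have "\<dots> \<le> (sq_norm k + sq_norm S) * ?d * (1 * sqrt r)" using r by (intro mult_mono) auto
        also have "\<dots> \<le> (sq_norm k + sq_norm S) * ?d * (r + r * 0 + sqrt (r + r * 0))" using r by (intro mult_left_mono) auto
        finally show "\<bar>m r * Z r\<bar> \<le> (sq_norm k + sq_norm S) * ?d * (r + r * 0 + sqrt (r + r * 0))" . }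
      { assume r: "1 < r"
        have "\<bar>m r * Z r\<bar> \<le> sq_norm S * (?d / sqrt r)"
          unfolding abs_mult using m_le[of r] radial_D1_decay[OF Z, of r] r by (intro mult_mono) auto
        also have "\<dots> = sq_norm S * ?d * sqrt (1/r)" using r by (simp add: real_sqrt_divide)
        also have "\<dots> \<le> (sq_norm k + sq_norm S) * ?d * (1/r + r * 0 + sqrt (1/r + r * 0))" using r by (intro mult_mono) auto
        finally show "\<bar>m r * Z r\<bar> \<le> (sq_norm k + sq_norm S) * ?d * (1/r + r * 0 + sqrt (1/r + r * 0))" . }
    qed auto
  qed
  moreover have "integral\<^sup>L ray (\<lambda>r. (S r)\<^sup>2 * r\<^sup>2 * Z r + m r * l r)
      = (\<integral>r. (S r)\<^sup>2 * Z r * r\<^sup>2 \<partial>ray) + (\<integral>r. m r * l r \<partial>ray)"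
    using interaction_integrable[OF Z] i by (subst Bochner_Integration.integral_add) (simp_all add: mult_ac)
  ultimately show "(\<integral>r. (S r)\<^sup>2 * Z r * r\<^sup>2 \<partial>ray) = - (\<integral>r. m r * l r \<partial>ray)" by linarith
qed

lemma sq_norm_pos:
  assumes "r > 0" "S r \<noteq> 0"
  shows "sq_norm S > 0"
proof -
  have "sq_norm S \<noteq> 0"
  proof
    assume "sq_norm S = 0"
    then have "AE r in ray. (S r)\<^sup>2 * r\<^sup>2 = 0"
      unfolding sq_norm_def using S2 by (subst (asm) integral_nonneg_eq_0_iff_AE) auto
    then have "AE r in ray. S r = (\<lambda>r. 0) r" unfolding AE_ray by eventually_elim auto
    then have "S r = 0" using has_ac_derivative_continuous[OF ac] assms(1) by (intro AE_ray_eq_continuous[where F=S and G="\<lambda>r. 0"]) auto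
    then show False using assms by simp
  qed
  then show ?thesis by (simp add: less_le)
qed

end

section \<open>The Pohozaev identity and the mass bound\<close>

text \<open>Machin's formula, with arctan(1/5) replaced by 1/5 and the subtracted arctangent
  dropped.\<close>

lemma pi_le_16_5: "pi \<le> 16/5"
proof -
  have "pi / 4 = 4 * arctan (1/5) - arctan (1/239)" by (rule machin)
  moreover have "arctan (1/5) \<le> 1/5" by (rule arctan_le_self) simp
  moreover have "arctan (1/239) \<ge> 0" by simp
  ultimately show ?thesis by linarith
qed

text \<open>With k = S' and l = Z', the last two assumptions are the radial equations S'' + 2/r S' =
  S (1 + Z) and Z'' + 2/r Z' = \<mu> S^2 in integrated form; in particular \<open>k\<close> and
  \<open>l\<close> are continuous.\<close>

locale radial_solution = radial_H1_function S k for S k +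
  fixes Z l \<mu>
  assumes Z: "radial_D1 Z l" and \<mu>: "\<mu> > 0"
    and k_ac: "has_ac_derivative k (\<lambda>r. S r * (1 + Z r) - 2 / r * k r)"
    and l_ac: "has_ac_derivative l (\<lambda>r. \<mu> * (S r)\<^sup>2 - 2 / r * l r)"
begin

lemma Z_ac: "has_ac_derivative Z l" and l2: "integrable ray (\<lambda>r. (l r)\<^sup>2 * r\<^sup>2)" and Z_tendsto: "(Z \<longlongrightarrow> 0) at_top"
  using Z by (auto simp: radial_D1_def)

lemma l_measurable [measurable]: "l \<in> borel_measurable ray"
  by (rule has_ac_derivative_measurable[OF Z_ac])

text \<open>Gauss's law; the constant of integration vanishes because \<open>c\<^sup>2/r\<^sup>2\<close> is not integrable
  at the origin.\<close>

lemma l_eq: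
  assumes r: "r > 0"
  shows "l r = \<mu> * m r / r\<^sup>2"
proof -
  define F where "F r = r\<^sup>2 * l r + (- \<mu>) * m r" for r
  have "has_ac_derivative F (\<lambda>r. (real 2 * r ^ (2 - 1)) * l r + r\<^sup>2 * (\<mu> * (S r)\<^sup>2 - 2 / r * l r) + (- \<mu>) * ((S r)\<^sup>2 * r\<^sup>2))"
    unfolding F_def[abs_def]
    by (intro has_ac_derivative_add has_ac_derivative_mult[OF has_ac_derivative_power l_ac] has_ac_derivative_cmult m_ac)
  then have "has_ac_derivative F (\<lambda>r. 0)"
    by (rule has_ac_derivative_eqI) (auto simp: field_simps power2_eq_square)
  from has_ac_derivative_const_unique[OF this] have F: "F r = F 1" if "r > 0" for r using that .
  define c where "c = F 1"
  have lc: "r\<^sup>2 * l r = c + \<mu> * m r" if "r > 0" for r using F[OF that] by (simp add: F_def c_def)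
  have "\<bar>c\<bar> \<le> 0 + e" if e: "e > 0" for e
  proof -
    \<comment> \<open>At the point \<open>a\<close> found below, |c + \<mu> m| is at most d and m is
      at most d times \<open>sq_norm k\<close>; \<open>D\<close> collects the two factors, and
      \<open>d\<close> is chosen so that d D \<le> e.\<close>
    define D where "D = 1 + \<mu> * sq_norm k"
    have D: "D \<ge> 1" using \<mu> by (simp add: D_def)
    define d where "d = min 1 (e / D)"
    have d: "d > 0" "d \<le> 1" "d * D \<le> e" using e D by (auto simp: d_def field_simps min_def)
    obtain a where a: "0 < a" "a < d" "a * ((l a)\<^sup>2 * a\<^sup>2) < d"
      using integrable_ray_small_values(1)[OF l2 _ d(1)] by auto
    have "(c + \<mu> * m a)\<^sup>2 = a * (a * ((l a)\<^sup>2 * a\<^sup>2))" unfolding lc[OF a(1), symmetric] by (simp add: power2_eq_square)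
    also have "\<dots> \<le> d * d" using a by (intro mult_mono) auto
    finally have "\<bar>c + \<mu> * m a\<bar> \<le> d" using d(1) by (simp add: power2_eq_square[symmetric] power2_le_iff_abs_le)
    moreover have "\<mu> * m a \<le> \<mu> * (sq_norm k * d)"
    proof -
      have "m a \<le> sq_norm k * a\<^sup>2" by (rule m_le_square[OF a(1)])
      also have "\<dots> \<le> sq_norm k * d"
      proof (rule mult_left_mono)
        have "a\<^sup>2 \<le> a * 1" unfolding power2_eq_square using a d by (intro mult_left_mono) auto
        then show "a\<^sup>2 \<le> d" using a by simp
      qed simp
      finally show ?thesis using \<mu> by simp
    qed
    moreover have "0 \<le> \<mu> * m a" using \<mu> by simp
    ultimately have "\<bar>c\<bar> \<le> d + \<mu> * (sq_norm k * d)" by linarith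
    also have "\<dots> = d * D" by (simp add: D_def algebra_simps)
    finally show ?thesis using d(3) by simp
  qed
  then have "c = 0" using field_le_epsilon[of "\<bar>c\<bar>" 0] by simp
  then show ?thesis using lc[OF r] r by (simp add: field_simps)
qed

text \<open>By Gauss's law \<open>Z\<close> is nondecreasing, and its limit at infinity is
  0.\<close>

lemma Z_nonpos: assumes r: "r > 0" shows "Z r \<le> 0"
proof (rule tendsto_lowerbound[OF Z_tendsto])
  have "Z r \<le> Z b" if "r \<le> b" for b
    by (rule has_ac_derivative_mono[OF Z_ac _ r that]) (use l_eq \<mu> in simp)
  then show "\<forall>\<^sub>F b in at_top. Z r \<le> Z b" using eventually_ge_at_top[of r] by (rule eventually_mono[rotated])
qed simp

text \<open>With M the full mass, -Z - M/r is nondecreasing, as its derivative is (M - \<mu> m) /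
  r^2, and it tends to 0.\<close>

lemma Z_lower: assumes r: "r > 0" shows "Z r \<ge> - (\<mu> * sq_norm S / r)"
proof -
  let ?M = "\<mu> * sq_norm S"
  have ac': "has_ac_derivative (\<lambda>r. (-1) * Z r + (- ?M) * (1 / r)) (\<lambda>r. (-1) * l r + (- ?M) * (- (1 / r\<^sup>2)))"
    by (intro has_ac_derivative_add has_ac_derivative_cmult Z_ac has_ac_derivative_inverse)
  have nn: "(-1) * l x + (- ?M) * (- (1 / x\<^sup>2)) \<ge> 0" if "x > 0" for x
  proof -
    have "\<mu> * m x / x\<^sup>2 \<le> ?M / x\<^sup>2" using m_le[of x] \<mu> by (intro divide_right_mono mult_left_mono) auto
    then show ?thesis by (simp add: l_eq[OF that])
  qed
  have lim: "((\<lambda>r. (-1) * Z r + (- ?M) * (1 / r)) \<longlongrightarrow> (-1) * 0 + (- ?M) * 0) at_top"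
    by (intro tendsto_intros Z_tendsto) (auto intro!: tendsto_divide_0 filterlim_at_top_imp_at_infinity filterlim_ident)
  have "(-1) * Z r + (- ?M) * (1 / r) \<le> (-1) * 0 + (- ?M) * 0"
  proof (rule tendsto_lowerbound[OF lim])
    show "\<forall>\<^sub>F b in at_top. (-1) * Z r + (- ?M) * (1 / r) \<le> (-1) * Z b + (- ?M) * (1 / b)"
      using eventually_ge_at_top[of r] by eventually_elim (use has_ac_derivative_mono[OF ac' nn] r in auto)
  qed simp
  then show ?thesis by simp
qed

abbreviation "C \<equiv> (\<integral>r. (S r)\<^sup>2 * (- Z r) * r\<^sup>2 \<partial>ray)"
abbreviation "K \<equiv> (\<integral>r. (m r)\<^sup>2 / r\<^sup>2 \<partial>ray)"

lemma C_integrable: "integrable ray (\<lambda>r. (S r)\<^sup>2 * (- Z r) * r\<^sup>2)"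
  using interaction_integrable[OF Z] by simp

lemma C_eq_K: "C = \<mu> * K"
proof -
  have "C = (\<integral>r. m r * l r \<partial>ray)" using interaction_eq(2)[OF Z] by simp
  also have "\<dots> = (\<integral>r. \<mu> * ((m r)\<^sup>2 / r\<^sup>2) \<partial>ray)"
    by (rule Bochner_Integration.integral_cong) (auto simp: l_eq power2_eq_square)
  also have "\<dots> = \<mu> * K" by (rule integral_mult_right_zero)
  finally show ?thesis .
qed

text \<open>The equation for \<open>S\<close> tested with \<open>S\<close> itself: the derivative of
  r^2 S S' is integrated.\<close>

lemma energy_identity: "sq_norm k + sq_norm S = C"
proof -
  \<comment> \<open>No pointwise bound on S' is used; r h(r) dominates r^3 S'^2 and is small along
    suitable radii at both ends.\<close>
  let ?h = "\<lambda>r. (S r)\<^sup>2 * r\<^sup>2 + (k r)\<^sup>2 * r\<^sup>2"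
  have h: "integrable ray ?h" using S2 k2 by simp
  have "has_ac_derivative (\<lambda>r. r\<^sup>2 * (S r * k r))
      (\<lambda>r. (real 2 * r ^ (2 - 1)) * (S r * k r) + r\<^sup>2 * (k r * k r + S r * (S r * (1 + Z r) - 2 / r * k r)))"
    by (intro has_ac_derivative_mult has_ac_derivative_power ac k_ac)
  then have F: "has_ac_derivative (\<lambda>r. r\<^sup>2 * (S r * k r)) (\<lambda>r. (k r)\<^sup>2 * r\<^sup>2 + (S r)\<^sup>2 * r\<^sup>2 - (S r)\<^sup>2 * (- Z r) * r\<^sup>2)"
    by (rule has_ac_derivative_eqI) (auto simp: field_simps power2_eq_square)
  have "integral\<^sup>L ray (\<lambda>r. (k r)\<^sup>2 * r\<^sup>2 + (S r)\<^sup>2 * r\<^sup>2 - (S r)\<^sup>2 * (- Z r) * r\<^sup>2) = 0"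
  proof (rule integral_ac_derivative_eq_0[OF F])
    show "integrable ray (\<lambda>r. (k r)\<^sup>2 * r\<^sup>2 + (S r)\<^sup>2 * r\<^sup>2 - (S r)\<^sup>2 * (- Z r) * r\<^sup>2)"
      using S2 k2 C_integrable by simp
    let ?D = "1 + sqrt (sq_norm k)"
    show "vanishes_at_ends (\<lambda>r. r\<^sup>2 * (S r * k r))"
    proof (rule vanishes_at_ends_of_bound[OF h, where C="?D"])
      fix r :: real
      { assume r: "0 < r" "r < 1"
        have "\<bar>r\<^sup>2 * (S r * k r)\<bar> = sqrt ((r\<^sup>2 * (S r * k r))\<^sup>2)" by simp
        also have "(r\<^sup>2 * (S r * k r))\<^sup>2 = ((S r)\<^sup>2 * r) * (r * ((k r)\<^sup>2 * r\<^sup>2))" by (simp add: power2_eq_square)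
        also have "sqrt \<dots> \<le> sqrt (sq_norm k * (r + r * ?h r))"
        proof (intro real_sqrt_le_mono mult_mono[OF decay_square[OF r(1)]])
          have "r * ((k r)\<^sup>2 * r\<^sup>2) \<le> r * ?h r" using r by (intro mult_left_mono) auto
          then show "r * ((k r)\<^sup>2 * r\<^sup>2) \<le> r + r * ?h r" using r by linarith
        qed (use r in auto)
        also have "\<dots> = sqrt (sq_norm k) * sqrt (r + r * ?h r)" by (rule real_sqrt_mult)
        also have "\<dots> \<le> ?D * (r + r * ?h r + sqrt (r + r * ?h r))" using r by (intro mult_mono) auto
        finally show "\<bar>r\<^sup>2 * (S r * k r)\<bar> \<le> ?D * (r + r * ?h r + sqrt (r + r * ?h r))" . }
      { assume r: "1 < r"
        have "2 * (\<bar>S r\<bar> * \<bar>k r\<bar>) \<le> (S r)\<^sup>2 + (k r)\<^sup>2" using sum_squares_bound[of "\<bar>S r\<bar>" "\<bar>k r\<bar>"] by simp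
        then have "\<bar>S r\<bar> * \<bar>k r\<bar> \<le> (S r)\<^sup>2 + (k r)\<^sup>2" using abs_ge_zero[of "S r * k r"] unfolding abs_mult by linarith
        then have "r\<^sup>2 * (\<bar>S r\<bar> * \<bar>k r\<bar>) \<le> r\<^sup>2 * ((S r)\<^sup>2 + (k r)\<^sup>2)" by (intro mult_left_mono) auto
        also have "\<dots> = 1 * ?h r" by (simp add: algebra_simps)
        also have "\<dots> \<le> r * ?h r" using r by (intro mult_right_mono) auto
        also have "\<dots> \<le> 1/r + r * ?h r + sqrt (1/r + r * ?h r)" using r by simp
        also have "\<dots> \<le> ?D * (1/r + r * ?h r + sqrt (1/r + r * ?h r))"
          using r mult_right_mono[of 1 ?D "1/r + r * ?h r + sqrt (1/r + r * ?h r)"] by simp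
        finally show "\<bar>r\<^sup>2 * (S r * k r)\<bar> \<le> ?D * (1/r + r * ?h r + sqrt (1/r + r * ?h r))" by (simp add: abs_mult) }
    qed auto
  qed
  then show ?thesis using S2 k2 C_integrable by (simp add: sq_norm_def)
qed

text \<open>The derivative of m^2 / r is integrated; its boundary values vanish since
  \<open>m\<close> is bounded and at most a multiple of r^2.\<close>

lemma K_eq: "2 * (\<integral>r. m r * ((S r)\<^sup>2 * r) \<partial>ray) = K" "integrable ray (\<lambda>r. m r * ((S r)\<^sup>2 * r))"
proof -
  show i: "integrable ray (\<lambda>r. m r * ((S r)\<^sup>2 * r))"
  proof (rule Bochner_Integration.integrable_bound[where f="\<lambda>r. sq_norm S * ((S r)\<^sup>2 * r)"])
    show "AE r in ray. norm (m r * ((S r)\<^sup>2 * r)) \<le> norm (sq_norm S * ((S r)\<^sup>2 * r))"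
      by (rule AE_I2) (auto simp: abs_mult intro!: mult_right_mono m_le)
  qed (use integrable_first_moment in auto)
  have "has_ac_derivative (\<lambda>r. m r * m r * (1 / r))
      (\<lambda>r. ((S r)\<^sup>2 * r\<^sup>2 * m r + m r * ((S r)\<^sup>2 * r\<^sup>2)) * (1 / r) + m r * m r * (- (1 / r\<^sup>2)))"
    by (intro has_ac_derivative_mult m_ac has_ac_derivative_inverse)
  then have F: "has_ac_derivative (\<lambda>r. m r * m r * (1 / r)) (\<lambda>r. 2 * (m r * ((S r)\<^sup>2 * r)) - (m r)\<^sup>2 / r\<^sup>2)"
    by (rule has_ac_derivative_eqI) (auto simp: field_simps power2_eq_square)
  have "integral\<^sup>L ray (\<lambda>r. 2 * (m r * ((S r)\<^sup>2 * r)) - (m r)\<^sup>2 / r\<^sup>2) = 0"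
  proof (rule integral_ac_derivative_eq_0[OF F])
    show "integrable ray (\<lambda>r. 2 * (m r * ((S r)\<^sup>2 * r)) - (m r)\<^sup>2 / r\<^sup>2)" using i self_energy_integrable by simp
    let ?D = "(sq_norm k)\<^sup>2 + (sq_norm S)\<^sup>2"
    show "vanishes_at_ends (\<lambda>r. m r * m r * (1 / r))"
    proof (rule vanishes_at_ends_of_bound[where h="\<lambda>r. 0" and C="?D"])
      fix r :: real
      { assume r: "0 < r" "r < 1"
        have "m r * m r * (1/r) \<le> (sq_norm k * r\<^sup>2) * (sq_norm k * r\<^sup>2) * (1/r)"
          using m_le_square[OF r(1)] r by (intro mult_right_mono mult_mono) auto
        also have "\<dots> = (sq_norm k)\<^sup>2 * r ^ 3" using r by (simp add: power2_eq_square power3_eq_cube)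
        also have "\<dots> \<le> ?D * r" using r power_decreasing[of 1 3 r] by (intro mult_mono) auto
        also have "\<dots> \<le> ?D * (r + r * 0 + sqrt (r + r * 0))" using r by (intro mult_left_mono) auto
        finally show "\<bar>m r * m r * (1 / r)\<bar> \<le> ?D * (r + r * 0 + sqrt (r + r * 0))" using r by simp }
      { assume r: "1 < r"
        have "m r * m r * (1/r) \<le> sq_norm S * sq_norm S * (1/r)"
          using m_le[of r] r by (intro mult_right_mono mult_mono) auto
        also have "\<dots> \<le> ?D * (1/r)" using r by (intro mult_right_mono) (auto simp: power2_eq_square)
        also have "\<dots> \<le> ?D * (1/r + r * 0 + sqrt (1/r + r * 0))" using r by (intro mult_left_mono) auto
        finally show "\<bar>m r * m r * (1 / r)\<bar> \<le> ?D * (1/r + r * 0 + sqrt (1/r + r * 0))" using r by simp }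
    qed auto
  qed
  then show "2 * (\<integral>r. m r * ((S r)\<^sup>2 * r) \<partial>ray) = K" using i self_energy_integrable by simp
qed

text \<open>The equation is tested with r S', the generator of dilations: the derivative of r^3
  (S'^2 - (1 + Z) S^2) is integrated. Gauss's law turns the term containing Z' into \<mu> m S^2 r,
  whose integral is half of C.\<close>

lemma Pohozaev_identity: "3 * C = sq_norm k + 3 * sq_norm S + C / 2"
proof -
  let ?h = "\<lambda>r. (S r)\<^sup>2 * r\<^sup>2 + (k r)\<^sup>2 * r\<^sup>2" and ?M = "\<mu> * sq_norm S"
  have M0: "?M \<ge> 0" using \<mu> by simp
  have h: "integrable ray ?h" using S2 k2 by simp
  have "has_ac_derivative (\<lambda>r. r ^ 3 * (k r * k r) + (-1) * (r ^ 3 * ((1 + Z r) * (S r * S r))))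
      (\<lambda>r. ((real 3 * r ^ (3 - 1)) * (k r * k r) + r ^ 3 * ((S r * (1 + Z r) - 2 / r * k r) * k r + k r * (S r * (1 + Z r) - 2 / r * k r)))
        + (-1) * ((real 3 * r ^ (3 - 1)) * ((1 + Z r) * (S r * S r)) + r ^ 3 * ((0 + l r) * (S r * S r) + (1 + Z r) * (k r * S r + S r * k r))))"
    by (intro has_ac_derivative_add has_ac_derivative_cmult has_ac_derivative_mult has_ac_derivative_power has_ac_derivative_const ac k_ac Z_ac)
  then have F: "has_ac_derivative (\<lambda>r. r ^ 3 * (k r * k r) + (-1) * (r ^ 3 * ((1 + Z r) * (S r * S r))))
     (\<lambda>r. 3 * ((S r)\<^sup>2 * (- Z r) * r\<^sup>2) - (k r)\<^sup>2 * r\<^sup>2 - 3 * ((S r)\<^sup>2 * r\<^sup>2) - \<mu> * (m r * ((S r)\<^sup>2 * r)))"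
  proof (rule has_ac_derivative_eqI)
    fix r :: real assume r: "r > 0"
    show "((real 3 * r ^ (3 - 1)) * (k r * k r) + r ^ 3 * ((S r * (1 + Z r) - 2 / r * k r) * k r + k r * (S r * (1 + Z r) - 2 / r * k r)))
        + (-1) * ((real 3 * r ^ (3 - 1)) * ((1 + Z r) * (S r * S r)) + r ^ 3 * ((0 + l r) * (S r * S r) + (1 + Z r) * (k r * S r + S r * k r)))
      = 3 * ((S r)\<^sup>2 * (- Z r) * r\<^sup>2) - (k r)\<^sup>2 * r\<^sup>2 - 3 * ((S r)\<^sup>2 * r\<^sup>2) - \<mu> * (m r * ((S r)\<^sup>2 * r))"
      unfolding l_eq[OF r] using r by (simp add: field_simps power2_eq_square power3_eq_cube)
  qed simp
  have "integral\<^sup>L ray (\<lambda>r. 3 * ((S r)\<^sup>2 * (- Z r) * r\<^sup>2) - (k r)\<^sup>2 * r\<^sup>2 - 3 * ((S r)\<^sup>2 * r\<^sup>2) - \<mu> * (m r * ((S r)\<^sup>2 * r))) = 0"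
  proof (rule integral_ac_derivative_eq_0[OF F])
    show "integrable ray (\<lambda>r. 3 * ((S r)\<^sup>2 * (- Z r) * r\<^sup>2) - (k r)\<^sup>2 * r\<^sup>2 - 3 * ((S r)\<^sup>2 * r\<^sup>2) - \<mu> * (m r * ((S r)\<^sup>2 * r)))"
      using S2 k2 C_integrable K_eq(2) by simp
    let ?D = "1 + ?M + sq_norm k * (1 + ?M)"
    have D0: "?D \<ge> 1" using M0 by simp
    \<comment> \<open>The bounds -M/r \<le> Z \<le> 0 give r |1 + Z| \<le> r + M.\<close>
    have bd: "\<bar>r ^ 3 * (k r * k r) + (-1) * (r ^ 3 * ((1 + Z r) * (S r * S r)))\<bar> \<le> r * ((k r)\<^sup>2 * r\<^sup>2) + (r + ?M) * ((S r)\<^sup>2 * r\<^sup>2)"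
      if r: "r > 0" for r
    proof -
      have "\<bar>1 + Z r\<bar> \<le> 1 + ?M / r" using Z_nonpos[OF r] Z_lower[OF r] by linarith
      then have "\<bar>1 + Z r\<bar> * r \<le> (1 + ?M / r) * r" using r by (intro mult_right_mono) auto
      also have "\<dots> = r + ?M" using r by (simp add: field_simps)
      finally have "(r * \<bar>1 + Z r\<bar>) * ((S r)\<^sup>2 * r\<^sup>2) \<le> (r + ?M) * ((S r)\<^sup>2 * r\<^sup>2)"
        by (intro mult_right_mono) (auto simp: mult.commute)
      then have "\<bar>r ^ 3 * ((1 + Z r) * (S r * S r))\<bar> \<le> (r + ?M) * ((S r)\<^sup>2 * r\<^sup>2)"
        using r by (simp add: abs_mult power2_eq_square power3_eq_cube mult_ac)
      moreover have "\<bar>r ^ 3 * (k r * k r)\<bar> = r * ((k r)\<^sup>2 * r\<^sup>2)"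
        using r by (simp add: abs_mult power2_eq_square power3_eq_cube mult_ac)
      ultimately show ?thesis by linarith
    qed
    show "vanishes_at_ends (\<lambda>r. r ^ 3 * (k r * k r) + (-1) * (r ^ 3 * ((1 + Z r) * (S r * S r))))"
    proof (rule vanishes_at_ends_of_bound[OF h, where C="?D"])
      fix r :: real
      let ?F = "r ^ 3 * (k r * k r) + (-1) * (r ^ 3 * ((1 + Z r) * (S r * S r)))"
      { assume r: "0 < r" "r < 1"
        have "(r + ?M) * ((S r)\<^sup>2 * r\<^sup>2) \<le> (1 + ?M) * (sq_norm k * r)"
          by (rule mult_mono[OF _ square_weight_le[OF r(1)]]) (use r M0 in auto)
        moreover have "r * ((k r)\<^sup>2 * r\<^sup>2) \<le> 1 * (r * ?h r)" using r by (simp add: distrib_left)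
        moreover have "1 * (r * ?h r) \<le> ?D * (r * ?h r)" using D0 r by (intro mult_right_mono) auto
        moreover have "(1 + ?M) * (sq_norm k * r) \<le> ?D * r"
        proof -
          have "(1 + ?M) * sq_norm k \<le> ?D" using M0 by (simp add: mult.commute)
          then have "(1 + ?M) * sq_norm k * r \<le> ?D * r" using r by (intro mult_right_mono) auto
          then show ?thesis by (simp only: mult.assoc)
        qed
        ultimately have "\<bar>?F\<bar> \<le> ?D * (r * ?h r) + ?D * r" using bd[OF r(1)] by linarith
        also have "\<dots> \<le> ?D * (r + r * ?h r + sqrt (r + r * ?h r))"
        proof -
          have "D * y + D * x \<le> D * (x + y + sqrt (x + y))" if "D \<ge> 1" "x \<ge> 0" "y \<ge> 0" for D x y :: real
            using that mult_nonneg_nonneg[of D "sqrt (x + y)"] by (simp add: distrib_left)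
          then show ?thesis using D0 r by simp
        qed
        finally show "\<bar>?F\<bar> \<le> ?D * (r + r * ?h r + sqrt (r + r * ?h r))" . }
      { assume r: "1 < r"
        have "(r + ?M) * ((S r)\<^sup>2 * r\<^sup>2) \<le> (r + ?M * r) * ((S r)\<^sup>2 * r\<^sup>2)"
          using r M0 mult_left_mono[of 1 r ?M] by (intro mult_right_mono add_left_mono) auto
        then have "(r + ?M) * ((S r)\<^sup>2 * r\<^sup>2) \<le> (1 + ?M) * (r * ((S r)\<^sup>2 * r\<^sup>2))" by (simp add: algebra_simps)
        moreover have "1 * (r * ((k r)\<^sup>2 * r\<^sup>2)) \<le> (1 + ?M) * (r * ((k r)\<^sup>2 * r\<^sup>2))" using M0 r by (intro mult_right_mono) auto
        ultimately have "\<bar>?F\<bar> \<le> (1 + ?M) * (r * ((S r)\<^sup>2 * r\<^sup>2)) + (1 + ?M) * (r * ((k r)\<^sup>2 * r\<^sup>2))"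
          using bd[of r] r by linarith
        also have "\<dots> = (1 + ?M) * (r * ?h r)" by (simp only: distrib_left)
        also have "\<dots> \<le> ?D * (r * ?h r)" using r M0 by (intro mult_right_mono) auto
        also have "\<dots> \<le> ?D * (1/r + r * ?h r + sqrt (1/r + r * ?h r))" using r D0 by (intro mult_left_mono) auto
        finally show "\<bar>?F\<bar> \<le> ?D * (1/r + r * ?h r + sqrt (1/r + r * ?h r))" . }
    qed (use D0 in auto)
  qed
  moreover have "integral\<^sup>L ray (\<lambda>r. 3 * ((S r)\<^sup>2 * (- Z r) * r\<^sup>2) - (k r)\<^sup>2 * r\<^sup>2 - 3 * ((S r)\<^sup>2 * r\<^sup>2) - \<mu> * (m r * ((S r)\<^sup>2 * r)))
     = 3 * C - sq_norm k - 3 * sq_norm S - \<mu> * (\<integral>r. m r * ((S r)\<^sup>2 * r) \<partial>ray)"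
    unfolding sq_norm_def using S2 k2 C_integrable K_eq(2)
    by (simp only: Bochner_Integration.integral_diff integrable_mult_right integral_mult_right_zero Bochner_Integration.integrable_diff)
  moreover have "\<mu> * (\<integral>r. m r * ((S r)\<^sup>2 * r) \<partial>ray) = C / 2" unfolding C_eq_K K_eq(1)[symmetric] by simp
  ultimately show ?thesis by linarith
qed

text \<open>Integrating the derivative of r^2 S^2 identifies the first moment with minus the
  integral of S S' r^2, to which Cauchy-Schwarz applies.\<close>

lemma first_moment_le: "(\<integral>r. (S r)\<^sup>2 * r \<partial>ray) \<le> sqrt (sq_norm S) * sqrt (sq_norm k)"
proof -
  let ?h = "\<lambda>r. (S r)\<^sup>2 * r\<^sup>2"
  have i: "integrable ray (\<lambda>r. (S r * r) * (k r * r))"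
    and cs: "\<bar>\<integral>r. (S r * r) * (k r * r) \<partial>ray\<bar> \<le> sqrt (sq_norm S) * sqrt (sq_norm k)"
    using integrable_mult_L2[of "\<lambda>r. S r * r" ray "\<lambda>r. k r * r"] Cauchy_Schwarz_integral[of "\<lambda>r. S r * r" ray "\<lambda>r. k r * r"] S2 k2
    by (auto simp: power_mult_distrib sq_norm_def)
  have "has_ac_derivative (\<lambda>r. r\<^sup>2 * (S r * S r)) (\<lambda>r. (real 2 * r ^ (2 - 1)) * (S r * S r) + r\<^sup>2 * (k r * S r + S r * k r))"
    by (intro has_ac_derivative_mult has_ac_derivative_power ac)
  then have F: "has_ac_derivative (\<lambda>r. r\<^sup>2 * (S r * S r)) (\<lambda>r. 2 * ((S r)\<^sup>2 * r) + 2 * ((S r * r) * (k r * r)))"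
    by (rule has_ac_derivative_eqI) (auto simp: field_simps power2_eq_square)
  have "integral\<^sup>L ray (\<lambda>r. 2 * ((S r)\<^sup>2 * r) + 2 * ((S r * r) * (k r * r))) = 0"
  proof (rule integral_ac_derivative_eq_0[OF F])
    show "integrable ray (\<lambda>r. 2 * ((S r)\<^sup>2 * r) + 2 * ((S r * r) * (k r * r)))" using i integrable_first_moment by simp
    let ?D = "1 + sq_norm k"
    show "vanishes_at_ends (\<lambda>r. r\<^sup>2 * (S r * S r))"
    proof (rule vanishes_at_ends_of_bound[OF S2, where C="?D"])
      fix r :: real
      { assume r: "0 < r" "r < 1"
        have "r\<^sup>2 * (S r * S r) \<le> sq_norm k * r" using square_weight_le[OF r(1)] by (simp add: power2_eq_square mult_ac)
        also have "\<dots> \<le> ?D * (r + r * ?h r + sqrt (r + r * ?h r))"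
          using r by (intro mult_mono) (auto intro!: add_nonneg_nonneg)
        finally show "\<bar>r\<^sup>2 * (S r * S r)\<bar> \<le> ?D * (r + r * ?h r + sqrt (r + r * ?h r))" by simp }
      { assume r: "1 < r"
        have "r\<^sup>2 * (S r * S r) = 1 * ?h r" by (simp add: power2_eq_square)
        also have "\<dots> \<le> r * ?h r" using r by (intro mult_right_mono) auto
        also have "\<dots> \<le> 1 * (1/r + r * ?h r + sqrt (1/r + r * ?h r))" using r by simp
        also have "\<dots> \<le> ?D * (1/r + r * ?h r + sqrt (1/r + r * ?h r))"
          using r by (intro mult_right_mono) (auto intro!: add_nonneg_nonneg)
        finally show "\<bar>r\<^sup>2 * (S r * S r)\<bar> \<le> ?D * (1/r + r * ?h r + sqrt (1/r + r * ?h r))" by simp }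
    qed auto
  qed
  then have "(\<integral>r. (S r)\<^sup>2 * r \<partial>ray) = - (\<integral>r. (S r * r) * (k r * r) \<partial>ray)" using i integrable_first_moment by simp
  then show ?thesis using cs by linarith
qed

lemma C_le: "C \<le> \<mu> * sq_norm S * (\<integral>r. (S r)\<^sup>2 * r \<partial>ray)"
proof -
  have "C \<le> (\<integral>r. \<mu> * sq_norm S * ((S r)\<^sup>2 * r) \<partial>ray)"
  proof (rule integral_mono[OF C_integrable])
    show "integrable ray (\<lambda>r. \<mu> * sq_norm S * ((S r)\<^sup>2 * r))" by (intro integrable_mult_right integrable_first_moment)
    fix r assume "r \<in> space ray"
    then have r: "r > 0" by simp
    have "(- Z r) * ((S r)\<^sup>2 * r\<^sup>2) \<le> (\<mu> * sq_norm S / r) * ((S r)\<^sup>2 * r\<^sup>2)"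
      using Z_lower[OF r] by (intro mult_right_mono) auto
    then show "(S r)\<^sup>2 * (- Z r) * r\<^sup>2 \<le> \<mu> * sq_norm S * ((S r)\<^sup>2 * r)"
      using r by (simp add: power2_eq_square mult_ac)
  qed
  then show ?thesis by simp
qed

lemma mass_bound:
  assumes "r > 0" "S r \<noteq> 0"
  shows "\<mu> * sq_norm S \<ge> 3/8 * pi * sqrt 3"
proof -
  have B: "sq_norm S > 0" by (rule sq_norm_pos[OF assms])
  have BA: "sq_norm S = 3 * sq_norm k" using energy_identity Pohozaev_identity by linarith
  then have A: "sq_norm k > 0" using B by simp
  have "4 * sq_norm k = C" using energy_identity BA by linarith
  also have "C \<le> \<mu> * sq_norm S * (sqrt (sq_norm S) * sqrt (sq_norm k))"
    by (rule order_trans[OF C_le mult_left_mono[OF first_moment_le]]) (use \<mu> B in simp)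
  also have "sqrt (sq_norm S) * sqrt (sq_norm k) = sqrt 3 * sq_norm k"
    using A by (simp add: BA real_sqrt_mult)
  finally have "4 \<le> \<mu> * sq_norm S * sqrt 3" using A by simp
  then have "4 * sqrt 3 \<le> \<mu> * sq_norm S * sqrt 3 * sqrt 3" by (intro mult_right_mono) auto
  also have "\<mu> * sq_norm S * sqrt 3 * sqrt 3 = 3 * (\<mu> * sq_norm S)" by simp
  finally have "4/3 * sqrt 3 \<le> \<mu> * sq_norm S" by simp
  \<comment> \<open>With \<pi> at most 16/5 the factor 3/8 \<pi> is at most 6/5, below 4/3.\<close>
  moreover have "3/8 * pi * sqrt 3 \<le> 4/3 * sqrt 3" using pi_le_16_5 by (intro mult_right_mono) auto
  ultimately show ?thesis by linarith
qed

end

section \<open>Maximising the self-energy\<close>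

text \<open>As m / r^2 is the Newtonian field of S^2, this is the Dirichlet integral of its
  potential, a gravitational self-energy up to a constant factor.\<close>

definition self_energy :: "(real \<Rightarrow> real) \<Rightarrow> real" where
  "self_energy S = (\<integral>r. (cumulated_mass S r)\<^sup>2 / r\<^sup>2 \<partial>ray)"

lemma self_energy_nonneg [simp]: "self_energy S \<ge> 0"
  unfolding self_energy_def by simp

lemma sq_norm_scale: "sq_norm (\<lambda>r. c * S r) = c\<^sup>2 * sq_norm S"
  unfolding sq_norm_def integral_mult_right_zero[symmetric]
  by (rule Bochner_Integration.integral_cong) (auto simp: power_mult_distrib)

lemma cumulated_mass_scale: "cumulated_mass (\<lambda>r. c * S r) = (\<lambda>r. c\<^sup>2 * cumulated_mass S r)"
  unfolding cumulated_mass_def cumulative_def integral_mult_right_zero[symmetric]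
  by (intro ext Bochner_Integration.integral_cong) (auto simp: power_mult_distrib)

lemma self_energy_scale: "self_energy (\<lambda>r. c * S r) = c ^ 4 * self_energy S"
  unfolding self_energy_def cumulated_mass_scale integral_mult_right_zero[symmetric]
  by (rule Bochner_Integration.integral_cong) (auto simp: power_mult_distrib power4_eq_xxxx power2_eq_square)

lemma radial_H1_scale: "radial_H1 S k \<Longrightarrow> radial_H1 (\<lambda>r. c * S r) (\<lambda>r. c * k r)"
  unfolding radial_H1_def by (auto intro: has_ac_derivative_cmult simp: power_mult_distrib mult.assoc)

lemma integrable_weighted_square_sum:
  assumes [measurable]: "f \<in> borel_measurable ray" "g \<in> borel_measurable ray"
    and f: "integrable ray (\<lambda>r. (f r)\<^sup>2 * r\<^sup>2)" and g: "integrable ray (\<lambda>r. (g r)\<^sup>2 * r\<^sup>2)"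
  shows "integrable ray (\<lambda>r. (a * f r + b * g r)\<^sup>2 * r\<^sup>2)"
proof (rule Bochner_Integration.integrable_bound[where f="\<lambda>r. 2 * a\<^sup>2 * ((f r)\<^sup>2 * r\<^sup>2) + 2 * b\<^sup>2 * ((g r)\<^sup>2 * r\<^sup>2)"])
  show "AE r in ray. norm ((a * f r + b * g r)\<^sup>2 * r\<^sup>2) \<le> norm (2 * a\<^sup>2 * ((f r)\<^sup>2 * r\<^sup>2) + 2 * b\<^sup>2 * ((g r)\<^sup>2 * r\<^sup>2))"
  proof (rule AE_I2)
    fix r
    have "(a * f r + b * g r)\<^sup>2 \<le> 2 * (a * f r)\<^sup>2 + 2 * (b * g r)\<^sup>2"
      using zero_le_power2[of "a * f r - b * g r"] by (simp add: power2_sum power2_diff)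
    then have "(a * f r + b * g r)\<^sup>2 * r\<^sup>2 \<le> (2 * (a * f r)\<^sup>2 + 2 * (b * g r)\<^sup>2) * r\<^sup>2" by (rule mult_right_mono) simp
    then show "norm ((a * f r + b * g r)\<^sup>2 * r\<^sup>2) \<le> norm (2 * a\<^sup>2 * ((f r)\<^sup>2 * r\<^sup>2) + 2 * b\<^sup>2 * ((g r)\<^sup>2 * r\<^sup>2))"
      by (simp add: algebra_simps power_mult_distrib)
  qed
qed (use f g in auto)

lemma radial_H1_combination:
  assumes "radial_H1 S k" "radial_H1 T t"
  shows "radial_H1 (\<lambda>r. a * S r + b * T r) (\<lambda>r. a * k r + b * t r)"
proof -
  interpret S: radial_H1_function S k using assms(1) by unfold_locales
  interpret T: radial_H1_function T t using assms(2) by unfold_locales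
  show ?thesis unfolding radial_H1_def
    by (intro conjI has_ac_derivative_add has_ac_derivative_cmult S.ac T.ac integrable_weighted_square_sum
      S.S_measurable S.k_measurable T.S_measurable T.k_measurable S.S2 S.k2 T.S2 T.k2)
qed

text \<open>Uniform convexity in quantitative form: if two functions have equal norm and their
  midpoint nearly the same norm, they are close.\<close>

lemma parallelogram_weighted:
  assumes [measurable]: "f \<in> borel_measurable ray" "g \<in> borel_measurable ray"
    and f: "integrable ray (\<lambda>r. (f r)\<^sup>2 * r\<^sup>2)" and g: "integrable ray (\<lambda>r. (g r)\<^sup>2 * r\<^sup>2)"
  shows "sq_norm (\<lambda>r. f r - g r) = 2 * sq_norm f + 2 * sq_norm g - 4 * sq_norm (\<lambda>r. 1/2 * f r + 1/2 * g r)"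
proof -
  have i: "integrable ray (\<lambda>r. (1/2 * f r + 1/2 * g r)\<^sup>2 * r\<^sup>2)" by (rule integrable_weighted_square_sum) (use f g in auto)
  have "sq_norm (\<lambda>r. f r - g r) = (\<integral>r. 2 * ((f r)\<^sup>2 * r\<^sup>2) + 2 * ((g r)\<^sup>2 * r\<^sup>2) - 4 * ((1/2 * f r + 1/2 * g r)\<^sup>2 * r\<^sup>2) \<partial>ray)"
    unfolding sq_norm_def by (rule Bochner_Integration.integral_cong) (auto simp: power2_eq_square field_simps)
  then show ?thesis using f g i by (simp add: sq_norm_def)
qed

context radial_H1_function
begin

text \<open>The bounds m \<le> N and m \<le> N r^2 make the integrand at most N^2 times the minimum
  of 1 and 1/r^2.\<close>

lemma self_energy_le:
  assumes "sq_norm k + sq_norm S \<le> N"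
  shows "self_energy S \<le> (1 + (\<integral>s. indicator {1..} s * (1 / s\<^sup>2) \<partial>ray)) * N\<^sup>2"
proof -
  let ?c = "\<integral>s. indicator {1..} s * (1 / s\<^sup>2) \<partial>ray"
  let ?w = "\<lambda>r::real. indicator {..1} r + indicator {1..} r * (1 / r\<^sup>2)"
  have A: "sq_norm k \<le> N" "sq_norm S \<le> N" "N \<ge> 0" using assms sq_norm_nonneg[of k] sq_norm_nonneg[of S] by linarith+
  have iw: "integrable ray ?w" by (intro Bochner_Integration.integrable_add integrable_ray_initial integrable_inverse_square_tail)
  have "self_energy S \<le> (\<integral>r. N\<^sup>2 * ?w r \<partial>ray)"
    unfolding self_energy_def
  proof (rule integral_mono[OF self_energy_integrable integrable_mult_right[OF iw]])
    fix r assume "r \<in> space ray"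
    then have r: "r > 0" by simp
    have mN: "m r \<le> N" using m_le[of r] A by linarith
    show "(m r)\<^sup>2 / r\<^sup>2 \<le> N\<^sup>2 * ?w r"
    proof (cases "r \<le> 1")
      case True
      have "m r \<le> N * r\<^sup>2" by (rule order_trans[OF m_le_square[OF r] mult_right_mono[OF A(1)]]) simp
      then have "m r * m r \<le> N * (N * r\<^sup>2)" using mN A by (intro mult_mono) auto
      then have "(m r)\<^sup>2 / r\<^sup>2 \<le> N\<^sup>2 * 1" using r by (simp add: field_simps power2_eq_square)
      also have "\<dots> \<le> N\<^sup>2 * ?w r" using True by (intro mult_left_mono) auto
      finally show ?thesis .
    next
      case False
      have "(m r)\<^sup>2 / r\<^sup>2 \<le> N\<^sup>2 / r\<^sup>2" using mN by (intro divide_right_mono power_mono) auto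
      then show ?thesis using False by simp
    qed
  qed
  also have "\<dots> = N\<^sup>2 * (integral\<^sup>L ray (indicator {..1} :: real \<Rightarrow> real) + ?c)"
    unfolding integral_mult_right_zero
    by (subst Bochner_Integration.integral_add[OF integrable_ray_initial integrable_inverse_square_tail]) simp
  also have "integral\<^sup>L ray (indicator {..1} :: real \<Rightarrow> real) = 1" by (rule integral_ray_initial) simp
  finally show ?thesis by (simp only: mult.commute)
qed

text \<open>Zero self-energy forces \<open>m\<close> to vanish at all positive radii, while
  \<open>m\<close> tends to \<open>sq_norm S\<close> at infinity.\<close>

lemma self_energy_pos:
  assumes "sq_norm S > 0"
  shows "self_energy S > 0"
proof -
  have "self_energy S \<noteq> 0"
  proof
    assume "self_energy S = 0"
    then have "AE r in ray. (m r)\<^sup>2 / r\<^sup>2 = 0"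
      unfolding self_energy_def using self_energy_integrable by (subst (asm) integral_nonneg_eq_0_iff_AE) auto
    then have "AE r in ray. m r = 0" unfolding AE_ray by eventually_elim auto
    then have z: "m r = 0" if "r > 0" for r
      using has_ac_derivative_continuous[OF m_ac] that by (intro AE_ray_eq_continuous[where F=m and G="\<lambda>r. 0"]) auto
    have "\<forall>\<^sub>F r in at_top. m r = 0" using eventually_gt_at_top[of 0] by eventually_elim (rule z)
    then have "(m \<longlongrightarrow> 0) at_top" by (rule tendsto_eventually)
    then have "sq_norm S = 0" using tendsto_unique[OF _ m_at_top] by simp
    then show False using assms by simp
  qed
  then show ?thesis by (simp add: less_le)
qed

end

text \<open>Mass escaping to infinity does no harm, since only \<open>m\<close> at fixed radii
  enters and 1/r^2 has an integrable tail. Radial decay dominates the squares on bounded intervals,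
  and the bounds on \<open>m\<close> dominate the outer integral. Here \<open>S\<close> is a mere
  pointwise limit; its membership in the space is derived later.\<close>

lemma self_energy_tendsto:
  assumes T: "\<And>n. radial_H1 (T n) (t n)" and N: "\<And>n. sq_norm (t n) + sq_norm (T n) \<le> 1"
    and lim: "\<And>r. r > 0 \<Longrightarrow> (\<lambda>n. T n r) \<longlonglongrightarrow> S r"
  shows "(\<lambda>n. self_energy (T n)) \<longlonglongrightarrow> self_energy S"
proof -
  interpret T: radial_H1_function "T n" "t n" for n using T by unfold_locales
  have N1: "sq_norm (t n) \<le> 1" "sq_norm (T n) \<le> 1" for n
    using N[of n] sq_norm_nonneg[of "t n"] sq_norm_nonneg[of "T n"] by linarith+
  have [measurable]: "S \<in> borel_measurable ray"
    by (rule borel_measurable_LIMSEQ_real[where u=T]) (use lim in auto)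
  have mlim: "(\<lambda>n. cumulated_mass (T n) r) \<longlonglongrightarrow> cumulated_mass S r" if r: "r > 0" for r
    unfolding cumulated_mass_def cumulative_def
  proof (rule integral_dominated_convergence[where w="\<lambda>s. r * indicator {..r} s"])
    show "integrable ray (\<lambda>s. r * indicator {..r} s)" by (intro integrable_mult_right integrable_ray_initial)
    show "AE s in ray. (\<lambda>n. indicator {..r} s * ((T n s)\<^sup>2 * s\<^sup>2)) \<longlonglongrightarrow> indicator {..r} s * ((S s)\<^sup>2 * s\<^sup>2)"
      by (rule AE_I2) (auto intro!: tendsto_intros lim)
    show "AE s in ray. norm (indicator {..r} s * ((T n s)\<^sup>2 * s\<^sup>2)) \<le> r * indicator {..r} s" for n
    proof (rule AE_I2)
      fix s assume "s \<in> space ray"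
      then have s: "s > 0" by simp
      show "norm (indicator {..r} s * ((T n s)\<^sup>2 * s\<^sup>2)) \<le> r * indicator {..r} s"
      proof (cases "s \<le> r")
        case True
        have "(T n s)\<^sup>2 * s\<^sup>2 \<le> sq_norm (t n) * s" by (rule T.square_weight_le[OF s])
        also have "\<dots> \<le> 1 * r" using N1(1)[of n] s True by (intro mult_mono) auto
        finally show ?thesis using True by simp
      qed simp
    qed
  qed (auto intro!: borel_measurable_times borel_measurable_ray)
  have m1: "cumulated_mass (T n) r \<le> 1" for n r using T.m_le[of n r] N1(2)[of n] by linarith
  show ?thesis unfolding self_energy_def
  proof (rule integral_dominated_convergence[where w="\<lambda>r. indicator {..1} r + indicator {1..} r * (1 / r\<^sup>2)"])
    show "integrable ray (\<lambda>r::real. indicator {..1} r + indicator {1..} r * (1 / r\<^sup>2))"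
      by (intro Bochner_Integration.integrable_add integrable_ray_initial integrable_inverse_square_tail)
    show "AE r in ray. (\<lambda>n. (cumulated_mass (T n) r)\<^sup>2 / r\<^sup>2) \<longlonglongrightarrow> (cumulated_mass S r)\<^sup>2 / r\<^sup>2"
      by (rule AE_I2) (auto intro!: tendsto_intros mlim)
    show "AE r in ray. norm ((cumulated_mass (T n) r)\<^sup>2 / r\<^sup>2) \<le> indicator {..1} r + indicator {1..} r * (1 / r\<^sup>2)" for n
    proof (rule AE_I2)
      fix r assume "r \<in> space ray"
      then have r: "r > 0" by simp
      show "norm ((cumulated_mass (T n) r)\<^sup>2 / r\<^sup>2) \<le> indicator {..1} r + indicator {1..} r * (1 / r\<^sup>2)"
      proof (cases "r \<le> 1")
        case True
        have "cumulated_mass (T n) r \<le> 1 * r\<^sup>2"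
          by (rule order_trans[OF T.m_le_square[OF r] mult_right_mono[OF N1(1)]]) simp
        then have "cumulated_mass (T n) r * cumulated_mass (T n) r \<le> 1 * (1 * r\<^sup>2)" using m1 by (intro mult_mono) auto
        then have "(cumulated_mass (T n) r)\<^sup>2 / r\<^sup>2 \<le> 1" using r by (simp add: field_simps power2_eq_square)
        then show ?thesis using True by (simp add: add_increasing2)
      next
        case False
        have "(cumulated_mass (T n) r)\<^sup>2 / r\<^sup>2 \<le> 1\<^sup>2 / r\<^sup>2" using m1 by (intro divide_right_mono power_mono) auto
        then show ?thesis using False by simp
      qed
    qed
    have "(\<lambda>r. if r > 0 then (cumulated_mass S r) else 0) \<in> borel_measurable ray"
      by (rule borel_measurable_LIMSEQ_real[where u="\<lambda>n r. cumulated_mass (T n) r"]) (use mlim in auto)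
    then have "cumulated_mass S \<in> borel_measurable ray" by (subst measurable_cong[where g="\<lambda>r. if r > 0 then (cumulated_mass S r) else 0"]) auto
    then show "(\<lambda>r. (cumulated_mass S r)\<^sup>2 / r\<^sup>2) \<in> borel_measurable ray" by (intro borel_measurable_divide borel_measurable_power) auto
  qed auto
qed

section \<open>Limits of sequences in weighted mean square\<close>

lemma ennreal_le_suminf: "f i \<le> (\<Sum>i. f i)" for f :: "nat \<Rightarrow> ennreal"
  using sum_le_suminf[of f "{i}"] by simp

text \<open>A sequence that is Cauchy at a geometric rate converges almost everywhere, and Fatou's
  lemma transfers the rate to the limit.\<close>

lemma L2_fast_Cauchy_limit:
  fixes g :: "nat \<Rightarrow> 'a \<Rightarrow> real"
  assumes [measurable]: "\<And>i. g i \<in> borel_measurable M"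
    and i: "\<And>i j. i \<le> j \<Longrightarrow> integrable M (\<lambda>x. (g j x - g i x)\<^sup>2)"
    and fast: "\<And>i j. i \<le> j \<Longrightarrow> (\<integral>x. (g j x - g i x)\<^sup>2 \<partial>M) \<le> (1/4) ^ i"
  obtains h where "h \<in> borel_measurable M" "AE x in M. (\<lambda>i. g i x) \<longlonglongrightarrow> h x"
    "\<And>i. integrable M (\<lambda>x. (h x - g i x)\<^sup>2)" "\<And>i. (\<integral>x. (h x - g i x)\<^sup>2 \<partial>M) \<le> (1/4) ^ i"
proof -
  \<comment> \<open>The squared increments are summed with weight 2^i: light enough for the
    integrals, at most 2^i / 4^i, to be summable, and heavy enough to force geometric decay of the
    increments at almost every point.\<close>
  define d where "d i x = g (Suc i) x - g i x" for i x
  have [measurable]: "d i \<in> borel_measurable M" for i unfolding d_def[abs_def] by measurable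
  have nn: "(\<integral>\<^sup>+x. ennreal ((g j x - g i x)\<^sup>2) \<partial>M) \<le> ennreal ((1/4) ^ i)" if "i \<le> j" for i j
    using nn_integral_eq_integral[OF i[OF that]] fast[OF that] by (simp add: ennreal_leI)
  have "(\<integral>\<^sup>+x. (\<Sum>i. ennreal (2 ^ i * (d i x)\<^sup>2)) \<partial>M) = (\<Sum>i. \<integral>\<^sup>+x. ennreal (2 ^ i * (d i x)\<^sup>2) \<partial>M)"
    by (rule nn_integral_suminf) simp
  also have "\<dots> \<le> (\<Sum>i. ennreal ((1/2) ^ i))"
  proof (rule suminf_le)
    fix i
    have "(\<integral>\<^sup>+x. ennreal (2 ^ i * (d i x)\<^sup>2) \<partial>M) = ennreal (2 ^ i) * (\<integral>\<^sup>+x. ennreal ((d i x)\<^sup>2) \<partial>M)"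
      by (subst nn_integral_cmult[symmetric]) (auto simp: ennreal_mult)
    also have "\<dots> \<le> ennreal (2 ^ i) * ennreal ((1/4) ^ i)"
      unfolding d_def by (intro mult_left_mono nn) auto
    also have "\<dots> = ennreal ((1/2) ^ i)"
      by (simp add: ennreal_mult[symmetric] power_mult_distrib[symmetric])
    finally show "(\<integral>\<^sup>+x. ennreal (2 ^ i * (d i x)\<^sup>2) \<partial>M) \<le> ennreal ((1/2) ^ i)" .
  qed auto
  also have "\<dots> = ennreal (\<Sum>i. (1/2) ^ i)" by (rule suminf_ennreal2) (auto intro: summable_geometric)
  also have "\<dots> < \<infinity>" by simp
  finally have "AE x in M. (\<Sum>i. ennreal (2 ^ i * (d i x)\<^sup>2)) \<noteq> \<infinity>" by (intro nn_integral_PInf_AE) auto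
  then have conv: "AE x in M. convergent (\<lambda>i. g i x)"
  proof eventually_elim
    case (elim x)
    define c where "c = enn2real (\<Sum>i. ennreal (2 ^ i * (d i x)\<^sup>2))"
    have le: "2 ^ i * (d i x)\<^sup>2 \<le> c" for i
    proof -
      have "ennreal (2 ^ i * (d i x)\<^sup>2) \<le> (\<Sum>i. ennreal (2 ^ i * (d i x)\<^sup>2))"
        by (rule ennreal_le_suminf)
      also have "\<dots> = ennreal c" unfolding c_def by (rule ennreal_enn2real[symmetric]) (use elim in \<open>simp only: less_top infinity_ennreal_def\<close>)
      finally show ?thesis using ennreal_le_iff[of c "2 ^ i * (d i x)\<^sup>2"] enn2real_nonneg unfolding c_def by blast
    qed
    have bd: "norm (d i x) \<le> sqrt c * (sqrt (1/2)) ^ i" for i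
    proof -
      have "\<bar>d i x\<bar> = sqrt ((d i x)\<^sup>2)" by simp
      also have "\<dots> \<le> sqrt (c * (1/2) ^ i)" using le[of i] by (intro real_sqrt_le_mono) (simp add: field_simps power_divide)
      also have "\<dots> = sqrt c * (sqrt (1/2)) ^ i" by (simp add: real_sqrt_mult real_sqrt_power)
      finally show ?thesis by simp
    qed
    have "summable (\<lambda>i. sqrt c * (sqrt (1/2)) ^ i)"
      by (intro summable_mult summable_geometric) (simp add: real_sqrt_divide)
    then have "summable (\<lambda>i. d i x)" by (rule summable_comparison_test') (use bd in auto)
    then have "convergent (\<lambda>n. \<Sum>i<n. d i x)" by (simp add: summable_iff_convergent)
    then obtain L where "(\<lambda>n. \<Sum>i<n. d i x) \<longlonglongrightarrow> L" by (auto simp: convergent_def)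
    then have "(\<lambda>n. (\<Sum>i<n. d i x) + g 0 x) \<longlonglongrightarrow> L + g 0 x" by (intro tendsto_intros)
    moreover have "(\<Sum>i<n. d i x) + g 0 x = g n x" for n unfolding d_def using sum_lessThan_telescope[of "\<lambda>i. g i x" n] by simp
    ultimately show ?case by (auto simp: convergent_def)
  qed
  define h where "h x = lim (\<lambda>i. g i x)" for x
  have [measurable]: "h \<in> borel_measurable M" unfolding h_def[abs_def] by measurable
  have lim: "AE x in M. (\<lambda>i. g i x) \<longlonglongrightarrow> h x" using conv by eventually_elim (simp add: h_def convergent_LIMSEQ_iff)
  have fatou: "(\<integral>\<^sup>+x. ennreal ((h x - g i x)\<^sup>2) \<partial>M) \<le> ennreal ((1/4) ^ i)" for i
  proof -
    have "(\<integral>\<^sup>+x. ennreal ((h x - g i x)\<^sup>2) \<partial>M) = (\<integral>\<^sup>+x. liminf (\<lambda>j. ennreal ((g j x - g i x)\<^sup>2)) \<partial>M)"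
    proof (rule nn_integral_cong_AE)
      show "AE x in M. ennreal ((h x - g i x)\<^sup>2) = liminf (\<lambda>j. ennreal ((g j x - g i x)\<^sup>2))"
        using lim
      proof eventually_elim
        case (elim x)
        then have "(\<lambda>j. ennreal ((g j x - g i x)\<^sup>2)) \<longlonglongrightarrow> ennreal ((h x - g i x)\<^sup>2)"
          by (intro tendsto_ennrealI tendsto_intros)
        then show ?case by (intro lim_imp_Liminf[symmetric]) auto
      qed
    qed
    also have "\<dots> \<le> liminf (\<lambda>j. \<integral>\<^sup>+x. ennreal ((g j x - g i x)\<^sup>2) \<partial>M)" by (rule nn_integral_liminf) simp
    also have "\<dots> \<le> ennreal ((1/4) ^ i)"
    proof (rule Liminf_le)
      show "\<forall>\<^sub>F j in sequentially. (\<integral>\<^sup>+x. ennreal ((g j x - g i x)\<^sup>2) \<partial>M) \<le> ennreal ((1/4) ^ i)"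
        using eventually_ge_at_top[of i] by eventually_elim (rule nn)
    qed simp
    finally show ?thesis .
  qed
  have int: "integrable M (\<lambda>x. (h x - g i x)\<^sup>2)" for i
    by (rule integrableI_nonneg) (use fatou[of i] in \<open>auto simp: le_less_trans\<close>)
  have "(\<integral>x. (h x - g i x)\<^sup>2 \<partial>M) \<le> (1/4) ^ i" for i
    using fatou[of i] nn_integral_eq_integral[OF int[of i]] by simp
  with int lim show ?thesis using that[of h] by simp
qed

text \<open>By Cauchy-Schwarz against 1/r, integrals over a compact interval are continuous in the
  weighted mean square, so the fundamental theorem passes to the limit.\<close>

lemma has_ac_derivative_L2_limit:
  assumes T: "\<And>n. has_ac_derivative (T n) (t n)" and lim: "\<And>r. r > 0 \<Longrightarrow> (\<lambda>n. T n r) \<longlonglongrightarrow> S r"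
    and [measurable]: "k \<in> borel_measurable ray"
    and i: "\<And>n. integrable ray (\<lambda>r. (k r * r - t n r * r)\<^sup>2)"
    and d: "(\<lambda>n. \<integral>r. (k r * r - t n r * r)\<^sup>2 \<partial>ray) \<longlonglongrightarrow> 0"
  shows "has_ac_derivative S k"
  unfolding has_ac_derivative_def
proof (intro allI impI)
  fix a b :: real assume ab: "0 < a" "a \<le> b"
  note [measurable] = has_ac_derivative_measurable[OF T]
  let ?g = "\<lambda>r. indicator {a..b} r * (1 / r)"
  have sq: "(?g r)\<^sup>2 = - (indicator {a..b} r * (- (1 / r\<^sup>2)))" for r by (simp add: indicator_def power_divide)
  have g2: "integrable ray (\<lambda>r. (?g r)\<^sup>2)" "(\<integral>r. (?g r)\<^sup>2 \<partial>ray) = 1/a - 1/b"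
    unfolding sq using has_ac_derivativeD[OF has_ac_derivative_inverse ab] by simp_all
  let ?f = "\<lambda>n r. (k r * r - t n r * r) * ?g r"
  have fi: "integrable ray (?f n)" for n by (rule integrable_mult_L2[OF _ _ i g2(1)]) auto
  have fle: "\<bar>integral\<^sup>L ray (?f n)\<bar> \<le> sqrt (\<integral>r. (k r * r - t n r * r)\<^sup>2 \<partial>ray) * sqrt (1/a - 1/b)" for n
    using Cauchy_Schwarz_integral[OF _ _ i g2(1), of n] unfolding g2(2) by simp
  have "(\<lambda>n. sqrt (\<integral>r. (k r * r - t n r * r)\<^sup>2 \<partial>ray) * sqrt (1/a - 1/b)) \<longlonglongrightarrow> sqrt 0 * sqrt (1/a - 1/b)"
    by (intro tendsto_intros d)
  then have "(\<lambda>n. sqrt (\<integral>r. (k r * r - t n r * r)\<^sup>2 \<partial>ray) * sqrt (1/a - 1/b)) \<longlonglongrightarrow> 0" by simp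
  then have f0: "(\<lambda>n. integral\<^sup>L ray (?f n)) \<longlonglongrightarrow> 0"
  proof (rule Lim_null_comparison[rotated])
    show "\<forall>\<^sub>F n in sequentially. norm (integral\<^sup>L ray (?f n)) \<le> sqrt (\<integral>r. (k r * r - t n r * r)\<^sup>2 \<partial>ray) * sqrt (1/a - 1/b)"
      using fle by (intro always_eventually allI) (simp only: real_norm_def)
  qed
  note tD = has_ac_derivativeD[OF T ab]
  have eq: "indicator {a..b} r * k r = ?f n r + indicator {a..b} r * t n r" if "r \<in> space ray" for n r
    using that by (simp add: field_simps)
  have ki: "integrable ray (\<lambda>r. indicator {a..b} r * k r)"
  proof (rule Bochner_Integration.integrable_cong[OF refl, THEN iffD1])
    show "integrable ray (\<lambda>r. ?f 0 r + indicator {a..b} r * t 0 r)" by (rule Bochner_Integration.integrable_add[OF fi tD(1)])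
  qed (simp only: eq[of _ 0])
  have "(\<integral>r. indicator {a..b} r * k r \<partial>ray) = integral\<^sup>L ray (?f n) + (T n b - T n a)" for n
  proof -
    have "(\<integral>r. indicator {a..b} r * k r \<partial>ray) = (\<integral>r. ?f n r + indicator {a..b} r * t n r \<partial>ray)"
      by (rule Bochner_Integration.integral_cong[OF refl]) (simp only: eq[of _ n])
    also have "\<dots> = integral\<^sup>L ray (?f n) + (\<integral>r. indicator {a..b} r * t n r \<partial>ray)"
      by (rule Bochner_Integration.integral_add[OF fi tD(1)])
    finally show ?thesis by (simp only: tD(2))
  qed
  moreover have "(\<lambda>n. integral\<^sup>L ray (?f n) + (T n b - T n a)) \<longlonglongrightarrow> 0 + (S b - S a)"
    by (intro tendsto_intros f0 lim) (use ab in auto)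
  ultimately have "(\<lambda>n::nat. \<integral>r. indicator {a..b} r * k r \<partial>ray) \<longlonglongrightarrow> 0 + (S b - S a)" by simp
  then have "(\<integral>r. indicator {a..b} r * k r \<partial>ray) = 0 + (S b - S a)" by (rule LIMSEQ_const_iff[THEN iffD1])
  then have "(\<integral>r. indicator {a..b} r * k r \<partial>ray) = S b - S a" by simp
  then show "integrable ray (\<lambda>x. indicator {a..b} x * k x) \<and> (\<integral>x. indicator {a..b} x * k x \<partial>ray) = S b - S a"
    using ki by simp
qed

text \<open>Diagonal extraction at the positive rationals; the increment estimate makes the sequence
  equicontinuous at every positive radius, which extends convergence to all radii.\<close>

lemma pointwise_convergent_subsequence:
  assumes T: "\<And>n::nat. radial_H1 (T n) (t n)" and N: "\<And>n. sq_norm (t n) \<le> 1"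
  shows "\<exists>\<sigma> S. strict_mono (\<sigma> :: nat \<Rightarrow> nat) \<and> (\<forall>r>0. (\<lambda>n. T (\<sigma> n) r) \<longlonglongrightarrow> S r)"
proof -
  interpret T: radial_H1_function "T n" "t n" for n using T by unfold_locales
  \<comment> \<open>An enumeration of the nonnegative rationals; the guard \<open>q n > 0\<close>
    excludes zero, where the decay bound gives nothing.\<close>
  define q :: "nat \<Rightarrow> real" where "q n = \<bar>real_of_rat (from_nat_into UNIV n)\<bar>" for n
  have q: "\<exists>n. q n = real_of_rat x" if "x > 0" for x
  proof -
    obtain n where "from_nat_into (UNIV :: rat set) n = x" using from_nat_into_surj[of UNIV x] by auto
    then show ?thesis using that by (intro exI[of _ n]) (simp add: q_def)
  qed
  have bd: "\<bar>T n r\<bar> \<le> 1 / sqrt r" if "r > 0" for n r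
  proof -
    have "\<bar>T n r\<bar> \<le> sqrt (sq_norm (t n)) / sqrt r" by (rule T.decay[OF that])
    also have "\<dots> \<le> 1 / sqrt r" using N[of n] that by (intro divide_right_mono) auto
    finally show ?thesis .
  qed
  interpret subseqs "\<lambda>n s. q n > 0 \<longrightarrow> convergent (\<lambda>i. T (s i) (q n))"
  proof
    fix n and s :: "nat \<Rightarrow> nat"
    show "\<exists>r'. strict_mono r' \<and> (q n > 0 \<longrightarrow> convergent (\<lambda>i. T ((s \<circ> r') i) (q n)))"
    proof (cases "q n > 0")
      case True
      have "bounded (range (\<lambda>i. T (s i) (q n)))"
        unfolding bounded_iff using bd[OF True] by (intro exI[of _ "1 / sqrt (q n)"]) auto
      then obtain l r' where "strict_mono r'" "((\<lambda>i. T (s i) (q n)) \<circ> r') \<longlonglongrightarrow> l"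
        using bounded_imp_convergent_subsequence by blast
      then show ?thesis by (intro exI[of _ r']) (auto simp: convergent_def o_def)
    qed (auto intro!: exI[of _ id] simp: strict_mono_def)
  qed
  have qc: "convergent (\<lambda>i. T (diagseq i) (q n))" if "q n > 0" for n
  proof -
    have "q n > 0 \<longrightarrow> convergent (\<lambda>i. T ((diagseq \<circ> ((+) (Suc n))) i) (q n))"
    proof (rule diagseq_holds)
      fix r s :: "nat \<Rightarrow> nat" and n
      assume "strict_mono r" "q n > 0 \<longrightarrow> convergent (\<lambda>i. T (s i) (q n))"
      then show "q n > 0 \<longrightarrow> convergent (\<lambda>i. T ((s \<circ> r) i) (q n))"
        using convergent_subseq_convergent[of "\<lambda>i. T (s i) (q n)" r] by (simp add: o_def)
    qed
    then have "convergent (\<lambda>i. T (diagseq (i + Suc n)) (q n))" using that by (simp add: o_def add.commute)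
    then show ?thesis using convergent_ignore_initial_segment[of "\<lambda>i. T (diagseq i) (q n)" "Suc n"] by blast
  qed
  have "convergent (\<lambda>i. T (diagseq i) r)" if r: "r > 0" for r
  proof -
    have "Cauchy (\<lambda>i. T (diagseq i) r)"
    proof (rule metric_CauchyI)
      fix e :: real assume e: "e > 0"
      \<comment> \<open>A rational x between r / (1 + d r) and r satisfies 1/x - 1/r \<le> d; the
        square root in the increment estimate then gives e/4.\<close>
      define d where "d = (e/4)\<^sup>2"
      have d: "d > 0" using e by (simp add: d_def)
      have "r * 1 < r * (1 + d * r)" using r d by (intro mult_strict_left_mono) auto
      then have lt: "r / (1 + d * r) < r" using r d by (subst pos_divide_less_eq) (auto intro: add_pos_pos)
      obtain x where x: "r / (1 + d * r) < real_of_rat x" "real_of_rat x < r" using of_rat_dense[OF lt] by blast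
      have x0: "real_of_rat x > 0" using x(1) r d by (smt (verit) divide_pos_pos mult_pos_pos)
      then obtain n where n: "q n = real_of_rat x" using q[of x] by auto
      have "1 / real_of_rat x \<le> 1 / (r / (1 + d * r))"
        using x(1) x0 r d by (intro divide_left_mono) (auto intro!: mult_pos_pos divide_pos_pos add_pos_pos)
      also have "\<dots> = 1 / r + d" using r by (simp add: add_divide_distrib)
      finally have "1 / real_of_rat x - 1 / r \<le> d" by simp
      then have "sqrt (1 / real_of_rat x - 1 / r) \<le> sqrt d" by (rule real_sqrt_le_mono)
      also have "sqrt d = e/4" using e by (simp add: d_def)
      finally have sq: "sqrt (1 / real_of_rat x - 1 / r) \<le> e/4" .
      have near: "\<bar>T i r - T i (q n)\<bar> \<le> e/4" for i
      proof -
        have "\<bar>T i r - T i (q n)\<bar> \<le> sqrt (sq_norm (t i)) * sqrt (1 / real_of_rat x - 1 / r)"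
          unfolding n sq_norm_def by (rule ac_increment[OF T.ac T.k2 x0]) (use x in simp)
        also have "\<dots> \<le> 1 * (e/4)"
        proof (rule mult_mono[OF _ sq])
          have "1 / r \<le> 1 / real_of_rat x" using x(2) x0 r by (intro divide_left_mono) auto
          then show "0 \<le> sqrt (1 / real_of_rat x - 1 / r)" by simp
        qed (use N[of i] in auto)
        finally show ?thesis by simp
      qed
      have "Cauchy (\<lambda>i. T (diagseq i) (q n))" using qc[of n] n x0 by (simp add: convergent_Cauchy)
      then have "\<exists>M. \<forall>i\<ge>M. \<forall>j\<ge>M. dist (T (diagseq i) (q n)) (T (diagseq j) (q n)) < e/4"
        by (rule metric_CauchyD) (use e in simp)
      then obtain M where M: "\<forall>i\<ge>M. \<forall>j\<ge>M. dist (T (diagseq i) (q n)) (T (diagseq j) (q n)) < e/4" ..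
      show "\<exists>M. \<forall>i\<ge>M. \<forall>j\<ge>M. dist (T (diagseq i) r) (T (diagseq j) r) < e"
      proof (intro exI[of _ M] allI impI)
        fix i j assume "i \<ge> M" "j \<ge> M"
        with M have "dist (T (diagseq i) (q n)) (T (diagseq j) (q n)) < e/4" by blast
        then show "dist (T (diagseq i) r) (T (diagseq j) r) < e"
          using near[of "diagseq i"] near[of "diagseq j"] e unfolding dist_real_def by linarith
      qed
    qed
    then show ?thesis by (rule Cauchy_convergent)
  qed
  then show ?thesis using subseq_diagseq
    by (intro exI[of _ diagseq] exI[of _ "\<lambda>r. lim (\<lambda>n. T (diagseq n) r)"]) (simp add: convergent_LIMSEQ_iff)
qed

text \<open>Compactness is only needed pointwise: by uniform convexity of the norm, a maximising sequence
  along which the self-energy converges is automatically a Cauchy sequence.\<close>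

lemma maximizing_sequence_limit:
  assumes T: "\<And>n::nat. radial_H1 (T n) (t n)" and N: "\<And>n. sq_norm (t n) + sq_norm (T n) = 1"
    and lim: "\<And>r. r > 0 \<Longrightarrow> (\<lambda>n. T n r) \<longlonglongrightarrow> S r"
    and K: "(\<lambda>n. self_energy (T n)) \<longlonglongrightarrow> K" "K > 0"
    and sup: "\<And>U u. radial_H1 U u \<Longrightarrow> self_energy U \<le> K * (sq_norm u + sq_norm U)\<^sup>2"
  shows "\<exists>k. radial_H1 S k \<and> sq_norm k + sq_norm S \<le> 1 \<and> self_energy S = K"
proof -
  interpret T: radial_H1_function "T n" "t n" for n using T by unfold_locales
  have KS: "self_energy S = K"
    using LIMSEQ_unique[OF self_energy_tendsto[OF T _ lim] K(1)] N by simp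
  define D where "D i j = sq_norm (\<lambda>r. t i r - t j r)" for i j
  define D' where "D' i j = sq_norm (\<lambda>r. T i r - T j r)" for i j
  define p where "p i j = sq_norm (\<lambda>r. 1/2 * t i r + 1/2 * t j r)" for i j
  define P where "P i j = sq_norm (\<lambda>r. 1/2 * T i r + 1/2 * T j r)" for i j
  have D0: "D i j \<ge> 0" "D' i j \<ge> 0" "p i j + P i j \<ge> 0" for i j by (simp_all add: D_def D'_def p_def P_def)
  have par: "D i j + D' i j = 4 - 4 * p i j - 4 * P i j" for i j
  proof -
    have "D i j = 2 * sq_norm (t i) + 2 * sq_norm (t j) - 4 * p i j"
      unfolding D_def p_def by (rule parallelogram_weighted) (simp_all add: T.k2)
    moreover have "D' i j = 2 * sq_norm (T i) + 2 * sq_norm (T j) - 4 * P i j"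
      unfolding D'_def P_def by (rule parallelogram_weighted) (simp_all add: T.S2)
    ultimately show ?thesis using N[of i] N[of j] by linarith
  qed
  have pP: "p i j + P i j \<le> 1" for i j using par[of i j] D0[of i j] by linarith
  then have le1: "sq_norm (\<lambda>r. 1/2 * t i r + 1/2 * t j r) + sq_norm (\<lambda>r. 1/2 * T i r + 1/2 * T j r) \<le> 1" for i j
    unfolding p_def P_def .
  \<comment> \<open>Maximality bounds the midpoint's self-energy by K (p + P)^2, hence by K (p + P)
    because p + P \<le> 1. With the parallelogram law, the distance between the derivatives is
    controlled by the midpoint's deficit of self-energy.\<close>
  have DK: "D i j \<le> 4 - 4 * (self_energy (\<lambda>r. 1/2 * T i r + 1/2 * T j r) / K)" for i j
  proof -
    define e where "e = self_energy (\<lambda>r. 1/2 * T i r + 1/2 * T j r)"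
    have "e \<le> K * (p i j + P i j)\<^sup>2" unfolding e_def p_def P_def by (rule sup[OF radial_H1_combination[OF T T]])
    also have "\<dots> \<le> K * (p i j + P i j)"
      using pP[of i j] D0(3)[of i j] K(2) mult_left_mono[of "p i j + P i j" 1 "p i j + P i j"]
      by (intro mult_left_mono) (auto simp: power2_eq_square)
    finally have "e / K \<le> p i j + P i j" using K(2) by (simp add: pos_divide_le_eq mult.commute)
    then have "D i j \<le> 4 - 4 * (e / K)" using par[of i j] D0(2)[of i j] by linarith
    then show ?thesis unfolding e_def .
  qed
  have Cauchy: "\<exists>n. \<forall>i\<ge>n. \<forall>j\<ge>n. D i j < e" if e: "e > 0" for e
  proof (rule ccontr)
    assume "\<not> ?thesis"
    then have "\<forall>n. \<exists>i j. i \<ge> n \<and> j \<ge> n \<and> D i j \<ge> e" by (meson not_less)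
    \<comment> \<open>Along these index pairs the midpoints still converge pointwise to
      \<open>S\<close>, so their self-energies tend to \<open>K\<close> and the deficits to zero,
      against the lower bound \<open>e\<close>.\<close>
    then obtain i j where ij: "\<And>n. i n \<ge> n" "\<And>n. j n \<ge> n" "\<And>n. D (i n) (j n) \<ge> e" by metis
    have sub: "(\<lambda>n. T (s n) r) \<longlonglongrightarrow> S r" if "r > 0" "\<And>n. s n \<ge> n" for s :: "nat \<Rightarrow> nat" and r
    proof -
      have "filterlim s at_top sequentially" by (rule filterlim_at_top_mono[OF filterlim_ident]) (use that(2) in auto)
      then show ?thesis by (rule filterlim_compose[OF lim[OF that(1)]])
    qed
    have "(\<lambda>n. self_energy (\<lambda>r. 1/2 * T (i n) r + 1/2 * T (j n) r)) \<longlonglongrightarrow> self_energy S"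
    proof (rule self_energy_tendsto[OF radial_H1_combination[OF T T] le1])
      fix r :: real assume r: "r > 0"
      have "(\<lambda>n. 1/2 * T (i n) r + 1/2 * T (j n) r) \<longlonglongrightarrow> 1/2 * S r + 1/2 * S r"
        by (intro tendsto_intros sub[OF r] ij)
      then show "(\<lambda>n. 1/2 * T (i n) r + 1/2 * T (j n) r) \<longlonglongrightarrow> S r" by simp
    qed
    then have "(\<lambda>n. 4 - 4 * (self_energy (\<lambda>r. 1/2 * T (i n) r + 1/2 * T (j n) r) / K)) \<longlonglongrightarrow> 4 - 4 * (K / K)"
      unfolding KS using K(2) by (intro tendsto_intros) auto
    then have "e \<le> 4 - 4 * (K / K)"
      by (rule LIMSEQ_le_const) (use ij(3) DK order_trans in blast)
    then show False using e K(2) by simp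
  qed
  define nn where "nn i = (SOME n. \<forall>a\<ge>n. \<forall>b\<ge>n. D a b < (1/4) ^ i)" for i :: nat
  have nn: "D a b < (1/4) ^ i" if "a \<ge> nn i" "b \<ge> nn i" for a b i
    using someI_ex[OF Cauchy[of "(1/4) ^ i"]] that unfolding nn_def by simp
  \<comment> \<open>The sum dominates all thresholds up to index \<open>i\<close> at once, and the
    summand \<open>i\<close> makes the chosen indices tend to infinity.\<close>
  define \<rho> where "\<rho> i = (\<Sum>j\<le>i. nn j) + i" for i
  have \<rho>nn: "\<rho> j \<ge> nn i" if "i \<le> j" for i j
    unfolding \<rho>_def using member_le_sum[of i "{..j}" nn] that by simp
  have \<rho>id: "\<rho> i \<ge> i" for i by (simp add: \<rho>_def)
  define g where "g i r = t (\<rho> i) r * r" for i r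
  have gm[measurable]: "g i \<in> borel_measurable ray" for i unfolding g_def[abs_def] by measurable
  have gd: "(g j r - g i r)\<^sup>2 = (1 * t (\<rho> j) r + (-1) * t (\<rho> i) r)\<^sup>2 * r\<^sup>2" for i j r
    by (simp add: g_def power_mult_distrib[symmetric] algebra_simps)
  have gi: "integrable ray (\<lambda>r. (g j r - g i r)\<^sup>2)" for i j
    unfolding gd by (rule integrable_weighted_square_sum) (simp_all add: T.k2)
  have "(\<integral>r. (g j r - g i r)\<^sup>2 \<partial>ray) \<le> (1/4) ^ i" if "i \<le> j" for i j
    using nn[OF \<rho>nn[OF that] \<rho>nn[OF order_refl]] by (simp add: gd D_def sq_norm_def)
  from L2_fast_Cauchy_limit[OF gm gi this]
  obtain h where [measurable]: "h \<in> borel_measurable ray" and hl: "AE r in ray. (\<lambda>i. g i r) \<longlonglongrightarrow> h r"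
    and hi: "\<And>i. integrable ray (\<lambda>x. (h x - g i x)\<^sup>2)" and hle: "\<And>i. (\<integral>x. (h x - g i x)\<^sup>2 \<partial>ray) \<le> (1/4) ^ i" by blast
  define k where "k r = h r / r" for r
  have [measurable]: "k \<in> borel_measurable ray" unfolding k_def[abs_def] by measurable
  have limS: "(\<lambda>i. T (\<rho> i) r) \<longlonglongrightarrow> S r" if "r > 0" for r
  proof -
    have "filterlim \<rho> at_top sequentially" by (rule filterlim_at_top_mono[OF filterlim_ident]) (use \<rho>id in auto)
    then show ?thesis by (rule filterlim_compose[OF lim[OF that]])
  qed
  have hk: "(h r - g i r)\<^sup>2 = (k r * r - t (\<rho> i) r * r)\<^sup>2" if "r \<in> space ray" for r i
    using that by (simp add: k_def g_def)
  have ac: "has_ac_derivative S k"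
  proof (rule has_ac_derivative_L2_limit[OF T.ac limS])
    show "integrable ray (\<lambda>r. (k r * r - t (\<rho> i) r * r)\<^sup>2)" for i
      using hi[of i] by (rule Bochner_Integration.integrable_cong[OF refl hk, THEN iffD1, rotated])
    have "(\<integral>r. (k r * r - t (\<rho> i) r * r)\<^sup>2 \<partial>ray) = (\<integral>r. (h r - g i r)\<^sup>2 \<partial>ray)" for i
      by (rule Bochner_Integration.integral_cong[OF refl hk[of _ i, symmetric]])
    then have bnd: "norm (\<integral>r. (k r * r - t (\<rho> i) r * r)\<^sup>2 \<partial>ray) \<le> (1/4) ^ i" for i using hle[of i] by simp
    have "(\<lambda>i. (1/4::real) ^ i) \<longlonglongrightarrow> 0" by (rule LIMSEQ_realpow_zero) auto
    then show "(\<lambda>i. \<integral>r. (k r * r - t (\<rho> i) r * r)\<^sup>2 \<partial>ray) \<longlonglongrightarrow> 0"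
    proof (rule Lim_null_comparison[rotated])
      show "\<forall>\<^sub>F i in sequentially. norm (\<integral>r. (k r * r - t (\<rho> i) r * r)\<^sup>2 \<partial>ray) \<le> (1/4) ^ i"
        using bnd by (intro always_eventually allI)
    qed
  qed auto
  note [measurable] = has_ac_derivative_measurable'[OF ac]
  \<comment> \<open>Fatou's lemma yields only an inequality for the norm of the limit; equality is
    recovered afterwards from maximality.\<close>
  have fatou: "(\<integral>\<^sup>+r. ennreal ((k r)\<^sup>2 * r\<^sup>2 + (S r)\<^sup>2 * r\<^sup>2) \<partial>ray) \<le> 1"
  proof -
    let ?F = "\<lambda>i r. (t (\<rho> i) r)\<^sup>2 * r\<^sup>2 + (T (\<rho> i) r)\<^sup>2 * r\<^sup>2"
    have "(\<integral>\<^sup>+r. ennreal ((k r)\<^sup>2 * r\<^sup>2 + (S r)\<^sup>2 * r\<^sup>2) \<partial>ray) = (\<integral>\<^sup>+r. liminf (\<lambda>i. ennreal (?F i r)) \<partial>ray)"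
    proof (rule nn_integral_cong_AE)
      have pos: "AE r in ray. r > 0" unfolding AE_ray by simp
      show "AE r in ray. ennreal ((k r)\<^sup>2 * r\<^sup>2 + (S r)\<^sup>2 * r\<^sup>2) = liminf (\<lambda>i. ennreal (?F i r))"
        using hl pos
      proof eventually_elim
        case (elim r)
        have "(\<lambda>i. (g i r)\<^sup>2 + (T (\<rho> i) r)\<^sup>2 * r\<^sup>2) \<longlonglongrightarrow> (h r)\<^sup>2 + (S r)\<^sup>2 * r\<^sup>2"
          by (intro tendsto_intros elim(1) limS[OF elim(2)])
        then have "(\<lambda>i. ennreal (?F i r)) \<longlonglongrightarrow> ennreal ((k r)\<^sup>2 * r\<^sup>2 + (S r)\<^sup>2 * r\<^sup>2)"
          using elim(2) by (intro tendsto_ennrealI) (simp add: g_def k_def power_mult_distrib power_divide)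
        then show ?case by (intro lim_imp_Liminf[symmetric]) auto
      qed
    qed
    also have "\<dots> \<le> liminf (\<lambda>i. \<integral>\<^sup>+r. ennreal (?F i r) \<partial>ray)" by (rule nn_integral_liminf) simp
    also have "(\<lambda>i. \<integral>\<^sup>+r. ennreal (?F i r) \<partial>ray) = (\<lambda>i. 1)"
    proof
      fix i
      have "integrable ray (?F i)" by (intro Bochner_Integration.integrable_add T.k2 T.S2)
      then have "(\<integral>\<^sup>+r. ennreal (?F i r) \<partial>ray) = ennreal (integral\<^sup>L ray (?F i))" by (rule nn_integral_eq_integral) simp
      also have "integral\<^sup>L ray (?F i) = 1"
        using N[of "\<rho> i"] by (simp add: sq_norm_def Bochner_Integration.integral_add[OF T.k2 T.S2])
      finally show "(\<integral>\<^sup>+r. ennreal (?F i r) \<partial>ray) = 1" by simp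
    qed
    also have "liminf (\<lambda>i::nat. 1 :: ennreal) = 1" by (simp add: Liminf_const)
    finally show ?thesis .
  qed
  have ikS: "integrable ray (\<lambda>r. (k r)\<^sup>2 * r\<^sup>2 + (S r)\<^sup>2 * r\<^sup>2)"
    by (rule integrableI_nonneg) (use fatou in \<open>auto simp: le_less_trans\<close>)
  have ik: "integrable ray (\<lambda>r. (k r)\<^sup>2 * r\<^sup>2)" and iS: "integrable ray (\<lambda>r. (S r)\<^sup>2 * r\<^sup>2)"
    by (rule Bochner_Integration.integrable_bound[OF ikS]; auto intro!: AE_I2)+
  have "integral\<^sup>L ray (\<lambda>r. (k r)\<^sup>2 * r\<^sup>2 + (S r)\<^sup>2 * r\<^sup>2) \<le> 1"
    using fatou nn_integral_eq_integral[OF ikS] by simp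
  then have "sq_norm k + sq_norm S \<le> 1" using ik iS by (simp add: sq_norm_def)
  then show ?thesis using ac ik iS KS by (intro exI[of _ k]) (simp add: radial_H1_def)
qed

lemma radial_H1_bump: "\<exists>S k. radial_H1 S k \<and> sq_norm S > 0"
proof -
  let ?S = "bump 1 1 2"
  have tf: "test_function {0<..} ?S" by (rule test_function_bump) auto
  obtain k a b where ab: "0 < a" "a \<le> b" and z: "\<And>x. x \<notin> {a..b} \<Longrightarrow> ?S x = 0" "\<And>x. x \<notin> {a..b} \<Longrightarrow> k x = 0"
    and d: "\<And>x::real. (?S has_real_derivative k x) (at x)" and c: "continuous_on UNIV k"
    by (rule test_function_ray[OF tf]) blast
  have cS: "continuous_on UNIV ?S" using d by (auto intro!: continuous_at_imp_continuous_on DERIV_isCont)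
  have "radial_H1 ?S k" unfolding radial_H1_def
  proof (intro conjI)
    show "has_ac_derivative ?S k" by (rule has_ac_derivative_C1[OF d]) (use c in \<open>auto intro: continuous_on_subset\<close>)
    show "integrable ray (\<lambda>r. (k r)\<^sup>2 * r\<^sup>2)"
      by (rule integrable_ray_continuous[OF _ _ ab(1), of _ b]) (use z c in \<open>auto intro!: continuous_intros intro: continuous_on_subset\<close>)
    show "integrable ray (\<lambda>r. (?S r)\<^sup>2 * r\<^sup>2)"
      by (rule integrable_ray_continuous[OF _ _ ab(1), of _ b]) (use z cS in \<open>auto intro!: continuous_intros intro: continuous_on_subset\<close>)
  qed
  moreover from this interpret radial_H1_function ?S k by unfold_locales
  have "sq_norm ?S > 0" by (rule sq_norm_pos[of "3/2"]) (use bump_nonzero[of 1 1 2 "3/2"] in auto)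
  ultimately show ?thesis by blast
qed

theorem self_energy_maximizer:
  obtains S k where "radial_H1 S k" "sq_norm k + sq_norm S = 1" "self_energy S > 0"
    "\<And>U u. radial_H1 U u \<Longrightarrow> self_energy U \<le> self_energy S * (sq_norm u + sq_norm U)\<^sup>2"
proof -
  define Q where "Q = {self_energy S | S. \<exists>k. radial_H1 S k \<and> sq_norm k + sq_norm S = 1}"
  define K where "K = Sup Q"
  let ?c = "1 + (\<integral>s. indicator {1..} s * (1 / s\<^sup>2) \<partial>ray)"
  have bdd: "bdd_above Q"
  proof (rule bdd_aboveI[where M="?c"])
    fix x assume "x \<in> Q"
    then obtain S k where S: "radial_H1 S k" "sq_norm k + sq_norm S = 1" and x: "x = self_energy S" by (auto simp: Q_def)
    interpret radial_H1_function S k using S(1) by unfold_locales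
    show "x \<le> ?c" unfolding x using self_energy_le[of 1] S(2) by simp
  qed
  \<comment> \<open>The self-energy has degree four and the squared norm degree two, so the supremum
    over the unit sphere bounds all functions; norm zero is treated by the a priori
    estimate.\<close>
  have normalize: "self_energy U \<le> K * (sq_norm u + sq_norm U)\<^sup>2" if U: "radial_H1 U u" for U u
  proof (cases "sq_norm u + sq_norm U = 0")
    case True
    interpret radial_H1_function U u using U by unfold_locales
    show ?thesis using self_energy_le[of 0] True by simp
  next
    case False
    define n where "n = sq_norm u + sq_norm U"
    have n: "n > 0" using False sq_norm_nonneg[of u] sq_norm_nonneg[of U] unfolding n_def by linarith
    define c where "c = 1 / sqrt n"
    have c2: "c\<^sup>2 = 1 / n" using n by (simp add: c_def power_divide)
    have "sq_norm (\<lambda>r. c * u r) + sq_norm (\<lambda>r. c * U r) = c\<^sup>2 * n" by (simp add: sq_norm_scale n_def distrib_left)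
    then have "sq_norm (\<lambda>r. c * u r) + sq_norm (\<lambda>r. c * U r) = 1" using c2 n by simp
    then have "self_energy (\<lambda>r. c * U r) \<in> Q" using radial_H1_scale[OF U, of c] by (auto simp: Q_def)
    then have "self_energy (\<lambda>r. c * U r) \<le> K" unfolding K_def by (rule cSup_upper[OF _ bdd])
    then have "c ^ 4 * self_energy U \<le> K" by (simp add: self_energy_scale)
    moreover have "c ^ 4 = 1 / n\<^sup>2" using c2 by (metis (no_types) power_even_eq power_one_over mult_2 numeral_Bit0 power2_eq_square power_divide power_one power4_eq_xxxx mult.assoc)
    ultimately have "self_energy U / n\<^sup>2 \<le> K" by simp
    then have "self_energy U \<le> K * n\<^sup>2" using n by (simp add: pos_divide_le_eq)
    then show ?thesis unfolding n_def .
  qed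
  obtain S0 k0 where S0: "radial_H1 S0 k0" "sq_norm S0 > 0" using radial_H1_bump by blast
  interpret S0: radial_H1_function S0 k0 using S0(1) by unfold_locales
  have "0 < K * (sq_norm k0 + sq_norm S0)\<^sup>2" using S0.self_energy_pos[OF S0(2)] normalize[OF S0(1)] by linarith
  then have K: "K > 0" by (simp add: zero_less_mult_iff)
  have ne: "Q \<noteq> {}"
  proof -
    define n where "n = sq_norm k0 + sq_norm S0"
    have n: "n > 0" using S0(2) sq_norm_nonneg[of k0] unfolding n_def by linarith
    have "sq_norm (\<lambda>r. 1 / sqrt n * k0 r) + sq_norm (\<lambda>r. 1 / sqrt n * S0 r) = (1 / sqrt n)\<^sup>2 * n"
      by (simp only: sq_norm_scale n_def distrib_left)
    also have "\<dots> = 1" using n by (simp add: power_divide)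
    finally show ?thesis using radial_H1_scale[OF S0(1), of "1 / sqrt n"] by (auto simp: Q_def)
  qed
  have "\<forall>n. \<exists>S k. radial_H1 S k \<and> sq_norm k + sq_norm S = 1 \<and> K - inverse (real (Suc n)) < self_energy S"
  proof
    fix n
    have "K - inverse (real (Suc n)) < Sup Q" unfolding K_def by simp
    then obtain x where "x \<in> Q" "K - inverse (real (Suc n)) < x" using less_cSup_iff[OF ne bdd] by blast
    then show "\<exists>S k. radial_H1 S k \<and> sq_norm k + sq_norm S = 1 \<and> K - inverse (real (Suc n)) < self_energy S"
      by (auto simp: Q_def)
  qed
  then obtain T t where T: "\<And>n. radial_H1 (T n) (t n)" "\<And>n. sq_norm (t n) + sq_norm (T n) = 1"
    "\<And>n. K - inverse (real (Suc n)) < self_energy (T n)" by metis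
  have le: "self_energy (T n) \<le> K" for n using normalize[OF T(1), of n] T(2)[of n] by simp
  have Tlim: "(\<lambda>n. self_energy (T n)) \<longlonglongrightarrow> K"
  proof (rule real_tendsto_sandwich[OF _ _ _ tendsto_const])
    have "(\<lambda>n. K - inverse (real (Suc n))) \<longlonglongrightarrow> K - 0" by (intro tendsto_intros LIMSEQ_inverse_real_of_nat)
    then show "(\<lambda>n. K - inverse (real (Suc n))) \<longlonglongrightarrow> K" by simp
  qed (use T(3) le in \<open>auto intro!: always_eventually less_imp_le\<close>)
  have t1: "sq_norm (t n) \<le> 1" for n using T(2)[of n] sq_norm_nonneg[of "T n"] by linarith
  have "\<exists>\<sigma> S. strict_mono (\<sigma> :: nat \<Rightarrow> nat) \<and> (\<forall>r>0. (\<lambda>n. T (\<sigma> n) r) \<longlonglongrightarrow> S r)"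
    by (rule pointwise_convergent_subsequence) (rule T(1), rule t1)
  then obtain \<sigma> S where \<sigma>: "strict_mono \<sigma>" "\<And>r. r > 0 \<Longrightarrow> (\<lambda>n. T (\<sigma> n) r) \<longlonglongrightarrow> S r" by blast
  have "\<exists>k. radial_H1 S k \<and> sq_norm k + sq_norm S \<le> 1 \<and> self_energy S = K"
  proof (rule maximizing_sequence_limit[where T="\<lambda>n. T (\<sigma> n)" and t="\<lambda>n. t (\<sigma> n)"])
    show "(\<lambda>n. self_energy (T (\<sigma> n))) \<longlonglongrightarrow> K" using LIMSEQ_subseq_LIMSEQ[OF Tlim \<sigma>(1)] by (simp add: o_def)
  qed (use T \<sigma>(2) K normalize in simp_all)
  then obtain k where k: "radial_H1 S k" "sq_norm k + sq_norm S \<le> 1" "self_energy S = K" by (elim exE conjE) (rule that)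
  let ?n = "sq_norm k + sq_norm S"
  \<comment> \<open>The limit attains \<open>K\<close> with norm at most 1, and the inequality for
    all functions leaves no room for a smaller norm.\<close>
  have "K \<le> K * ?n\<^sup>2" using normalize[OF k(1)] k(3) by simp
  then have "1 \<le> ?n\<^sup>2" using K by simp
  then have "?n \<ge> 1" using power2_le_imp_le[of 1 ?n] by simp
  then have "?n = 1" using k(2) by linarith
  then show ?thesis using k normalize K by (intro that[of S k]) simp_all
qed

section \<open>Potentials and the Euler--Lagrange equation\<close>

lemma has_weak_gradient_measurable:
  assumes "has_weak_gradient S k {0<..}"
  shows "S \<in> borel_measurable ray" "k \<in> borel_measurable ray"
  using assms by (auto simp: has_weak_gradient_ray_iff intro: locally_integrable_ray_measurable)

lemma radial_power_integrable:
  assumes "integrable lborel (\<lambda>x. (radial_ext S x) ^ p)" and S: "S \<in> borel_measurable ray"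
    and F: "F \<in> borel_measurable ray" "AE r in ray. S r = F r"
  shows "integrable ray (\<lambda>r. (F r) ^ p * r\<^sup>2)"
proof -
  have m: "(\<lambda>r. S r ^ p) \<in> borel_measurable ray" using S by measurable
  have "integrable ray (\<lambda>r. S r ^ p * r\<^sup>2)"
    using assms(1) by (simp add: radial_ext_def integrable_radial_iff[OF m])
  then show ?thesis
    by (rule integrable_cong_AE_imp) (use F in \<open>auto elim: eventually_mono intro!: borel_measurable_times borel_measurable_power borel_measurable_ray\<close>)
qed

lemma H1r_representative:
  assumes "S \<in> H1r"
  obtains F k where "has_weak_gradient S k {0<..}" "AE r in ray. S r = F r" "radial_H1 F k"
proof -
  obtain g where i: "integrable lborel (\<lambda>x. (radial_ext S x)\<^sup>2)"
    and g: "has_weak_gradient (radial_ext S) g UNIV" "integrable lborel (\<lambda>x. (norm (g x))\<^sup>2)"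
    using assms by (auto simp: H1r_def)
  obtain k where k: "has_weak_gradient S k {0<..}" "integrable ray (\<lambda>r. (k r)\<^sup>2 * r\<^sup>2)" by (rule radial_weak_gradient[OF g])
  obtain F where F: "has_ac_derivative F k" "AE r in ray. S r = F r" by (rule has_weak_gradient_ray_ac[OF k(1)])
  have "integrable ray (\<lambda>r. (F r)\<^sup>2 * r\<^sup>2)"
    by (rule radial_power_integrable[OF i has_weak_gradient_measurable(1)[OF k(1)] has_ac_derivative_measurable'[OF F(1)] F(2)])
  then show ?thesis using that[OF k(1) F(2)] F(1) k(2) by (simp add: radial_H1_def)
qed

text \<open>Sixth-power integrability makes the representative small at some distant radii, and the
  increment estimate turns this into convergence to 0.\<close>

lemma D1r_representative:
  assumes "Z \<in> D1r"
  obtains G l where "has_weak_gradient Z l {0<..}" "AE r in ray. Z r = G r" "radial_D1 G l"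
proof -
  obtain g where i: "integrable lborel (\<lambda>x. (radial_ext Z x) ^ 6)"
    and g: "has_weak_gradient (radial_ext Z) g UNIV" "integrable lborel (\<lambda>x. (norm (g x))\<^sup>2)"
    using assms by (auto simp: D1r_def)
  obtain l where l: "has_weak_gradient Z l {0<..}" "integrable ray (\<lambda>r. (l r)\<^sup>2 * r\<^sup>2)" by (rule radial_weak_gradient[OF g])
  obtain G where G: "has_ac_derivative G l" "AE r in ray. Z r = G r" by (rule has_weak_gradient_ray_ac[OF l(1)])
  have "integrable ray (\<lambda>r. (G r) ^ 6 * r\<^sup>2)"
    by (rule radial_power_integrable[OF i has_weak_gradient_measurable(1)[OF l(1)] has_ac_derivative_measurable'[OF G(1)] G(2)])
  then have "(G \<longlongrightarrow> 0) at_top" by (intro radial_decay_tendsto[OF G(1) l(2)] frequently_small[where p=6]) auto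
  then show ?thesis using that[OF l(1) G(2)] G(1) l(2) by (simp add: radial_D1_def)
qed

lemma radial_gradient_integrable:
  assumes k: "continuous_on {0<..} k" "integrable ray (\<lambda>r. (k r)\<^sup>2 * r\<^sup>2)"
  shows "integrable lborel (\<lambda>x::real^3. (norm ((k (norm x) / norm x) *\<^sub>R x))\<^sup>2)"
proof -
  have m: "(\<lambda>r. (k r)\<^sup>2) \<in> borel_measurable ray" and km: "(\<lambda>r. k r / r) \<in> borel_measurable ray"
    by (intro continuous_measurable_ray continuous_intros k; simp)+
  have "integrable lborel (\<lambda>x::real^3. (k (norm x))\<^sup>2)" using k(2) by (simp add: integrable_radial_iff[OF m])
  then show ?thesis
  proof (rule integrable_cong_AE_imp)
    show "(\<lambda>x::real^3. (norm ((k (norm x) / norm x) *\<^sub>R x))\<^sup>2) \<in> borel_measurable lborel"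
      using radial_measurable[OF km] by measurable
    show "AE x in lborel. (k (norm x))\<^sup>2 = (norm ((k (norm x) / norm x) *\<^sub>R (x::real^3)))\<^sup>2"
      using AE_norm_pos by eventually_elim simp
  qed
qed

text \<open>The return from the half-line to space; the derivative is continuous and bounded near
  the origin so that difference quotients of the radial extension are dominated.\<close>

lemma H1rI:
  assumes S: "radial_H1 S k" and k: "continuous_on {0<..} k" "\<And>R. \<exists>C. \<forall>r\<in>{0<..R}. \<bar>k r\<bar> \<le> C"
  shows "S \<in> H1r"
proof -
  interpret radial_H1_function S k using S by unfold_locales
  have m: "(\<lambda>r. (S r)\<^sup>2) \<in> borel_measurable ray" by measurable
  have "integrable lborel (\<lambda>x. (radial_ext S x)\<^sup>2)" using S2 by (simp add: radial_ext_def integrable_radial_iff[OF m])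
  moreover have "has_weak_gradient (radial_ext S) (\<lambda>x. (k (norm x) / norm x) *\<^sub>R x) UNIV"
    by (rule radial_has_weak_gradient[OF has_ac_derivative_deriv[OF ac k(1)] k])
  ultimately show ?thesis using radial_gradient_integrable[OF k(1) k2] unfolding H1r_def by blast
qed

lemma D1rI:
  assumes Z: "radial_D1 Z l" and l: "continuous_on {0<..} l" "\<And>R. \<exists>C. \<forall>r\<in>{0<..R}. \<bar>l r\<bar> \<le> C"
    and i: "integrable ray (\<lambda>r. (Z r) ^ 6 * r\<^sup>2)"
  shows "Z \<in> D1r"
proof -
  have ac: "has_ac_derivative Z l" and l2: "integrable ray (\<lambda>r. (l r)\<^sup>2 * r\<^sup>2)" using Z by (auto simp: radial_D1_def)
  have m: "(\<lambda>r. (Z r) ^ 6) \<in> borel_measurable ray" using has_ac_derivative_measurable'[OF ac] by measurable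
  have "integrable lborel (\<lambda>x. (radial_ext Z x) ^ 6)" using i by (simp add: radial_ext_def integrable_radial_iff[OF m])
  moreover have "has_weak_gradient (radial_ext Z) (\<lambda>x. (l (norm x) / norm x) *\<^sub>R x) UNIV"
    by (rule radial_has_weak_gradient[OF has_ac_derivative_deriv[OF ac l(1)] l])
  ultimately show ?thesis using radial_gradient_integrable[OF l(1) l2] unfolding D1r_def by blast
qed

lemma radial_deriv_eq:
  assumes S: "has_weak_gradient S k {0<..}" and F: "has_ac_derivative F k" "AE r in ray. S r = F r"
  shows "AE r in ray. radial_deriv S r = k r" "radial_deriv S \<in> borel_measurable ray"
proof -
  have "has_weak_gradient S (radial_deriv S) {0<..}" unfolding radial_deriv_def by (rule someI[where P="\<lambda>g. has_weak_gradient S g {0<..}", OF S])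
  then show "AE r in ray. radial_deriv S r = k r" "radial_deriv S \<in> borel_measurable ray"
    using has_weak_gradient_ray_unique[OF _ F] has_weak_gradient_measurable(2) by blast+
qed

lemma energy_eq:
  assumes S: "has_weak_gradient S k {0<..}" "AE r in ray. S r = F r" "radial_H1 F k"
    and Z: "has_weak_gradient Z l {0<..}" "AE r in ray. Z r = G r" "radial_D1 G l"
  shows "energy \<mu> S Z = 1/2 * (sq_norm k + sq_norm F + sq_norm l / (2 * \<mu>))"
proof -
  have F: "has_ac_derivative F k" "integrable ray (\<lambda>r. (k r)\<^sup>2 * r\<^sup>2)" "integrable ray (\<lambda>r. (F r)\<^sup>2 * r\<^sup>2)"
    and G: "has_ac_derivative G l" "integrable ray (\<lambda>r. (l r)\<^sup>2 * r\<^sup>2)"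
    using S(3) Z(3) by (auto simp: radial_H1_def radial_D1_def)
  note dS = radial_deriv_eq[OF S(1) F(1) S(2)] and dZ = radial_deriv_eq[OF Z(1) G(1) Z(2)]
  note [measurable] = dS(2) dZ(2) has_weak_gradient_measurable[OF S(1)] has_weak_gradient_measurable[OF Z(1)]
    has_ac_derivative_measurable'[OF F(1)] has_ac_derivative_measurable'[OF G(1)]
  have "(\<integral>r. ((radial_deriv S r)\<^sup>2 + (S r)\<^sup>2 + (radial_deriv Z r)\<^sup>2 / (2 * \<mu>)) * r\<^sup>2 \<partial>ray)
      = (\<integral>r. (k r)\<^sup>2 * r\<^sup>2 + (F r)\<^sup>2 * r\<^sup>2 + 1 / (2 * \<mu>) * ((l r)\<^sup>2 * r\<^sup>2) \<partial>ray)"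
  proof (rule integral_cong_AE)
    show "AE r in ray. ((radial_deriv S r)\<^sup>2 + (S r)\<^sup>2 + (radial_deriv Z r)\<^sup>2 / (2 * \<mu>)) * r\<^sup>2
        = (k r)\<^sup>2 * r\<^sup>2 + (F r)\<^sup>2 * r\<^sup>2 + 1 / (2 * \<mu>) * ((l r)\<^sup>2 * r\<^sup>2)"
      using dS(1) dZ(1) S(2) by eventually_elim (simp add: algebra_simps)
  qed auto
  also have "\<dots> = sq_norm k + sq_norm F + 1 / (2 * \<mu>) * sq_norm l"
    using F(2,3) integrable_mult_right[OF G(2), of "1 / (2 * \<mu>)"]
    by (simp only: sq_norm_def Bochner_Integration.integral_add Bochner_Integration.integrable_add integral_mult_right_zero)
  finally show ?thesis unfolding energy_def integral_ray[symmetric] by simp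
qed

lemma interaction_ray_eq:
  assumes S: "S \<in> borel_measurable ray" "AE r in ray. S r = F r" "F \<in> borel_measurable ray"
    and Z: "Z \<in> borel_measurable ray" "AE r in ray. Z r = G r" "G \<in> borel_measurable ray"
  shows "interaction S Z = 1/2 * (\<integral>r. (F r)\<^sup>2 * G r * r\<^sup>2 \<partial>ray)"
proof -
  note [measurable] = S(1,3) Z(1,3)
  have "(\<integral>r. (S r)\<^sup>2 * Z r * r\<^sup>2 \<partial>ray) = (\<integral>r. (F r)\<^sup>2 * G r * r\<^sup>2 \<partial>ray)"
  proof (rule integral_cong_AE)
    show "AE r in ray. (S r)\<^sup>2 * Z r * r\<^sup>2 = (F r)\<^sup>2 * G r * r\<^sup>2" using S(2) Z(2) by eventually_elim simp
  qed auto
  then show ?thesis unfolding interaction_def integral_ray[symmetric] by simp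
qed

lemma ac_increment_le:
  assumes F: "has_ac_derivative F f" and ab: "0 < a" "a \<le> b" and M: "\<And>x. a \<le> x \<Longrightarrow> x \<le> b \<Longrightarrow> \<bar>f x\<bar> \<le> M"
  shows "\<bar>F b - F a\<bar> \<le> M * (b - a)"
proof -
  have one: "has_ac_derivative (\<lambda>r. r) (\<lambda>r. 1)" using has_ac_derivative_power[of 1] by simp
  have i: "integrable ray (\<lambda>x. M * (indicator {a..b} x * 1))" by (rule integrable_mult_right[OF has_ac_derivativeD(1)[OF one ab]])
  have "\<bar>F b - F a\<bar> = norm (\<integral>x. indicator {a..b} x * f x \<partial>ray)" using has_ac_derivativeD(2)[OF F ab] by simp
  also have "\<dots> \<le> (\<integral>x. norm (indicator {a..b} x * f x) \<partial>ray)" by (rule integral_norm_bound)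
  also have "\<dots> \<le> (\<integral>x. M * (indicator {a..b} x * 1) \<partial>ray)"
  proof (rule integral_mono[OF integrable_norm[OF has_ac_derivativeD(1)[OF F ab]] i])
    fix x show "norm (indicator {a..b} x * f x) \<le> M * (indicator {a..b} x * 1)" using M[of x] by (cases "x \<in> {a..b}") auto
  qed
  also have "\<dots> = M * (b - a)" unfolding integral_mult_right_zero has_ac_derivativeD(2)[OF one ab] ..
  finally show ?thesis .
qed

section \<open>The Newtonian potential of a squared radial function\<close>

context radial_H1_function
begin

text \<open>The integral of m / s^2 from \<open>r\<close> to infinity, written as total minus
  cumulative integral so that the facts about the latter apply.\<close>

definition potential :: "real \<Rightarrow> real" where
  "potential r = (\<integral>s. m s / s\<^sup>2 \<partial>ray) - cumulative (\<lambda>s. m s / s\<^sup>2) r"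

lemma potential_ac: "has_ac_derivative potential (\<lambda>r. - (m r / r\<^sup>2))"
  using has_ac_derivative_add[OF has_ac_derivative_const has_ac_derivative_cmult[OF has_ac_derivative_cumulative[OF field_integrable], of "-1"],
      of "\<integral>s. m s / s\<^sup>2 \<partial>ray"]
  by (simp add: potential_def[abs_def])

lemma potential_measurable [measurable]: "potential \<in> borel_measurable ray"
  by (rule has_ac_derivative_measurable'[OF potential_ac])

lemma potential_continuous: "continuous_on {0<..} potential"
  by (rule has_ac_derivative_continuous[OF potential_ac])

lemma field_continuous: "continuous_on {0<..} (\<lambda>r. c * (m r / r\<^sup>2))"
  by (intro continuous_intros has_ac_derivative_continuous[OF m_ac]) auto

lemma potential_tendsto: "(potential \<longlongrightarrow> 0) at_top"
  using tendsto_diff[OF tendsto_const[of "\<integral>s. m s / s\<^sup>2 \<partial>ray"] cumulative_at_top[OF field_integrable]]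
  by (simp add: potential_def[abs_def])

lemma potential_nonneg: "potential r \<ge> 0"
  unfolding potential_def using cumulative_le[OF field_integrable] by simp

lemma potential_le: "potential r \<le> (\<integral>s. m s / s\<^sup>2 \<partial>ray)"
  unfolding potential_def using cumulative_nonneg[of "\<lambda>s. m s / s\<^sup>2" r] by simp

lemma potential_le_Newton:
  assumes r: "r > 0"
  shows "potential r \<le> sq_norm S / r"
proof -
  have ac': "has_ac_derivative (\<lambda>r. potential r + (- sq_norm S) * (1 / r)) (\<lambda>r. - (m r / r\<^sup>2) + (- sq_norm S) * (- (1 / r\<^sup>2)))"
    by (intro has_ac_derivative_add has_ac_derivative_cmult potential_ac has_ac_derivative_inverse)
  have nn: "- (m x / x\<^sup>2) + (- sq_norm S) * (- (1 / x\<^sup>2)) \<ge> 0" if "x > 0" for x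
    using divide_right_mono[OF m_le[of x], of "x\<^sup>2"] by simp
  have lim: "((\<lambda>r. potential r + (- sq_norm S) * (1 / r)) \<longlongrightarrow> 0 + (- sq_norm S) * 0) at_top"
    by (intro tendsto_intros potential_tendsto) (auto intro!: tendsto_divide_0 filterlim_at_top_imp_at_infinity filterlim_ident)
  have "potential r + (- sq_norm S) * (1 / r) \<le> 0 + (- sq_norm S) * 0"
  proof (rule tendsto_lowerbound[OF lim])
    have "potential r + (- sq_norm S) * (1 / r) \<le> potential b + (- sq_norm S) * (1 / b)" if "r \<le> b" for b
      by (rule has_ac_derivative_mono[OF ac' nn r that])
    then show "\<forall>\<^sub>F b in at_top. potential r + (- sq_norm S) * (1 / r) \<le> potential b + (- sq_norm S) * (1 / b)"
      using eventually_ge_at_top[of r] by (rule eventually_mono[rotated])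
  qed simp
  then show ?thesis by simp
qed

lemma potential_D1:
  shows "radial_D1 (\<lambda>r. - c * potential r) (\<lambda>r. c * (m r / r\<^sup>2))" and "sq_norm (\<lambda>r. c * (m r / r\<^sup>2)) = c\<^sup>2 * self_energy S"
proof -
  have e: "(c * (m r / r\<^sup>2))\<^sup>2 * r\<^sup>2 = c\<^sup>2 * ((m r)\<^sup>2 / r\<^sup>2)" for r
    by (cases "r = 0") (simp_all add: power2_eq_square)
  show "radial_D1 (\<lambda>r. - c * potential r) (\<lambda>r. c * (m r / r\<^sup>2))"
    unfolding radial_D1_def e
  proof (intro conjI integrable_mult_right self_energy_integrable)
    show "has_ac_derivative (\<lambda>r. - c * potential r) (\<lambda>r. c * (m r / r\<^sup>2))"
      using has_ac_derivative_cmult[OF potential_ac, of "- c"] by simp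
    show "((\<lambda>r. - c * potential r) \<longlongrightarrow> 0) at_top" using tendsto_mult[OF tendsto_const[of "- c"] potential_tendsto] by simp
  qed
  show "sq_norm (\<lambda>r. c * (m r / r\<^sup>2)) = c\<^sup>2 * self_energy S"
    unfolding sq_norm_def e self_energy_def by (rule integral_mult_right_zero)
qed

text \<open>The field is bounded near the origin. The potential is bounded, and at most
  \<open>sq_norm S\<close> / r at a distance, so its sixth power times r^2 falls off like
  r^(-4).\<close>

lemma potential_in_D1r: "(\<lambda>r. - c * potential r) \<in> D1r"
proof (rule D1rI[OF potential_D1(1) field_continuous])
  fix R :: real
  have "\<bar>c * (m r / r\<^sup>2)\<bar> \<le> \<bar>c\<bar> * sq_norm k" if "r \<in> {0<..R}" for r
  proof -
    have "m r / r\<^sup>2 \<le> sq_norm k" using m_le_square[of r] that by (simp add: pos_divide_le_eq)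
    then have "\<bar>m r / r\<^sup>2\<bar> \<le> sq_norm k" by simp
    then show ?thesis unfolding abs_mult by (intro mult_left_mono) auto
  qed
  then show "\<exists>C. \<forall>r\<in>{0<..R}. \<bar>c * (m r / r\<^sup>2)\<bar> \<le> C" by blast
next
  let ?H = "\<integral>s. m s / s\<^sup>2 \<partial>ray" and ?B = "sq_norm S"
  have H0: "?H \<ge> 0" by simp
  have i: "integrable ray (\<lambda>r. c ^ 6 * (?H ^ 6 * indicator {..1} r + ?B ^ 6 * (indicator {1..} r * (1 / r\<^sup>2))))"
    by (intro integrable_mult_right Bochner_Integration.integrable_add integrable_ray_initial integrable_inverse_square_tail)
  show "integrable ray (\<lambda>r. (- c * potential r) ^ 6 * r\<^sup>2)"
  proof (rule Bochner_Integration.integrable_bound[OF i])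
    show "AE r in ray. norm ((- c * potential r) ^ 6 * r\<^sup>2) \<le> norm (c ^ 6 * (?H ^ 6 * indicator {..1} r + ?B ^ 6 * (indicator {1..} r * (1 / r\<^sup>2))))"
    proof (rule AE_I2)
      fix r assume "r \<in> space ray"
      then have r: "r > 0" by simp
      define w where "w = ?H ^ 6 * indicator {..1} r + ?B ^ 6 * (indicator {1..} r * (1 / r\<^sup>2))"
      have w1: "?H ^ 6 * indicator {..1} r \<le> w" "?B ^ 6 * (indicator {1..} r * (1 / r\<^sup>2)) \<le> w" using H0 by (auto simp: w_def)
      have w0: "w \<ge> 0" using H0 by (auto simp: w_def)
      have "potential r ^ 6 * r\<^sup>2 \<le> w"
      proof (cases "r \<le> 1")
        case True
        have "potential r ^ 6 * r\<^sup>2 \<le> ?H ^ 6 * 1"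
          using potential_le[of r] potential_nonneg[of r] True r by (intro mult_mono power_mono power_le_one) auto
        then show ?thesis using w1(1) True by simp
      next
        case False
        have "potential r ^ 6 * r\<^sup>2 \<le> (?B / r) ^ 6 * r\<^sup>2"
          using potential_le_Newton[OF r] potential_nonneg[of r] by (intro mult_right_mono power_mono) auto
        also have "\<dots> = ?B ^ 6 * (1 / r ^ 4)" using r by (simp add: power_divide field_simps power_numeral_reduce)
        also have "\<dots> \<le> ?B ^ 6 * (1 / r\<^sup>2)" using False r power_increasing[of 2 4 r] by (intro mult_left_mono divide_left_mono) auto
        finally show ?thesis using w1(2) False by simp
      qed
      then have "c ^ 6 * (potential r ^ 6 * r\<^sup>2) \<le> c ^ 6 * w" by (intro mult_left_mono zero_le_even_power) auto
      moreover have "(- c * potential r) ^ 6 * r\<^sup>2 = c ^ 6 * (potential r ^ 6 * r\<^sup>2)" by (simp add: power_mult_distrib)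
      moreover have "0 \<le> c ^ 6 * w" "0 \<le> c ^ 6 * (potential r ^ 6 * r\<^sup>2)" using w0 by (auto simp: zero_le_even_power)
      ultimately show "norm ((- c * potential r) ^ 6 * r\<^sup>2) \<le> norm (c ^ 6 * (?H ^ 6 * indicator {..1} r + ?B ^ 6 * (indicator {1..} r * (1 / r\<^sup>2))))"
        unfolding w_def[symmetric] real_norm_def by (simp only: abs_of_nonneg)
    qed
  qed measurable
qed

text \<open>The constraint says that the integral of m l is 2, so the integral of (l r - c m / r)^2
  equals D - 4 c + c^2 K. The optimal choice c = 2 / K gives the bound, and equality forces the
  square to vanish.\<close>

lemma constrained_Dirichlet_bound:
  assumes Z: "radial_D1 Z l" and I: "(\<integral>r. (S r)\<^sup>2 * Z r * r\<^sup>2 \<partial>ray) = -2"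
  shows "4 \<le> self_energy S * sq_norm l"
    and "self_energy S * sq_norm l = 4 \<Longrightarrow> AE r in ray. l r = 2 / self_energy S * (m r / r\<^sup>2)"
proof -
  have l2: "integrable ray (\<lambda>r. (l r)\<^sup>2 * r\<^sup>2)" and Zac: "has_ac_derivative Z l" using Z by (auto simp: radial_D1_def)
  note [measurable] = has_ac_derivative_measurable[OF Zac]
  have ml: "(\<integral>r. m r * l r \<partial>ray) = 2" "integrable ray (\<lambda>r. m r * l r)" using interaction_eq[OF Z] I by simp_all
  let ?K = "self_energy S" and ?D = "sq_norm l"
  have sq: "(\<integral>r. (l r * r - c * (m r / r))\<^sup>2 \<partial>ray) = ?D - 4 * c + c\<^sup>2 * ?K" 
    and sqi: "integrable ray (\<lambda>r. (l r * r - c * (m r / r))\<^sup>2)" for c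
  proof -
    have e: "(l r * r - c * (m r / r))\<^sup>2 = (l r)\<^sup>2 * r\<^sup>2 - 2 * c * (m r * l r) + c\<^sup>2 * ((m r)\<^sup>2 / r\<^sup>2)" if "r \<in> space ray" for r
      using that by (simp add: power2_diff power_mult_distrib power_divide)
    have j: "integrable ray (\<lambda>r. (l r)\<^sup>2 * r\<^sup>2 - 2 * c * (m r * l r))" "integrable ray (\<lambda>r. c\<^sup>2 * ((m r)\<^sup>2 / r\<^sup>2))"
      by (intro Bochner_Integration.integrable_diff integrable_mult_right l2 ml self_energy_integrable)+
    show "integrable ray (\<lambda>r. (l r * r - c * (m r / r))\<^sup>2)"
      by (rule Bochner_Integration.integrable_cong[OF refl e, THEN iffD2]) (auto intro!: Bochner_Integration.integrable_add j simp del: times_divide_eq_right)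
    have "(\<integral>r. (l r * r - c * (m r / r))\<^sup>2 \<partial>ray) = (\<integral>r. (l r)\<^sup>2 * r\<^sup>2 - 2 * c * (m r * l r) + c\<^sup>2 * ((m r)\<^sup>2 / r\<^sup>2) \<partial>ray)"
      by (rule Bochner_Integration.integral_cong[OF refl e])
    also have "\<dots> = (\<integral>r. (l r)\<^sup>2 * r\<^sup>2 - 2 * c * (m r * l r) \<partial>ray) + (\<integral>r. c\<^sup>2 * ((m r)\<^sup>2 / r\<^sup>2) \<partial>ray)"
      by (rule Bochner_Integration.integral_add[OF j])
    also have "(\<integral>r. (l r)\<^sup>2 * r\<^sup>2 - 2 * c * (m r * l r) \<partial>ray) = ?D - 2 * c * 2"
      unfolding sq_norm_def ml(1)[symmetric] integral_mult_right_zero[symmetric]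
      by (rule Bochner_Integration.integral_diff[OF l2 integrable_mult_right[OF ml(2)]])
    also have "(\<integral>r. c\<^sup>2 * ((m r)\<^sup>2 / r\<^sup>2) \<partial>ray) = c\<^sup>2 * ?K" unfolding self_energy_def by (rule integral_mult_right_zero)
    finally show "(\<integral>r. (l r * r - c * (m r / r))\<^sup>2 \<partial>ray) = ?D - 4 * c + c\<^sup>2 * ?K" by simp
  qed
  have ge: "?D - 4 * c + c\<^sup>2 * ?K \<ge> 0" for c unfolding sq[symmetric] by simp
  have K: "?K > 0"
  proof (rule ccontr)
    assume "\<not> ?thesis"
    then have "?K = 0" using self_energy_nonneg[of S] by linarith
    \<comment> \<open>With K = 0 the expression at c = D + 1 is D - 4 (D + 1), which is
      negative.\<close>
    then show False using ge[of "?D + 1"] sq_norm_nonneg[of l] by simp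
  qed
  have "?D - 4 * (2 / ?K) + (2 / ?K)\<^sup>2 * ?K = ?D - 4 / ?K" using K by (simp add: power2_eq_square)
  then have D: "?D - 4 / ?K \<ge> 0" using ge[of "2 / ?K"] by simp
  then show "4 \<le> ?K * ?D" using K by (simp add: field_simps)
  assume "?K * ?D = 4"
  then have "?D = 4 / ?K" using K by (simp add: field_simps)
  then have "(\<integral>r. (l r * r - 2 / ?K * (m r / r))\<^sup>2 \<partial>ray) = 0"
    unfolding sq using \<open>?D - 4 * (2 / ?K) + (2 / ?K)\<^sup>2 * ?K = ?D - 4 / ?K\<close> by simp
  then have "AE r in ray. (l r * r - 2 / ?K * (m r / r))\<^sup>2 = 0"
    using sqi[of "2 / ?K"] by (subst (asm) integral_nonneg_eq_0_iff_AE) auto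
  moreover have "AE r in ray. r > 0" unfolding AE_ray by simp
  ultimately show "AE r in ray. l r = 2 / ?K * (m r / r\<^sup>2)"
  proof eventually_elim
    case (elim r)
    have "l r = l r * r / r" using elim(2) by simp
    also have "l r * r = 2 / ?K * (m r / r)" using elim(1) by simp
    finally show ?case by (simp add: power2_eq_square)
  qed
qed

end

section \<open>First variation and regularity of maximisers\<close>

lemma stationary_quadratic:
  fixes K N L M P :: real
  assumes "\<And>t. 4 * t * P \<le> K * ((N + 2 * t * L + t\<^sup>2 * M)\<^sup>2 - N\<^sup>2)"
  shows "P = K * N * L"
proof -
  \<comment> \<open>The hypothesis makes \<open>f\<close> nonnegative, and \<open>f\<close> vanishes
    at 0; the derivative at this minimum is zero.\<close>
  define f where "f t = K * ((N + 2 * t * L + t\<^sup>2 * M)\<^sup>2 - N\<^sup>2) - 4 * t * P" for t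
  have "(f has_real_derivative K * (2 * N * (2 * L)) - 4 * P) (at 0)"
    unfolding f_def[abs_def] by (auto intro!: derivative_eq_intros)
  moreover have "\<forall>y. \<bar>0 - y\<bar> < 1 \<longrightarrow> f 0 \<le> f y" using assms by (simp add: f_def)
  ultimately have "K * (2 * N * (2 * L)) - 4 * P = 0" by (rule DERIV_local_min[OF _ zero_less_one])
  then show ?thesis by simp
qed

text \<open>Here \<kappa> is the best constant in the quartic inequality, and \<open>S\<close>
  attains it with arbitrary norm. The locale thus covers the scaled maximiser as well as the first
  component of an arbitrary minimiser.\<close>

locale self_energy_extremal = radial_H1_function +
  fixes \<kappa> N
  assumes N_def: "N = sq_norm k + sq_norm S" and N_pos: "N > 0" and \<kappa>_pos: "\<kappa> > 0"
    and K_eq: "self_energy S = \<kappa> * N\<^sup>2"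
    and extremal: "\<And>U u. radial_H1 U u \<Longrightarrow> self_energy U \<le> \<kappa> * (sq_norm u + sq_norm U)\<^sup>2"
begin

text \<open>The right-hand side of the Euler-Lagrange equation in divergence form, (r^2 S')' =
  f.\<close>

abbreviation "f \<equiv> \<lambda>r. r\<^sup>2 * S r * (1 - potential r / (\<kappa> * N))"

text \<open>The self-energy of \<open>S + t \<phi>\<close> is bounded below by its
  linearisation, since \<open>(a + b)\<^sup>2 \<ge> a\<^sup>2 + 2 a b\<close> and the quadratic term of the mass is nonnegative.\<close>

lemma Euler_Lagrange_test:
  assumes \<phi>: "test_function {0<..} \<phi>"
  shows "(\<integral>r. (r\<^sup>2 * k r) * frechet_derivative \<phi> (at r) 1 \<partial>ray) = - (\<integral>r. f r * \<phi> r \<partial>ray)"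
proof -
  obtain \<phi>' a b where ab: "0 < a" "a \<le> b" and z: "\<And>x. x \<notin> {a..b} \<Longrightarrow> \<phi> x = 0" "\<And>x. x \<notin> {a..b} \<Longrightarrow> \<phi>' x = 0"
    and d: "\<And>x::real. (\<phi> has_real_derivative \<phi>' x) (at x)" and c': "continuous_on UNIV \<phi>'"
    and fr: "\<And>x. frechet_derivative \<phi> (at x) 1 = \<phi>' x"
    by (rule test_function_ray[OF \<phi>]) blast
  have c: "continuous_on UNIV \<phi>" using d by (auto intro!: continuous_at_imp_continuous_on DERIV_isCont)
  have cr: "continuous_on {0<..} \<phi>" "continuous_on {0<..} \<phi>'" using c c' by (auto intro: continuous_on_subset)
  have Sc: "continuous_on {0<..} S" by (rule has_ac_derivative_continuous[OF ac])
  have \<phi>H: "radial_H1 \<phi> \<phi>'" unfolding radial_H1_def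
  proof (intro conjI)
    show "has_ac_derivative \<phi> \<phi>'" by (rule has_ac_derivative_C1[OF d cr(2)])
    show "integrable ray (\<lambda>r. (\<phi>' r)\<^sup>2 * r\<^sup>2)"
      by (rule integrable_ray_continuous[OF _ _ ab(1), of _ b]) (use z cr in \<open>auto intro!: continuous_intros\<close>)
    show "integrable ray (\<lambda>r. (\<phi> r)\<^sup>2 * r\<^sup>2)"
      by (rule integrable_ray_continuous[OF _ _ ab(1), of _ b]) (use z cr in \<open>auto intro!: continuous_intros\<close>)
  qed
  interpret \<phi>: radial_H1_function \<phi> \<phi>' using \<phi>H by unfold_locales
  have ih: "integrable ray (\<lambda>r. S r * \<phi> r * r\<^sup>2)"
    by (rule integrable_ray_continuous[OF _ _ ab(1), of _ b]) (use z cr Sc in \<open>auto intro!: continuous_intros\<close>)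
  have ik: "integrable ray (\<lambda>r. (k r * r) * (\<phi>' r * r))"
    by (rule integrable_mult_L2) (use k2 \<phi>.k2 in \<open>auto simp: power_mult_distrib\<close>)
  \<comment> \<open>The cross term in the mass: that of S + t \<phi> is m + 2 t p plus t^2 times the
    mass of \<phi>.\<close>
  define p where "p = cumulative (\<lambda>r. S r * \<phi> r * r\<^sup>2)"
  have p_ac: "has_ac_derivative p (\<lambda>r. S r * \<phi> r * r\<^sup>2)" unfolding p_def by (rule has_ac_derivative_cumulative[OF ih])
  note [measurable] = has_ac_derivative_measurable'[OF p_ac]
  define B where "B = (\<integral>r. \<bar>S r * \<phi> r * r\<^sup>2\<bar> \<partial>ray)"
  have pB: "\<bar>p r\<bar> \<le> B" for r
  proof -
    have "\<bar>p r\<bar> \<le> (\<integral>s. norm (indicator {..r} s * (S s * \<phi> s * s\<^sup>2)) \<partial>ray)"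
      unfolding p_def cumulative_def using integral_norm_bound[of ray "\<lambda>s. indicator {..r} s * (S s * \<phi> s * s\<^sup>2)"] by simp
    also have "\<dots> \<le> B" unfolding B_def
      by (rule integral_mono[OF integrable_norm[OF integrable_cumulative[OF ih]] integrable_abs[OF ih]]) (auto simp: indicator_def)
    finally show ?thesis .
  qed
  have pz: "p r = 0" if "r < a" for r
  proof -
    have "p r = (\<integral>s. 0 \<partial>ray)" unfolding p_def cumulative_def
      by (rule Bochner_Integration.integral_cong) (use z that in \<open>auto simp: indicator_def\<close>)
    then show ?thesis by simp
  qed
  have ip: "integrable ray (\<lambda>r. p r * (m r / r\<^sup>2))"
  proof (rule Bochner_Integration.integrable_bound[where f="\<lambda>r. B * (m r / r\<^sup>2)"])
    show "integrable ray (\<lambda>r. B * (m r / r\<^sup>2))" by (rule integrable_mult_right[OF field_integrable])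
    show "AE r in ray. norm (p r * (m r / r\<^sup>2)) \<le> norm (B * (m r / r\<^sup>2))"
    proof (rule AE_I2)
      fix r
      have "\<bar>p r\<bar> * \<bar>m r / r\<^sup>2\<bar> \<le> \<bar>B\<bar> * \<bar>m r / r\<^sup>2\<bar>" using pB[of r] by (intro mult_right_mono) auto
      then show "norm (p r * (m r / r\<^sup>2)) \<le> norm (B * (m r / r\<^sup>2))" by (simp only: real_norm_def abs_mult)
    qed
  qed measurable
  define P where "P = (\<integral>r. p r * (m r / r\<^sup>2) \<partial>ray)"
  define L where "L = (\<integral>r. (k r * r) * (\<phi>' r * r) \<partial>ray) + (\<integral>r. S r * \<phi> r * r\<^sup>2 \<partial>ray)"
  define M where "M = sq_norm \<phi>' + sq_norm \<phi>"
  have N_expand: "sq_norm (\<lambda>r. 1 * k r + t * \<phi>' r) + sq_norm (\<lambda>r. 1 * S r + t * \<phi> r) = N + 2 * t * L + t\<^sup>2 * M" for t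
  proof -
    have "sq_norm (\<lambda>r. 1 * k r + t * \<phi>' r) = (\<integral>r. (k r)\<^sup>2 * r\<^sup>2 + 2 * t * ((k r * r) * (\<phi>' r * r)) + t\<^sup>2 * ((\<phi>' r)\<^sup>2 * r\<^sup>2) \<partial>ray)"
      unfolding sq_norm_def by (rule Bochner_Integration.integral_cong) (auto simp: power2_eq_square algebra_simps)
    also have "\<dots> = sq_norm k + 2 * t * (\<integral>r. (k r * r) * (\<phi>' r * r) \<partial>ray) + t\<^sup>2 * sq_norm \<phi>'"
      unfolding sq_norm_def using k2 ik \<phi>.k2
      by (simp only: Bochner_Integration.integral_add Bochner_Integration.integrable_add integrable_mult_right integral_mult_right_zero)
    finally have 1: "sq_norm (\<lambda>r. 1 * k r + t * \<phi>' r) = sq_norm k + 2 * t * (\<integral>r. (k r * r) * (\<phi>' r * r) \<partial>ray) + t\<^sup>2 * sq_norm \<phi>'" .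
    have "sq_norm (\<lambda>r. 1 * S r + t * \<phi> r) = (\<integral>r. (S r)\<^sup>2 * r\<^sup>2 + 2 * t * (S r * \<phi> r * r\<^sup>2) + t\<^sup>2 * ((\<phi> r)\<^sup>2 * r\<^sup>2) \<partial>ray)"
      unfolding sq_norm_def by (rule Bochner_Integration.integral_cong) (auto simp: power2_eq_square algebra_simps)
    also have "\<dots> = sq_norm S + 2 * t * (\<integral>r. S r * \<phi> r * r\<^sup>2 \<partial>ray) + t\<^sup>2 * sq_norm \<phi>"
      unfolding sq_norm_def using S2 ih \<phi>.S2
      by (simp only: Bochner_Integration.integral_add Bochner_Integration.integrable_add integrable_mult_right integral_mult_right_zero)
    finally have 2: "sq_norm (\<lambda>r. 1 * S r + t * \<phi> r) = sq_norm S + 2 * t * (\<integral>r. S r * \<phi> r * r\<^sup>2 \<partial>ray) + t\<^sup>2 * sq_norm \<phi>" .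
    show ?thesis unfolding 1 2 N_def L_def M_def by (simp add: algebra_simps)
  qed
  have K_lower: "self_energy S + 4 * t * P \<le> self_energy (\<lambda>r. 1 * S r + t * \<phi> r)" for t
  proof -
    interpret T: radial_H1_function "\<lambda>r. 1 * S r + t * \<phi> r" "\<lambda>r. 1 * k r + t * \<phi>' r"
      by unfold_locales (rule radial_H1_combination[OF H1 \<phi>H])
    have mT: "T.m r = m r + 2 * t * p r + t\<^sup>2 * \<phi>.m r" for r
    proof -
      have "T.m r = (\<integral>s. indicator {..r} s * ((S s)\<^sup>2 * s\<^sup>2) + 2 * t * (indicator {..r} s * (S s * \<phi> s * s\<^sup>2))
          + t\<^sup>2 * (indicator {..r} s * ((\<phi> s)\<^sup>2 * s\<^sup>2)) \<partial>ray)"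
        unfolding cumulated_mass_def cumulative_def
        by (rule Bochner_Integration.integral_cong) (auto simp: power2_eq_square algebra_simps)
      also have "\<dots> = m r + 2 * t * p r + t\<^sup>2 * \<phi>.m r"
        unfolding cumulated_mass_def cumulative_def p_def
        using integrable_cumulative[OF S2] integrable_cumulative[OF ih] integrable_cumulative[OF \<phi>.S2]
        by (simp only: Bochner_Integration.integral_add Bochner_Integration.integrable_add integrable_mult_right integral_mult_right_zero)
      finally show ?thesis .
    qed
    have "self_energy S + 4 * t * P = (\<integral>r. (m r)\<^sup>2 / r\<^sup>2 + 4 * t * (p r * (m r / r\<^sup>2)) \<partial>ray)"
      unfolding self_energy_def P_def using self_energy_integrable ip
      by (simp only: Bochner_Integration.integral_add integrable_mult_right integral_mult_right_zero)
    also have "\<dots> \<le> self_energy (\<lambda>r. 1 * S r + t * \<phi> r)"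
      unfolding self_energy_def
    proof (rule integral_mono[OF Bochner_Integration.integrable_add[OF self_energy_integrable integrable_mult_right[OF ip]] T.self_energy_integrable])
      fix r
      have "(m r)\<^sup>2 + 2 * m r * (2 * t * p r) \<le> (m r)\<^sup>2 + 2 * m r * (2 * t * p r + t\<^sup>2 * \<phi>.m r)"
        by (intro add_left_mono mult_left_mono) auto
      also have "\<dots> \<le> (m r + (2 * t * p r + t\<^sup>2 * \<phi>.m r))\<^sup>2" unfolding power2_sum[of "m r"] by simp
      also have "m r + (2 * t * p r + t\<^sup>2 * \<phi>.m r) = T.m r" by (simp only: mT add.assoc)
      finally have "((m r)\<^sup>2 + 2 * m r * (2 * t * p r)) / r\<^sup>2 \<le> (T.m r)\<^sup>2 / r\<^sup>2" by (rule divide_right_mono) simp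
      moreover have "((m r)\<^sup>2 + 2 * m r * (2 * t * p r)) / r\<^sup>2 = (m r)\<^sup>2 / r\<^sup>2 + 4 * t * (p r * (m r / r\<^sup>2))"
        by (simp add: add_divide_distrib)
      ultimately show "(m r)\<^sup>2 / r\<^sup>2 + 4 * t * (p r * (m r / r\<^sup>2)) \<le> (T.m r)\<^sup>2 / r\<^sup>2" by simp
    qed
    finally show ?thesis .
  qed
  have "P = \<kappa> * N * L"
  proof (rule stationary_quadratic[where M=M])
    fix t
    have "self_energy (\<lambda>r. 1 * S r + t * \<phi> r) \<le> \<kappa> * (N + 2 * t * L + t\<^sup>2 * M)\<^sup>2"
      using extremal[OF radial_H1_combination[OF H1 \<phi>H, of 1 t]] unfolding N_expand .
    then show "4 * t * P \<le> \<kappa> * ((N + 2 * t * L + t\<^sup>2 * M)\<^sup>2 - N\<^sup>2)"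
      using K_lower[of t] K_eq by (simp add: right_diff_distrib)
  qed
  then have LP: "L = P / (\<kappa> * N)" using N_pos \<kappa>_pos by simp
  have iW: "integrable ray (\<lambda>r. S r * \<phi> r * r\<^sup>2 * potential r)"
    by (rule integrable_ray_continuous[OF _ _ ab(1), of _ b]) (use z cr Sc potential_continuous in \<open>auto intro!: continuous_intros\<close>)
  have "integral\<^sup>L ray (\<lambda>r. S r * \<phi> r * r\<^sup>2 * potential r + p r * (- (m r / r\<^sup>2))) = 0"
  \<comment> \<open>The potential has derivative -m / r^2, so partial integration turns
    \<open>P\<close> into an integral against \<phi>. Near the origin \<open>p\<close> vanishes; at
    infinity \<open>p\<close> is bounded and the potential tends to 0.\<close>
  proof (rule integral_ac_derivative_eq_0[OF has_ac_derivative_mult[OF p_ac potential_ac]])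
    show "integrable ray (\<lambda>r. S r * \<phi> r * r\<^sup>2 * potential r + p r * (- (m r / r\<^sup>2)))"
      using iW ip by simp
    show "vanishes_at_ends (\<lambda>r. p r * potential r)"
    proof (rule vanishes_at_endsI)
      have "\<forall>\<^sub>F r in at_right 0. p r * potential r = 0"
        unfolding eventually_at_right_field using ab(1) pz by (intro exI[of _ a]) auto
      then show "((\<lambda>r. p r * potential r) \<longlongrightarrow> 0) (at_right 0)" by (rule tendsto_eventually)
      have "((\<lambda>r. B * potential r) \<longlongrightarrow> B * 0) at_top" by (intro tendsto_intros potential_tendsto)
      then have B0: "((\<lambda>r. B * potential r) \<longlongrightarrow> 0) at_top" by simp
      have "norm (p r * potential r) \<le> B * potential r" for r
        using mult_right_mono[OF pB[of r] potential_nonneg[of r]] potential_nonneg[of r] by (simp add: abs_mult)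
      then show "((\<lambda>r. p r * potential r) \<longlongrightarrow> 0) at_top"
        by (intro Lim_null_comparison[OF _ B0] always_eventually allI)
    qed
  qed
  then have PW: "P = (\<integral>r. S r * \<phi> r * r\<^sup>2 * potential r \<partial>ray)" using iW ip by (simp add: P_def)
  have "(\<integral>r. f r * \<phi> r \<partial>ray) = (\<integral>r. S r * \<phi> r * r\<^sup>2 - 1 / (\<kappa> * N) * (S r * \<phi> r * r\<^sup>2 * potential r) \<partial>ray)"
    by (rule Bochner_Integration.integral_cong) (auto simp: algebra_simps)
  also have "\<dots> = (\<integral>r. S r * \<phi> r * r\<^sup>2 \<partial>ray) - 1 / (\<kappa> * N) * P"
    unfolding PW using ih iW
    by (simp only: Bochner_Integration.integral_diff integrable_mult_right integral_mult_right_zero)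
  also have "\<dots> = - (\<integral>r. (k r * r) * (\<phi>' r * r) \<partial>ray)" using LP by (simp add: L_def)
  also have "(\<integral>r. (k r * r) * (\<phi>' r * r) \<partial>ray) = (\<integral>r. (r\<^sup>2 * k r) * frechet_derivative \<phi> (at r) 1 \<partial>ray)"
    by (rule Bochner_Integration.integral_cong) (auto simp: fr power2_eq_square)
  finally show ?thesis by simp
qed

lemma f_continuous: "continuous_on {0<..} f"
  using N_pos \<kappa>_pos by (intro continuous_intros has_ac_derivative_continuous[OF ac] potential_continuous) auto

text \<open>Radial decay bounds \<open>S\<close> by a multiple of r^(-1/2), so s |S s| is bounded on
  \<open>{0<..R}\<close>; the other factor s remains.\<close>

lemma f_bound: "\<exists>C\<ge>0. \<forall>s\<in>{0<..R}. \<bar>f s\<bar> \<le> C * s"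
proof (intro exI conjI ballI)
  let ?H = "\<integral>s. m s / s\<^sup>2 \<partial>ray"
  let ?C = "sqrt (sq_norm k) * sqrt \<bar>R\<bar> * (1 + ?H / (\<kappa> * N))"
  have H0: "?H \<ge> 0" by simp
  then have q0: "?H / (\<kappa> * N) \<ge> 0" using N_pos \<kappa>_pos by (intro divide_nonneg_pos mult_pos_pos)
  then show "?C \<ge> 0" by (intro mult_nonneg_nonneg add_nonneg_nonneg) auto
  fix s assume s: "s \<in> {0<..R}"
  have "s * \<bar>S s\<bar> \<le> s * (sqrt (sq_norm k) / sqrt s)" using decay[of s] s by (intro mult_left_mono) auto
  also have "\<dots> = sqrt (sq_norm k) * (s / sqrt s)" by simp
  also have "s / sqrt s = sqrt s" using s by (simp add: real_div_sqrt)
  also have "sqrt (sq_norm k) * sqrt s \<le> sqrt (sq_norm k) * sqrt \<bar>R\<bar>" using s by (intro mult_left_mono) auto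
  finally have 1: "s * \<bar>S s\<bar> \<le> sqrt (sq_norm k) * sqrt \<bar>R\<bar>" .
  have "0 \<le> potential s / (\<kappa> * N)" using N_pos \<kappa>_pos by (intro divide_nonneg_pos mult_pos_pos potential_nonneg)
  moreover have "potential s / (\<kappa> * N) \<le> ?H / (\<kappa> * N)" using N_pos \<kappa>_pos by (intro divide_right_mono potential_le) auto
  ultimately have 2: "\<bar>1 - potential s / (\<kappa> * N)\<bar> \<le> 1 + ?H / (\<kappa> * N)" by linarith
  have "\<bar>f s\<bar> = s * (s * \<bar>S s\<bar> * \<bar>1 - potential s / (\<kappa> * N)\<bar>)" using s by (simp add: abs_mult power2_eq_square)
  also have "\<dots> \<le> s * ?C" by (intro mult_left_mono mult_mono[OF 1 2]) (use s in auto)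
  finally show "\<bar>f s\<bar> \<le> ?C * s" by (simp add: mult.commute)
qed

text \<open>The weak equation gives r^2 k a continuous representative Q with derivative
  \<open>f\<close>, and q = Q / r^2. Square-integrability of q r makes Q small at some points near
  the origin, which excludes a part of order 1/r^2 in q; with |f| \<le> C s this gives |Q| \<le> C
  r^2.\<close>

lemma regular_derivative:
  obtains q where "radial_H1 S q" "AE r in ray. k r = q r" "sq_norm q = sq_norm k" "continuous_on {0<..} q"
    "\<And>R. \<exists>C. \<forall>r\<in>{0<..R}. \<bar>q r\<bar> \<le> C"
    "has_ac_derivative q (\<lambda>r. S r * (1 - potential r / (\<kappa> * N)) - 2 / r * q r)"
proof -
  have "locally_integrable {0<..} (\<lambda>r. r\<^sup>2 * k r)"
    unfolding locally_integrable_ray_iff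
  proof (intro allI impI)
    fix a b :: real assume ab: "0 < a" "a \<le> b"
    have "integrable ray (\<lambda>r. indicator {a..b} r * (k r * r\<^sup>2))"
      by (rule has_ac_derivative_bounded_mult[OF ac _ ab]) (intro continuous_intros)
    then show "integrable ray (\<lambda>r. indicator {a..b} r * (r\<^sup>2 * k r))" by (simp add: mult.commute)
  qed
  moreover have "locally_integrable {0<..} f"
    unfolding locally_integrable_def set_integrable_def
    using borel_integrable_compact continuous_on_subset[OF f_continuous] by blast
  ultimately have "has_weak_gradient (\<lambda>r. r\<^sup>2 * k r) f {0<..}"
    unfolding has_weak_gradient_ray_iff using Euler_Lagrange_test by blast
  then obtain Q where Q: "has_ac_derivative Q f" "AE r in ray. r\<^sup>2 * k r = Q r" by (rule has_weak_gradient_ray_ac)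
  define q where "q r = (1 / r) * ((1 / r) * Q r)" for r
  have Qq: "Q r = r\<^sup>2 * q r" if "r > 0" for r using that by (simp add: q_def power2_eq_square)
  have qc: "continuous_on {0<..} q" unfolding q_def[abs_def]
    by (intro continuous_intros has_ac_derivative_continuous[OF Q(1)]) auto
  note [measurable] = continuous_measurable_ray[OF qc]
  have kq: "AE r in ray. k r = q r"
  proof -
    have "AE r in ray. r > 0" unfolding AE_ray by simp
    with Q(2) show ?thesis by eventually_elim (simp add: q_def power2_eq_square field_simps)
  qed
  have "has_ac_derivative q (\<lambda>r. - (1 / r\<^sup>2) * ((1 / r) * Q r) + 1 / r * (- (1 / r\<^sup>2) * Q r + 1 / r * f r))"
    unfolding q_def[abs_def] by (intro has_ac_derivative_mult has_ac_derivative_inverse Q(1))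
  then have q_ac: "has_ac_derivative q (\<lambda>r. S r * (1 - potential r / (\<kappa> * N)) - 2 / r * q r)"
  proof (rule has_ac_derivative_eqI)
    fix r :: real assume r: "r > 0"
    show "- (1 / r\<^sup>2) * ((1 / r) * Q r) + 1 / r * (- (1 / r\<^sup>2) * Q r + 1 / r * f r) = S r * (1 - potential r / (\<kappa> * N)) - 2 / r * q r"
    proof -
      have "1 / r * (1 / r * (r\<^sup>2 * X * Y)) = X * Y" for X Y :: real using r by (simp add: power2_eq_square)
      from this[of "S r" "1 - potential r / (\<kappa> * N)"]
      have X: "1 / r * (1 / r * f r) = S r * (1 - potential r / (\<kappa> * N))" .
      have q: "1 / r\<^sup>2 * (1 / r * Q r) = q r / r" "1 / r * (1 / r\<^sup>2 * Q r) = q r / r"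
        using r by (simp_all add: Qq)
      have expand: "- v * (u * X) + u * (- v * X + Y) = - (v * (u * X)) - u * (v * X) + u * Y" for u v X Y :: real
        by (simp add: algebra_simps)
      show ?thesis unfolding expand X q by simp
    qed
  qed simp
  have q2: "integrable ray (\<lambda>r. (q r)\<^sup>2 * r\<^sup>2)"
    using k2 by (rule integrable_cong_AE_imp) (use kq in \<open>auto elim: eventually_mono\<close>)
  have H1q: "radial_H1 S q" unfolding radial_H1_def
  proof (intro conjI q2 S2)
    show "has_ac_derivative S q" by (rule has_ac_derivative_cong[OF ac refl kq]) simp
  qed
  have nq: "sq_norm q = sq_norm k" unfolding sq_norm_def
    by (rule integral_cong_AE) (use kq in \<open>auto elim: eventually_mono\<close>)
  have bd: "\<exists>C. \<forall>r\<in>{0<..R}. \<bar>q r\<bar> \<le> C" for R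
  proof -
    obtain C where C: "C \<ge> 0" "\<And>s. s \<in> {0<..R} \<Longrightarrow> \<bar>f s\<bar> \<le> C * s" using f_bound[of R] by blast
    have "\<bar>q r\<bar> \<le> C" if r: "r \<in> {0<..R}" for r
    proof -
      have "\<bar>Q r\<bar> \<le> C * r\<^sup>2 + e" if e: "e > 0" for e
      proof -
        \<comment> \<open>Bounding \<open>d\<close> by \<open>r\<close> keeps the point
          \<open>a\<close>, at which \<open>Q\<close> is small, to the left of
          \<open>r\<close>.\<close>
        define d where "d = min e r"
        have d: "d > 0" "d \<le> e" "d \<le> r" using e r by (auto simp: d_def)
        obtain a where a: "0 < a" "a < d" "a * ((q a)\<^sup>2 * a\<^sup>2) < d"
          using integrable_ray_small_values(1)[OF q2 _ d(1)] by auto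
        have "(Q a)\<^sup>2 = a * (a * ((q a)\<^sup>2 * a\<^sup>2))" unfolding Qq[OF a(1)] by (simp add: power2_eq_square)
        also have "\<dots> \<le> d * d" using a by (intro mult_mono) auto
        finally have "\<bar>Q a\<bar> \<le> d" using d(1) by (simp add: power2_eq_square[symmetric] power2_le_iff_abs_le)
        moreover have "\<bar>Q r - Q a\<bar> \<le> C * r * (r - a)"
        proof (rule ac_increment_le[OF Q(1) a(1)])
          show "a \<le> r" using a d by linarith
          fix x assume x: "a \<le> x" "x \<le> r"
          have "\<bar>f x\<bar> \<le> C * x" using C(2)[of x] x a r by auto
          also have "\<dots> \<le> C * r" using x C(1) by (intro mult_left_mono)
          finally show "\<bar>f x\<bar> \<le> C * r" .
        qed
        moreover have "C * r * (r - a) \<le> C * r * r" using C(1) r a by (intro mult_left_mono) auto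
        ultimately show ?thesis using d(2) by (simp add: power2_eq_square)
      qed
      then have "\<bar>Q r\<bar> \<le> C * r\<^sup>2" by (rule field_le_epsilon)
      then have "r\<^sup>2 * \<bar>q r\<bar> \<le> r\<^sup>2 * C" using r by (simp add: Qq abs_mult mult.commute)
      then show ?thesis using r by simp
    qed
    then show ?thesis by blast
  qed
  show ?thesis by (rule that[OF H1q kq nq qc bd q_ac])
qed

end

section \<open>Minimisers of the energy\<close>

lemma divide_measurable_ray: "q \<in> borel_measurable ray \<Longrightarrow> (\<lambda>r. c / r * q r) \<in> borel_measurable ray" for q :: "real \<Rightarrow> real"
  by (rule borel_measurable_times[OF borel_measurable_ray]) auto

text \<open>The first weak derivative in the Laplacian agrees with \<open>k\<close> almost
  everywhere, and it is itself weakly differentiable, hence has an absolutely continuous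
  representative.\<close>

lemma has_radial_laplacian_representative:
  assumes L: "has_radial_laplacian u L" and F: "has_ac_derivative F k" "AE r in ray. u r = F r"
    and R: "R \<in> borel_measurable ray" "AE r in ray. L r = R r"
  obtains q where "AE r in ray. k r = q r" "has_ac_derivative q (\<lambda>r. R r - 2 / r * q r)"
proof -
  obtain u' u'' where u: "has_weak_gradient u u' {0<..}" "has_weak_gradient u' u'' {0<..}"
    and Lu: "AE r in ray. L r = u'' r + 2 / r * u' r"
    using L unfolding has_radial_laplacian_def AE_ray by blast
  have u'k: "AE r in ray. u' r = k r" by (rule has_weak_gradient_ray_unique[OF u(1) F])
  obtain q where q: "has_ac_derivative q u''" "AE r in ray. u' r = q r" by (rule has_weak_gradient_ray_ac[OF u(2)])
  note qm = has_ac_derivative_measurable'[OF q(1)]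
  have "has_ac_derivative q (\<lambda>r. R r - 2 / r * q r)"
  proof (rule has_ac_derivative_cong[OF q(1) refl])
    show "AE r in ray. u'' r = R r - 2 / r * q r" using Lu R(2) q(2) by eventually_elim simp
    show "(\<lambda>r. R r - 2 / r * q r) \<in> borel_measurable ray" by (intro borel_measurable_diff R divide_measurable_ray qm)
  qed
  moreover have "AE r in ray. k r = q r" using u'k q(2) by eventually_elim simp
  ultimately show ?thesis by (rule that[rotated])
qed

lemma has_radial_laplacianI:
  assumes F: "has_ac_derivative F q" and q: "has_ac_derivative q (\<lambda>r. R r - 2 / r * q r)"
    and u: "u \<in> borel_measurable ray" "AE r in ray. u r = F r"
  shows "has_radial_laplacian u R"
  unfolding has_radial_laplacian_def
proof (intro exI conjI)
  show "has_weak_gradient u q {0<..}" by (rule has_weak_gradient_of_ac[OF F u])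
  show "has_weak_gradient q (\<lambda>r. R r - 2 / r * q r) {0<..}"
    by (rule has_weak_gradient_of_ac[OF q has_ac_derivative_measurable'[OF q]]) simp
qed simp

lemma solves_systemI:
  assumes F: "has_ac_derivative F q" "has_ac_derivative q (\<lambda>r. (F r + F r * G r) - 2 / r * q r)" "(F \<longlongrightarrow> 0) at_top"
    and G: "has_ac_derivative G l" "has_ac_derivative l (\<lambda>r. \<mu> * (F r)\<^sup>2 - 2 / r * l r)" "(G \<longlongrightarrow> 0) at_top"
    and S: "S \<in> borel_measurable ray" "AE r in ray. S r = F r"
    and Z: "Z \<in> borel_measurable ray" "AE r in ray. Z r = G r"
  shows "solves_system \<mu> S Z"
proof -
  have lim: "(u \<longlongrightarrow> 0) (inf at_top (ae_filter lborel))"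
    if U: "(U \<longlongrightarrow> 0) at_top" and ae: "AE r in ray. u r = U r" for u U :: "real \<Rightarrow> real"
  proof (rule Lim_transform_eventually)
    show "(U \<longlongrightarrow> 0) (inf at_top (ae_filter lborel))" by (rule tendsto_mono[OF inf_le1 U])
    have "\<forall>\<^sub>F r in ae_filter lborel. r > 0 \<longrightarrow> u r = U r" using ae unfolding AE_ray .
    then show "\<forall>\<^sub>F r in inf at_top (ae_filter lborel). U r = u r"
      unfolding eventually_inf using eventually_gt_at_top[of "0::real"] by (intro exI[of _ "\<lambda>r. r > 0"] exI[of _ "\<lambda>r. r > 0 \<longrightarrow> u r = U r"]) auto
  qed
  show ?thesis unfolding solves_system_def
  proof (intro conjI)
    have "AE r in ray. (F r + F r * G r) - S r = S r * Z r" using S(2) Z(2) by eventually_elim simp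
    then show "\<exists>LS. has_radial_laplacian S LS \<and> (AE \<xi> in lborel. \<xi> > 0 \<longrightarrow> LS \<xi> - S \<xi> = S \<xi> * Z \<xi>)"
      using has_radial_laplacianI[OF F(1,2) S] unfolding AE_ray by blast
    have "AE r in ray. \<mu> * (F r)\<^sup>2 = \<mu> * (S r)\<^sup>2" using S(2) by eventually_elim simp
    then show "\<exists>LZ. has_radial_laplacian Z LZ \<and> (AE \<xi> in lborel. \<xi> > 0 \<longrightarrow> LZ \<xi> = \<mu> * (S \<xi>)\<^sup>2)"
      using has_radial_laplacianI[OF G(1,2) Z] unfolding AE_ray by blast
  qed (rule lim[OF F(3) S(2)] lim[OF G(3) Z(2)])+
qed

text \<open>The zero pair solves the system and has mass zero, hence the exclusion of
  \<open>trivial_pair\<close>. If \<open>S\<close> vanishes, the two-sided bound on \<open>Z\<close>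
  makes \<open>Z\<close> vanish too, so a nontrivial solution has nonzero \<open>S\<close>.\<close>

theorem mass_lower_bound:
  assumes \<mu>: "\<mu> > 0" and S: "S \<in> H1r" and Z: "Z \<in> D1r" and sys: "solves_system \<mu> S Z" and nt: "\<not> trivial_pair S Z"
  shows "mass \<mu> S \<ge> 3/8 * pi * sqrt 3"
proof -
  obtain F k where F: "has_weak_gradient S k {0<..}" "AE r in ray. S r = F r" "radial_H1 F k" by (rule H1r_representative[OF S])
  obtain G l where G: "has_weak_gradient Z l {0<..}" "AE r in ray. Z r = G r" "radial_D1 G l" by (rule D1r_representative[OF Z])
  have Fac: "has_ac_derivative F k" and F2: "integrable ray (\<lambda>r. (k r)\<^sup>2 * r\<^sup>2)" "integrable ray (\<lambda>r. (F r)\<^sup>2 * r\<^sup>2)"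
    using F(3) by (auto simp: radial_H1_def)
  have Gac: "has_ac_derivative G l" and G2: "integrable ray (\<lambda>r. (l r)\<^sup>2 * r\<^sup>2)" "(G \<longlongrightarrow> 0) at_top"
    using G(3) by (auto simp: radial_D1_def)
  note [measurable] = has_weak_gradient_measurable(1)[OF F(1)] has_ac_derivative_measurable'[OF Fac] has_ac_derivative_measurable'[OF Gac]
  obtain LS where LS: "has_radial_laplacian S LS" "AE r in ray. LS r - S r = S r * Z r"
    using sys unfolding solves_system_def AE_ray by blast
  obtain LZ where LZ: "has_radial_laplacian Z LZ" "AE r in ray. LZ r = \<mu> * (S r)\<^sup>2"
    using sys unfolding solves_system_def AE_ray by blast
  have LS': "AE r in ray. LS r = F r * (1 + G r)" using LS(2) F(2) G(2) by eventually_elim (simp add: algebra_simps)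
  have LZ': "AE r in ray. LZ r = \<mu> * (F r)\<^sup>2" using LZ(2) F(2) by eventually_elim simp
  obtain q where q: "AE r in ray. k r = q r" "has_ac_derivative q (\<lambda>r. F r * (1 + G r) - 2 / r * q r)"
    by (rule has_radial_laplacian_representative[OF LS(1) Fac F(2) _ LS']) measurable
  obtain p where p: "AE r in ray. l r = p r" "has_ac_derivative p (\<lambda>r. \<mu> * (F r)\<^sup>2 - 2 / r * p r)"
    by (rule has_radial_laplacian_representative[OF LZ(1) Gac G(2) _ LZ']) measurable
  note [measurable] = has_ac_derivative_measurable'[OF q(2)] has_ac_derivative_measurable'[OF p(2)]
  have "radial_H1 F q" unfolding radial_H1_def
  proof (intro conjI F2(2))
    show "has_ac_derivative F q" by (rule has_ac_derivative_cong[OF Fac refl q(1)]) measurable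
    show "integrable ray (\<lambda>r. (q r)\<^sup>2 * r\<^sup>2)"
    proof (rule integrable_cong_AE_imp[OF F2(1)])
      show "AE r in ray. (k r)\<^sup>2 * r\<^sup>2 = (q r)\<^sup>2 * r\<^sup>2" using q(1) by eventually_elim simp
    qed measurable
  qed
  moreover have "radial_D1 G p" unfolding radial_D1_def
  proof (intro conjI G2(2))
    show "has_ac_derivative G p" by (rule has_ac_derivative_cong[OF Gac refl p(1)]) measurable
    show "integrable ray (\<lambda>r. (p r)\<^sup>2 * r\<^sup>2)"
    proof (rule integrable_cong_AE_imp[OF G2(1)])
      show "AE r in ray. (l r)\<^sup>2 * r\<^sup>2 = (p r)\<^sup>2 * r\<^sup>2" using p(1) by eventually_elim simp
    qed measurable
  qed
  ultimately interpret radial_solution F q G p \<mu> using \<mu> q(2) p(2) by unfold_locales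
  have "\<exists>r>0. F r \<noteq> 0"
  proof (rule ccontr)
    assume "\<not> ?thesis"
    then have F0: "F r = 0" if "r > 0" for r using that by blast
    have "sq_norm F = (\<integral>r. 0 \<partial>ray)" unfolding sq_norm_def by (rule Bochner_Integration.integral_cong) (auto simp: F0)
    then have "sq_norm F = 0" by simp
    then have G0: "G r = 0" if "r > 0" for r using Z_lower[OF that] Z_nonpos[OF that] by simp
    have "AE r in ray. r > 0" unfolding AE_ray by simp
    with F(2) G(2) have "AE r in ray. S r = 0 \<and> Z r = 0" by eventually_elim (simp add: F0 G0)
    then show False using nt unfolding trivial_pair_def AE_ray by simp
  qed
  then have "\<mu> * sq_norm F \<ge> 3/8 * pi * sqrt 3" using mass_bound by blast
  moreover have "mass \<mu> S = \<mu> * sq_norm F"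
  proof -
    have "(\<integral>r. r\<^sup>2 * (S r)\<^sup>2 \<partial>ray) = sq_norm F" unfolding sq_norm_def
      by (rule integral_cong_AE) (use F(2) in \<open>auto elim!: eventually_mono intro!: borel_measurable_times borel_measurable_ray\<close>)
    then show ?thesis unfolding mass_def integral_ray by simp
  qed
  ultimately show ?thesis by simp
qed

text \<open>For squared norm N the least value of D / (2 \<mu>) is 2 / (\<mu> \<kappa> N^2). The sum
  N + 2 / (\<mu> \<kappa> N^2) is critical exactly when \<mu> \<kappa> N^3 = 4.\<close>

lemma scaled_maximizer:
  assumes \<mu>: "\<mu> > 0"
  obtains \<kappa> N S k where "\<kappa> > 0" "N > 0" "\<mu> * \<kappa> * N ^ 3 = 4"
    "\<And>U u. radial_H1 U u \<Longrightarrow> self_energy U \<le> \<kappa> * (sq_norm u + sq_norm U)\<^sup>2"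
    "radial_H1 S k" "sq_norm k + sq_norm S = N" "self_energy S = \<kappa> * N\<^sup>2"
proof -
  obtain S1 k1 where S1: "radial_H1 S1 k1" "sq_norm k1 + sq_norm S1 = 1" "self_energy S1 > 0"
    and ex: "\<And>U u. radial_H1 U u \<Longrightarrow> self_energy U \<le> self_energy S1 * (sq_norm u + sq_norm U)\<^sup>2"
    by (rule self_energy_maximizer) blast
  define \<kappa> where "\<kappa> = self_energy S1"
  define N where "N = root 3 (4 / (\<mu> * \<kappa>))"
  have \<kappa>: "\<kappa> > 0" using S1(3) by (simp add: \<kappa>_def)
  have N: "N > 0" using \<mu> \<kappa> by (simp add: N_def)
  have "N ^ 3 = 4 / (\<mu> * \<kappa>)" unfolding N_def by (rule odd_real_root_pow) simp
  then have N3: "\<mu> * \<kappa> * N ^ 3 = 4" using \<mu> \<kappa> by simp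
  let ?c = "sqrt N"
  have "sq_norm (\<lambda>r. ?c * k1 r) + sq_norm (\<lambda>r. ?c * S1 r) = N * (sq_norm k1 + sq_norm S1)"
    using N by (simp add: sq_norm_scale distrib_left)
  then have n: "sq_norm (\<lambda>r. ?c * k1 r) + sq_norm (\<lambda>r. ?c * S1 r) = N" using S1(2) by simp
  have "?c ^ 4 = (?c\<^sup>2)\<^sup>2" by (simp add: power_mult[symmetric])
  then have "?c ^ 4 = N\<^sup>2" using N by simp
  then have K: "self_energy (\<lambda>r. ?c * S1 r) = \<kappa> * N\<^sup>2" by (simp add: self_energy_scale \<kappa>_def)
  show ?thesis by (rule that[OF \<kappa> N N3 ex[folded \<kappa>_def] radial_H1_scale[OF S1(1)] n K])
qed

text \<open>With x = D / (2 \<mu>) the constraints give N0^3 \<le> 2 N^2 x. The factorisation 2 N^3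
  - 3 N0 N^2 + N0^3 = (N - N0)^2 (2 N + N0) then bounds 2 N^2 (N + x - 3/2 N0) below by a term that
  vanishes only at N = N0.\<close>

lemma reduced_minimum:
  fixes \<mu> \<kappa> N0 N K D :: real
  assumes pos: "\<mu> > 0" "\<kappa> > 0" "N0 > 0" and N0: "\<mu> * \<kappa> * N0 ^ 3 = 4" and N: "N \<ge> 0" and D: "D \<ge> 0"
    and KD: "K * D \<ge> 4" and K: "K \<le> \<kappa> * N\<^sup>2"
  shows "N + D / (2 * \<mu>) \<ge> 3/2 * N0"
    and "N + D / (2 * \<mu>) = 3/2 * N0 \<Longrightarrow> N = N0 \<and> K = \<kappa> * N0\<^sup>2 \<and> K * D = 4"
proof -
  define x where "x = D / (2 * \<mu>)"
  have Dx: "D = 2 * \<mu> * x" using pos by (simp add: x_def)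
  have x0: "x \<ge> 0" using D pos by (simp add: x_def)
  have "N \<noteq> 0"
  proof
    assume "N = 0"
    then have "K * D \<le> 0" using K D by (simp add: mult_nonpos_nonneg)
    then show False using KD by simp
  qed
  then have Np: "N > 0" using N by simp
  have "K * D \<le> \<kappa> * N\<^sup>2 * D" by (rule mult_right_mono[OF K D])
  then have "\<mu> * \<kappa> * N0 ^ 3 \<le> \<mu> * \<kappa> * (2 * N\<^sup>2 * x)" using KD N0 by (simp add: Dx mult_ac)
  then have Nx: "N0 ^ 3 \<le> 2 * N\<^sup>2 * x" using pos by simp
  have fac: "2 * N\<^sup>2 * N - 3 * N0 * N\<^sup>2 + N0 ^ 3 = (N - N0)\<^sup>2 * (2 * N + N0)"
    by (simp add: power2_eq_square power3_eq_cube algebra_simps)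
  have fac0: "(N - N0)\<^sup>2 * (2 * N + N0) \<ge> 0" using Np pos by simp
  have eq: "2 * N\<^sup>2 * (N + x - 3/2 * N0) = 2 * N\<^sup>2 * N - 3 * N0 * N\<^sup>2 + 2 * N\<^sup>2 * x" by (simp add: algebra_simps)
  have ge: "2 * N\<^sup>2 * (N + x - 3/2 * N0) \<ge> (N - N0)\<^sup>2 * (2 * N + N0)" using eq fac Nx by linarith
  then have "2 * N\<^sup>2 * (N + x - 3/2 * N0) \<ge> 0" using fac0 by linarith
  then have "N + x - 3/2 * N0 \<ge> 0" using Np by (simp add: zero_le_mult_iff)
  then show "N + D / (2 * \<mu>) \<ge> 3/2 * N0" unfolding x_def by simp
  assume "N + D / (2 * \<mu>) = 3/2 * N0"
  then have e: "N + x = 3/2 * N0" unfolding x_def .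
  then have "N + x - 3/2 * N0 = 0" by simp
  from ge[unfolded this mult_zero_right] have "(N - N0)\<^sup>2 * (2 * N + N0) \<le> 0" .
  then have "(N - N0)\<^sup>2 * (2 * N + N0) = 0" using fac0 by linarith
  then have NN: "N = N0" using Np pos by auto
  then have x: "x = N0 / 2" using e by simp
  have Dm: "D = \<mu> * N0" using Dx x by simp
  have "\<kappa> * N0\<^sup>2 * (\<mu> * N0) = 4" using N0 by (simp add: power2_eq_square power3_eq_cube mult_ac)
  then have "\<kappa> * N0\<^sup>2 * (\<mu> * N0) \<le> K * (\<mu> * N0)" using KD Dm by simp
  then have "\<kappa> * N0\<^sup>2 \<le> K" using pos by simp
  then have "K = \<kappa> * N0\<^sup>2" using K NN by simp
  then show "N = N0 \<and> K = \<kappa> * N0\<^sup>2 \<and> K * D = 4" using NN Dm \<open>\<kappa> * N0\<^sup>2 * (\<mu> * N0) = 4\<close> by simp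
qed

lemma admissible_representative:
  assumes "(S, Z) \<in> admissible"
  obtains F k G l where "has_weak_gradient S k {0<..}" "AE r in ray. S r = F r" "radial_H1 F k"
    "has_weak_gradient Z l {0<..}" "AE r in ray. Z r = G r" "radial_D1 G l" "(\<integral>r. (F r)\<^sup>2 * G r * r\<^sup>2 \<partial>ray) = -2"
proof -
  have S: "S \<in> H1r" and Z: "Z \<in> D1r" and I: "interaction S Z = -1" using assms by (auto simp: admissible_def)
  obtain F k where F: "has_weak_gradient S k {0<..}" "AE r in ray. S r = F r" "radial_H1 F k" by (rule H1r_representative[OF S])
  obtain G l where G: "has_weak_gradient Z l {0<..}" "AE r in ray. Z r = G r" "radial_D1 G l" by (rule D1r_representative[OF Z])
  have Fac: "has_ac_derivative F k" and Gac: "has_ac_derivative G l" using F(3) G(3) by (auto simp: radial_H1_def radial_D1_def)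
  have "interaction S Z = 1/2 * (\<integral>r. (F r)\<^sup>2 * G r * r\<^sup>2 \<partial>ray)"
    by (rule interaction_ray_eq[OF has_weak_gradient_measurable(1)[OF F(1)] F(2) has_ac_derivative_measurable'[OF Fac]
      has_weak_gradient_measurable(1)[OF G(1)] G(2) has_ac_derivative_measurable'[OF Gac]])
  then have "(\<integral>r. (F r)\<^sup>2 * G r * r\<^sup>2 \<partial>ray) = -2" using I by simp
  then show ?thesis by (rule that[OF F G])
qed

lemma admissible_energy_bound:
  assumes \<mu>: "\<mu> > 0" and \<kappa>: "\<kappa> > 0" "N0 > 0" "\<mu> * \<kappa> * N0 ^ 3 = 4"
    and ex: "\<And>U u. radial_H1 U u \<Longrightarrow> self_energy U \<le> \<kappa> * (sq_norm u + sq_norm U)\<^sup>2"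
    and F: "radial_H1 F k" and G: "radial_D1 G l" and I: "(\<integral>r. (F r)\<^sup>2 * G r * r\<^sup>2 \<partial>ray) = -2"
  shows "sq_norm k + sq_norm F + sq_norm l / (2 * \<mu>) \<ge> 3/2 * N0"
    and "sq_norm k + sq_norm F + sq_norm l / (2 * \<mu>) = 3/2 * N0 \<Longrightarrow>
      sq_norm k + sq_norm F = N0 \<and> self_energy F = \<kappa> * N0\<^sup>2 \<and> (AE r in ray. l r = 2 / self_energy F * (cumulated_mass F r / r\<^sup>2))"
proof -
  interpret radial_H1_function F k using F by unfold_locales
  have N: "sq_norm k + sq_norm F \<ge> 0" by simp
  note b = constrained_Dirichlet_bound[OF G I]
  note red = reduced_minimum[OF \<mu> \<kappa> N sq_norm_nonneg b(1) ex[OF F]]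
  show "sq_norm k + sq_norm F + sq_norm l / (2 * \<mu>) \<ge> 3/2 * N0" by (rule red(1))
  show "sq_norm k + sq_norm F + sq_norm l / (2 * \<mu>) = 3/2 * N0 \<Longrightarrow>
      sq_norm k + sq_norm F = N0 \<and> self_energy F = \<kappa> * N0\<^sup>2 \<and> (AE r in ray. l r = 2 / self_energy F * (m r / r\<^sup>2))"
    using red(2) b(2) by blast
qed

lemma extremal_energy_minimizer:
  assumes \<mu>: "\<mu> > 0" and \<kappa>: "\<kappa> > 0" "N0 > 0" "\<mu> * \<kappa> * N0 ^ 3 = 4"
    and ex: "\<And>U u. radial_H1 U u \<Longrightarrow> self_energy U \<le> \<kappa> * (sq_norm u + sq_norm U)\<^sup>2"
    and S: "radial_H1 S k" "sq_norm k + sq_norm S = N0" "self_energy S = \<kappa> * N0\<^sup>2"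
  shows "\<exists>Z. (S, Z) \<in> admissible \<and> energy \<mu> S Z = 3/4 * N0"
proof -
  interpret self_energy_extremal S k \<kappa> N0 using S \<kappa> ex by unfold_locales auto
  obtain q where q: "radial_H1 S q" "AE r in ray. k r = q r" "sq_norm q = sq_norm k" "continuous_on {0<..} q"
    "\<And>R. \<exists>C. \<forall>r\<in>{0<..R}. \<bar>q r\<bar> \<le> C"
    by (rule regular_derivative) (rule that)
  \<comment> \<open>This factor normalises the constraint, the integral of m Z' being c K = 2; it is
    also the optimal factor in the Dirichlet bound.\<close>
  define c where "c = 2 / self_energy S"
  have K: "self_energy S > 0" using S(3) \<kappa> by simp
  let ?Z = "\<lambda>r. - c * potential r" and ?l = "\<lambda>r. c * (m r / r\<^sup>2)"
  note Z = potential_D1[of c]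
  have qac: "has_ac_derivative S q" using q(1) by (simp add: radial_H1_def)
  have Zac: "has_ac_derivative ?Z ?l" using Z(1) by (simp add: radial_D1_def)
  have Sw: "has_weak_gradient S q {0<..}" by (rule has_weak_gradient_of_ac[OF qac]) simp_all
  have Zw: "has_weak_gradient ?Z ?l {0<..}" by (rule has_weak_gradient_of_ac[OF Zac has_ac_derivative_measurable'[OF Zac]]) simp
  have "(\<integral>r. (S r)\<^sup>2 * ?Z r * r\<^sup>2 \<partial>ray) = - (\<integral>r. m r * ?l r \<partial>ray)" by (rule interaction_eq(2)[OF Z(1)])
  also have "(\<integral>r. m r * ?l r \<partial>ray) = (\<integral>r. c * ((m r)\<^sup>2 / r\<^sup>2) \<partial>ray)"
    by (rule Bochner_Integration.integral_cong) (auto simp: power2_eq_square)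
  also have "\<dots> = c * self_energy S" unfolding self_energy_def by (rule integral_mult_right_zero)
  also have "\<dots> = 2" using K by (simp add: c_def)
  finally have I: "(\<integral>r. (S r)\<^sup>2 * ?Z r * r\<^sup>2 \<partial>ray) = - 2" .
  have "interaction S ?Z = 1/2 * (\<integral>r. (S r)\<^sup>2 * ?Z r * r\<^sup>2 \<partial>ray)"
    by (rule interaction_ray_eq) (simp_all add: has_ac_derivative_measurable'[OF Zac])
  then have "interaction S ?Z = -1" using I by simp
  moreover have "S \<in> H1r" by (rule H1rI[OF q(1,4,5)])
  ultimately have "(S, ?Z) \<in> admissible" using potential_in_D1r[of c] by (simp add: admissible_def)
  moreover have "energy \<mu> S ?Z = 3/4 * N0"
  proof -
    have "sq_norm ?l = c\<^sup>2 * self_energy S" by (rule Z(2))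
    also have "\<dots> = 4 / self_energy S" unfolding c_def using K by (simp add: power2_eq_square)
    finally have l: "sq_norm ?l = 4 / self_energy S" .
    have "energy \<mu> S ?Z = 1/2 * (sq_norm q + sq_norm S + sq_norm ?l / (2 * \<mu>))"
      by (rule energy_eq[OF Sw _ q(1) Zw _ Z(1)]) simp_all
    also have "sq_norm ?l / (2 * \<mu>) = 2 / (\<mu> * self_energy S)"
      unfolding l using \<mu> K by (simp add: field_simps)
    also have "\<mu> * self_energy S = 4 / N0" using \<kappa> by (simp add: S(3) field_simps power2_eq_square power3_eq_cube)
    finally show ?thesis using q(3) S(2) by simp
  qed
  ultimately show ?thesis by blast
qed

text \<open>Least energy is equality in the reduced problem, so the representative of
  \<open>S\<close> is extremal for the quartic inequality and Z' is a multiple of m / r^2. The pair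
  thus solves the system up to constants, which the scaling adjusts.\<close>

lemma minimizer_solves_system:
  assumes \<mu>: "\<mu> > 0" and \<kappa>: "\<kappa> > 0" "N0 > 0" "\<mu> * \<kappa> * N0 ^ 3 = 4"
    and ex: "\<And>U u. radial_H1 U u \<Longrightarrow> self_energy U \<le> \<kappa> * (sq_norm u + sq_norm U)\<^sup>2"
    and adm: "(S, Z) \<in> admissible" and E: "energy \<mu> S Z = 3/4 * N0"
  shows "solves_system \<mu> (\<lambda>r. N0 / 2 * S r) (\<lambda>r. N0 / 2 * Z r)"
proof -
  obtain F k G l where F: "has_weak_gradient S k {0<..}" "AE r in ray. S r = F r" "radial_H1 F k"
    and G: "has_weak_gradient Z l {0<..}" "AE r in ray. Z r = G r" "radial_D1 G l" and I: "(\<integral>r. (F r)\<^sup>2 * G r * r\<^sup>2 \<partial>ray) = -2"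
    by (rule admissible_representative[OF adm])
  have "sq_norm k + sq_norm F + sq_norm l / (2 * \<mu>) = 3/2 * N0" using energy_eq[OF F G, of \<mu>] E by simp
  from admissible_energy_bound(2)[OF \<mu> \<kappa> ex F(3) G(3) I this]
  have N: "sq_norm k + sq_norm F = N0" and K: "self_energy F = \<kappa> * N0\<^sup>2"
    and l: "AE r in ray. l r = 2 / self_energy F * (cumulated_mass F r / r\<^sup>2)" by blast+
  interpret self_energy_extremal F k \<kappa> N0 using F(3) N K \<kappa> ex by unfold_locales auto
  define c where "c = 2 / self_energy F"
  \<comment> \<open>The equation for \<open>S\<close> is linear in \<open>S\<close> and requires s c
    = 1 / (\<kappa> N0) of the factor of \<open>Z\<close>; a common factor in the equation for
    \<open>Z\<close> requires c = \<mu> s. The value N0 / 2 satisfies both, the second because \<mu>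
    \<kappa> N0^3 = 4.\<close>
  define s where "s = N0 / 2"
  have cs: "c = \<mu> * s"
    unfolding c_def s_def K using \<kappa> by (simp add: field_simps power2_eq_square power3_eq_cube)
  have cs': "s * c = 1 / (\<kappa> * N0)"
    unfolding c_def s_def K using \<kappa> by (simp add: field_simps power2_eq_square)
  let ?W = "\<lambda>r. - c * potential r" and ?l = "\<lambda>r. c * (m r / r\<^sup>2)"
  have Gac: "has_ac_derivative G l" and G0: "(G \<longlongrightarrow> 0) at_top" using G(3) by (auto simp: radial_D1_def)
  have Wac: "has_ac_derivative ?W ?l" and W0: "(?W \<longlongrightarrow> 0) at_top" using potential_D1(1)[of c] by (auto simp: radial_D1_def)
  \<comment> \<open>The derivatives agree almost everywhere, so the difference is constant, and both
    functions tend to 0 at infinity.\<close>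
  have GW: "G r = ?W r" if r: "r > 0" for r
  proof -
    have "has_ac_derivative G ?l"
      by (rule has_ac_derivative_cong[OF Gac refl l[folded c_def] has_ac_derivative_measurable[OF Wac]])
    then have "has_ac_derivative (\<lambda>r. G r + (-1) * ?W r) (\<lambda>r. ?l r + (-1) * ?l r)"
      by (intro has_ac_derivative_add has_ac_derivative_cmult Wac)
    then have "has_ac_derivative (\<lambda>r. G r + (-1) * ?W r) (\<lambda>r. 0)" by simp
    from has_ac_derivative_const_unique[OF this] have const: "G r + (-1) * ?W r = G 1 + (-1) * ?W 1" if "r > 0" for r using that .
    have "\<forall>\<^sub>F r in at_top. G r + (-1) * ?W r = G 1 + (-1) * ?W 1" using eventually_gt_at_top[of 0] by eventually_elim (rule const)
    then have "((\<lambda>r. G r + (-1) * ?W r) \<longlongrightarrow> G 1 + (-1) * ?W 1) at_top" by (rule tendsto_eventually)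
    moreover have "((\<lambda>r. G r + (-1) * ?W r) \<longlongrightarrow> 0 + (-1) * 0) at_top" by (intro tendsto_intros G0 W0)
    ultimately have "G 1 + (-1) * ?W 1 = 0 + (-1) * 0" by (rule tendsto_unique[rotated]) simp
    then show ?thesis using const[OF r] by simp
  qed
  obtain q where q: "radial_H1 F q" "has_ac_derivative q (\<lambda>r. F r * (1 - potential r / (\<kappa> * N0)) - 2 / r * q r)"
    by (rule regular_derivative) (rule that)
  have qac: "has_ac_derivative F q" using q(1) by (simp add: radial_H1_def)
  show ?thesis unfolding s_def[symmetric]
  proof (rule solves_systemI)
    show "has_ac_derivative (\<lambda>r. s * F r) (\<lambda>r. s * q r)" by (rule has_ac_derivative_cmult[OF qac])
    show "has_ac_derivative (\<lambda>r. s * q r) (\<lambda>r. (s * F r + s * F r * (s * ?W r)) - 2 / r * (s * q r))"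
    proof (rule has_ac_derivative_eqI[OF has_ac_derivative_cmult[OF q(2), of s]])
      fix r :: real
      have "s * (s * c) * X = s * (X / (\<kappa> * N0))" for X unfolding cs' by simp
      from this[of "F r * potential r"]
      show "s * (F r * (1 - potential r / (\<kappa> * N0)) - 2 / r * q r) = (s * F r + s * F r * (s * ?W r)) - 2 / r * (s * q r)"
        by (simp add: algebra_simps)
    qed simp
    show "((\<lambda>r. s * F r) \<longlongrightarrow> 0) at_top" using tendsto_mult[OF tendsto_const[of s] tendsto_0] by simp
    show "has_ac_derivative (\<lambda>r. s * ?W r) (\<lambda>r. s * ?l r)" by (rule has_ac_derivative_cmult[OF Wac])
    have "has_ac_derivative (\<lambda>r. s * c * ((1 / r) * ((1 / r) * m r)))
        (\<lambda>r. s * c * (- (1 / r\<^sup>2) * ((1 / r) * m r) + 1 / r * (- (1 / r\<^sup>2) * m r + 1 / r * ((F r)\<^sup>2 * r\<^sup>2))))"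
      by (intro has_ac_derivative_cmult has_ac_derivative_mult has_ac_derivative_inverse m_ac)
    then show "has_ac_derivative (\<lambda>r. s * ?l r) (\<lambda>r. \<mu> * (s * F r)\<^sup>2 - 2 / r * (s * ?l r))"
    proof (rule has_ac_derivative_eqI)
      fix r :: real assume r: "r > 0"
      show "s * c * ((1 / r) * ((1 / r) * m r)) = s * ?l r" by (simp add: power2_eq_square)
      have "s * c * (- (1 / r\<^sup>2) * ((1 / r) * m r) + 1 / r * (- (1 / r\<^sup>2) * m r + 1 / r * ((F r)\<^sup>2 * r\<^sup>2)))
          = s * c * ((F r)\<^sup>2 - 2 * (m r / r ^ 3))"
        using r by (simp add: field_simps power2_eq_square power3_eq_cube)
      also have "\<dots> = \<mu> * (s * F r)\<^sup>2 - 2 / r * (s * ?l r)"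
        unfolding cs using r by (simp add: field_simps power2_eq_square power3_eq_cube)
      finally show "s * c * (- (1 / r\<^sup>2) * ((1 / r) * m r) + 1 / r * (- (1 / r\<^sup>2) * m r + 1 / r * ((F r)\<^sup>2 * r\<^sup>2)))
          = \<mu> * (s * F r)\<^sup>2 - 2 / r * (s * ?l r)" .
    qed
    show "((\<lambda>r. s * ?W r) \<longlongrightarrow> 0) at_top" using tendsto_mult[OF tendsto_const[of s] W0] by simp
    show "(\<lambda>r. s * S r) \<in> borel_measurable ray" "(\<lambda>r. s * Z r) \<in> borel_measurable ray"
      using has_weak_gradient_measurable(1)[OF F(1)] has_weak_gradient_measurable(1)[OF G(1)] by measurable
    show "AE r in ray. s * S r = s * F r" using F(2) by eventually_elim simp
    have "AE r in ray. r > 0" unfolding AE_ray by simp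
    with G(2) show "AE r in ray. s * Z r = s * ?W r" by eventually_elim (simp add: GW)
  qed
qed

theorem theorem2:
  fixes G \<mu> :: real
  assumes "G > 0" and "\<mu> = 4 * pi * G"
  shows "(\<exists>S Z. is_minimizer \<mu> S Z) \<and>
    (\<forall>S Z. is_minimizer \<mu> S Z \<longrightarrow>
       (\<exists>c>0. solves_system \<mu> (\<lambda>\<xi>. c * S \<xi>) (\<lambda>\<xi>. c * Z \<xi>))) \<and>
    (\<forall>S Z. S \<in> H1r \<longrightarrow> Z \<in> D1r \<longrightarrow> solves_system \<mu> S Z \<longrightarrow> \<not> trivial_pair S Z \<longrightarrow>
       mass \<mu> S \<ge> 3/8 * pi * sqrt 3)"
proof -
  have \<mu>: "\<mu> > 0" using assms by simp
  obtain \<kappa> N0 S0 k0 where \<kappa>: "\<kappa> > 0" "N0 > 0" "\<mu> * \<kappa> * N0 ^ 3 = 4"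
    and ex: "\<And>U u. radial_H1 U u \<Longrightarrow> self_energy U \<le> \<kappa> * (sq_norm u + sq_norm U)\<^sup>2"
    and S0: "radial_H1 S0 k0" "sq_norm k0 + sq_norm S0 = N0" "self_energy S0 = \<kappa> * N0\<^sup>2"
    by (rule scaled_maximizer[OF \<mu>]) blast
  obtain Z0 where Z0: "(S0, Z0) \<in> admissible" "energy \<mu> S0 Z0 = 3/4 * N0"
    using extremal_energy_minimizer[OF \<mu> \<kappa> ex S0] by blast
  have lower: "3/4 * N0 \<le> energy \<mu> S Z" if adm: "(S, Z) \<in> admissible" for S Z
  proof -
    obtain F k H l where F: "has_weak_gradient S k {0<..}" "AE r in ray. S r = F r" "radial_H1 F k"
      and H: "has_weak_gradient Z l {0<..}" "AE r in ray. Z r = H r" "radial_D1 H l" and I: "(\<integral>r. (F r)\<^sup>2 * H r * r\<^sup>2 \<partial>ray) = -2"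
      by (rule admissible_representative[OF adm])
    show ?thesis using admissible_energy_bound(1)[OF \<mu> \<kappa> ex F(3) H(3) I] energy_eq[OF F H, of \<mu>] by simp
  qed
  have inf: "(INF (T, W)\<in>admissible. energy \<mu> T W) = 3/4 * N0"
  proof (rule cInf_eq_minimum)
    show "3/4 * N0 \<in> (\<lambda>(T, W). energy \<mu> T W) ` admissible" using Z0 by force
  qed (use lower in auto)
  have "is_minimizer \<mu> S0 Z0" unfolding is_minimizer_def inf using Z0 by simp
  moreover have "solves_system \<mu> (\<lambda>\<xi>. N0 / 2 * S \<xi>) (\<lambda>\<xi>. N0 / 2 * Z \<xi>)" if "is_minimizer \<mu> S Z" for S Z
    using that unfolding is_minimizer_def inf by (intro minimizer_solves_system[OF \<mu> \<kappa> ex]) auto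
  moreover have "N0 / 2 > 0" using \<kappa> by simp
  ultimately show ?thesis using mass_lower_bound[OF \<mu>] by blast
qed

end
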